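(* Let $B\in\mathcal B_0$ and $N>0$. Suppose Assumption (A) holds and that $\limsup_{t\to0}t\log P_t(A,B)\le-\mathsf d(A,B)^2/2$ for every $A\in\mathcal B_0$ with $\mathsf d(A,B)<N$. Then for every $A\in\mathcal B_0$ with $\mathsf d(A,B)<N$, $$\liminf_{t\to0}t\log P_t(A,B)\ge-\frac{\mathsf d(A,B)^2}{2},\qquad\text{hence}\qquad \lim_{t\to0}t\log P_t(A,B)=-\frac{\mathsf d(A,B)^2}{2}.$$
   Context: Framework. $(E,\mathcal B,\mu)$ is a $\sigma$-finite measure space, $H$ a real separable Hilbert space with inner product $(\cdot,\cdot)_H$ and norm $|\cdot|_H$; $L^p(\mu)$ is the real $L^p$-space with norm $\|\cdot\|_p$, $L^0(\mu)$ the real measurable functions modulo $\mu$-a.e. equality, $L^2(\mu;H)$ the square-integrable $H$-valued functions. $\mathbb D$ is a dense subspace of $L^2(\mu)$ and $D:\mathbb D\to L^2(\mu;H)$ is a closed linear operator with the derivation property: for $f_1,\dots,f_m\in\mathbb D$ and $F\in C^1(\mathbb R^m)$ with bounded first derivatives and $F(0)=0$, $F(f_1,\dots,f_m)\in\mathbb D$ and $D F(f_1,\dots,f_m)=\sum_j\partial_jF(f_1,\dots,f_m)Df_j$. Put $\mathcal E^0(f,g)=\frac12\int_E(Df,Dg)_H\,d\mu$, $\mathcal E^0(f)=\mathcal E^0(f,f)$, $\mathcal E^0_l(f,g)=\mathcal E^0(f,g)+l\int_E fg\,d\mu$, $\mathcal E^0_l(f)=\mathcal E^0_l(f,f)$;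 $\mathbb D$ is a Hilbert space under $\mathcal E^0_1$. For $A\in\mathcal B$: $\mathbb D_A=\{f\in\mathbb D: f=0\ \mu\text{-a.e. on }E\setminus A\}$, $\mathbb D_{A,b}=\mathbb D_A\cap L^\infty(\mu)$. A measurable nest is an increasing sequence $\{E_k\}$ in $\mathcal B$ such that (i) for each $k$ there is $h_k\in\mathbb D$ with $h_k\ge 1$ a.e. on $E_k$, and (ii) $\bigcup_k\mathbb D_{E_k}$ is dense in $\mathbb D$. For a nest: $L^p_{\rm loc}(\mu,\{E_k\})=\{f\in L^0(\mu): f\mathbf 1_{E_k}\in L^p(\mu)\ \forall k\}$; $\mathbb D_{\rm loc}(\{E_k\})=\{f\in L^0(\mu):\exists f_k\in\mathbb D,\ f=f_k \text{ a.e. on }E_k\ \forall k\}$, with $Df:=Df_k$ on $E_k$; $\mathbb D_0=\{f\in\mathbb D_{\rm loc}(\{E_k\})\cap L^\infty(\mu): |Df|_H\le1\text{ a.e.}\}$ (independent of the nest). For $A,B$ of positive measure, $\mathsf d(A,B)=\sup_{f\in\mathbb D_0}\{\operatorname{ess\,inf}_A f-\operatorname{ess\,sup}_B f\}\in[0,\infty]$. Assumption (A): $b,c$ are $H$-valued measurable functions and $V$ a real measurable function on $E$ such that (A.1) there is a measurable nest $\{E_k\}$ with $|b|_H,|c|_H\in L^2_{\rm loc}(\mu,\{E_k\})$, $V\in L^1_{\rm loc}(\mu,\{E_k\})$; (A.2) there are $\eta\in[0,1)$, $\theta,\omega,l\ge0$ with, for all $f,g\in\bigcup_k\mathbb D_{E_k,b}$,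 $-\int_E\{(b+c,Df)_Hf+Vf^2\}d\mu\le\eta\mathcal E^0(f)+\theta\|f\|_2^2$ and $|\int_E\{(b,Df)_Hg+(c,Dg)_Hf+Vfg\}d\mu|\le\omega\mathcal E^0_l(f)^{1/2}\mathcal E^0_l(g)^{1/2}$. Then $\mathcal E(f,g)=\mathcal E^0(f,g)+\int_E\{(b,Df)_Hg+(c,Dg)_Hf+Vfg\}d\mu$ extends continuously to $\mathbb D\times\mathbb D$, $\mathcal E+\theta(\cdot,\cdot)_{L^2}$ is a coercive closed form, and $\{T_t\}_{t>0}$ is the associated strongly continuous (positivity preserving) semigroup on $L^2(\mu)$. $\mathcal B_0=\{A\in\mathcal B:0<\mu(A)<\infty\}$ and $P_t(A,B)=\int_AT_t\mathbf 1_B\,d\mu$. *)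

theory Defs
  imports "HOL-Analysis.Analysis"
begin

text \<open>Functions on E are represented by their representatives 'a => real; all
 identities between them are understood mu-a.e.  The Hilbert space H is a type
 of class real_inner + complete_space; separability is rendered by
 second_countable_topology (equivalent for metric spaces).\<close>

definition L2 :: "'a measure \<Rightarrow> ('a \<Rightarrow> real) \<Rightarrow> bool" where
  "L2 M f \<longleftrightarrow> f \<in> borel_measurable M \<and> integrable M (\<lambda>x. (f x)^2)"

definition L2H :: "'a measure \<Rightarrow> ('a \<Rightarrow> 'h::{real_inner, second_countable_topology}) \<Rightarrow> bool" where
  "L2H M F \<longleftrightarrow> F \<in> borel_measurable M \<and> integrable M (\<lambda>x. (norm (F x))^2)"

definition l2norm :: "'a measure \<Rightarrow> ('a \<Rightarrow> real) \<Rightarrow> real" where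
  "l2norm M f = sqrt (\<integral>x. (f x)^2 \<partial>M)"

definition l2normH :: "'a measure \<Rightarrow> ('a \<Rightarrow> 'h::real_inner) \<Rightarrow> real" where
  "l2normH M F = sqrt (\<integral>x. (norm (F x))^2 \<partial>M)"

definition E0 :: "'a measure \<Rightarrow> (('a \<Rightarrow> real) \<Rightarrow> 'a \<Rightarrow> 'h::real_inner)
    \<Rightarrow> ('a \<Rightarrow> real) \<Rightarrow> ('a \<Rightarrow> real) \<Rightarrow> real" where
  "E0 M D f g = (1/2) * (\<integral>x. inner (D f x) (D g x) \<partial>M)"

definition E0l :: "'a measure \<Rightarrow> (('a \<Rightarrow> real) \<Rightarrow> 'a \<Rightarrow> 'h::real_inner)
    \<Rightarrow> real \<Rightarrow> ('a \<Rightarrow> real) \<Rightarrow> real" where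
  "E0l M D l f = E0 M D f f + l * (\<integral>x. (f x)^2 \<partial>M)"

text \<open>F : R^m -> R (represented on nat => real, depending only on the first m
  coordinates) is C^1 with bounded first derivatives dF j (j < m).\<close>

definition C1_bounded :: "nat \<Rightarrow> ((nat \<Rightarrow> real) \<Rightarrow> real) \<Rightarrow> (nat \<Rightarrow> (nat \<Rightarrow> real) \<Rightarrow> real) \<Rightarrow> bool" where
  "C1_bounded m F dF \<longleftrightarrow>
     (\<forall>x y. (\<forall>j<m. x j = y j) \<longrightarrow> F x = F y)
   \<and> (\<forall>j<m. \<forall>x. ((\<lambda>s. F (x(j := s))) has_real_derivative dF j x) (at (x j)))
   \<and> (\<forall>j<m. \<forall>x. \<forall>\<epsilon>>0. \<exists>\<delta>>0. \<forall>y. (\<forall>i<m. \<bar>y i - x i\<bar> < \<delta>) \<longrightarrow> \<bar>dF j y - dF j x\<bar> < \<epsilon>)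
   \<and> (\<exists>C. \<forall>j<m. \<forall>x. \<bar>dF j x\<bar> \<le> C)"

definition dirichlet_operator :: "'a measure \<Rightarrow> ('a \<Rightarrow> real) set
    \<Rightarrow> (('a \<Rightarrow> real) \<Rightarrow> 'a \<Rightarrow> 'h::{real_inner, second_countable_topology}) \<Rightarrow> bool" where
  "dirichlet_operator M Dom D \<longleftrightarrow>
     Dom \<subseteq> {f. L2 M f}
   \<and> (\<forall>f\<in>Dom. L2H M (D f))
   \<and> (\<lambda>x. 0) \<in> Dom
   \<and> (\<forall>f\<in>Dom. \<forall>g\<in>Dom. \<forall>a b::real. (\<lambda>x. a * f x + b * g x) \<in> Dom \<and>
        (AE x in M. D (\<lambda>x. a * f x + b * g x) x = a *\<^sub>R D f x + b *\<^sub>R D g x))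
   \<and> (\<forall>f\<in>Dom. \<forall>g. L2 M g \<and> (AE x in M. f x = g x) \<longrightarrow>
        g \<in> Dom \<and> (AE x in M. D f x = D g x))
   \<and> (\<forall>f. L2 M f \<longrightarrow> (\<forall>\<epsilon>>0. \<exists>g\<in>Dom. l2norm M (\<lambda>x. f x - g x) < \<epsilon>))
   \<and> (\<forall>u u0 G. (\<forall>n. u n \<in> Dom) \<and> L2 M u0 \<and> L2H M G
        \<and> (\<lambda>n. l2norm M (\<lambda>x. u n x - u0 x)) \<longlonglongrightarrow> 0
        \<and> (\<lambda>n. l2normH M (\<lambda>x. D (u n) x - G x)) \<longlonglongrightarrow> 0
        \<longrightarrow> u0 \<in> Dom \<and> (AE x in M. D u0 x = G x))
   \<and> (\<forall>m fs F dF. (\<forall>j<m. fs j \<in> Dom) \<and> C1_bounded m F dF \<and> F (\<lambda>_. 0) = 0 \<longrightarrow>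
        (\<lambda>p. F (\<lambda>j. fs j p)) \<in> Dom \<and>
        (AE p in M. D (\<lambda>p. F (\<lambda>j. fs j p)) p = (\<Sum>j<m. dF j (\<lambda>i. fs i p) *\<^sub>R D (fs j) p)))"

definition DA :: "'a measure \<Rightarrow> ('a \<Rightarrow> real) set \<Rightarrow> 'a set \<Rightarrow> ('a \<Rightarrow> real) set" where
  "DA M Dom A = {f \<in> Dom. AE x in M. x \<notin> A \<longrightarrow> f x = 0}"

definition DAb :: "'a measure \<Rightarrow> ('a \<Rightarrow> real) set \<Rightarrow> 'a set \<Rightarrow> ('a \<Rightarrow> real) set" where
  "DAb M Dom A = {f \<in> DA M Dom A. \<exists>C. AE x in M. \<bar>f x\<bar> \<le> C}"

definition measurable_nest :: "'a measure \<Rightarrow> ('a \<Rightarrow> real) set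
    \<Rightarrow> (('a \<Rightarrow> real) \<Rightarrow> 'a \<Rightarrow> 'h::real_inner) \<Rightarrow> (nat \<Rightarrow> 'a set) \<Rightarrow> bool" where
  "measurable_nest M Dom D Ek \<longleftrightarrow>
     (\<forall>k. Ek k \<in> sets M) \<and> incseq Ek
   \<and> (\<forall>k. \<exists>h\<in>Dom. AE x in M. x \<in> Ek k \<longrightarrow> 1 \<le> h x)
   \<and> (\<forall>f\<in>Dom. \<forall>\<epsilon>>0. \<exists>k. \<exists>g\<in>DA M Dom (Ek k). E0l M D 1 (\<lambda>x. f x - g x) < \<epsilon>)"

definition bform :: "'a measure \<Rightarrow> (('a \<Rightarrow> real) \<Rightarrow> 'a \<Rightarrow> 'h::real_inner)
    \<Rightarrow> ('a \<Rightarrow> 'h) \<Rightarrow> ('a \<Rightarrow> 'h) \<Rightarrow> ('a \<Rightarrow> real) \<Rightarrow> ('a \<Rightarrow> real) \<Rightarrow> ('a \<Rightarrow> real) \<Rightarrow> real" where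
  "bform M D b c V f g =
     (\<integral>x. inner (b x) (D f x) * g x + inner (c x) (D g x) * f x + V x * f x * g x \<partial>M)"

definition assumption_A :: "'a measure \<Rightarrow> ('a \<Rightarrow> real) set
    \<Rightarrow> (('a \<Rightarrow> real) \<Rightarrow> 'a \<Rightarrow> 'h::{real_inner, second_countable_topology})
    \<Rightarrow> ('a \<Rightarrow> 'h) \<Rightarrow> ('a \<Rightarrow> 'h) \<Rightarrow> ('a \<Rightarrow> real) \<Rightarrow> (nat \<Rightarrow> 'a set) \<Rightarrow> bool" where
  "assumption_A M Dom D b c V Ek \<longleftrightarrow>
     b \<in> borel_measurable M \<and> c \<in> borel_measurable M \<and> V \<in> borel_measurable M
   \<and> measurable_nest M Dom D Ek
   \<and> (\<forall>k. integrable M (\<lambda>x. indicator (Ek k) x * (norm (b x))^2))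
   \<and> (\<forall>k. integrable M (\<lambda>x. indicator (Ek k) x * (norm (c x))^2))
   \<and> (\<forall>k. integrable M (\<lambda>x. indicator (Ek k) x * V x))
   \<and> (\<exists>\<eta> \<theta> \<omega> l::real. 0 \<le> \<eta> \<and> \<eta> < 1 \<and> 0 \<le> \<theta> \<and> 0 \<le> \<omega> \<and> 0 \<le> l
       \<and> (\<forall>f\<in>(\<Union>k. DAb M Dom (Ek k)).
            - (\<integral>x. inner (b x + c x) (D f x) * f x + V x * (f x)^2 \<partial>M)
              \<le> \<eta> * E0 M D f f + \<theta> * (\<integral>x. (f x)^2 \<partial>M))
       \<and> (\<forall>f\<in>(\<Union>k. DAb M Dom (Ek k)). \<forall>g\<in>(\<Union>k. DAb M Dom (Ek k)).
            \<bar>bform M D b c V f g\<bar> \<le> \<omega> * sqrt (E0l M D l f) * sqrt (E0l M D l g)))"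

definition form_extension :: "'a measure \<Rightarrow> ('a \<Rightarrow> real) set
    \<Rightarrow> (('a \<Rightarrow> real) \<Rightarrow> 'a \<Rightarrow> 'h::real_inner)
    \<Rightarrow> ('a \<Rightarrow> 'h) \<Rightarrow> ('a \<Rightarrow> 'h) \<Rightarrow> ('a \<Rightarrow> real) \<Rightarrow> (nat \<Rightarrow> 'a set)
    \<Rightarrow> (('a \<Rightarrow> real) \<Rightarrow> ('a \<Rightarrow> real) \<Rightarrow> real) \<Rightarrow> bool" where
  "form_extension M Dom D b c V Ek Ef \<longleftrightarrow>
     (\<forall>f\<in>Dom. \<forall>g\<in>Dom. \<forall>h\<in>Dom. \<forall>\<alpha> \<beta>::real.
        Ef (\<lambda>x. \<alpha> * f x + \<beta> * g x) h = \<alpha> * Ef f h + \<beta> * Ef g h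
      \<and> Ef h (\<lambda>x. \<alpha> * f x + \<beta> * g x) = \<alpha> * Ef h f + \<beta> * Ef h g)
   \<and> (\<exists>C. \<forall>f\<in>Dom. \<forall>g\<in>Dom. \<bar>Ef f g\<bar> \<le> C * sqrt (E0l M D 1 f) * sqrt (E0l M D 1 g))
   \<and> (\<forall>f\<in>(\<Union>k. DAb M Dom (Ek k)). \<forall>g\<in>(\<Union>k. DAb M Dom (Ek k)).
        Ef f g = E0 M D f g + bform M D b c V f g)"

text \<open>T is the strongly continuous semigroup on L^2 associated with Ef, i.e.
  T_t = exp(tL) where L is the generator: Ef(u,v) = (-Lu,v).  Characterised by:
  T_t f -> f in L^2 as t -> 0+, and for t > 0, T_t f lies in Dom, is strongly
  differentiable in L^2 with derivative u' satisfying (u',g) = -Ef(T_t f, g).\<close>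

definition associated_semigroup :: "'a measure \<Rightarrow> ('a \<Rightarrow> real) set
    \<Rightarrow> (('a \<Rightarrow> real) \<Rightarrow> ('a \<Rightarrow> real) \<Rightarrow> real)
    \<Rightarrow> (real \<Rightarrow> ('a \<Rightarrow> real) \<Rightarrow> 'a \<Rightarrow> real) \<Rightarrow> bool" where
  "associated_semigroup M Dom Ef T \<longleftrightarrow>
     (\<forall>f. L2 M f \<longrightarrow>
        ((\<lambda>t. l2norm M (\<lambda>x. T t f x - f x)) \<longlongrightarrow> 0) (at_right 0)
      \<and> (\<forall>t>0. T t f \<in> Dom \<and>
          (\<exists>u'. L2 M u'
             \<and> ((\<lambda>s. l2norm M (\<lambda>x. (T s f x - T t f x) / (s - t) - u' x)) \<longlongrightarrow> 0) (at t)
             \<and> (\<forall>g\<in>Dom. (\<integral>x. u' x * g x \<partial>M) = - Ef (T t f) g))))"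

definition heat_setting :: "'a measure \<Rightarrow> ('a \<Rightarrow> real) set
    \<Rightarrow> (('a \<Rightarrow> real) \<Rightarrow> 'a \<Rightarrow> 'h::{real_inner, second_countable_topology})
    \<Rightarrow> ('a \<Rightarrow> 'h) \<Rightarrow> ('a \<Rightarrow> 'h) \<Rightarrow> ('a \<Rightarrow> real)
    \<Rightarrow> (real \<Rightarrow> ('a \<Rightarrow> real) \<Rightarrow> 'a \<Rightarrow> real) \<Rightarrow> bool" where
  "heat_setting M Dom D b c V T \<longleftrightarrow>
     sigma_finite_measure M \<and> dirichlet_operator M Dom D
   \<and> (\<exists>Ek Ef. assumption_A M Dom D b c V Ek \<and> form_extension M Dom D b c V Ek Ef
              \<and> associated_semigroup M Dom Ef T)"

definition ess_inf_on :: "'a measure \<Rightarrow> 'a set \<Rightarrow> ('a \<Rightarrow> real) \<Rightarrow> ereal" where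
  "ess_inf_on M A f = Sup {c::ereal. AE x in M. x \<in> A \<longrightarrow> c \<le> ereal (f x)}"

definition ess_sup_on :: "'a measure \<Rightarrow> 'a set \<Rightarrow> ('a \<Rightarrow> real) \<Rightarrow> ereal" where
  "ess_sup_on M A f = Inf {c::ereal. AE x in M. x \<in> A \<longrightarrow> ereal (f x) \<le> c}"

definition D0 :: "'a measure \<Rightarrow> ('a \<Rightarrow> real) set
    \<Rightarrow> (('a \<Rightarrow> real) \<Rightarrow> 'a \<Rightarrow> 'h::real_inner) \<Rightarrow> ('a \<Rightarrow> real) set" where
  "D0 M Dom D = {f. f \<in> borel_measurable M \<and> (\<exists>C. AE x in M. \<bar>f x\<bar> \<le> C)
      \<and> (\<exists>Ek fk. measurable_nest M Dom D Ek \<and>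
           (\<forall>k. fk k \<in> Dom \<and> (AE x in M. x \<in> Ek k \<longrightarrow> f x = fk k x)
                \<and> (AE x in M. x \<in> Ek k \<longrightarrow> norm (D (fk k) x) \<le> 1)))}"

definition intdist :: "'a measure \<Rightarrow> ('a \<Rightarrow> real) set
    \<Rightarrow> (('a \<Rightarrow> real) \<Rightarrow> 'a \<Rightarrow> 'h::real_inner) \<Rightarrow> 'a set \<Rightarrow> 'a set \<Rightarrow> ereal" where
  "intdist M Dom D A B = Sup ((\<lambda>f. ess_inf_on M A f - ess_sup_on M B f) ` D0 M Dom D)"

definition B0 :: "'a measure \<Rightarrow> 'a set set" where
  "B0 M = {A \<in> sets M. 0 < emeasure M A \<and> emeasure M A < \<infinity>}"

definition Pt :: "'a measure \<Rightarrow> (real \<Rightarrow> ('a \<Rightarrow> real) \<Rightarrow> 'a \<Rightarrow> real) \<Rightarrow> real \<Rightarrow> 'a set \<Rightarrow> 'a set \<Rightarrow> real" where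
  "Pt M T t A B = (\<integral>x. indicator A x * T t (indicator B :: 'a \<Rightarrow> real) x \<partial>M)"

definition tlogP :: "'a measure \<Rightarrow> (real \<Rightarrow> ('a \<Rightarrow> real) \<Rightarrow> 'a \<Rightarrow> real) \<Rightarrow> 'a set \<Rightarrow> 'a set \<Rightarrow> real \<Rightarrow> ereal" where
  "tlogP M T A B t = (if 0 < Pt M T t A B then ereal (t * ln (Pt M T t A B)) else - \<infinity>)"

end

theory Submission
  imports Defs
begin

text \<open>Let \<open>v\<^sub>s = T\<^sub>s 1\<^sub>B\<close> and suppose \<open>t log P\<^sub>t(A,B) \<le> -L\<close> along some \<open>t \<longrightarrow> 0\<close>, where \<open>L > d\<^sup>2/2\<close> and \<open>d\<close> is
  the distance of \<open>A\<close> and \<open>B\<close>.  The functions \<open>- t log v\<^sub>t\<^sub>s\<close>, truncated at \<open>K = L + 1\<close>, satisfy a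
  Hamilton-Jacobi inequality \<open>\<partial>\<^sub>s y + |D y|\<^sup>2/2 \<le> O(t)\<close> when tested against cutoff functions.  After
  averaging over finitely many time windows and passing to forward convex combinations, the limit
  is a time-discrete subsolution \<open>y\<^sub>s\<close> with values in \<open>[0, K]\<close> that vanishes on \<open>B\<close>.  For a subsolution,
  \<open>W = sup\<^sub>s s y\<^sub>s\<close> satisfies \<open>|D W|\<^sup>2 \<le> 2 W\<close>, so \<open>sqrt (2 W)\<close> is admissible in the definition of the
  distance, and therefore \<open>y\<^sub>1 \<le> L' < L\<close> on a part of \<open>A\<close> of positive measure.  By Jensen's inequality
  \<open>P\<^sub>t(A,B)\<close> then exceeds \<open>exp (-L/t)\<close> infinitely often, a contradiction.\<close>

section \<open>Square integrable functions\<close>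

text \<open>In the model case y_s = d^2/(2s) the product s y_s is constant in s, which is why s y_s
  is maximised. At a maximising time y + s dy/ds = 0, so |DW|^2 = s^2 |Dy|^2 <= -2 s^2 dy/ds = 2 s y
  = 2W. The main obstacle is that b, c, V are integrable only on the members of a nest: every energy
  estimate is tested with functions supported there, and all gradient bounds are local. Convexity
  stands in for weak compactness: |Dy|^2 is convex and the rest of the inequality is linear, so
  convex combinations preserve it, while forward combinations can be made to converge strongly.
  Finitely many time windows let one sequence of weights serve all times and avoid questions of
  measurability in time. The level K = L + 1 makes e^{-K/t} negligible against e^{-L/t}. The code
  stores the profile upside down: \<open>Z\<close>, \<open>Zb\<close> and their limits
  \<open>z\<close>, \<open>zb\<close> stand for K - y. They lie in [0, K], the limits increase in
  time, and \<open>zb\<close> equals K on B.\<close>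

lemma L2_iff_L2H: "L2 M f \<longleftrightarrow> L2H M f"
  by (simp add: L2_def L2H_def)

lemma L2H_measurable: "L2H M F \<Longrightarrow> F \<in> borel_measurable M"
  by (simp add: L2H_def)

lemma L2_measurable: "L2 M f \<Longrightarrow> f \<in> borel_measurable M"
  by (simp add: L2_def)

lemma L2_square_integrable: "L2 M f \<Longrightarrow> integrable M (\<lambda>x. (f x)\<^sup>2)"
  by (simp add: L2_def)

lemma L2H_square_integrable: "L2H M F \<Longrightarrow> integrable M (\<lambda>x. (norm (F x))\<^sup>2)"
  by (simp add: L2H_def)

lemma L2H_bound:
  fixes F :: "'a \<Rightarrow> 'h::{real_inner, second_countable_topology}"
  assumes "F \<in> borel_measurable M" "integrable M W" "AE x in M. (norm (F x))\<^sup>2 \<le> W x"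
  shows "L2H M F"
  unfolding L2H_def
proof (intro conjI)
  show "integrable M (\<lambda>x. (norm (F x))\<^sup>2)"
    by (rule Bochner_Integration.integrable_bound[OF assms(2)]) (use assms in auto)
qed fact

lemma norm_add_square_le: "(norm (a + b))\<^sup>2 \<le> 2 * (norm a)\<^sup>2 + 2 * (norm (b::'h::real_normed_vector))\<^sup>2"
proof -
  have "(norm (a + b))\<^sup>2 \<le> (norm a + norm b)\<^sup>2"
    by (intro power_mono norm_triangle_ineq norm_ge_zero)
  also have "\<dots> \<le> 2 * (norm a)\<^sup>2 + 2 * (norm b)\<^sup>2"
    using sum_squares_bound[of "norm a" "norm b"] by (simp add: power2_sum)
  finally show ?thesis .
qed

lemma L2H_mult:
  fixes F :: "'a \<Rightarrow> 'h::{real_inner, second_countable_topology}"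
  assumes "L2H M F" "\<phi> \<in> borel_measurable M" "AE x in M. \<bar>\<phi> x\<bar> \<le> C"
  shows "L2H M (\<lambda>x. \<phi> x *\<^sub>R F x)"
proof (rule L2H_bound)
  show "(\<lambda>x. \<phi> x *\<^sub>R F x) \<in> borel_measurable M"
    using assms by (auto simp: L2H_def)
  show "integrable M (\<lambda>x. C\<^sup>2 * (norm (F x))\<^sup>2)"
    using assms by (auto simp: L2H_def)
  show "AE x in M. (norm (\<phi> x *\<^sub>R F x))\<^sup>2 \<le> C\<^sup>2 * (norm (F x))\<^sup>2"
    using assms(3)
  proof eventually_elim
    case (elim x)
    have "(\<bar>\<phi> x\<bar>)\<^sup>2 \<le> C\<^sup>2" using elim by (intro power_mono) auto
    then show ?case by (simp add: power_mult_distrib mult_right_mono)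
  qed
qed

lemma L2H_scale: "L2H M F \<Longrightarrow> L2H M (\<lambda>x. a *\<^sub>R F x)"
  by (rule L2H_mult[where C="\<bar>a\<bar>"]) auto

lemma L2H_add:
  fixes F :: "'a \<Rightarrow> 'h::{real_inner, second_countable_topology}"
  assumes "L2H M F" "L2H M G"
  shows "L2H M (\<lambda>x. F x + G x)"
  by (rule L2H_bound[where W="\<lambda>x. 2 * (norm (F x))\<^sup>2 + 2 * (norm (G x))\<^sup>2"])
     (use assms in \<open>auto simp: L2H_def norm_add_square_le\<close>)

lemma L2H_diff:
  fixes F :: "'a \<Rightarrow> 'h::{real_inner, second_countable_topology}"
  assumes "L2H M F" "L2H M G"
  shows "L2H M (\<lambda>x. F x - G x)"
  using L2H_add[OF assms(1) L2H_scale[OF assms(2), of "-1"]] by simp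

lemma L2H_norm:
  fixes F :: "'a \<Rightarrow> 'h::{real_inner, second_countable_topology}"
  assumes "L2H M F"
  shows "L2 M (\<lambda>x. norm (F x))"
  using assms by (auto simp: L2H_def L2_def)

lemma L2_mult: "L2 M f \<Longrightarrow> \<phi> \<in> borel_measurable M \<Longrightarrow> AE x in M. \<bar>\<phi> x\<bar> \<le> C \<Longrightarrow> L2 M (\<lambda>x. \<phi> x * f x)"
  using L2H_mult[of M f \<phi> C] by (simp add: L2_iff_L2H)

lemma L2_add: "L2 M f \<Longrightarrow> L2 M g \<Longrightarrow> L2 M (\<lambda>x. f x + g x)"
  by (simp add: L2_iff_L2H L2H_add)

lemma L2_diff: "L2 M f \<Longrightarrow> L2 M g \<Longrightarrow> L2 M (\<lambda>x. f x - g x)"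
  by (simp add: L2_iff_L2H L2H_diff)

lemma L2_cmult: "L2 M f \<Longrightarrow> L2 M (\<lambda>x. a * f x)"
  by (rule L2_mult[where C="\<bar>a\<bar>"]) auto

lemma L2_product_integrable:
  assumes "L2 M f" "L2 M g"
  shows "integrable M (\<lambda>x. f x * g x)"
proof (rule Bochner_Integration.integrable_bound[where f="\<lambda>x. (f x)\<^sup>2 + (g x)\<^sup>2"])
  show "AE x in M. norm (f x * g x) \<le> norm ((f x)\<^sup>2 + (g x)\<^sup>2)"
  proof (rule AE_I2)
    fix x
    have "2 * \<bar>f x\<bar> * \<bar>g x\<bar> \<le> (f x)\<^sup>2 + (g x)\<^sup>2"
      using sum_squares_bound[of "\<bar>f x\<bar>" "\<bar>g x\<bar>"] by simp
    moreover have "0 \<le> \<bar>f x\<bar> * \<bar>g x\<bar>" by simp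
    ultimately have "\<bar>f x\<bar> * \<bar>g x\<bar> \<le> (f x)\<^sup>2 + (g x)\<^sup>2" by (simp only: mult.assoc)
    then show "norm (f x * g x) \<le> norm ((f x)\<^sup>2 + (g x)\<^sup>2)"
      by (simp add: abs_mult)
  qed
qed (use assms in \<open>auto simp: L2_def\<close>)

lemma L2H_norm_product_integrable:
  fixes F :: "'a \<Rightarrow> 'h::{real_inner, second_countable_topology}"
  assumes "L2H M F" "L2H M G"
  shows "integrable M (\<lambda>x. norm (F x) * norm (G x))"
  by (rule L2_product_integrable) (use assms in \<open>auto intro: L2H_norm\<close>)

lemma L2H_inner_integrable:
  fixes F :: "'a \<Rightarrow> 'h::{real_inner, second_countable_topology}"
  assumes "L2H M F" "L2H M G"
  shows "integrable M (\<lambda>x. inner (F x) (G x))"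
  by (rule Bochner_Integration.integrable_bound[OF L2H_norm_product_integrable[OF assms]])
     (use assms in \<open>auto simp: L2H_def norm_mult Cauchy_Schwarz_ineq2\<close>)

lemma integral_square_add_le:
  fixes F :: "'a \<Rightarrow> 'h::{real_inner, second_countable_topology}"
  assumes "L2H M F" "L2H M G"
  shows "(\<integral>x. (norm (F x + G x))\<^sup>2 \<partial>M) \<le> 2 * (\<integral>x. (norm (F x))\<^sup>2 \<partial>M) + 2 * (\<integral>x. (norm (G x))\<^sup>2 \<partial>M)"
proof -
  have "(\<integral>x. (norm (F x + G x))\<^sup>2 \<partial>M) \<le> (\<integral>x. 2 * (norm (F x))\<^sup>2 + 2 * (norm (G x))\<^sup>2 \<partial>M)"
    using assms L2H_add[OF assms]
    by (intro integral_mono) (auto simp: L2H_def norm_add_square_le)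
  then show ?thesis using assms by (simp add: L2H_def)
qed

lemma l2norm_tendsto_0_iff:
  "((\<lambda>n. l2norm M (f n)) \<longlongrightarrow> 0) F \<longleftrightarrow> ((\<lambda>n. \<integral>x. (f n x)\<^sup>2 \<partial>M) \<longlongrightarrow> 0) F"
proof
  assume "((\<lambda>n. l2norm M (f n)) \<longlongrightarrow> 0) F"
  from tendsto_power[OF this, of 2] show "((\<lambda>n. \<integral>x. (f n x)\<^sup>2 \<partial>M) \<longlongrightarrow> 0) F"
    by (simp add: l2norm_def)
next
  assume "((\<lambda>n. \<integral>x. (f n x)\<^sup>2 \<partial>M) \<longlongrightarrow> 0) F"
  from tendsto_real_sqrt[OF this] show "((\<lambda>n. l2norm M (f n)) \<longlongrightarrow> 0) F"
    by (simp add: l2norm_def)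
qed

lemma l2normH_tendsto_0_iff:
  "((\<lambda>n. l2normH M (f n)) \<longlongrightarrow> 0) F \<longleftrightarrow> ((\<lambda>n. \<integral>x. (norm (f n x))\<^sup>2 \<partial>M) \<longlongrightarrow> 0) F"
proof
  assume "((\<lambda>n. l2normH M (f n)) \<longlongrightarrow> 0) F"
  from tendsto_power[OF this, of 2] show "((\<lambda>n. \<integral>x. (norm (f n x))\<^sup>2 \<partial>M) \<longlongrightarrow> 0) F"
    by (simp add: l2normH_def)
next
  assume "((\<lambda>n. \<integral>x. (norm (f n x))\<^sup>2 \<partial>M) \<longlongrightarrow> 0) F"
  from tendsto_real_sqrt[OF this] show "((\<lambda>n. l2normH M (f n)) \<longlongrightarrow> 0) F"
    by (simp add: l2normH_def)
qed

lemma L2H_dominated_convergence: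
  fixes F :: "nat \<Rightarrow> 'a \<Rightarrow> 'h::{real_inner, second_countable_topology}"
  assumes m: "\<And>n. F n \<in> borel_measurable M" "G \<in> borel_measurable M"
    and W: "L2 M W"
    and lim: "AE x in M. (\<lambda>n. F n x) \<longlonglongrightarrow> G x"
    and dom: "\<And>n. AE x in M. norm (F n x) \<le> W x"
  shows "L2H M G" "(\<lambda>n. \<integral>x. (norm (F n x - G x))\<^sup>2 \<partial>M) \<longlonglongrightarrow> 0"
proof -
  have dom': "AE x in M. \<forall>n. norm (F n x) \<le> W x"
    using dom by (simp add: AE_all_countable)
  have G: "AE x in M. norm (G x) \<le> W x"
    using lim dom'
  proof eventually_elim
    case (elim x)
    show ?case
      by (rule Lim_bounded[where M=0, OF tendsto_norm[OF elim(1)]]) (use elim(2) in auto)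
  qed
  show "L2H M G"
    by (rule L2H_bound[OF m(2) L2_square_integrable[OF W]])
       (use G in eventually_elim, auto intro: power_mono)
  have "(\<lambda>n. \<integral>x. (norm (F n x - G x))\<^sup>2 \<partial>M) \<longlonglongrightarrow> (\<integral>x. 0 \<partial>M)"
  proof (rule integral_dominated_convergence[where w="\<lambda>x. 4 * (W x)\<^sup>2"])
    show "AE x in M. (\<lambda>n. (norm (F n x - G x))\<^sup>2) \<longlonglongrightarrow> 0"
      using lim
    proof eventually_elim
      case (elim x)
      have "(\<lambda>n. (norm (F n x - G x))\<^sup>2) \<longlonglongrightarrow> (norm (G x - G x))\<^sup>2"
        by (intro tendsto_intros elim)
      then show ?case by simp
    qed
    show "AE x in M. norm ((norm (F n x - G x))\<^sup>2) \<le> 4 * (W x)\<^sup>2" for n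
      using G dom[of n]
    proof eventually_elim
      case (elim x)
      have "norm (F n x - G x) \<le> 2 * W x"
        using norm_triangle_ineq4[of "F n x" "G x"] elim by linarith
      then have "(norm (F n x - G x))\<^sup>2 \<le> (2 * W x)\<^sup>2" by (intro power_mono) auto
      then show ?case by (simp add: power_mult_distrib)
    qed
  qed (use m W in \<open>auto simp: L2_def\<close>)
  then show "(\<lambda>n. \<integral>x. (norm (F n x - G x))\<^sup>2 \<partial>M) \<longlonglongrightarrow> 0" by simp
qed

lemma square_integral_0_AE_subseq:
  fixes F :: "nat \<Rightarrow> 'a \<Rightarrow> 'h::{real_inner, second_countable_topology}"
  assumes "\<And>n. L2H M (F n)" "(\<lambda>n. \<integral>x. (norm (F n x))\<^sup>2 \<partial>M) \<longlonglongrightarrow> 0"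
  shows "\<exists>r::nat\<Rightarrow>nat. strict_mono r \<and> (AE x in M. (\<lambda>n. F (r n) x) \<longlonglongrightarrow> 0)"
proof -
  have "\<exists>r::nat\<Rightarrow>nat. strict_mono r \<and> (AE x in M. (\<lambda>n. (norm (F (r n) x))\<^sup>2) \<longlonglongrightarrow> 0)"
    by (rule tendsto_L1_AE_subseq) (use assms in \<open>auto simp: L2H_def\<close>)
  then obtain r :: "nat \<Rightarrow> nat" where r: "strict_mono r" "AE x in M. (\<lambda>n. (norm (F (r n) x))\<^sup>2) \<longlonglongrightarrow> 0" by auto
  have "AE x in M. (\<lambda>n. F (r n) x) \<longlonglongrightarrow> 0"
    using r(2)
  proof eventually_elim
    case (elim x)
    from tendsto_real_sqrt[OF this] show ?case by (simp add: tendsto_norm_zero_iff)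
  qed
  with r(1) show ?thesis by blast
qed

text \<open>Young's inequality with a free weight \<open>l\<close>, in place of Cauchy-Schwarz: only
  integrals of squares occur, no square roots, and \<open>l\<close> can be tuned to the size of
  either factor.\<close>

lemma integral_product_le:
  assumes "L2 M f" "L2 M g" "0 < l"
  shows "\<bar>\<integral>x. f x * g x \<partial>M\<bar> \<le> l * (\<integral>x. (f x)\<^sup>2 \<partial>M) + (\<integral>x. (g x)\<^sup>2 \<partial>M) / l"
proof -
  have i: "integrable M (\<lambda>x. l * (f x)\<^sup>2 + (g x)\<^sup>2 / l)"
    using assms by (auto simp: L2_def)
  have "\<bar>\<integral>x. f x * g x \<partial>M\<bar> \<le> (\<integral>x. \<bar>f x * g x\<bar> \<partial>M)" by (rule integral_abs_bound)
  also have "\<dots> \<le> (\<integral>x. l * (f x)\<^sup>2 + (g x)\<^sup>2 / l \<partial>M)"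
  proof (rule integral_mono[OF _ i])
    show "integrable M (\<lambda>x. \<bar>f x * g x\<bar>)" using L2_product_integrable[OF assms(1,2)] by simp
    fix x
    have "0 \<le> (l * \<bar>f x\<bar> - \<bar>g x\<bar>)\<^sup>2" by simp
    then have "2 * l * (\<bar>f x\<bar> * \<bar>g x\<bar>) \<le> l\<^sup>2 * (f x)\<^sup>2 + (g x)\<^sup>2"
      by (simp add: power2_diff power_mult_distrib algebra_simps)
    then have "2 * \<bar>f x * g x\<bar> \<le> l * (f x)\<^sup>2 + (g x)\<^sup>2 / l"
      using \<open>0 < l\<close> by (simp add: abs_mult field_simps power2_eq_square)
    moreover have "0 \<le> \<bar>f x * g x\<bar>" by simp
    ultimately show "\<bar>f x * g x\<bar> \<le> l * (f x)\<^sup>2 + (g x)\<^sup>2 / l" by linarith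
  qed
  also have "\<dots> = l * (\<integral>x. (f x)\<^sup>2 \<partial>M) + (\<integral>x. (g x)\<^sup>2 \<partial>M) / l"
    using assms by (simp add: L2_def)
  finally show ?thesis .
qed

lemma L2H_product_tendsto:
  fixes F :: "nat \<Rightarrow> 'a \<Rightarrow> 'h::{real_inner, second_countable_topology}"
  assumes "\<And>n. L2H M (F n)" "L2H M F0" "L2H M G"
    and "(\<lambda>n. \<integral>x. (norm (F n x - F0 x))\<^sup>2 \<partial>M) \<longlonglongrightarrow> 0"
  shows "(\<lambda>n. \<integral>x. inner (F n x) (G x) \<partial>M) \<longlonglongrightarrow> (\<integral>x. inner (F0 x) (G x) \<partial>M)"
proof -
  define e where "e n = (\<integral>x. (norm (F n x - F0 x))\<^sup>2 \<partial>M)" for n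
  define g where "g = (\<integral>x. (norm (G x))\<^sup>2 \<partial>M)"
  have b: "norm ((\<integral>x. inner (F n x) (G x) \<partial>M) - (\<integral>x. inner (F0 x) (G x) \<partial>M)) \<le> e n / l + l * g" if "0 < l" for n l
  proof -
    have "(\<integral>x. inner (F n x) (G x) \<partial>M) - (\<integral>x. inner (F0 x) (G x) \<partial>M) = (\<integral>x. inner (F n x - F0 x) (G x) \<partial>M)"
      using assms by (simp add: L2H_inner_integrable inner_diff_left)
    also have "norm \<dots> \<le> (\<integral>x. norm (inner (F n x - F0 x) (G x)) \<partial>M)"
      by (rule integral_norm_bound)
    also have "\<dots> \<le> (\<integral>x. norm (G x) * norm (F n x - F0 x) \<partial>M)"
      by (rule integral_mono)
         (use assms in \<open>auto intro!: L2H_inner_integrable L2H_norm_product_integrable L2H_diff simp: Cauchy_Schwarz_ineq2 mult.commute[of "norm (G _)"]\<close>)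
    also have "\<dots> \<le> \<bar>\<integral>x. norm (G x) * norm (F n x - F0 x) \<partial>M\<bar>" by simp
    also have "\<dots> \<le> l * g + e n / l"
      using integral_product_le[of M "\<lambda>x. norm (G x)" "\<lambda>x. norm (F n x - F0 x)" l] assms that
      by (simp add: L2H_norm L2H_diff g_def e_def)
    finally show ?thesis by simp
  qed
  have g0: "0 \<le> g" by (simp add: g_def)
  show ?thesis
  proof (rule LIMSEQ_I)
    fix r :: real assume r: "0 < r"
    \<comment> \<open>This keeps the fixed contribution l g below r/2; the vanishing contribution e
      n / l is then brought below r/2 by taking n large.\<close>
    define l where "l = r / (2 * (g + 1))"
    have l: "0 < l" "l * g < r / 2 + 0"
      using r g0 by (auto simp: l_def field_simps add_pos_nonneg)
    from assms(4) have "e \<longlonglongrightarrow> 0" by (simp add: e_def[abs_def])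
    then have "\<forall>\<^sub>F n in sequentially. e n < l * r / 2"
      using l r by (intro order_tendstoD) auto
    then obtain n0 where n0: "\<And>n. n \<ge> n0 \<Longrightarrow> e n < l * r / 2" by (auto simp: eventually_sequentially)
    show "\<exists>n0. \<forall>n\<ge>n0. norm ((\<integral>x. inner (F n x) (G x) \<partial>M) - (\<integral>x. inner (F0 x) (G x) \<partial>M)) < r"
    proof (intro exI allI impI)
      fix n assume "n \<ge> n0"
      then have "e n / l < r / 2" using n0 l by (simp add: field_simps)
      with b[OF l(1), of n] l(2) show "norm ((\<integral>x. inner (F n x) (G x) \<partial>M) - (\<integral>x. inner (F0 x) (G x) \<partial>M)) < r"
        by linarith
    qed
  qed
qed

text \<open>Along a sequence with $\sum 2^k \|U_{r(k+1)} - U_{r(k)}\|^2 < \infty$ the increments decay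
  geometrically almost everywhere.\<close>

lemma L2H_complete:
  fixes U :: "nat \<Rightarrow> 'a \<Rightarrow> 'h::{real_inner, complete_space, second_countable_topology}"
  assumes U: "\<And>n. L2H M (U n)"
    and C: "\<And>e::real. e > 0 \<Longrightarrow> \<exists>N. \<forall>m\<ge>N. \<forall>n\<ge>N. (\<integral>x. (norm (U m x - U n x))\<^sup>2 \<partial>M) < e"
  shows "\<exists>V r. L2H M V \<and> (\<lambda>n. \<integral>x. (norm (U n x - V x))\<^sup>2 \<partial>M) \<longlonglongrightarrow> 0
    \<and> strict_mono (r :: nat \<Rightarrow> nat) \<and> (AE x in M. (\<lambda>n. U (r n) x) \<longlonglongrightarrow> V x)"
proof -
  have [measurable]: "U n \<in> borel_measurable M" for n using U by (simp add: L2H_def)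
  \<comment> \<open>The rate 1/4 leaves room for the weight 2^k below: 2^k (1/4)^k is still
    summable, and finiteness of the weighted sum controls the increments pointwise.\<close>
  have "\<exists>N. \<forall>k. (\<forall>m\<ge>N k. \<forall>n\<ge>N k. (\<integral>x. (norm (U m x - U n x))\<^sup>2 \<partial>M) < (1/4)^k)"
    by (intro choice allI C) simp
  then obtain N where N: "\<And>k m n. m \<ge> N k \<Longrightarrow> n \<ge> N k \<Longrightarrow> (\<integral>x. (norm (U m x - U n x))\<^sup>2 \<partial>M) < (1/4)^k"
    by blast
  \<comment> \<open>The sum dominates every \<open>N i\<close> with i <= k, and the added k makes
    \<open>r\<close> strictly increasing although \<open>N\<close> is not known to be
    monotone.\<close>
  define r where "r k = (\<Sum>i\<le>k. N i) + k" for k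
  have r_mono: "strict_mono r" by (rule strict_mono_Suc_iff[THEN iffD2]) (simp add: r_def)
  have rN: "N k \<le> r j" if "k \<le> j" for k j
  proof -
    have "N k \<le> (\<Sum>i\<le>j. N i)" using that by (intro member_le_sum) auto
    then show ?thesis by (simp add: r_def)
  qed
  define d where "d k x = norm (U (r (Suc k)) x - U (r k) x)" for k x
  have [measurable]: "d k \<in> borel_measurable M" for k unfolding d_def by measurable
  have d_int: "integrable M (\<lambda>x. (d k x)\<^sup>2)" for k
    using L2H_diff[OF U U, of "r (Suc k)" "r k"] by (simp add: d_def L2H_def)
  have nn: "(\<integral>\<^sup>+x. ennreal (2^k * (d k x)\<^sup>2) \<partial>M) \<le> ennreal ((1/2)^k)" for k
  proof -
    have "(\<integral>\<^sup>+x. ennreal (2^k * (d k x)\<^sup>2) \<partial>M) = ennreal (\<integral>x. 2^k * (d k x)\<^sup>2 \<partial>M)"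
      using d_int by (intro nn_integral_eq_integral) auto
    also have "(\<integral>x. 2^k * (d k x)\<^sup>2 \<partial>M) = 2^k * (\<integral>x. (d k x)\<^sup>2 \<partial>M)" by simp
    also have "\<dots> \<le> 2^k * (1/4)^k"
      using N[OF rN[of k "Suc k"] rN[of k k]] by (intro mult_left_mono) (auto simp: d_def)
    also have "\<dots> = (1/2::real)^k" by (simp add: power_mult_distrib[symmetric])
    finally show ?thesis by (simp add: ennreal_leI)
  qed
  have "(\<integral>\<^sup>+x. (\<Sum>k. ennreal (2^k * (d k x)\<^sup>2)) \<partial>M) = (\<Sum>k. \<integral>\<^sup>+x. ennreal (2^k * (d k x)\<^sup>2) \<partial>M)"
    by (intro nn_integral_suminf) simp
  also have "\<dots> \<le> (\<Sum>k. ennreal ((1/2)^k))" by (intro suminf_le nn) auto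
  also have "\<dots> < \<infinity>" by (subst suminf_ennreal2) (auto intro!: summable_geometric)
  finally have "AE x in M. (\<Sum>k. ennreal (2^k * (d k x)\<^sup>2)) \<noteq> \<infinity>"
    by (intro nn_integral_PInf_AE) auto
  then have ae_conv: "AE x in M. convergent (\<lambda>k. U (r k) x)"
  proof eventually_elim
    case (elim x)
    have nd: "0 \<le> d k x" for k by (simp add: d_def)
    have "summable (\<lambda>k. 2^k * (d k x)\<^sup>2)"
      using elim by (intro summable_suminf_not_top) (auto simp: top_ennreal.rep_eq)
    from summable_LIMSEQ_zero[OF this] have "Bseq (\<lambda>k. 2^k * (d k x)\<^sup>2)"
      by (intro convergent_imp_Bseq) (auto simp: convergent_def)
    then obtain B where B: "0 < B" "\<And>k. 2^k * (d k x)\<^sup>2 \<le> B"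
      unfolding Bseq_def by (auto simp: abs_mult)
    have le: "d k x \<le> sqrt B * (sqrt (1/2))^k" for k
    proof -
      have "(d k x)\<^sup>2 \<le> B * (1/2)^k" using B(2)[of k] by (simp add: field_simps power_one_over)
      then have "sqrt ((d k x)\<^sup>2) \<le> sqrt (B * (1/2)^k)" by (rule real_sqrt_le_mono)
      then show ?thesis using nd by (simp add: real_sqrt_mult real_sqrt_power)
    qed
    have "sqrt (1/2) < sqrt (1::real)" by (rule real_sqrt_less_mono) simp
    then have "summable (\<lambda>k. sqrt B * (sqrt (1/2))^k)"
      by (intro summable_mult summable_geometric) simp
    then have "summable (\<lambda>k. d k x)"
      by (rule summable_comparison_test_ev[rotated]) (auto intro!: always_eventually simp: nd le)
    then have Cs: "Cauchy (\<lambda>n. \<Sum>k<n. d k x)"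
      by (intro convergent_Cauchy) (simp add: summable_iff_convergent)
    have tri: "norm (U (r (m + p)) x - U (r m) x) \<le> (\<Sum>k<m+p. d k x) - (\<Sum>k<m. d k x)" for m p
    proof (induction p)
      case (Suc p)
      have "norm (U (r (m + Suc p)) x - U (r m) x) \<le> d (m + p) x + norm (U (r (m + p)) x - U (r m) x)"
        using norm_triangle_ineq[of "U (r (Suc (m + p))) x - U (r (m + p)) x" "U (r (m + p)) x - U (r m) x"]
        by (simp add: d_def)
      with Suc show ?case by simp
    qed simp
    have "Cauchy (\<lambda>k. U (r k) x)"
    proof (rule metric_CauchyI)
      fix e :: real assume "0 < e"
      from metric_CauchyD[OF Cs this] obtain K where K: "\<And>m n. m \<ge> K \<Longrightarrow> n \<ge> K \<Longrightarrow> dist (\<Sum>k<m. d k x) (\<Sum>k<n. d k x) < e"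
        by blast
      have *: "dist (U (r m) x) (U (r n) x) < e" if "K \<le> m" "m \<le> n" for m n
      proof -
        have "norm (U (r n) x - U (r m) x) \<le> (\<Sum>k<n. d k x) - (\<Sum>k<m. d k x)"
          using tri[of m "n - m"] that by simp
        also have "\<dots> < e" using K[of m n] that by (simp add: dist_real_def)
        finally show ?thesis by (simp add: dist_norm norm_minus_commute)
      qed
      show "\<exists>K. \<forall>m\<ge>K. \<forall>n\<ge>K. dist (U (r m) x) (U (r n) x) < e"
      proof (intro exI[of _ K] allI impI)
        fix m n assume "K \<le> m" "K \<le> n"
        then show "dist (U (r m) x) (U (r n) x) < e"
          using *[of m n] *[of n m] by (cases "m \<le> n") (auto simp: dist_commute)
      qed
    qed
    then show ?case by (rule Cauchy_convergent)
  qed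
  \<comment> \<open>The limit is taken on the measurable set where the subsequence is Cauchy and set
    to 0 elsewhere, which makes \<open>V\<close> measurable at once.\<close>
  define S where "S = {x \<in> space M. Cauchy (\<lambda>k. U (r k) x)}"
  have [measurable]: "S \<in> sets M" unfolding S_def by measurable
  define V where "V x = (if x \<in> S then lim (\<lambda>k. U (r k) x) else 0)" for x
  have limS: "(\<lambda>k. if x \<in> S then U (r k) x else 0) \<longlonglongrightarrow> V x" for x
    by (auto simp: V_def S_def Cauchy_convergent_iff convergent_LIMSEQ_iff)
  have Vm [measurable]: "V \<in> borel_measurable M"
    by (rule borel_measurable_LIMSEQ_metric[where f="\<lambda>k x. if x \<in> S then U (r k) x else 0"])
       (auto intro: limS)
  have lim: "AE x in M. (\<lambda>k. U (r k) x) \<longlonglongrightarrow> V x"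
    using ae_conv AE_space
  proof eventually_elim
    case (elim x)
    then have "x \<in> S" by (simp add: S_def convergent_Cauchy)
    with limS[of x] show ?case by simp
  qed
  \<comment> \<open>Fatou along the subsequence: \<open>U n\<close> is within (1/4)^k of all late
    \<open>U (r j)\<close>, hence of their limit. As n is arbitrary beyond \<open>N k\<close>, the
    whole sequence converges.\<close>
  have fat: "integrable M (\<lambda>x. (norm (U n x - V x))\<^sup>2) \<and> (\<integral>x. (norm (U n x - V x))\<^sup>2 \<partial>M) \<le> (1/4)^k"
    if "n \<ge> N k" for n k
  proof -
    have "(\<integral>\<^sup>+x. ennreal ((norm (U n x - V x))\<^sup>2) \<partial>M)
        \<le> (\<integral>\<^sup>+x. liminf (\<lambda>j. ennreal ((norm (U n x - U (r j) x))\<^sup>2)) \<partial>M)"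
    proof (rule nn_integral_mono_AE)
      show "AE x in M. ennreal ((norm (U n x - V x))\<^sup>2) \<le> liminf (\<lambda>j. ennreal ((norm (U n x - U (r j) x))\<^sup>2))"
        using lim
      proof eventually_elim
        case (elim x)
        have "(\<lambda>j. ennreal ((norm (U n x - U (r j) x))\<^sup>2)) \<longlonglongrightarrow> ennreal ((norm (U n x - V x))\<^sup>2)"
          by (intro tendsto_ennrealI tendsto_intros elim)
        from lim_imp_Liminf[OF trivial_limit_sequentially this] show ?case by simp
      qed
    qed
    also have "\<dots> \<le> liminf (\<lambda>j. \<integral>\<^sup>+x. ennreal ((norm (U n x - U (r j) x))\<^sup>2) \<partial>M)"
      by (rule nn_integral_liminf) simp
    also have "\<dots> \<le> ennreal ((1/4)^k)"
    proof -
      have "\<forall>\<^sub>F j in sequentially. (\<integral>\<^sup>+x. ennreal ((norm (U n x - U (r j) x))\<^sup>2) \<partial>M) \<le> ennreal ((1/4)^k)"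
        unfolding eventually_sequentially
      proof (intro exI allI impI)
        fix j assume "k \<le> j"
        have "(\<integral>\<^sup>+x. ennreal ((norm (U n x - U (r j) x))\<^sup>2) \<partial>M) = ennreal (\<integral>x. (norm (U n x - U (r j) x))\<^sup>2 \<partial>M)"
          using L2H_diff[OF U U, of n "r j"] by (intro nn_integral_eq_integral) (auto simp: L2H_def)
        also have "\<dots> \<le> ennreal ((1/4)^k)"
          using N[OF that rN[OF \<open>k \<le> j\<close>]] by (intro ennreal_leI) simp
        finally show "(\<integral>\<^sup>+x. ennreal ((norm (U n x - U (r j) x))\<^sup>2) \<partial>M) \<le> ennreal ((1/4)^k)" .
      qed
      then show ?thesis
        using Liminf_mono[of "\<lambda>j. \<integral>\<^sup>+x. ennreal ((norm (U n x - U (r j) x))\<^sup>2) \<partial>M" "\<lambda>_. ennreal ((1/4)^k)" sequentially]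
        by (simp add: Liminf_const)
    qed
    finally have *: "(\<integral>\<^sup>+x. ennreal ((norm (U n x - V x))\<^sup>2) \<partial>M) \<le> ennreal ((1/4)^k)" .
    have i: "integrable M (\<lambda>x. (norm (U n x - V x))\<^sup>2)"
    proof (rule integrableI_bounded)
      have "(\<integral>\<^sup>+x. ennreal (norm ((norm (U n x - V x))\<^sup>2)) \<partial>M) \<le> ennreal ((1/4)^k)" using * by simp
      also have "\<dots> < \<infinity>" by simp
      finally show "(\<integral>\<^sup>+x. ennreal (norm ((norm (U n x - V x))\<^sup>2)) \<partial>M) < \<infinity>" .
    qed simp
    from * have "(\<integral>x. (norm (U n x - V x))\<^sup>2 \<partial>M) \<le> (1/4)^k"
      by (subst (asm) nn_integral_eq_integral[OF i]) auto
    with i show ?thesis by blast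
  qed
  have "L2H M (\<lambda>x. U (N 0) x - V x)" using fat[of 0 "N 0"] by (simp add: L2H_def)
  from L2H_diff[OF U[of "N 0"] this] have LV: "L2H M V" by simp
  have "(\<lambda>n. \<integral>x. (norm (U n x - V x))\<^sup>2 \<partial>M) \<longlonglongrightarrow> 0"
  proof (rule LIMSEQ_I)
    fix e :: real assume "0 < e"
    then obtain k where k: "(1/4::real)^k < e" using real_arch_pow_inv[of e "1/4"] by auto
    show "\<exists>n0. \<forall>n\<ge>n0. norm ((\<integral>x. (norm (U n x - V x))\<^sup>2 \<partial>M) - 0) < e"
      using fat[of k] k by (intro exI[of _ "N k"]) (auto intro: le_less_trans)
  qed
  with LV r_mono lim show ?thesis by blast
qed

section \<open>Calculus in the domain of the derivation\<close>

text \<open>The chain rule of the derivation asks for functions that are C^1 on the whole line with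
  bounded slope. Functions that are natural only on an interval are extended by gluing pieces whose
  values and slopes agree at the junction.\<close>

lemma has_real_derivative_glue:
  fixes f g :: "real \<Rightarrow> real"
  assumes f: "\<And>x. c \<le> x \<Longrightarrow> (f has_real_derivative f' x) (at x)"
    and g: "\<And>x. x \<le> c \<Longrightarrow> (g has_real_derivative g' x) (at x)"
    and eq: "f c = g c" "f' c = g' c"
  shows "((\<lambda>x. if x \<le> c then g x else f x) has_real_derivative (if x \<le> c then g' x else f' x)) (at x)"
proof (cases x c rule: linorder_cases)
  case less
  then have "\<forall>\<^sub>F y in nhds x. (if y \<le> c then g y else f y) = g y"
    using eventually_nhds_in_open[of "{..<c}" x] by (auto elim!: eventually_mono)
  with g[of x] less show ?thesis by (subst DERIV_cong_ev[OF refl _ refl]) auto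
next
  case greater
  then have "\<forall>\<^sub>F y in nhds x. (if y \<le> c then g y else f y) = f y"
    using eventually_nhds_in_open[of "{c<..}" x] by (auto elim!: eventually_mono)
  with f[of x] greater show ?thesis by (subst DERIV_cong_ev[OF refl _ refl]) auto
next
  case equal
  let ?F = "\<lambda>x. if x \<le> c then g x else f x"
  have "((\<lambda>y. (g y - g c) / (y - c)) \<longlongrightarrow> g' c) (at_left c)"
    using g[of c] by (simp add: has_field_derivative_iff filterlim_at_split)
  then have 1: "((\<lambda>y. (?F y - g c) / (y - c)) \<longlongrightarrow> g' c) (at_left c)"
    by (rule Lim_transform_eventually) (auto simp: eventually_at_filter)
  have "((\<lambda>y. (f y - g c) / (y - c)) \<longlongrightarrow> g' c) (at_right c)"
    using f[of c] eq by (simp add: has_field_derivative_iff filterlim_at_split)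
  then have 2: "((\<lambda>y. (?F y - g c) / (y - c)) \<longlongrightarrow> g' c) (at_right c)"
    by (rule Lim_transform_eventually) (auto simp: eventually_at_filter)
  from 1 2 equal show ?thesis
    by (simp add: has_field_derivative_iff filterlim_at_split)
qed

lemma continuous_on_glue:
  fixes f g :: "real \<Rightarrow> real"
  assumes "continuous_on {c..} f" "continuous_on {..c} g" "f c = g c"
  shows "continuous_on UNIV (\<lambda>x. if x \<le> c then g x else f x)"
proof -
  have "continuous_on ({..c} \<union> {c..}) (\<lambda>x. if x \<le> c then g x else f x)"
    by (rule continuous_on_If) (use assms in auto)
  moreover have "{..c} \<union> {c..} = UNIV" by auto
  ultimately show ?thesis by simp
qed

section \<open>The closed derivation: chain rule, truncations, products\<close>

locale derivation =
  fixes M :: "'a measure" and Dom :: "('a \<Rightarrow> real) set"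
    and D :: "('a \<Rightarrow> real) \<Rightarrow> 'a \<Rightarrow> 'h::{real_inner, complete_space, second_countable_topology}"
  assumes derivation: "dirichlet_operator M Dom D"
begin

lemma dom_L2: "f \<in> Dom \<Longrightarrow> L2 M f"
  using derivation unfolding dirichlet_operator_def by blast

lemma D_L2H: "f \<in> Dom \<Longrightarrow> L2H M (D f)"
  using derivation unfolding dirichlet_operator_def by blast

lemma dom_measurable: "f \<in> Dom \<Longrightarrow> f \<in> borel_measurable M"
  using dom_L2 L2_measurable by blast

lemma D_measurable: "f \<in> Dom \<Longrightarrow> D f \<in> borel_measurable M"
  using D_L2H L2H_measurable by blast

lemma dom_square_integrable: "f \<in> Dom \<Longrightarrow> integrable M (\<lambda>x. (f x)\<^sup>2)"
  using dom_L2 by (simp add: L2_def)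

lemma D_square_integrable: "f \<in> Dom \<Longrightarrow> integrable M (\<lambda>x. (norm (D f x))\<^sup>2)"
  using D_L2H by (simp add: L2H_def)

lemma dom_zero: "(\<lambda>x. 0) \<in> Dom"
  using derivation unfolding dirichlet_operator_def by blast

lemma dom_lin: "f \<in> Dom \<Longrightarrow> g \<in> Dom \<Longrightarrow> (\<lambda>x. a * f x + b * g x) \<in> Dom"
  using derivation unfolding dirichlet_operator_def by blast

lemma D_lin: "f \<in> Dom \<Longrightarrow> g \<in> Dom \<Longrightarrow>
    AE x in M. D (\<lambda>x. a * f x + b * g x) x = a *\<^sub>R D f x + b *\<^sub>R D g x"
  using derivation unfolding dirichlet_operator_def by blast

lemma dom_cong: "f \<in> Dom \<Longrightarrow> L2 M g \<Longrightarrow> AE x in M. f x = g x \<Longrightarrow> g \<in> Dom"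
  using derivation unfolding dirichlet_operator_def by blast

lemma D_cong: "f \<in> Dom \<Longrightarrow> g \<in> Dom \<Longrightarrow> AE x in M. f x = g x \<Longrightarrow> AE x in M. D f x = D g x"
  using derivation dom_L2 unfolding dirichlet_operator_def by blast

lemma dom_dense_L2: "L2 M f \<Longrightarrow> 0 < e \<Longrightarrow> \<exists>g\<in>Dom. l2norm M (\<lambda>x. f x - g x) < e"
  using derivation unfolding dirichlet_operator_def by blast

lemma dom_closed:
  assumes "\<And>n. u n \<in> Dom" "L2 M u0" "L2H M G"
    and "(\<lambda>n. \<integral>x. (u n x - u0 x)\<^sup>2 \<partial>M) \<longlonglongrightarrow> 0"
    and "(\<lambda>n. \<integral>x. (norm (D (u n) x - G x))\<^sup>2 \<partial>M) \<longlonglongrightarrow> 0"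
  shows "u0 \<in> Dom" "AE x in M. D u0 x = G x"
proof -
  have "\<forall>u u0 G. (\<forall>n. u n \<in> Dom) \<and> L2 M u0 \<and> L2H M G
        \<and> (\<lambda>n. l2norm M (\<lambda>x. u n x - u0 x)) \<longlonglongrightarrow> 0
        \<and> (\<lambda>n. l2normH M (\<lambda>x. D (u n) x - G x)) \<longlonglongrightarrow> 0
        \<longrightarrow> u0 \<in> Dom \<and> (AE x in M. D u0 x = G x)"
    using derivation unfolding dirichlet_operator_def by blast
  with assms show "u0 \<in> Dom" "AE x in M. D u0 x = G x"
    by (auto simp: l2norm_tendsto_0_iff l2normH_tendsto_0_iff)
qed

lemma dom_chain:
  assumes f: "f \<in> Dom"
    and d: "\<And>x. (\<phi> has_real_derivative \<phi>' x) (at x)"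
    and c: "continuous_on UNIV \<phi>'" and b: "\<And>x. \<bar>\<phi>' x\<bar> \<le> C" and 0: "\<phi> 0 = 0"
  shows "(\<lambda>x. \<phi> (f x)) \<in> Dom" "AE x in M. D (\<lambda>x. \<phi> (f x)) x = \<phi>' (f x) *\<^sub>R D f x"
proof -
  define F where "F = (\<lambda>p::nat\<Rightarrow>real. \<phi> (p 0))"
  define dF where "dF = (\<lambda>(j::nat) p::nat\<Rightarrow>real. \<phi>' (p 0))"
  have "C1_bounded 1 F dF"
    unfolding C1_bounded_def
  proof (intro conjI allI impI)
    fix j :: nat and x assume "j < 1"
    then show "((\<lambda>s. F (x(j := s))) has_real_derivative dF j x) (at (x j))"
      using d by (simp add: F_def dF_def)
  next
    fix j :: nat and x :: "nat \<Rightarrow> real" and e :: real assume "j < 1" "0 < e"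
    have "isCont \<phi>' (x 0)" using c by (simp add: continuous_on_eq_continuous_at)
    then obtain r where "r > 0" "\<And>y. \<bar>y - x 0\<bar> < r \<Longrightarrow> \<bar>\<phi>' y - \<phi>' (x 0)\<bar> < e"
      using \<open>0 < e\<close> unfolding continuous_at_eps_delta by (auto simp: dist_real_def)
    then show "\<exists>\<delta>>0. \<forall>y. (\<forall>i<1. \<bar>y i - x i\<bar> < \<delta>) \<longrightarrow> \<bar>dF j y - dF j x\<bar> < e"
      by (auto simp: dF_def)
  qed (auto simp: F_def dF_def intro: b)
  moreover have "\<forall>m fs F dF. (\<forall>j<m. fs j \<in> Dom) \<and> C1_bounded m F dF \<and> F (\<lambda>_. 0) = 0 \<longrightarrow>
        (\<lambda>p. F (\<lambda>j. fs j p)) \<in> Dom \<and>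
        (AE p in M. D (\<lambda>p. F (\<lambda>j. fs j p)) p = (\<Sum>j<m. dF j (\<lambda>i. fs i p) *\<^sub>R D (fs j) p))"
    using derivation unfolding dirichlet_operator_def by blast
  then have "(\<forall>j<(1::nat). f \<in> Dom) \<and> C1_bounded 1 F dF \<and> F (\<lambda>_. 0) = 0 \<longrightarrow>
        (\<lambda>p. F (\<lambda>j. f p)) \<in> Dom \<and>
        (AE p in M. D (\<lambda>p. F (\<lambda>j. f p)) p = (\<Sum>j<(1::nat). dF j (\<lambda>i. f p) *\<^sub>R D f p))"
    by (elim allE[of _ 1] allE[of _ "\<lambda>_. f"] allE[of _ F] allE[of _ dF])
  ultimately show "(\<lambda>x. \<phi> (f x)) \<in> Dom" "AE x in M. D (\<lambda>x. \<phi> (f x)) x = \<phi>' (f x) *\<^sub>R D f x"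
    using f 0 by (simp_all add: F_def dF_def)
qed

lemma dom_chain_nonneg:
  assumes f: "f \<in> Dom" "\<And>x. 0 \<le> f x"
    and d: "\<And>x. 0 \<le> x \<Longrightarrow> (\<phi> has_real_derivative \<phi>' x) (at x)"
    and c: "continuous_on {0..} \<phi>'" and b: "\<And>x. 0 \<le> x \<Longrightarrow> \<bar>\<phi>' x\<bar> \<le> C" and 0: "\<phi> 0 = 0"
  shows "(\<lambda>x. \<phi> (f x)) \<in> Dom" "AE x in M. D (\<lambda>x. \<phi> (f x)) x = \<phi>' (f x) *\<^sub>R D f x"
proof -
  \<comment> \<open>Left of 0 the function is continued by its tangent at 0, which keeps the slope
    continuous and bounded by the same \<open>C\<close>. Since f is nonnegative, the continuation
    leaves the composition unchanged.\<close>
  define \<psi> where "\<psi> x = (if x \<le> 0 then \<phi>' 0 * x else \<phi> x)" for x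
  define \<psi>' where "\<psi>' x = (if x \<le> 0 then \<phi>' 0 else \<phi>' x)" for x
  have eq: "\<psi> (f x) = \<phi> (f x)" "\<psi>' (f x) = \<phi>' (f x)" for x
    using f(2)[of x] 0 by (auto simp: \<psi>_def \<psi>'_def)
  have 1: "(\<psi> has_real_derivative \<psi>' x) (at x)" for x
    unfolding \<psi>_def \<psi>'_def
    by (rule has_real_derivative_glue) (use d 0 in \<open>auto intro!: derivative_eq_intros\<close>)
  have 2: "continuous_on UNIV \<psi>'"
    unfolding \<psi>'_def[abs_def] by (rule continuous_on_glue) (use c in auto)
  have 3: "\<bar>\<psi>' x\<bar> \<le> C" for x using b[of 0] b[of x] by (auto simp: \<psi>'_def)
  have 4: "\<psi> 0 = 0" by (simp add: \<psi>_def)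
  show "(\<lambda>x. \<phi> (f x)) \<in> Dom" "AE x in M. D (\<lambda>x. \<phi> (f x)) x = \<phi>' (f x) *\<^sub>R D f x"
    using dom_chain[OF f(1) 1 2 3 4] by (simp_all add: eq)
qed

lemma dom_add: "f \<in> Dom \<Longrightarrow> g \<in> Dom \<Longrightarrow> (\<lambda>x. f x + g x) \<in> Dom"
  using dom_lin[of f g 1 1] by simp

lemma D_add: "f \<in> Dom \<Longrightarrow> g \<in> Dom \<Longrightarrow> AE x in M. D (\<lambda>x. f x + g x) x = D f x + D g x"
  using D_lin[of f g 1 1] by simp

lemma dom_diff: "f \<in> Dom \<Longrightarrow> g \<in> Dom \<Longrightarrow> (\<lambda>x. f x - g x) \<in> Dom"
  using dom_lin[of f g 1 "-1"] by simp

lemma D_diff: "f \<in> Dom \<Longrightarrow> g \<in> Dom \<Longrightarrow> AE x in M. D (\<lambda>x. f x - g x) x = D f x - D g x"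
  using D_lin[of f g 1 "-1"] by simp

lemma dom_cmult: "f \<in> Dom \<Longrightarrow> (\<lambda>x. a * f x) \<in> Dom"
  using dom_lin[of f f a 0] by simp

lemma D_cmult: "f \<in> Dom \<Longrightarrow> AE x in M. D (\<lambda>x. a * f x) x = a *\<^sub>R D f x"
  using D_lin[of f f a 0] by simp

lemma dom_uminus: "f \<in> Dom \<Longrightarrow> (\<lambda>x. - f x) \<in> Dom"
  using dom_cmult[of f "-1"] by simp

lemma D_zero: "AE x in M. D (\<lambda>x. 0) x = 0"
  using D_cmult[OF dom_zero, of 0] by simp

lemma dom_sum:
  assumes "finite S" "\<And>i. i \<in> S \<Longrightarrow> u i \<in> Dom"
  shows "(\<lambda>x. \<Sum>i\<in>S. c i * u i x) \<in> Dom \<and>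
    (AE x in M. D (\<lambda>x. \<Sum>i\<in>S. c i * u i x) x = (\<Sum>i\<in>S. c i *\<^sub>R D (u i) x))"
  using assms
proof (induction S)
  case empty
  then show ?case using dom_zero D_zero by simp
next
  case (insert i S)
  then have IH: "(\<lambda>x. \<Sum>i\<in>S. c i * u i x) \<in> Dom"
    "AE x in M. D (\<lambda>x. \<Sum>i\<in>S. c i * u i x) x = (\<Sum>i\<in>S. c i *\<^sub>R D (u i) x)" and ui: "u i \<in> Dom" by auto
  have "AE x in M. D (\<lambda>x. c i * u i x + 1 * (\<Sum>i\<in>S. c i * u i x)) x
    = c i *\<^sub>R D (u i) x + 1 *\<^sub>R D (\<lambda>x. \<Sum>i\<in>S. c i * u i x) x"
    by (rule D_lin[OF ui IH(1)])
  with IH(2) have "AE x in M. D (\<lambda>x. \<Sum>i\<in>insert i S. c i * u i x) x = (\<Sum>i\<in>insert i S. c i *\<^sub>R D (u i) x)"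
    by eventually_elim (use insert in simp)
  moreover have "(\<lambda>x. \<Sum>i\<in>insert i S. c i * u i x) \<in> Dom"
    using dom_lin[OF ui IH(1), of "c i" 1] insert by simp
  ultimately show ?case by blast
qed

text \<open>Convergence in the Hilbert space norm of \<open>Dom\<close>, that of E0_1. Keeping the
  two integrals apart lets closedness of D be applied directly; \<open>dconv_iff_E0l\<close>
  recovers the single norm.\<close>

definition dconv :: "(nat \<Rightarrow> 'a \<Rightarrow> real) \<Rightarrow> ('a \<Rightarrow> real) \<Rightarrow> bool" where
  "dconv u u0 \<longleftrightarrow> (\<forall>n. u n \<in> Dom) \<and> u0 \<in> Dom \<and> (\<lambda>n. \<integral>x. (u n x - u0 x)\<^sup>2 \<partial>M) \<longlonglongrightarrow> 0
    \<and> (\<lambda>n. \<integral>x. (norm (D (u n) x - D u0 x))\<^sup>2 \<partial>M) \<longlonglongrightarrow> 0"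

lemma dconvD:
  assumes "dconv u u0"
  shows "u n \<in> Dom" "u0 \<in> Dom" "(\<lambda>n. \<integral>x. (u n x - u0 x)\<^sup>2 \<partial>M) \<longlonglongrightarrow> 0"
    "(\<lambda>n. \<integral>x. (norm (D (u n) x - D u0 x))\<^sup>2 \<partial>M) \<longlonglongrightarrow> 0"
  using assms by (auto simp: dconv_def)

lemma dconv_subseq: "dconv u u0 \<Longrightarrow> strict_mono r \<Longrightarrow> dconv (\<lambda>n. u (r n)) u0"
  using LIMSEQ_subseq_LIMSEQ[of _ _ r] by (auto simp: dconv_def comp_def)

lemma dconv_AE_subseq:
  assumes "dconv u u0"
  shows "\<exists>r::nat\<Rightarrow>nat. strict_mono r \<and> (AE x in M. (\<lambda>n. u (r n) x) \<longlonglongrightarrow> u0 x)"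
proof -
  have "\<exists>r::nat\<Rightarrow>nat. strict_mono r \<and> (AE x in M. (\<lambda>n. u (r n) x - u0 x) \<longlonglongrightarrow> 0)"
    by (rule square_integral_0_AE_subseq)
       (use assms in \<open>auto simp: dconv_def L2_iff_L2H[symmetric] intro!: dom_L2 dom_diff\<close>)
  then show ?thesis by (simp add: LIM_zero_iff)
qed

text \<open>Dominated convergence is applied to the functions and to their gradients separately;
  closedness then identifies the pointwise limit of the gradients as the gradient of the limit. The
  truncation results below rest on it.\<close>

lemma dconv_dominated:
  assumes u: "\<And>n. u n \<in> Dom" and m: "u0 \<in> borel_measurable M" "G \<in> borel_measurable M"
    and UW: "L2 M U" "L2 M W"
    and lim: "AE x in M. (\<lambda>n. u n x) \<longlonglongrightarrow> u0 x" "AE x in M. (\<lambda>n. D (u n) x) \<longlonglongrightarrow> G x"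
    and dom: "\<And>n. AE x in M. \<bar>u n x\<bar> \<le> U x" "\<And>n. AE x in M. norm (D (u n) x) \<le> W x"
  shows "dconv u u0" "AE x in M. D u0 x = G x"
proof -
  note a = L2H_dominated_convergence[OF _ m(1) UW(1) lim(1)]
  note b = L2H_dominated_convergence[OF _ m(2) UW(2) lim(2)]
  have 1: "L2 M u0" "(\<lambda>n. \<integral>x. (u n x - u0 x)\<^sup>2 \<partial>M) \<longlonglongrightarrow> 0"
    using a u dom(1) by (auto simp: L2_iff_L2H dom_measurable)
  have 2: "L2H M G" "(\<lambda>n. \<integral>x. (norm (D (u n) x - G x))\<^sup>2 \<partial>M) \<longlonglongrightarrow> 0"
    using b u dom(2) by (auto simp: D_measurable)
  note cl = dom_closed[OF u 1(1) 2(1) 1(2) 2(2)]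
  show "AE x in M. D u0 x = G x" by (rule cl(2))
  have "(\<integral>x. (norm (D (u n) x - G x))\<^sup>2 \<partial>M) = (\<integral>x. (norm (D (u n) x - D u0 x))\<^sup>2 \<partial>M)" for n
    by (rule integral_cong_AE)
       (use cl(2) D_measurable[OF u] D_measurable[OF cl(1)] m in auto)
  then show "dconv u u0" using u cl(1) 1(2) 2(2) by (simp add: dconv_def)
qed

text \<open>The truncations are limits of the $C^1$ functions $\sqrt{((x-k)^+)^2+e^2}-e$.\<close>

lemma dom_pos_part_shift:
  assumes f: "f \<in> Dom" and k: "0 \<le> k"
  shows "(\<lambda>x. max (f x - k) 0) \<in> Dom"
    "AE x in M. D (\<lambda>x. max (f x - k) 0) x = (if k < f x then D f x else 0)"
proof -
  define \<phi> where "\<phi> e x = (if x \<le> k then 0 else sqrt ((x - k)\<^sup>2 + e\<^sup>2) - e)" for e x :: real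
  define \<phi>' where "\<phi>' e x = (if x \<le> k then 0 else (x - k) / sqrt ((x - k)\<^sup>2 + e\<^sup>2))" for e x :: real
  have pos: "0 < (x - k)\<^sup>2 + e\<^sup>2" if "0 < e" for x e :: real
    using that by (intro add_nonneg_pos) auto
  have two: "(x * 2 - k * 2) / (2 * s) = (x - k) / s" for x s :: real
    by (cases "s = 0") (auto simp: field_simps)
  have 1: "(\<phi> e has_real_derivative \<phi>' e x) (at x)" if "0 < e" for x e
    unfolding \<phi>_def \<phi>'_def
  proof (rule has_real_derivative_glue)
    fix x
    show "((\<lambda>x. sqrt ((x - k)\<^sup>2 + e\<^sup>2) - e) has_real_derivative (x - k) / sqrt ((x - k)\<^sup>2 + e\<^sup>2)) (at x)"
      using pos[OF that, of x] two[of x "sqrt ((x - k)\<^sup>2 + e\<^sup>2)"]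
      by (auto intro!: derivative_eq_intros simp: field_simps)
  qed (use that in auto)
  have 2: "continuous_on UNIV (\<phi>' e)" if "0 < e" for e
    unfolding \<phi>'_def[abs_def]
    by (rule continuous_on_glue) (use pos[OF that] in \<open>auto intro!: continuous_intros simp: less_imp_neq[symmetric]\<close>)
  have 3: "\<bar>\<phi>' e x\<bar> \<le> 1" for e x
  proof (cases "x \<le> k")
    case False
    have "x - k \<le> sqrt ((x - k)\<^sup>2 + e\<^sup>2)" by (rule real_le_rsqrt) simp
    moreover from this False have "0 < sqrt ((x - k)\<^sup>2 + e\<^sup>2)" by linarith
    ultimately show ?thesis using False by (simp add: \<phi>'_def)
  qed (simp add: \<phi>'_def)
  have 4: "\<phi> e 0 = 0" for e using k by (simp add: \<phi>_def)
  have 5: "\<bar>\<phi> e x\<bar> \<le> \<bar>x\<bar>" if "0 < e" for e x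
  proof (cases "x \<le> k")
    case False
    have "sqrt ((x - k)\<^sup>2 + e\<^sup>2) \<le> (x - k) + e"
      using False that by (intro sqrt_sum_squares_le_sum) auto
    moreover have "e \<le> sqrt ((x - k)\<^sup>2 + e\<^sup>2)" using that by (intro real_le_rsqrt) auto
    ultimately show ?thesis using False k by (simp add: \<phi>_def)
  qed (simp add: \<phi>_def)
  define e where "e n = 1 / (real n + 1)" for n
  have e0: "0 < e n" for n by (simp add: e_def)
  have elim: "e \<longlonglongrightarrow> 0" unfolding e_def[abs_def] using LIMSEQ_inverse_real_of_nat by (simp add: inverse_eq_divide add.commute)
  have l1: "(\<lambda>n. \<phi> (e n) y) \<longlonglongrightarrow> max (y - k) 0" for y
  proof (cases "y \<le> k")
    case False
    have "(\<lambda>n. sqrt ((y - k)\<^sup>2 + (e n)\<^sup>2) - e n) \<longlonglongrightarrow> sqrt ((y - k)\<^sup>2 + 0\<^sup>2) - 0"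
      by (intro tendsto_intros elim)
    with False show ?thesis by (simp add: \<phi>_def)
  qed (simp add: \<phi>_def)
  \<comment> \<open>At y = k every regularised slope is 0, so the limiting slope vanishes there.
    This is the origin of the strict inequality k < f x in the formula.\<close>
  have l2: "(\<lambda>n. \<phi>' (e n) y) \<longlonglongrightarrow> (if k < y then 1 else 0)" for y
  proof (cases "y \<le> k")
    case False
    have "(\<lambda>n. (y - k) / sqrt ((y - k)\<^sup>2 + (e n)\<^sup>2)) \<longlonglongrightarrow> (y - k) / sqrt ((y - k)\<^sup>2 + 0\<^sup>2)"
      by (intro tendsto_intros elim) (use False in auto)
    with False show ?thesis by (simp add: \<phi>'_def)
  qed (simp add: \<phi>'_def)
  have ch: "(\<lambda>x. \<phi> (e n) (f x)) \<in> Dom" "AE x in M. D (\<lambda>x. \<phi> (e n) (f x)) x = \<phi>' (e n) (f x) *\<^sub>R D f x" for n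
    using dom_chain[OF f 1[OF e0] 2[OF e0] 3 4] by blast+
  have chA: "AE x in M. \<forall>n. D (\<lambda>x. \<phi> (e n) (f x)) x = \<phi>' (e n) (f x) *\<^sub>R D f x"
    using ch(2) by (simp add: AE_all_countable)
  have [measurable]: "f \<in> borel_measurable M" "D f \<in> borel_measurable M"
    using f dom_measurable D_measurable by auto
  have lim2: "AE x in M. (\<lambda>n. D (\<lambda>x. \<phi> (e n) (f x)) x) \<longlonglongrightarrow> (if k < f x then D f x else 0)"
    using chA
  proof eventually_elim
    case (elim x)
    have "(\<lambda>n. \<phi>' (e n) (f x) *\<^sub>R D f x) \<longlonglongrightarrow> (if k < f x then 1 else 0) *\<^sub>R D f x"
      by (intro tendsto_intros l2)
    then show ?case using elim by (simp split: if_splits)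
  qed
  have dom2: "AE x in M. norm (D (\<lambda>x. \<phi> (e n) (f x)) x) \<le> norm (D f x)" for n
    using ch(2)[of n]
  proof eventually_elim
    case (elim x)
    show ?case using mult_right_mono[OF 3[of "e n" "f x"], of "norm (D f x)"] by (simp add: elim)
  qed
  have U: "L2 M (\<lambda>x. \<bar>f x\<bar>)" using dom_L2[OF f] by (simp add: L2_def)
  have dom1: "AE x in M. \<bar>\<phi> (e n) (f x)\<bar> \<le> \<bar>f x\<bar>" for n using 5[OF e0] by simp
  have lim1: "AE x in M. (\<lambda>n. \<phi> (e n) (f x)) \<longlonglongrightarrow> max (f x - k) 0" using l1 by simp
  note * = dconv_dominated[OF ch(1) _ _ U L2H_norm[OF D_L2H[OF f]] lim1 lim2 dom1 dom2]
  show "(\<lambda>x. max (f x - k) 0) \<in> Dom"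
    "AE x in M. D (\<lambda>x. max (f x - k) 0) x = (if k < f x then D f x else 0)"
    using *(1) *(2) by (auto simp: dconv_def)
qed

lemma dom_pos_part:
  assumes "f \<in> Dom"
  shows "(\<lambda>x. max (f x) 0) \<in> Dom" "AE x in M. D (\<lambda>x. max (f x) 0) x = (if 0 < f x then D f x else 0)"
  using dom_pos_part_shift[OF assms, of 0] by simp_all

text \<open>f is the difference of its positive and negative parts, and the gradients of both parts
  vanish on {f = 0}, because their formulas involve strict inequalities.\<close>

lemma D_zero_set:
  assumes f: "f \<in> Dom"
  shows "AE x in M. f x = 0 \<longrightarrow> D f x = 0"
proof -
  have "AE x in M. D (\<lambda>x. max (f x) 0 - max (- f x) 0) x = D (\<lambda>x. max (f x) 0) x - D (\<lambda>x. max (- f x) 0) x"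
    by (intro D_diff dom_pos_part f dom_uminus)
  moreover have "(\<lambda>x. max (f x) 0 - max (- f x) 0) = f" by (auto simp: fun_eq_iff)
  ultimately have "AE x in M. D f x = D (\<lambda>x. max (f x) 0) x - D (\<lambda>x. max (- f x) 0) x" by simp
  then show ?thesis
    using dom_pos_part(2)[OF f] dom_pos_part(2)[OF dom_uminus[OF f]]
    by eventually_elim auto
qed

lemma dom_max:
  assumes f: "f \<in> Dom" and g: "g \<in> Dom"
  shows "(\<lambda>x. max (f x) (g x)) \<in> Dom"
    "AE x in M. D (\<lambda>x. max (f x) (g x)) x = (if f x < g x then D g x else D f x)"
proof -
  have eq: "(\<lambda>x. max (f x) (g x)) = (\<lambda>x. f x + max (g x - f x) 0)" by (auto simp: fun_eq_iff max_def)
  note d = dom_diff[OF g f]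
  note p = dom_pos_part[OF d]
  show "(\<lambda>x. max (f x) (g x)) \<in> Dom" unfolding eq by (rule dom_add[OF f p(1)])
  show "AE x in M. D (\<lambda>x. max (f x) (g x)) x = (if f x < g x then D g x else D f x)"
    unfolding eq using D_add[OF f p(1)] p(2) D_diff[OF g f]
    by eventually_elim auto
qed

text \<open>The square has unbounded slope, so outside [-c, c] it is replaced by its tangent lines;
  boundedness of f makes the modification invisible.\<close>

lemma dom_square:
  assumes f: "f \<in> Dom" and C: "AE x in M. \<bar>f x\<bar> \<le> C"
  shows "(\<lambda>x. (f x)\<^sup>2) \<in> Dom" "AE x in M. D (\<lambda>x. (f x)\<^sup>2) x = (2 * f x) *\<^sub>R D f x"
proof -
  define c where "c = \<bar>C\<bar>"
  have c: "0 \<le> c" "AE x in M. \<bar>f x\<bar> \<le> c"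
    using C by (auto simp: c_def elim!: eventually_mono)
  define \<psi> where "\<psi> x = (if x \<le> c then x\<^sup>2 else 2 * c * x - c\<^sup>2)" for x
  define \<psi>' where "\<psi>' x = (if x \<le> c then 2 * x else 2 * c)" for x
  define \<phi> where "\<phi> x = (if x \<le> - c then - 2 * c * x - c\<^sup>2 else \<psi> x)" for x
  define \<phi>' where "\<phi>' x = (if x \<le> - c then - 2 * c else \<psi>' x)" for x
  have \<psi>: "(\<psi> has_real_derivative \<psi>' x) (at x)" for x
    unfolding \<psi>_def \<psi>'_def
    by (rule has_real_derivative_glue) (auto intro!: derivative_eq_intros simp: power2_eq_square)
  have \<psi>': "continuous_on UNIV \<psi>'"
    unfolding \<psi>'_def[abs_def] by (rule continuous_on_glue) (auto intro!: continuous_intros)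
  have 1: "(\<phi> has_real_derivative \<phi>' x) (at x)" for x
    unfolding \<phi>_def \<phi>'_def
    by (rule has_real_derivative_glue[OF \<psi>])
       (use c in \<open>auto intro!: derivative_eq_intros simp: \<psi>_def \<psi>'_def power2_eq_square\<close>)
  have 2: "continuous_on UNIV \<phi>'"
    unfolding \<phi>'_def[abs_def] by (rule continuous_on_glue)
      (use \<psi>' c in \<open>auto intro!: continuous_intros intro: continuous_on_subset simp: \<psi>'_def[of "-c"]\<close>)
  have 3: "\<bar>\<phi>' x\<bar> \<le> 2 * c" for x using c by (auto simp: \<phi>'_def \<psi>'_def)
  have 4: "\<phi> 0 = 0" using c by (auto simp: \<phi>_def \<psi>_def)
  have eq: "\<phi> y = y\<^sup>2" "\<phi>' y = 2 * y" if "\<bar>y\<bar> \<le> c" for y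
  proof -
    have "y = - c" if "y \<le> - c" using that \<open>\<bar>y\<bar> \<le> c\<close> by linarith
    then show "\<phi> y = y\<^sup>2" "\<phi>' y = 2 * y" using that
      by (auto simp: \<phi>_def \<psi>_def \<phi>'_def \<psi>'_def power2_eq_square)
  qed
  note ch = dom_chain[OF f 1 2 3 4]
  have [measurable]: "f \<in> borel_measurable M" using f by (rule dom_measurable)
  have ae: "AE x in M. \<phi> (f x) = (f x)\<^sup>2" using c(2) by eventually_elim (simp add: eq)
  have L: "L2 M (\<lambda>x. (f x)\<^sup>2)"
    using L2_mult[OF dom_L2[OF f] dom_measurable[OF f] C] by (simp add: power2_eq_square)
  show d: "(\<lambda>x. (f x)\<^sup>2) \<in> Dom" by (rule dom_cong[OF ch(1) L ae])
  show "AE x in M. D (\<lambda>x. (f x)\<^sup>2) x = (2 * f x) *\<^sub>R D f x"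
    using D_cong[OF ch(1) d ae] ch(2) c(2) by eventually_elim (simp add: eq)
qed

text \<open>Polarisation, fg = ((f+g)^2 - (f-g)^2)/4, reduces the Leibniz rule to the
  square.\<close>

lemma dom_product:
  assumes f: "f \<in> Dom" "AE x in M. \<bar>f x\<bar> \<le> A" and g: "g \<in> Dom" "AE x in M. \<bar>g x\<bar> \<le> B"
  shows "(\<lambda>x. f x * g x) \<in> Dom" "AE x in M. D (\<lambda>x. f x * g x) x = f x *\<^sub>R D g x + g x *\<^sub>R D f x"
proof -
  have "AE x in M. \<bar>f x + g x\<bar> \<le> A + B" using f(2) g(2) by eventually_elim linarith
  note p = dom_square[OF dom_add[OF f(1) g(1)] this]
  have "AE x in M. \<bar>f x - g x\<bar> \<le> A + B" using f(2) g(2) by eventually_elim linarith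
  note q = dom_square[OF dom_diff[OF f(1) g(1)] this]
  have eq: "(\<lambda>x. f x * g x) = (\<lambda>x. (1/4) * (f x + g x)\<^sup>2 + (-1/4) * (f x - g x)\<^sup>2)"
    by (auto simp: fun_eq_iff power2_eq_square algebra_simps)
  show "(\<lambda>x. f x * g x) \<in> Dom" unfolding eq by (intro dom_lin p q)
  have "AE x in M. D (\<lambda>x. f x * g x) x = (1/4) *\<^sub>R D (\<lambda>x. (f x + g x)\<^sup>2) x + (-1/4) *\<^sub>R D (\<lambda>x. (f x - g x)\<^sup>2) x"
    unfolding eq by (intro D_lin p q)
  with p(2) q(2) D_add[OF f(1) g(1)] D_diff[OF f(1) g(1)]
  show "AE x in M. D (\<lambda>x. f x * g x) x = f x *\<^sub>R D g x + g x *\<^sub>R D f x"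
  proof eventually_elim
    case (elim x)
    have *: "(1/4) *\<^sub>R (2 * p) *\<^sub>R (a + b) + (-1/4) *\<^sub>R (2 * q) *\<^sub>R (a - b)
      = ((p - q) / 2) *\<^sub>R a + ((p + q) / 2) *\<^sub>R b" for p q :: real and a b :: 'h
      by (simp add: scaleR_add_right scaleR_diff_right add_divide_distrib diff_divide_distrib
          scaleR_add_left scaleR_diff_left)
    show ?case using elim *[of "f x + g x" "D f x" "D g x" "f x - g x"] by simp
  qed
qed

lemma D_diff_integral:
  assumes "f \<in> Dom" "g \<in> Dom"
  shows "(\<integral>x. (norm (D (\<lambda>x. f x - g x) x))\<^sup>2 \<partial>M) = (\<integral>x. (norm (D f x - D g x))\<^sup>2 \<partial>M)"
  by (rule integral_cong_AE)
     (use D_diff[OF assms] assms D_measurable dom_diff in auto)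

lemma E0l_diff:
  assumes "f \<in> Dom" "g \<in> Dom"
  shows "E0l M D l (\<lambda>x. f x - g x) = (1/2) * (\<integral>x. (norm (D f x - D g x))\<^sup>2 \<partial>M) + l * (\<integral>x. (f x - g x)\<^sup>2 \<partial>M)"
  using D_diff_integral[OF assms] by (simp add: E0l_def E0_def power2_norm_eq_inner)

lemma dconv_iff_E0l:
  assumes "\<And>n. u n \<in> Dom" "u0 \<in> Dom"
  shows "dconv u u0 \<longleftrightarrow> (\<lambda>n. E0l M D 1 (\<lambda>x. u n x - u0 x)) \<longlonglongrightarrow> 0"
proof
  assume "dconv u u0"
  then have "(\<lambda>n. (1/2) * (\<integral>x. (norm (D (u n) x - D u0 x))\<^sup>2 \<partial>M) + 1 * (\<integral>x. (u n x - u0 x)\<^sup>2 \<partial>M)) \<longlonglongrightarrow> (1/2) * 0 + 1 * 0"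
    by (intro tendsto_intros) (auto simp: dconv_def)
  then show "(\<lambda>n. E0l M D 1 (\<lambda>x. u n x - u0 x)) \<longlonglongrightarrow> 0" by (simp add: E0l_diff assms)
next
  assume *: "(\<lambda>n. E0l M D 1 (\<lambda>x. u n x - u0 x)) \<longlonglongrightarrow> 0"
  have "(\<lambda>n. \<integral>x. (u n x - u0 x)\<^sup>2 \<partial>M) \<longlonglongrightarrow> 0"
    by (rule tendsto_sandwich[OF _ _ tendsto_const *]) (auto simp: E0l_diff assms)
  moreover have "(\<lambda>n. \<integral>x. (norm (D (u n) x - D u0 x))\<^sup>2 \<partial>M) \<longlonglongrightarrow> 0"
    by (rule tendsto_sandwich[OF _ _ tendsto_const tendsto_mult_right_zero[OF *, of 2]])
       (auto simp: E0l_diff assms)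
  ultimately show "dconv u u0" using assms by (simp add: dconv_def)
qed

lemma dconv_lin:
  assumes u: "dconv u u0" and w: "dconv w w0"
  shows "dconv (\<lambda>n x. a * u n x + b * w n x) (\<lambda>x. a * u0 x + b * w0 x)"
proof -
  note [simp] = dconvD(1,2)[OF u] dconvD(1,2)[OF w]
  have b1: "(\<lambda>n. \<integral>x. ((a * u n x + b * w n x) - (a * u0 x + b * w0 x))\<^sup>2 \<partial>M) \<longlonglongrightarrow> 0"
  proof (rule tendsto_sandwich[OF _ _ tendsto_const])
    show "\<forall>\<^sub>F n in sequentially. (\<integral>x. ((a * u n x + b * w n x) - (a * u0 x + b * w0 x))\<^sup>2 \<partial>M)
      \<le> 2 * a\<^sup>2 * (\<integral>x. (u n x - u0 x)\<^sup>2 \<partial>M) + 2 * b\<^sup>2 * (\<integral>x. (w n x - w0 x)\<^sup>2 \<partial>M)"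
    proof (rule always_eventually, rule allI)
      fix n
      have "L2H M (\<lambda>x. a * (u n x - u0 x))" "L2H M (\<lambda>x. b * (w n x - w0 x))"
        by (auto simp: L2_iff_L2H[symmetric] intro!: dom_cmult dom_diff dom_L2)
      note * = integral_square_add_le[OF this]
      have "(a * u n x + b * w n x) - (a * u0 x + b * w0 x) = a * (u n x - u0 x) + b * (w n x - w0 x)" for x
        by (simp add: algebra_simps)
      with * show "(\<integral>x. ((a * u n x + b * w n x) - (a * u0 x + b * w0 x))\<^sup>2 \<partial>M)
      \<le> 2 * a\<^sup>2 * (\<integral>x. (u n x - u0 x)\<^sup>2 \<partial>M) + 2 * b\<^sup>2 * (\<integral>x. (w n x - w0 x)\<^sup>2 \<partial>M)"
        by (simp add: power_mult_distrib)
    qed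
    show "(\<lambda>n. 2 * a\<^sup>2 * (\<integral>x. (u n x - u0 x)\<^sup>2 \<partial>M) + 2 * b\<^sup>2 * (\<integral>x. (w n x - w0 x)\<^sup>2 \<partial>M)) \<longlonglongrightarrow> 0"
      by (intro tendsto_add_zero tendsto_mult_right_zero dconvD[OF u] dconvD[OF w])
  qed simp
  have b2: "(\<lambda>n. \<integral>x. (norm (D (\<lambda>x. a * u n x + b * w n x) x - D (\<lambda>x. a * u0 x + b * w0 x) x))\<^sup>2 \<partial>M) \<longlonglongrightarrow> 0"
  proof (rule tendsto_sandwich[OF _ _ tendsto_const])
    show "\<forall>\<^sub>F n in sequentially. (\<integral>x. (norm (D (\<lambda>x. a * u n x + b * w n x) x - D (\<lambda>x. a * u0 x + b * w0 x) x))\<^sup>2 \<partial>M)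
      \<le> 2 * a\<^sup>2 * (\<integral>x. (norm (D (u n) x - D u0 x))\<^sup>2 \<partial>M) + 2 * b\<^sup>2 * (\<integral>x. (norm (D (w n) x - D w0 x))\<^sup>2 \<partial>M)"
    proof (rule always_eventually, rule allI)
      fix n
      have [measurable]: "D (\<lambda>x. a * u n x + b * w n x) \<in> borel_measurable M"
        "D (\<lambda>x. a * u0 x + b * w0 x) \<in> borel_measurable M" "D (u n) \<in> borel_measurable M"
        "D u0 \<in> borel_measurable M" "D (w n) \<in> borel_measurable M" "D w0 \<in> borel_measurable M"
        by (auto intro!: D_measurable dom_lin)
      have L: "L2H M (\<lambda>x. a *\<^sub>R (D (u n) x - D u0 x))" "L2H M (\<lambda>x. b *\<^sub>R (D (w n) x - D w0 x))"
        by (auto intro!: L2H_scale L2H_diff D_L2H)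
      have "(\<integral>x. (norm (D (\<lambda>x. a * u n x + b * w n x) x - D (\<lambda>x. a * u0 x + b * w0 x) x))\<^sup>2 \<partial>M)
        = (\<integral>x. (norm (a *\<^sub>R (D (u n) x - D u0 x) + b *\<^sub>R (D (w n) x - D w0 x)))\<^sup>2 \<partial>M)"
      proof (rule integral_cong_AE)
        show "AE x in M. (norm (D (\<lambda>x. a * u n x + b * w n x) x - D (\<lambda>x. a * u0 x + b * w0 x) x))\<^sup>2
          = (norm (a *\<^sub>R (D (u n) x - D u0 x) + b *\<^sub>R (D (w n) x - D w0 x)))\<^sup>2"
          using D_lin[of "u n" "w n" a b] D_lin[of u0 w0 a b]
          by (auto simp: algebra_simps elim!: eventually_elim2)
      qed measurable
      then show "(\<integral>x. (norm (D (\<lambda>x. a * u n x + b * w n x) x - D (\<lambda>x. a * u0 x + b * w0 x) x))\<^sup>2 \<partial>M)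
      \<le> 2 * a\<^sup>2 * (\<integral>x. (norm (D (u n) x - D u0 x))\<^sup>2 \<partial>M) + 2 * b\<^sup>2 * (\<integral>x. (norm (D (w n) x - D w0 x))\<^sup>2 \<partial>M)"
        using integral_square_add_le[OF L] by (simp add: power_mult_distrib)
    qed
    show "(\<lambda>n. 2 * a\<^sup>2 * (\<integral>x. (norm (D (u n) x - D u0 x))\<^sup>2 \<partial>M) + 2 * b\<^sup>2 * (\<integral>x. (norm (D (w n) x - D w0 x))\<^sup>2 \<partial>M)) \<longlonglongrightarrow> 0"
      by (intro tendsto_add_zero tendsto_mult_right_zero dconvD[OF u] dconvD[OF w])
  qed simp
  show ?thesis unfolding dconv_def using b1 b2 by (auto intro!: dom_lin)
qed

lemma dconv_diff: "dconv u u0 \<Longrightarrow> dconv w w0 \<Longrightarrow> dconv (\<lambda>n x. u n x - w n x) (\<lambda>x. u0 x - w0 x)"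
  using dconv_lin[of u u0 w w0 1 "-1"] by simp

lemma dconv_uminus: "dconv u u0 \<Longrightarrow> dconv (\<lambda>n x. - u n x) (\<lambda>x. - u0 x)"
  using dconv_lin[of u u0 u u0 "-1" 0] by simp

lemma dconv_const: "u \<in> Dom \<Longrightarrow> dconv (\<lambda>_. u) u"
  by (simp add: dconv_def)

text \<open>Since $Du = 0$ almost everywhere on $\{u = 0\}$, the indicators of $\{u_n > 0\}$ converge
  wherever it matters.\<close>

lemma dconv_pos_part_subseq:
  assumes u: "dconv u u0"
  shows "\<exists>r::nat\<Rightarrow>nat. strict_mono r \<and> dconv (\<lambda>n x. max (u (r n) x) 0) (\<lambda>x. max (u0 x) 0)"
proof -
  \<comment> \<open>The subsequence provides pointwise convergence, which decides the sign of the
    approximants wherever u0 is not 0.\<close>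
  from dconv_AE_subseq[OF u] obtain r :: "nat \<Rightarrow> nat" where r: "strict_mono r"
    and ae: "AE x in M. (\<lambda>n. u (r n) x) \<longlonglongrightarrow> u0 x" by auto
  define w where "w n = u (r n)" for n
  have w: "dconv w u0" unfolding w_def by (rule dconv_subseq[OF u r])
  note [simp] = dconvD(1,2)[OF w]
  have [measurable]: "w n \<in> borel_measurable M" "u0 \<in> borel_measurable M"
    "D (w n) \<in> borel_measurable M" "D u0 \<in> borel_measurable M" for n
    by (auto intro: dom_measurable D_measurable)
  have pd: "(\<lambda>x. max (w n x) 0) \<in> Dom" "(\<lambda>x. max (u0 x) 0) \<in> Dom" for n
    by (auto intro: dom_pos_part)
  have [measurable]: "D (\<lambda>x. max (w n x) 0) \<in> borel_measurable M" "D (\<lambda>x. max (u0 x) 0) \<in> borel_measurable M" for n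
    by (auto intro: D_measurable pd)
  \<comment> \<open>The difference of the gradients of the positive parts is p + q: p is the change
    of the gradient on {w n > 0}, q the change of the set with the gradient of u0 held
    fixed.\<close>
  define p where "p n x = (if 0 < w n x then 1 else 0 :: real) *\<^sub>R (D (w n) x - D u0 x)" for n x
  define q where "q n x = (if 0 < w n x then D u0 x else 0) - (if 0 < u0 x then D u0 x else 0)" for n x
  have pL: "L2H M (p n)" for n
    unfolding p_def by (intro L2H_mult[where C=1] L2H_diff D_L2H) auto
  have "L2H M (\<lambda>x. (if 0 < w n x then 1 else 0 :: real) *\<^sub>R D u0 x - (if 0 < u0 x then 1 else 0 :: real) *\<^sub>R D u0 x)" for n
    by (intro L2H_diff L2H_mult[where C=1] D_L2H) auto
  moreover have "(\<lambda>x. (if 0 < w n x then 1 else 0 :: real) *\<^sub>R D u0 x - (if 0 < u0 x then 1 else 0 :: real) *\<^sub>R D u0 x) = q n" for n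
    by (auto simp: q_def fun_eq_iff)
  ultimately have qL: "L2H M (q n)" for n by simp
  have [measurable]: "p n \<in> borel_measurable M" "q n \<in> borel_measurable M" for n
    using pL qL by (auto simp: L2H_def)
  have p0: "(\<lambda>n. \<integral>x. (norm (p n x))\<^sup>2 \<partial>M) \<longlonglongrightarrow> 0"
  proof (rule tendsto_sandwich[OF _ _ tendsto_const dconvD(4)[OF w]])
    show "\<forall>\<^sub>F n in sequentially. (\<integral>x. (norm (p n x))\<^sup>2 \<partial>M) \<le> (\<integral>x. (norm (D (w n) x - D u0 x))\<^sup>2 \<partial>M)"
    proof (intro always_eventually allI integral_mono)
      show "integrable M (\<lambda>x. (norm (D (w n) x - D u0 x))\<^sup>2)" for n
        using L2H_diff[OF D_L2H D_L2H, of "w n" u0] by (simp add: L2H_def)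
    qed (use pL in \<open>auto simp: p_def L2H_def\<close>)
  qed simp
  have q0: "(\<lambda>n. \<integral>x. (norm (q n x - 0))\<^sup>2 \<partial>M) \<longlonglongrightarrow> 0"
  proof (rule L2H_dominated_convergence(2)[where W="\<lambda>x. norm (D u0 x)"])
    show "AE x in M. (\<lambda>n. q n x) \<longlonglongrightarrow> 0"
      using ae D_zero_set[OF dconvD(2)[OF w]]
    proof eventually_elim
      case (elim x)
      have l: "(\<lambda>n. w n x) \<longlonglongrightarrow> u0 x" using elim(1) by (simp add: w_def)
      show ?case
      proof (cases "u0 x" "0::real" rule: linorder_cases)
        case less
        from order_tendstoD(2)[OF l less] have "\<forall>\<^sub>F n in sequentially. q n x = 0"
          by eventually_elim (use less in \<open>auto simp: q_def\<close>)
        then show ?thesis by (rule tendsto_eventually)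
      next
        \<comment> \<open>Here the indicators of {w n > 0} may oscillate forever, but they multiply
          D u0, which is 0.\<close>
        case equal
        then have "q n x = 0" for n using elim(2) by (simp add: q_def)
        then show ?thesis by simp
      next
        case greater
        from order_tendstoD(1)[OF l greater] have "\<forall>\<^sub>F n in sequentially. q n x = 0"
          by eventually_elim (use greater in \<open>auto simp: q_def\<close>)
        then show ?thesis by (rule tendsto_eventually)
      qed
    qed
    show "L2 M (\<lambda>x. norm (D u0 x))" by (intro L2H_norm D_L2H) simp
  qed (use qL in \<open>auto simp: q_def L2H_def\<close>)
  have "dconv (\<lambda>n x. max (w n x) 0) (\<lambda>x. max (u0 x) 0)"
    unfolding dconv_def
  proof (intro conjI allI pd)
    show "(\<lambda>n. \<integral>x. (max (w n x) 0 - max (u0 x) 0)\<^sup>2 \<partial>M) \<longlonglongrightarrow> 0"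
    proof (rule tendsto_sandwich[OF _ _ tendsto_const dconvD(3)[OF w]])
      show "\<forall>\<^sub>F n in sequentially. (\<integral>x. (max (w n x) 0 - max (u0 x) 0)\<^sup>2 \<partial>M) \<le> (\<integral>x. (w n x - u0 x)\<^sup>2 \<partial>M)"
      proof (intro always_eventually allI integral_mono)
        fix n x
        have "\<bar>max (w n x) 0 - max (u0 x) 0\<bar> \<le> \<bar>w n x - u0 x\<bar>" by (auto simp: max_def)
        then show "(max (w n x) 0 - max (u0 x) 0)\<^sup>2 \<le> (w n x - u0 x)\<^sup>2" by (simp add: abs_le_square_iff)
      next
        fix n
        show "integrable M (\<lambda>x. (max (w n x) 0 - max (u0 x) 0)\<^sup>2)"
          by (intro L2_square_integrable L2_diff dom_L2 pd)
        show "integrable M (\<lambda>x. (w n x - u0 x)\<^sup>2)"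
          by (intro L2_square_integrable L2_diff dom_L2) auto
      qed
    qed simp
    show "(\<lambda>n. \<integral>x. (norm (D (\<lambda>x. max (w n x) 0) x - D (\<lambda>x. max (u0 x) 0) x))\<^sup>2 \<partial>M) \<longlonglongrightarrow> 0"
    proof (rule tendsto_sandwich[OF _ _ tendsto_const])
      show "\<forall>\<^sub>F n in sequentially. (\<integral>x. (norm (D (\<lambda>x. max (w n x) 0) x - D (\<lambda>x. max (u0 x) 0) x))\<^sup>2 \<partial>M)
        \<le> 2 * (\<integral>x. (norm (p n x))\<^sup>2 \<partial>M) + 2 * (\<integral>x. (norm (q n x))\<^sup>2 \<partial>M)"
      proof (intro always_eventually allI)
        fix n
        have "AE x in M. (norm (D (\<lambda>x. max (w n x) 0) x - D (\<lambda>x. max (u0 x) 0) x))\<^sup>2 = (norm (p n x + q n x))\<^sup>2"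
          using dom_pos_part(2)[OF dconvD(1)[OF w, of n]] dom_pos_part(2)[OF dconvD(2)[OF w]]
          by eventually_elim (simp add: p_def q_def)
        then have "(\<integral>x. (norm (D (\<lambda>x. max (w n x) 0) x - D (\<lambda>x. max (u0 x) 0) x))\<^sup>2 \<partial>M) = (\<integral>x. (norm (p n x + q n x))\<^sup>2 \<partial>M)"
          by (intro integral_cong_AE) measurable
        also have "\<dots> \<le> 2 * (\<integral>x. (norm (p n x))\<^sup>2 \<partial>M) + 2 * (\<integral>x. (norm (q n x))\<^sup>2 \<partial>M)"
          by (rule integral_square_add_le[OF pL qL])
        finally show "(\<integral>x. (norm (D (\<lambda>x. max (w n x) 0) x - D (\<lambda>x. max (u0 x) 0) x))\<^sup>2 \<partial>M)
          \<le> 2 * (\<integral>x. (norm (p n x))\<^sup>2 \<partial>M) + 2 * (\<integral>x. (norm (q n x))\<^sup>2 \<partial>M)" .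
      qed
      show "(\<lambda>n. 2 * (\<integral>x. (norm (p n x))\<^sup>2 \<partial>M) + 2 * (\<integral>x. (norm (q n x))\<^sup>2 \<partial>M)) \<longlonglongrightarrow> 0"
        using p0 q0 by (intro tendsto_add_zero tendsto_mult_right_zero) auto
    qed simp
  qed
  with r show ?thesis by (auto simp: w_def)
qed

end

section \<open>Nests and cutoff functions\<close>

context derivation
begin

lemma dconv_cong_limit:
  assumes u: "dconv u u0" and v: "v \<in> Dom" "AE x in M. u0 x = v x"
  shows "dconv u v"
proof -
  note [simp] = dconvD(1,2)[OF u]
  have [measurable]: "u n \<in> borel_measurable M" "u0 \<in> borel_measurable M" "v \<in> borel_measurable M"
    "D (u n) \<in> borel_measurable M" "D u0 \<in> borel_measurable M" "D v \<in> borel_measurable M" for n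
    by (auto intro: dom_measurable D_measurable v)
  have "(\<integral>x. (u n x - u0 x)\<^sup>2 \<partial>M) = (\<integral>x. (u n x - v x)\<^sup>2 \<partial>M)" for n
    by (rule integral_cong_AE) (use v(2) in auto)
  moreover have "(\<integral>x. (norm (D (u n) x - D u0 x))\<^sup>2 \<partial>M) = (\<integral>x. (norm (D (u n) x - D v x))\<^sup>2 \<partial>M)" for n
    by (rule integral_cong_AE) (use D_cong[OF _ v] in auto)
  ultimately show ?thesis using u v(1) by (simp add: dconv_def)
qed

lemma E0l_diff_commute: "f \<in> Dom \<Longrightarrow> g \<in> Dom \<Longrightarrow> E0l M D l (\<lambda>x. f x - g x) = E0l M D l (\<lambda>x. g x - f x)"
  by (simp add: E0l_diff norm_minus_commute power2_commute)

lemma E0l_nonneg: "0 \<le> l \<Longrightarrow> 0 \<le> E0l M D l f"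
  by (simp add: E0l_def E0_def)

lemma E0l_add_le:
  assumes f: "f \<in> Dom" and g: "g \<in> Dom"
  shows "E0l M D 1 (\<lambda>x. f x + g x) \<le> 2 * E0l M D 1 f + 2 * E0l M D 1 g"
proof -
  have "(\<integral>x. (norm (D (\<lambda>x. f x + g x) x))\<^sup>2 \<partial>M) = (\<integral>x. (norm (D f x + D g x))\<^sup>2 \<partial>M)"
    by (rule integral_cong_AE) (use D_add[OF f g] f g D_measurable dom_add in auto)
  moreover note integral_square_add_le[OF D_L2H[OF f] D_L2H[OF g]]
    integral_square_add_le[of M f g]
  ultimately show ?thesis
    using dom_L2[OF f] dom_L2[OF g]
    by (simp add: E0l_def E0_def power2_norm_eq_inner[symmetric] L2_iff_L2H algebra_simps)
qed

lemma E0l_triangle: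
  assumes "f \<in> Dom" "g \<in> Dom" "h \<in> Dom"
  shows "E0l M D 1 (\<lambda>x. f x - h x) \<le> 2 * E0l M D 1 (\<lambda>x. f x - g x) + 2 * E0l M D 1 (\<lambda>x. g x - h x)"
  using E0l_add_le[OF dom_diff[OF assms(1,2)] dom_diff[OF assms(2,3)]] by simp

lemma dconv_imp_close:
  assumes "dconv u u0" "0 < e"
  shows "\<exists>N. \<forall>n\<ge>N. E0l M D 1 (\<lambda>x. u0 x - u n x) < e"
proof -
  note d = dconvD(1,2)[OF assms(1)]
  have "(\<lambda>n. E0l M D 1 (\<lambda>x. u n x - u0 x)) \<longlonglongrightarrow> 0"
    using assms(1) dconv_iff_E0l[OF d] by simp
  from order_tendstoD(2)[OF this assms(2)] show ?thesis
    by (simp add: eventually_sequentially E0l_diff_commute[OF d])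
qed

text \<open>The excess over level n vanishes pointwise together with its gradient, which is D f
  restricted to {f > n}; both are dominated by f and D f. Subtracting such excesses gives the
  bounded approximants of \<open>nest_dense_bounded\<close>.\<close>

lemma dconv_truncation:
  assumes f: "f \<in> Dom"
  shows "dconv (\<lambda>n x. max (f x - real n) 0) (\<lambda>x. 0)"
proof -
  have ch: "(\<lambda>x. max (f x - real n) 0) \<in> Dom"
    "AE x in M. D (\<lambda>x. max (f x - real n) 0) x = (if real n < f x then D f x else 0)" for n
    using dom_pos_part_shift[OF f, of "real n"] by auto
  have chA: "AE x in M. \<forall>n. D (\<lambda>x. max (f x - real n) 0) x = (if real n < f x then D f x else 0)"
    using ch(2) by (simp add: AE_all_countable)
  have ev: "\<forall>\<^sub>F n in sequentially. \<not> real n < f x" for x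
  proof -
    obtain N where "f x < real N" using reals_Archimedean2 by blast
    then show ?thesis by (intro eventually_sequentiallyI[of N]) (auto simp: not_less intro: order_trans[of "f x" "real N"])
  qed
  show ?thesis
  proof (rule dconv_dominated(1)[where G="\<lambda>x. 0" and U="\<lambda>x. \<bar>f x\<bar>" and W="\<lambda>x. norm (D f x)"])
    show "AE x in M. (\<lambda>n. max (f x - real n) 0) \<longlonglongrightarrow> 0"
    proof (rule AE_I2)
      fix x
      have "\<forall>\<^sub>F n in sequentially. max (f x - real n) 0 = 0" using ev[of x] by eventually_elim auto
      then show "(\<lambda>n. max (f x - real n) 0) \<longlonglongrightarrow> 0" by (rule tendsto_eventually)
    qed
    show "AE x in M. (\<lambda>n. D (\<lambda>x. max (f x - real n) 0) x) \<longlonglongrightarrow> 0"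
      using chA
    proof eventually_elim
      case (elim x)
      have "\<forall>\<^sub>F n in sequentially. D (\<lambda>x. max (f x - real n) 0) x = 0"
        using ev[of x] by eventually_elim (simp add: elim)
      then show ?case by (rule tendsto_eventually)
    qed
    show "AE x in M. norm (D (\<lambda>x. max (f x - real n) 0) x) \<le> norm (D f x)" for n
      using ch(2)[of n] by eventually_elim auto
  qed (use ch dom_L2[OF f] L2H_norm[OF D_L2H[OF f]] in \<open>auto simp: L2_def\<close>)
qed

text \<open>Lowering f by a vanishing amount cuts off the gradient only where f is small; in the
  limit only {f = 0} is lost, and D f = 0 there. In \<open>nest_with_cutoffs\<close> this pushes a
  function inside a superlevel set.\<close>

lemma dconv_shrink:
  assumes f: "f \<in> Dom" "\<And>x. 0 \<le> f x" and C: "0 \<le> C"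
  shows "dconv (\<lambda>n x. max (f x - C / (real n + 1)) 0) f"
proof -
  have c0: "0 \<le> C / (real n + 1)" for n using C by simp
  have ch: "(\<lambda>x. max (f x - C / (real n + 1)) 0) \<in> Dom"
    "AE x in M. D (\<lambda>x. max (f x - C / (real n + 1)) 0) x = (if C / (real n + 1) < f x then D f x else 0)" for n
    using dom_pos_part_shift[OF f(1) c0[of n]] by auto
  have chA: "AE x in M. \<forall>n. D (\<lambda>x. max (f x - C / (real n + 1)) 0) x = (if C / (real n + 1) < f x then D f x else 0)"
    using ch(2) by (simp add: AE_all_countable)
  have l: "(\<lambda>n. C / (real n + 1)) \<longlonglongrightarrow> 0"
    using tendsto_mult_right_zero[OF LIMSEQ_inverse_real_of_nat, of C] by (simp add: inverse_eq_divide add.commute)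
  show ?thesis
  proof (rule dconv_dominated(1)[where G="D f" and U="\<lambda>x. \<bar>f x\<bar>" and W="\<lambda>x. norm (D f x)"])
    show "AE x in M. (\<lambda>n. max (f x - C / (real n + 1)) 0) \<longlonglongrightarrow> f x"
    proof (rule AE_I2)
      fix x
      have "(\<lambda>n. max (f x - C / (real n + 1)) 0) \<longlonglongrightarrow> max (f x - 0) 0"
        by (intro tendsto_intros l)
      then show "(\<lambda>n. max (f x - C / (real n + 1)) 0) \<longlonglongrightarrow> f x" using f(2)[of x] by simp
    qed
    show "AE x in M. (\<lambda>n. D (\<lambda>x. max (f x - C / (real n + 1)) 0) x) \<longlonglongrightarrow> D f x"
      using chA D_zero_set[OF f(1)]
    proof eventually_elim
      case (elim x)
      show ?case
      proof (cases "f x = 0")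
        case True
        then have "D (\<lambda>x. max (f x - C / (real n + 1)) 0) x = D f x" for n using elim by simp
        then show ?thesis by simp
      next
        case False
        then have "0 < f x" using f(2)[of x] by simp
        from order_tendstoD(2)[OF l this]
        have "\<forall>\<^sub>F n in sequentially. D (\<lambda>x. max (f x - C / (real n + 1)) 0) x = D f x"
          by eventually_elim (simp add: elim)
        then show ?thesis by (rule tendsto_eventually)
      qed
    qed
    show "AE x in M. norm (D (\<lambda>x. max (f x - C / (real n + 1)) 0) x) \<le> norm (D f x)" for n
      using ch(2)[of n] by eventually_elim auto
    show "AE x in M. \<bar>max (f x - C / (real n + 1)) 0\<bar> \<le> \<bar>f x\<bar>" for n
      using f(2) c0[of n] by (auto simp: max_def)
  qed (use ch dom_L2[OF f(1)] L2H_norm[OF D_L2H[OF f(1)]] D_measurable[OF f(1)] in \<open>auto simp: L2_def\<close>)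
qed

lemma nest_dense_bounded:
  assumes E: "measurable_nest M Dom D E" and u: "u \<in> Dom"
  shows "\<exists>w k. (\<forall>n. w n \<in> DAb M Dom (E (k n))) \<and> dconv w u"
proof -
  have ex: "\<exists>k. \<exists>g\<in>DAb M Dom (E k). E0l M D 1 (\<lambda>x. u x - g x) < e" if e: "0 < e" for e
  proof -
    from E u e obtain k g where g: "g \<in> DA M Dom (E k)" "E0l M D 1 (\<lambda>x. u x - g x) < e / 4"
      unfolding measurable_nest_def by (metis divide_pos_pos zero_less_numeral)
    then have gd: "g \<in> Dom" "AE x in M. x \<notin> E k \<longrightarrow> g x = 0" by (auto simp: DA_def)
    \<comment> \<open>The expression is g clipped to [-n, n], built from two excesses. It vanishes
      wherever g does, so the support is kept.\<close>
    have "dconv (\<lambda>n x. (g x - max (g x - real n) 0) - (0 - max (- g x - real n) 0)) (\<lambda>x. (g x - 0) - (0 - 0))"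
      by (intro dconv_diff dconv_const dconv_truncation gd dom_uminus dom_zero)
    then have c: "dconv (\<lambda>n x. (g x - max (g x - real n) 0) - (0 - max (- g x - real n) 0)) g" by simp
    from dconv_imp_close[OF this, of "e / 4"] e obtain n where
      n: "E0l M D 1 (\<lambda>x. g x - ((g x - max (g x - real n) 0) - (0 - max (- g x - real n) 0))) < e / 4" by auto
    define w where "w x = (g x - max (g x - real n) 0) - (0 - max (- g x - real n) 0)" for x
    have wd: "w \<in> Dom" unfolding w_def[abs_def] by (rule dconvD(1)[OF c])
    have "\<bar>w x\<bar> \<le> real n" for x by (auto simp: w_def max_def)
    moreover have "w x = 0" if "g x = 0" for x using that by (auto simp: w_def)
    ultimately have "w \<in> DAb M Dom (E k)"
      using wd gd(2) by (auto simp: DAb_def DA_def elim!: eventually_mono)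
    moreover have "E0l M D 1 (\<lambda>x. u x - w x) < e"
      using E0l_triangle[OF u gd(1) wd] g(2) n by (simp add: w_def)
    ultimately show ?thesis by blast
  qed
  have "\<exists>k g. g \<in> DAb M Dom (E k) \<and> E0l M D 1 (\<lambda>x. u x - g x) < 1 / (real n + 1)" for n
    using ex[of "1 / (real n + 1)"] by auto
  then obtain k w where w: "\<And>n. w n \<in> DAb M Dom (E (k n))" "\<And>n. E0l M D 1 (\<lambda>x. u x - w n x) < 1 / (real n + 1)"
    by metis
  have wd: "w n \<in> Dom" for n using w(1)[of n] by (simp add: DAb_def DA_def)
  have "(\<lambda>n. E0l M D 1 (\<lambda>x. w n x - u x)) \<longlonglongrightarrow> 0"
  proof (rule tendsto_sandwich[OF _ _ tendsto_const])
    show "(\<lambda>n. 1 / (real n + 1)) \<longlonglongrightarrow> 0"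
      using LIMSEQ_inverse_real_of_nat by (simp add: inverse_eq_divide add.commute)
    show "\<forall>\<^sub>F n in sequentially. E0l M D 1 (\<lambda>x. w n x - u x) \<le> 1 / (real n + 1)"
      using w(2) by (auto simp: E0l_diff_commute[OF wd u] intro!: always_eventually less_imp_le)
  qed (simp add: E0l_nonneg)
  then have "dconv w u" using dconv_iff_E0l[OF wd u] by simp
  with w(1) show ?thesis by blast
qed

text \<open>The approximants w are replaced by min(w^+, u), written as w^+ minus the positive part
  of w^+ - u, which stays supported in the same member of the nest. Each positive part costs a
  subsequence. The bound 0 <= w <= u is what allows dominated convergence in
  \<open>Ef_formula\<close>.\<close>

lemma nest_dense_bounded_nonneg:
  assumes E: "measurable_nest M Dom D E" and u: "u \<in> Dom" "\<And>x. 0 \<le> u x"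
  shows "\<exists>w k. (\<forall>n. w n \<in> DAb M Dom (E (k n))) \<and> (\<forall>n x. 0 \<le> w n x \<and> w n x \<le> u x)
    \<and> dconv w u \<and> (AE x in M. (\<lambda>n. w n x) \<longlonglongrightarrow> u x)"
proof -
  from nest_dense_bounded[OF E u(1)] obtain w k where w: "\<And>n. w n \<in> DAb M Dom (E (k n))" "dconv w u" by blast
  from dconv_pos_part_subseq[OF w(2)] obtain r :: "nat \<Rightarrow> nat"
    where r: "strict_mono r" "dconv (\<lambda>n x. max (w (r n) x) 0) (\<lambda>x. max (u x) 0)" by blast
  have eq: "(\<lambda>x. max (u x) 0) = u" using u(2) by (auto simp: fun_eq_iff)
  define p where "p n x = max (w (r n) x) 0" for n x
  have p: "dconv p u" using r(2) by (simp add: p_def[abs_def] eq)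
  from dconv_diff[OF p dconv_const[OF u(1)]] have "dconv (\<lambda>n x. p n x - u x) (\<lambda>x. 0)" by simp
  from dconv_pos_part_subseq[OF this] obtain s :: "nat \<Rightarrow> nat"
    where s: "strict_mono s" "dconv (\<lambda>n x. max (p (s n) x - u x) 0) (\<lambda>x. 0)" by auto
  from dconv_diff[OF dconv_subseq[OF p s(1)] s(2)]
  have m: "dconv (\<lambda>n x. p (s n) x - max (p (s n) x - u x) 0) u" by simp
  from dconv_AE_subseq[OF this] obtain q :: "nat \<Rightarrow> nat" where q: "strict_mono q"
    "AE x in M. (\<lambda>n. p (s (q n)) x - max (p (s (q n)) x - u x) 0) \<longlonglongrightarrow> u x" by blast
  define z where "z n x = p (s (q n)) x - max (p (s (q n)) x - u x) 0" for n x
  have z: "dconv z u" unfolding z_def[abs_def] using dconv_subseq[OF m q(1)] by simp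
  have zb: "0 \<le> z n x \<and> z n x \<le> u x" for n x
    using u(2)[of x] by (auto simp: z_def p_def max_def)
  have "z n \<in> DAb M Dom (E (k (r (s (q n)))))" for n
  proof -
    have W: "w (r (s (q n))) \<in> DAb M Dom (E (k (r (s (q n)))))" by (rule w)
    have z0: "z n x = 0" if "w (r (s (q n))) x = 0" for x using that u(2)[of x] by (auto simp: z_def p_def)
    have zle: "\<bar>z n x\<bar> \<le> \<bar>w (r (s (q n))) x\<bar>" for x using u(2)[of x] by (auto simp: z_def p_def max_def)
    from W obtain B where B: "AE x in M. \<bar>w (r (s (q n))) x\<bar> \<le> B" by (auto simp: DAb_def)
    have "AE x in M. \<bar>z n x\<bar> \<le> B" using B by eventually_elim (use zle in \<open>auto intro: order_trans\<close>)
    moreover have "AE x in M. x \<notin> E (k (r (s (q n)))) \<longrightarrow> z n x = 0"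
      using W z0 by (auto simp: DAb_def DA_def elim!: eventually_mono)
    ultimately show ?thesis using dconvD(1)[OF z, of n] by (auto simp: DAb_def DA_def)
  qed
  moreover have "AE x in M. (\<lambda>n. z n x) \<longlonglongrightarrow> u x" using q(2) by (simp add: z_def)
  ultimately show ?thesis using zb z by (intro exI[of _ z] exI[of _ "\<lambda>n. k (r (s (q n)))"]) blast
qed

lemma DA_mono: "f \<in> DA M Dom A \<Longrightarrow> A \<subseteq> B \<Longrightarrow> f \<in> DA M Dom B"
  by (auto simp: DA_def elim!: eventually_mono)

text \<open>Positive and negative parts are approximated separately, and the larger of the two
  indices carries both supports. The factor 2 in \<open>E0l_add_le\<close> explains the tolerance
  e/4.\<close>

lemma measurable_nestI_nonneg:
  assumes "\<And>k. F k \<in> sets M" "incseq F" "\<And>k. \<exists>h\<in>Dom. AE x in M. x \<in> F k \<longrightarrow> 1 \<le> h x"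
    and dense: "\<And>f e. f \<in> Dom \<Longrightarrow> (\<And>x. 0 \<le> f x) \<Longrightarrow> 0 < e \<Longrightarrow>
      \<exists>k. \<exists>g\<in>DA M Dom (F k). E0l M D 1 (\<lambda>x. f x - g x) < e"
  shows "measurable_nest M Dom D F"
  unfolding measurable_nest_def
proof (intro conjI ballI allI impI assms(1-3))
  fix f and e :: real assume f: "f \<in> Dom" and e: "0 < e"
  note p = dom_pos_part(1)[OF f] and n = dom_pos_part(1)[OF dom_uminus[OF f]]
  from dense[OF p, of "e / 4"] e obtain k1 g1
    where g1: "g1 \<in> DA M Dom (F k1)" "E0l M D 1 (\<lambda>x. max (f x) 0 - g1 x) < e / 4" by auto
  from dense[OF n, of "e / 4"] e obtain k2 g2
    where g2: "g2 \<in> DA M Dom (F k2)" "E0l M D 1 (\<lambda>x. max (- f x) 0 - g2 x) < e / 4" by auto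
  let ?k = "max k1 k2"
  have sub: "F k1 \<subseteq> F ?k" "F k2 \<subseteq> F ?k" by (rule incseqD[OF assms(2)], simp)+
  have g: "g1 \<in> DA M Dom (F ?k)" "g2 \<in> DA M Dom (F ?k)"
    using g1(1) g2(1) sub by (auto intro: DA_mono)
  then have d: "g1 \<in> Dom" "g2 \<in> Dom" by (auto simp: DA_def)
  have "AE x in M. x \<notin> F ?k \<longrightarrow> g1 x = 0" "AE x in M. x \<notin> F ?k \<longrightarrow> g2 x = 0"
    using g by (auto simp: DA_def)
  then have "AE x in M. x \<notin> F ?k \<longrightarrow> g1 x - g2 x = 0" by eventually_elim auto
  then have "(\<lambda>x. g1 x - g2 x) \<in> DA M Dom (F ?k)"
    using d by (auto simp: DA_def intro: dom_diff)
  moreover have "E0l M D 1 (\<lambda>x. f x - (g1 x - g2 x)) < e"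
  proof -
    have eq: "(\<lambda>x. f x - (g1 x - g2 x)) = (\<lambda>x. (max (f x) 0 - g1 x) + (g2 x - max (- f x) 0))"
      by (auto simp: fun_eq_iff max_def)
    have "E0l M D 1 (\<lambda>x. f x - (g1 x - g2 x)) \<le> 2 * E0l M D 1 (\<lambda>x. max (f x) 0 - g1 x) + 2 * E0l M D 1 (\<lambda>x. g2 x - max (- f x) 0)"
      unfolding eq by (rule E0l_add_le) (intro dom_diff p n d)+
    then show ?thesis using g1(2) g2(2) by (simp add: E0l_diff_commute[OF d(2) n])
  qed
  ultimately show "\<exists>k. \<exists>g\<in>DA M Dom (F k). E0l M D 1 (\<lambda>x. f x - g x) < e"
    by (intro exI[of _ ?k] bexI[of _ "\<lambda>x. g1 x - g2 x"])
qed

text \<open>A nest alone does not provide cutoff functions, since the functions dominating the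
  indicators of its members need not be supported in other members.  With
  $g_{k,i} \to h_k$ supported in the nest, the sets $\{\sum_{k,i\le l} g_{k,i}^+ \ge 1/(l+1)\}$ form a
  nest admitting cutoffs.\<close>

lemma nest_with_cutoffs:
  assumes E: "measurable_nest M Dom D E"
  shows "\<exists>F \<zeta>. measurable_nest M Dom D F \<and> (\<forall>l. \<zeta> l \<in> Dom \<and> (\<forall>x. 0 \<le> \<zeta> l x \<and> \<zeta> l x \<le> 1)
    \<and> (\<forall>x\<in>F l. \<zeta> l x = 1) \<and> (AE x in M. x \<in> F l \<longrightarrow> D (\<zeta> l) x = 0)
    \<and> (\<exists>k. AE x in M. x \<notin> E k \<longrightarrow> \<zeta> l x = 0))"
proof -
  have Einc: "incseq E" using E by (simp add: measurable_nest_def)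
  from E obtain h where h: "\<And>k. h k \<in> Dom" "\<And>k. AE x in M. x \<in> E k \<longrightarrow> 1 \<le> h k x"
    unfolding measurable_nest_def by metis
  have "\<exists>g \<kappa>. (\<forall>i. g i \<in> DAb M Dom (E (\<kappa> i))) \<and> dconv g (h k)" for k
    by (rule nest_dense_bounded[OF E h(1)])
  then obtain g \<kappa> where g: "\<And>k i. g k i \<in> DAb M Dom (E (\<kappa> k i))" "\<And>k. dconv (g k) (h k)" by metis
  have gd: "g k i \<in> Dom" "AE x in M. x \<notin> E (\<kappa> k i) \<longrightarrow> g k i x = 0" for k i
    using g(1)[of k i] by (auto simp: DAb_def DA_def)
  \<comment> \<open>Each term is supported in some member of \<open>E\<close>, hence so is the
    finite sum; as l grows, S l eventually dominates the positive part of any given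
    \<open>g k i\<close>.\<close>
  define S where "S l x = (\<Sum>(k,i)\<in>{..l}\<times>{..l}. 1 * max (g k i x) 0)" for l x
  have Sd: "S l \<in> Dom" for l
  proof -
    have "(\<lambda>x. \<Sum>p\<in>{..l}\<times>{..l}. 1 * (\<lambda>x. max (g (fst p) (snd p) x) 0) x) \<in> Dom"
      using dom_sum[of "{..l}\<times>{..l}" "\<lambda>p x. max (g (fst p) (snd p) x) 0" "\<lambda>_. 1"] dom_pos_part(1)[OF gd(1)] by blast
    then show ?thesis by (simp add: S_def[abs_def] case_prod_unfold)
  qed
  have S0: "0 \<le> S l x" for l x unfolding S_def by (intro sum_nonneg) auto
  have Sge: "max (g k i x) 0 \<le> S l x" if "k \<le> l" "i \<le> l" for k i l x
  proof -
    have "max (g k i x) 0 = (\<lambda>(k,i). 1 * max (g k i x) 0) (k, i)" by simp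
    also have "\<dots> \<le> S l x" unfolding S_def by (rule member_le_sum) (use that in auto)
    finally show ?thesis .
  qed
  have Smono: "S l x \<le> S m x" if "l \<le> m" for l m x
    unfolding S_def by (rule sum_mono2) (use that in auto)
  have [measurable]: "S l \<in> borel_measurable M" for l by (rule dom_measurable[OF Sd])
  define F where "F l = {x \<in> space M. 1 \<le> (real l + 1) * S l x}" for l
  have Fnest: "measurable_nest M Dom D F"
  proof (rule measurable_nestI_nonneg)
    show "F k \<in> sets M" for k unfolding F_def by measurable
    show "incseq F"
    proof (rule incseq_SucI, rule subsetI)
      fix n x assume x: "x \<in> F n"
      have "(real n + 1) * S n x \<le> (real (Suc n) + 1) * S (Suc n) x"
        using S0 Smono[of n "Suc n" x] by (intro mult_mono) auto
      with x show "x \<in> F (Suc n)" by (simp add: F_def)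
    qed
    show "\<exists>h\<in>Dom. AE x in M. x \<in> F k \<longrightarrow> 1 \<le> h x" for k
      by (rule bexI[OF _ dom_cmult[OF Sd[of k], of "real k + 1"]]) (auto simp: F_def)
  next
    fix f and e :: real assume f: "f \<in> Dom" "\<And>x. 0 \<le> f x" and e: "0 < e"
    from nest_dense_bounded_nonneg[OF E f] obtain w k0 where
      w: "\<And>n. w n \<in> DAb M Dom (E (k0 n))" "\<And>n x. 0 \<le> w n x \<and> w n x \<le> f x" "dconv w f" by blast
    from dconv_imp_close[OF w(3), of "e / 8"] e obtain n where n: "E0l M D 1 (\<lambda>x. f x - w n x) < e / 8" by auto
    define f1 where "f1 = w n"
    define k where "k = k0 n"
    have f1: "f1 \<in> Dom" "\<And>x. 0 \<le> f1 x" "AE x in M. x \<notin> E k \<longrightarrow> f1 x = 0"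
      using w(1)[of n] w(2)[of n] by (auto simp: f1_def k_def DAb_def DA_def)
    obtain C0 where C0: "AE x in M. \<bar>f1 x\<bar> \<le> C0" using w(1)[of n] by (auto simp: f1_def DAb_def)
    define C where "C = \<bar>C0\<bar>"
    have C: "0 \<le> C" "AE x in M. f1 x \<le> C" using C0 by (auto simp: C_def elim!: eventually_mono)
    from dconv_pos_part_subseq[OF g(2)[of k]] obtain r :: "nat \<Rightarrow> nat"
      where r: "dconv (\<lambda>n x. max (g k (r n) x) 0) (\<lambda>x. max (h k x) 0)" by blast
    \<comment> \<open>Almost everywhere f1 <= C (h k)^+, because f1 <= C while h k >= 1 on
      \<open>E k\<close>, and f1 = 0 elsewhere. So the excess of f1 over C (h k)^+ is 0, and with g
      k i in place of h k it tends to 0.\<close>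
    have "dconv (\<lambda>n x. 1 * f1 x + (-C) * max (g k (r n) x) 0) (\<lambda>x. 1 * f1 x + (-C) * max (h k x) 0)"
      by (rule dconv_lin[OF dconv_const[OF f1(1)] r])
    from dconv_pos_part_subseq[OF this] obtain s :: "nat \<Rightarrow> nat"
      where s: "dconv (\<lambda>n x. max (f1 x - C * max (g k (r (s n)) x) 0) 0) (\<lambda>x. max (f1 x - C * max (h k x) 0) 0)"
      by auto
    have "AE x in M. max (f1 x - C * max (h k x) 0) 0 = 0"
      using C(2) f1(3) h(2)[of k]
    proof eventually_elim
      case (elim x)
      show ?case
      proof (cases "x \<in> E k")
        case True
        then have "C * 1 \<le> C * max (h k x) 0" using elim C(1) by (intro mult_left_mono) auto
        with elim show ?thesis by auto
      next
        case False
        have "0 \<le> C * max (h k x) 0" using C(1) by simp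
        with False elim show ?thesis by simp
      qed
    qed
    from dconv_cong_limit[OF s dom_zero this]
    have "dconv (\<lambda>n x. max (f1 x - C * max (g k (r (s n)) x) 0) 0) (\<lambda>x. 0)" .
    from dconv_diff[OF dconv_const[OF f1(1)] this]
    have "dconv (\<lambda>n x. f1 x - max (f1 x - C * max (g k (r (s n)) x) 0) 0) f1" by simp
    from dconv_imp_close[OF this, of "e / 16"] e obtain i'
      where i': "E0l M D 1 (\<lambda>x. f1 x - (f1 x - max (f1 x - C * max (g k (r (s i')) x) 0) 0)) < e / 16" by auto
    define i where "i = r (s i')"
    \<comment> \<open>This is min(f1, C g^+): close to f1, and dominated by C S l for all large
      l.\<close>
    define u where "u x = f1 x - max (f1 x - C * max (g k i x) 0) 0" for x
    have ud: "u \<in> Dom" unfolding u_def[abs_def] i_def using dconvD(1)[OF \<open>dconv (\<lambda>n x. f1 x - max (f1 x - C * max (g k (r (s n)) x) 0) 0) f1\<close>] .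
    have u0: "0 \<le> u x" for x
    proof -
      have "0 \<le> C * max (g k i x) 0" using C(1) by simp
      then show ?thesis using f1(2)[of x] by (auto simp: u_def)
    qed
    have ule: "u x \<le> C * max (g k i x) 0" for x by (auto simp: u_def)
    from dconv_imp_close[OF dconv_shrink[OF ud u0 C(1)], of "e / 16"] e obtain N
      where N: "\<And>n. n \<ge> N \<Longrightarrow> E0l M D 1 (\<lambda>x. u x - max (u x - C / (real n + 1)) 0) < e / 16" by auto
    define l where "l = max N (max k i)"
    \<comment> \<open>Off \<open>F l\<close> one has u <= C S l < C/(l+1), so lowering u by C/(l+1)
      gives a function supported in \<open>F l\<close>.\<close>
    define v where "v x = max (u x - C / (real l + 1)) 0" for x
    have vd: "v \<in> Dom" unfolding v_def[abs_def] by (rule dom_pos_part_shift[OF ud]) (use C in auto)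
    have "v x = 0" if "x \<in> space M" "x \<notin> F l" for x
    proof -
      have "(real l + 1) * S l x < 1" using that by (simp add: F_def)
      then have "S l x < 1 / (real l + 1)" by (simp add: field_simps)
      moreover have "max (g k i x) 0 \<le> S l x" by (rule Sge) (auto simp: l_def)
      ultimately have "max (g k i x) 0 < 1 / (real l + 1)" by linarith
      then have "C * max (g k i x) 0 \<le> C * (1 / (real l + 1))" using C(1) by (intro mult_left_mono) auto
      with ule[of x] show ?thesis by (simp add: v_def)
    qed
    then have "v \<in> DA M Dom (F l)" using vd by (auto simp: DA_def)
    moreover have "E0l M D 1 (\<lambda>x. f x - v x) < e"
    proof -
      have "E0l M D 1 (\<lambda>x. f x - v x) \<le> 2 * E0l M D 1 (\<lambda>x. f x - f1 x) + 2 * E0l M D 1 (\<lambda>x. f1 x - v x)"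
        by (rule E0l_triangle[OF f(1) f1(1) vd])
      moreover have "E0l M D 1 (\<lambda>x. f1 x - v x) \<le> 2 * E0l M D 1 (\<lambda>x. f1 x - u x) + 2 * E0l M D 1 (\<lambda>x. u x - v x)"
        by (rule E0l_triangle[OF f1(1) ud vd])
      moreover have "E0l M D 1 (\<lambda>x. f1 x - u x) < e / 16" using i' by (simp add: u_def i_def)
      moreover have "E0l M D 1 (\<lambda>x. u x - v x) < e / 16" using N[of l] by (simp add: v_def l_def)
      moreover have "E0l M D 1 (\<lambda>x. f x - f1 x) < e / 8" using n by (simp add: f1_def)
      ultimately show ?thesis using e by linarith
    qed
    ultimately show "\<exists>k. \<exists>g\<in>DA M Dom (F k). E0l M D 1 (\<lambda>x. f x - g x) < e" by blast
  qed
  define q where "q l = 1 / (real l + 1)" for l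
  have q: "0 < q l" for l by (simp add: q_def)
  \<comment> \<open>A C^1 profile that rises from 0 to 1 and is flat from q l on. Since
    \<open>F l\<close> is the set where S l >= q l, composing it with S l gives 1 there with zero
    gradient.\<close>
  define \<phi> where "\<phi> l x = (if x \<le> q l then 1 - (1 - x / q l)\<^sup>2 else 1)" for l x
  define \<phi>' where "\<phi>' l x = (if x \<le> q l then 2 * (1 - x / q l) / q l else 0)" for l x
  have 1: "(\<phi> l has_real_derivative \<phi>' l x) (at x)" for l x
    unfolding \<phi>_def \<phi>'_def
    by (rule has_real_derivative_glue) (use q[of l] in \<open>auto intro!: derivative_eq_intros simp: field_simps power4_eq_xxxx power2_eq_square\<close>)
  have 2: "continuous_on {0..} (\<phi>' l)" for l
  proof -
    have "continuous_on UNIV (\<phi>' l)" unfolding \<phi>'_def[abs_def]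
      by (rule continuous_on_glue) (use q[of l] in \<open>auto intro!: continuous_intros\<close>)
    then show ?thesis by (rule continuous_on_subset) simp
  qed
  have 3: "\<bar>\<phi>' l x\<bar> \<le> 2 / q l" if "0 \<le> x" for l x
    using that q[of l] by (auto simp: \<phi>'_def abs_mult divide_simps)
  have 4: "\<phi> l 0 = 0" for l using q[of l] by (simp add: \<phi>_def)
  have range: "0 \<le> \<phi> l x \<and> \<phi> l x \<le> 1" if "0 \<le> x" for l x
  proof (cases "x \<le> q l")
    case True
    then have "0 \<le> 1 - x / q l" "1 - x / q l \<le> 1" using that q[of l] by (auto simp: field_simps)
    then have "(1 - x / q l)\<^sup>2 \<le> 1" by (intro power_le_one)
    with True show ?thesis by (simp add: \<phi>_def)
  qed (simp add: \<phi>_def)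
  have one: "\<phi> l x = 1" "\<phi>' l x = 0" if "q l \<le> x" for l x
  proof -
    have "x = q l" if "x \<le> q l" using that \<open>q l \<le> x\<close> by simp
    then show "\<phi> l x = 1" "\<phi>' l x = 0" using q[of l] by (auto simp: \<phi>_def \<phi>'_def)
  qed
  have ch: "(\<lambda>x. \<phi> l (S l x)) \<in> Dom"
    "AE x in M. D (\<lambda>x. \<phi> l (S l x)) x = \<phi>' l (S l x) *\<^sub>R D (S l) x" for l
    using dom_chain_nonneg[OF Sd S0 1 2 3 4] by auto
  define \<zeta> where "\<zeta> l x = \<phi> l (S l x)" for l x
  have qS: "q l \<le> S l x" if "x \<in> F l" for l x using that by (simp add: F_def q_def field_simps)
  have supp: "\<exists>k. AE x in M. x \<notin> E k \<longrightarrow> \<zeta> l x = 0" for l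
  proof -
    define K where "K = Max ((\<lambda>p. \<kappa> (fst p) (snd p)) ` ({..l}\<times>{..l}))"
    have K: "\<kappa> k i \<le> K" if "k \<le> l" "i \<le> l" for k i
    proof -
      have "\<kappa> k i \<in> (\<lambda>p. \<kappa> (fst p) (snd p)) ` ({..l}\<times>{..l})"
        by (rule image_eqI[of _ _ "(k, i)"]) (use that in auto)
      then show ?thesis unfolding K_def by (intro Max_ge) auto
    qed
    have "AE x in M. \<forall>k i. x \<notin> E (\<kappa> k i) \<longrightarrow> g k i x = 0"
      using gd(2) by (simp add: AE_all_countable)
    then have "AE x in M. x \<notin> E K \<longrightarrow> \<zeta> l x = 0"
    proof eventually_elim
      case (elim x)
      show ?case
      proof
        assume x: "x \<notin> E K"
        have "g k i x = 0" if "k \<le> l" "i \<le> l" for k i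
          using incseqD[OF Einc K[OF that]] x elim by blast
        then have "S l x = 0" unfolding S_def by (intro sum.neutral) auto
        then show "\<zeta> l x = 0" using 4 by (simp add: \<zeta>_def)
      qed
    qed
    then show ?thesis by blast
  qed
  have "\<zeta> l \<in> Dom \<and> (\<forall>x. 0 \<le> \<zeta> l x \<and> \<zeta> l x \<le> 1)
    \<and> (\<forall>x\<in>F l. \<zeta> l x = 1) \<and> (AE x in M. x \<in> F l \<longrightarrow> D (\<zeta> l) x = 0)
    \<and> (\<exists>k. AE x in M. x \<notin> E k \<longrightarrow> \<zeta> l x = 0)" for l
  proof (intro conjI supp)
    show "\<zeta> l \<in> Dom" using ch(1)[of l] by (simp add: \<zeta>_def[abs_def])
    show "\<forall>x. 0 \<le> \<zeta> l x \<and> \<zeta> l x \<le> 1" using range[OF S0] by (simp add: \<zeta>_def)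
    show "\<forall>x\<in>F l. \<zeta> l x = 1" using one(1)[OF qS] by (simp add: \<zeta>_def)
    show "AE x in M. x \<in> F l \<longrightarrow> D (\<zeta> l) x = 0"
      using ch(2)[of l] by eventually_elim (use one(2)[OF qS] in \<open>simp add: \<zeta>_def[abs_def]\<close>)
  qed
  with Fnest show ?thesis by blast
qed

text \<open>A function supported in a member of the nest vanishes on the uncovered part N of A, so
  its distance from the indicator of N is at least that indicator's norm; yet such functions are
  dense in L^2. Hence N is null.\<close>

lemma nest_exhausts:
  assumes F: "measurable_nest M Dom D F" and A: "A \<in> sets M" "emeasure M A < \<infinity>"
  shows "AE x in M. x \<in> A \<longrightarrow> (\<exists>l. x \<in> F l)"
proof -
  have Fm [measurable]: "F l \<in> sets M" for l using F by (simp add: measurable_nest_def)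
  define N where "N = A - (\<Union>l. F l)"
  have Nm: "N \<in> sets M" unfolding N_def using A by auto
  have Nf: "emeasure M N < \<infinity>"
    using emeasure_mono[of N A M] A by (auto simp: N_def intro: le_less_trans)
  define u :: "'a \<Rightarrow> real" where "u = indicator N"
  have usq: "(u x)\<^sup>2 = indicator N x" for x by (simp add: u_def indicator_def)
  have u: "L2 M u" using Nm Nf by (auto simp: L2_def usq) (simp add: u_def)
  have "measure M N \<le> 4 * e" if e: "0 < e" for e
  proof -
    from dom_dense_L2[OF u, of "sqrt e"] e obtain g where g: "g \<in> Dom" "l2norm M (\<lambda>x. u x - g x) < sqrt e" by auto
    have g2: "(\<integral>x. (u x - g x)\<^sup>2 \<partial>M) < e" using g(2) by (simp add: l2norm_def)
    from F g(1) e obtain k f where f: "f \<in> DA M Dom (F k)" "E0l M D 1 (\<lambda>x. g x - f x) < e"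
      unfolding measurable_nest_def by blast
    then have fd: "f \<in> Dom" and f0: "AE x in M. x \<notin> F k \<longrightarrow> f x = 0" by (auto simp: DA_def)
    have f2: "(\<integral>x. (g x - f x)\<^sup>2 \<partial>M) < e"
    proof -
      have "0 \<le> E0 M D (\<lambda>x. g x - f x) (\<lambda>x. g x - f x)" by (simp add: E0_def)
      then show ?thesis using f(2) by (simp add: E0l_def)
    qed
    have i: "integrable M (\<lambda>x. (u x - f x)\<^sup>2)"
      by (intro L2_square_integrable L2_diff u dom_L2 fd)
    have "(\<integral>x. indicator N x \<partial>M) \<le> (\<integral>x. (u x - f x)\<^sup>2 \<partial>M)"
    proof (rule integral_mono_AE[OF _ i])
      show "integrable M (indicator N :: 'a \<Rightarrow> real)" using Nm Nf by simp
      show "AE x in M. indicator N x \<le> (u x - f x)\<^sup>2"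
        using f0 by eventually_elim (auto simp: N_def u_def indicator_def)
    qed
    also have "\<dots> = (\<integral>x. (norm ((u x - g x) + (g x - f x)))\<^sup>2 \<partial>M)" by simp
    also have "\<dots> \<le> 2 * (\<integral>x. (norm (u x - g x))\<^sup>2 \<partial>M) + 2 * (\<integral>x. (norm (g x - f x))\<^sup>2 \<partial>M)"
      by (rule integral_square_add_le)
         (use u dom_L2[OF g(1)] dom_L2[OF fd] in \<open>auto simp: L2_iff_L2H intro: L2H_diff\<close>)
    finally show ?thesis using g2 f2 Nm by simp
  qed
  \<comment> \<open>If the measure were positive, this choice would bound it by half of
    itself.\<close>
  from this[of "measure M N / 8"] have "measure M N = 0"
    using measure_nonneg[of M N] by (cases "measure M N = 0") auto
  then have "emeasure M N = 0" using Nf by (simp add: emeasure_eq_ennreal_measure)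
  then have "AE x in M. x \<notin> N" using Nm by (intro AE_not_in) (simp add: null_sets_def)
  then show ?thesis by eventually_elim (auto simp: N_def)
qed

end

section \<open>The perturbed form and positivity of the heat flow\<close>

lemma L2H_square_integral_tendsto:
  fixes F :: "nat \<Rightarrow> 'a \<Rightarrow> 'h::{real_inner, second_countable_topology}"
  assumes F: "\<And>n. L2H M (F n)" "L2H M F0"
    and lim: "(\<lambda>n. \<integral>x. (norm (F n x - F0 x))\<^sup>2 \<partial>M) \<longlonglongrightarrow> 0"
  shows "(\<lambda>n. \<integral>x. (norm (F n x))\<^sup>2 \<partial>M) \<longlonglongrightarrow> (\<integral>x. (norm (F0 x))\<^sup>2 \<partial>M)"
proof -
  have eq: "(\<integral>x. (norm (F n x))\<^sup>2 \<partial>M) = (\<integral>x. (norm (F n x - F0 x))\<^sup>2 \<partial>M) + 2 * (\<integral>x. inner (F n x) (F0 x) \<partial>M)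
    - (\<integral>x. (norm (F0 x))\<^sup>2 \<partial>M)" for n
  proof -
    have "(\<integral>x. (norm (F n x))\<^sup>2 \<partial>M) = (\<integral>x. (norm (F n x - F0 x))\<^sup>2 + 2 * inner (F n x) (F0 x) - (norm (F0 x))\<^sup>2 \<partial>M)"
      by (intro Bochner_Integration.integral_cong)
         (auto simp: power2_norm_eq_inner inner_diff_left inner_diff_right inner_commute)
    then show ?thesis
      using L2H_square_integrable[OF L2H_diff[OF F(1)[of n] F(2)]] L2H_inner_integrable[OF F(1)[of n] F(2)]
        L2H_square_integrable[OF F(2)] by simp
  qed
  have "(\<lambda>n. (\<integral>x. (norm (F n x - F0 x))\<^sup>2 \<partial>M) + 2 * (\<integral>x. inner (F n x) (F0 x) \<partial>M) - (\<integral>x. (norm (F0 x))\<^sup>2 \<partial>M))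
    \<longlonglongrightarrow> 0 + 2 * (\<integral>x. inner (F0 x) (F0 x) \<partial>M) - (\<integral>x. (norm (F0 x))\<^sup>2 \<partial>M)"
    by (intro tendsto_intros lim L2H_product_tendsto F)
  then show ?thesis unfolding eq by (simp add: power2_norm_eq_inner)
qed

text \<open>Differentiation of a nonlinear functional along an L^2-differentiable curve:
  \<open>P\<close> is the derivative of the density, \<open>C\<close> bounds the quadratic remainder
  and \<open>a'\<close> is the velocity. The admissible size of \<tau> depends on \<open>a'\<close>
  and e alone, and \<open>P\<close> enters the error only through the integral of its square; the
  time windows rely on this uniformity.\<close>

lemma functional_increment:
  assumes a: "L2 M a" "L2 M a0" "L2 M a'" and P: "L2 M P" and m: "\<Psi> \<in> borel_measurable M"
    and e: "0 < e" "e \<le> 1" and C: "0 \<le> C"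
    and inc: "(\<integral>x. (a x - a0 x - \<tau> * a' x)\<^sup>2 \<partial>M) \<le> e\<^sup>2 * \<tau>\<^sup>2"
    and bd: "AE x in M. \<bar>\<Psi> x - P x * (a x - a0 x)\<bar> \<le> C * (a x - a0 x)\<^sup>2"
    and \<tau>: "2 * \<bar>\<tau>\<bar> * ((\<integral>x. (a' x)\<^sup>2 \<partial>M) + 1) \<le> e"
  shows "integrable M \<Psi>" "\<bar>(\<integral>x. \<Psi> x \<partial>M) - \<tau> * (\<integral>x. P x * a' x \<partial>M)\<bar> \<le> e * \<bar>\<tau>\<bar> * (1 + C + (\<integral>x. (P x)\<^sup>2 \<partial>M))"
proof -
  define d where "d x = a x - a0 x" for x
  define r where "r x = d x - \<tau> * a' x" for x
  have d: "L2 M d" unfolding d_def[abs_def] by (intro L2_diff a)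
  have r: "L2 M r" unfolding r_def[abs_def] by (intro L2_diff d L2_cmult a)
  define R where "R x = \<Psi> x - P x * d x" for x
  have [measurable]: "P \<in> borel_measurable M" "d \<in> borel_measurable M" using P d by (auto simp: L2_def)
  have Rm: "R \<in> borel_measurable M" unfolding R_def[abs_def] using m by measurable
  have Ri: "integrable M R"
    by (rule Bochner_Integration.integrable_bound[where f="\<lambda>x. C * (d x)\<^sup>2"])
       (use d Rm bd C in \<open>auto simp: L2_def R_def d_def\<close>)
  have bd': "AE x in M. \<bar>R x\<bar> \<le> C * (d x)\<^sup>2" using bd by (simp add: R_def d_def)
  have Pd: "integrable M (\<lambda>x. P x * d x)" by (rule L2_product_integrable[OF P d])
  have "integrable M (\<lambda>x. R x + P x * d x)" using Ri Pd by simp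
  then show Psi: "integrable M \<Psi>" by (simp add: R_def)
  have r2: "(\<integral>x. (r x)\<^sup>2 \<partial>M) \<le> e\<^sup>2 * \<tau>\<^sup>2" using inc by (simp add: r_def d_def)
  have d2: "(\<integral>x. (d x)\<^sup>2 \<partial>M) \<le> 2 * \<tau>\<^sup>2 * ((\<integral>x. (a' x)\<^sup>2 \<partial>M) + 1)"
  proof -
    have "(\<integral>x. (norm (r x + \<tau> * a' x))\<^sup>2 \<partial>M) \<le> 2 * (\<integral>x. (norm (r x))\<^sup>2 \<partial>M) + 2 * (\<integral>x. (norm (\<tau> * a' x))\<^sup>2 \<partial>M)"
      by (rule integral_square_add_le) (use r L2_cmult[OF a(3)] in \<open>auto simp: L2_iff_L2H\<close>)
    then have "(\<integral>x. (d x)\<^sup>2 \<partial>M) \<le> 2 * (\<integral>x. (r x)\<^sup>2 \<partial>M) + 2 * \<tau>\<^sup>2 * (\<integral>x. (a' x)\<^sup>2 \<partial>M)"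
      by (simp add: r_def power_mult_distrib)
    moreover have "e\<^sup>2 * \<tau>\<^sup>2 \<le> 1 * \<tau>\<^sup>2" using e by (intro mult_right_mono) (auto intro: power_le_one)
    ultimately show ?thesis using r2 by (simp add: algebra_simps)
  qed
  have Rb: "\<bar>\<integral>x. R x \<partial>M\<bar> \<le> C * e * \<bar>\<tau>\<bar>"
  proof -
    have "\<bar>\<integral>x. R x \<partial>M\<bar> \<le> (\<integral>x. \<bar>R x\<bar> \<partial>M)" by (rule integral_abs_bound)
    also have "\<dots> \<le> (\<integral>x. C * (d x)\<^sup>2 \<partial>M)"
      by (rule integral_mono_AE) (use Ri d bd' in \<open>auto simp: L2_def\<close>)
    also have "\<dots> \<le> C * (2 * \<tau>\<^sup>2 * ((\<integral>x. (a' x)\<^sup>2 \<partial>M) + 1))"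
      using mult_left_mono[OF d2 C] by simp
    also have "\<dots> = C * (\<bar>\<tau>\<bar> * (2 * \<bar>\<tau>\<bar> * ((\<integral>x. (a' x)\<^sup>2 \<partial>M) + 1)))"
    proof -
      have "\<tau>\<^sup>2 = \<bar>\<tau>\<bar> * \<bar>\<tau>\<bar>" by (simp add: power2_eq_square)
      then show ?thesis by (simp add: ac_simps)
    qed
    also have "\<dots> \<le> C * (\<bar>\<tau>\<bar> * e)" using \<tau> C by (intro mult_left_mono) auto
    finally show ?thesis by (simp add: ac_simps)
  qed
  have Prb: "\<bar>\<integral>x. P x * r x \<partial>M\<bar> \<le> e * \<bar>\<tau>\<bar> * (1 + (\<integral>x. (P x)\<^sup>2 \<partial>M))"
  \<comment> \<open>For \<tau> = 0 the weight e |\<tau>| chosen below would be 0; in that case r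
    vanishes almost everywhere and the estimate is trivial.\<close>
  proof (cases "\<tau> = 0")
    case True
    with r2 have "(\<integral>x. (r x)\<^sup>2 \<partial>M) = 0" by (intro antisym) auto
    then have "AE x in M. (r x)\<^sup>2 = 0"
      using integral_nonneg_eq_0_iff_AE[OF L2_square_integrable[OF r]] by simp
    then have "(\<integral>x. P x * r x \<partial>M) = 0" by (intro integral_eq_zero_AE) (auto elim!: eventually_mono)
    then show ?thesis using True by simp
  next
    case False
    define l where "l = e * \<bar>\<tau>\<bar>"
    have l: "0 < l" using False e by (simp add: l_def)
    have "(\<integral>x. (r x)\<^sup>2 \<partial>M) \<le> l * l" using r2 by (simp add: l_def power2_eq_square ac_simps)
    then have "(\<integral>x. (r x)\<^sup>2 \<partial>M) / l \<le> l" using l by (simp add: divide_le_eq)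
    then show ?thesis using integral_product_le[OF P r l] by (simp add: l_def algebra_simps)
  qed
  have Pa: "integrable M (\<lambda>x. P x * a' x)" by (rule L2_product_integrable[OF P a(3)])
  have Pr: "integrable M (\<lambda>x. P x * r x)" by (rule L2_product_integrable[OF P r])
  have "(\<integral>x. \<Psi> x \<partial>M) = (\<integral>x. R x + P x * r x + \<tau> * (P x * a' x) \<partial>M)"
    by (intro Bochner_Integration.integral_cong) (auto simp: R_def r_def algebra_simps)
  also have "\<dots> = (\<integral>x. R x \<partial>M) + (\<integral>x. P x * r x \<partial>M) + \<tau> * (\<integral>x. P x * a' x \<partial>M)"
    using Ri Pr Pa by simp
  finally show "\<bar>(\<integral>x. \<Psi> x \<partial>M) - \<tau> * (\<integral>x. P x * a' x \<partial>M)\<bar> \<le> e * \<bar>\<tau>\<bar> * (1 + C + (\<integral>x. (P x)\<^sup>2 \<partial>M))"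
    using Rb Prb by (simp add: algebra_simps)
qed

text \<open>First order Taylor expansion of the square of the negative part, which is C^1 with
  Lipschitz derivative. It serves to differentiate in time the squared norm of the negative part of
  the flow.\<close>

lemma neg_part_square_expansion:
  "\<bar>(max (- p) 0)\<^sup>2 - (max (- q) 0)\<^sup>2 + 2 * max (- q) 0 * (p - q)\<bar> \<le> (p - q)\<^sup>2" for p q :: real
proof -
  consider "p \<le> 0" "q \<le> 0" | "p \<le> 0" "0 < q" | "0 < p" "q \<le> 0" | "0 < p" "0 < q" by linarith
  then show ?thesis
  proof cases
    case 1
    then have "max (- p) 0 = - p" "max (- q) 0 = - q" by auto
    moreover have "(- p)\<^sup>2 - (- q)\<^sup>2 + 2 * (- q) * (p - q) = (p - q)\<^sup>2" by (simp add: power2_eq_square algebra_simps)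
    ultimately show ?thesis by simp
  next
    case 2
    then have "max (- p) 0 = - p" "max (- q) 0 = 0" by auto
    moreover have "p\<^sup>2 \<le> (p - q)\<^sup>2" using 2 by (simp add: abs_le_square_iff[symmetric])
    ultimately show ?thesis by simp
  next
    case 3
    then have "max (- p) 0 = 0" "max (- q) 0 = - q" by auto
    moreover have "0 - (- q)\<^sup>2 + 2 * (- q) * (p - q) = (p - q)\<^sup>2 - p\<^sup>2" by (simp add: power2_eq_square algebra_simps)
    moreover have "p\<^sup>2 \<le> (p - q)\<^sup>2" using 3 by (simp add: abs_le_square_iff[symmetric])
    ultimately show ?thesis by simp
  next
    case 4
    then have "max (- p) 0 = 0" "max (- q) 0 = 0" by auto
    then show ?thesis by simp
  qed
qed

section \<open>The extended form: continuity, lower bound, locality, representation\<close>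

locale perturbed_form = derivation M Dom D
  for M :: "'a measure" and Dom :: "('a \<Rightarrow> real) set"
    and D :: "('a \<Rightarrow> real) \<Rightarrow> 'a \<Rightarrow> 'h::{real_inner, complete_space, second_countable_topology}" +
  fixes b c :: "'a \<Rightarrow> 'h" and V :: "'a \<Rightarrow> real" and E :: "nat \<Rightarrow> 'a set"
    and Ef :: "('a \<Rightarrow> real) \<Rightarrow> ('a \<Rightarrow> real) \<Rightarrow> real"
  assumes assumption_A: "assumption_A M Dom D b c V E"
    and form_extension: "form_extension M Dom D b c V E Ef"
begin

lemma coeff_measurable [measurable]:
  "b \<in> borel_measurable M" "c \<in> borel_measurable M" "V \<in> borel_measurable M" "E k \<in> sets M"
  using assumption_A by (auto simp: assumption_A_def measurable_nest_def)

lemma nest: "measurable_nest M Dom D E"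
  using assumption_A by (auto simp: assumption_A_def)

lemma coeff_L2:
  "L2H M (\<lambda>x. (indicator (E k) x :: real) *\<^sub>R b x)" "L2H M (\<lambda>x. (indicator (E k) x :: real) *\<^sub>R c x)"
  "integrable M (\<lambda>x. indicator (E k) x * V x)"
proof -
  have i: "integrable M (\<lambda>x. indicator (E k) x * (norm (b x))\<^sup>2)" "integrable M (\<lambda>x. indicator (E k) x * (norm (c x))\<^sup>2)"
    using assumption_A by (auto simp: assumption_A_def)
  have eq: "(norm ((indicator (E k) x :: real) *\<^sub>R y))\<^sup>2 = indicator (E k) x * (norm y)\<^sup>2" for x and y :: 'h
    by (simp add: indicator_def)
  show "L2H M (\<lambda>x. (indicator (E k) x :: real) *\<^sub>R b x)" "L2H M (\<lambda>x. (indicator (E k) x :: real) *\<^sub>R c x)"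
    using i by (simp_all only: L2H_def eq) measurable
  show "integrable M (\<lambda>x. indicator (E k) x * V x)"
    using assumption_A by (auto simp: assumption_A_def)
qed

lemma Ef_lin:
  assumes "f \<in> Dom" "g \<in> Dom" "h \<in> Dom"
  shows "Ef (\<lambda>x. p * f x + q * g x) h = p * Ef f h + q * Ef g h"
    "Ef h (\<lambda>x. p * f x + q * g x) = p * Ef h f + q * Ef h g"
  using form_extension assms by (auto simp: form_extension_def)

lemma Ef_diff:
  assumes "f \<in> Dom" "g \<in> Dom" "h \<in> Dom"
  shows "Ef (\<lambda>x. f x - g x) h = Ef f h - Ef g h" "Ef h (\<lambda>x. f x - g x) = Ef h f - Ef h g"
  using Ef_lin[OF assms, of 1 "-1"] by simp_all

lemma Ef_bounded: "\<exists>C\<ge>0. \<forall>f\<in>Dom. \<forall>g\<in>Dom. \<bar>Ef f g\<bar> \<le> C * sqrt (E0l M D 1 f) * sqrt (E0l M D 1 g)"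
proof -
  have "\<exists>C. \<forall>f\<in>Dom. \<forall>g\<in>Dom. \<bar>Ef f g\<bar> \<le> C * sqrt (E0l M D 1 f) * sqrt (E0l M D 1 g)"
    using form_extension unfolding form_extension_def by (elim conjE)
  then obtain C where C: "\<And>f g. f \<in> Dom \<Longrightarrow> g \<in> Dom \<Longrightarrow> \<bar>Ef f g\<bar> \<le> C * sqrt (E0l M D 1 f) * sqrt (E0l M D 1 g)"
    by blast
  have "C * sqrt (E0l M D 1 f) * sqrt (E0l M D 1 g) \<le> \<bar>C\<bar> * sqrt (E0l M D 1 f) * sqrt (E0l M D 1 g)" for f g
    by (intro mult_right_mono) (auto simp: E0l_nonneg)
  then show ?thesis by (intro exI[of _ "\<bar>C\<bar>"] conjI ballI order_trans[OF C]) auto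
qed

lemma Ef_tendsto:
  assumes u: "dconv u u0" and w: "dconv w w0"
  shows "(\<lambda>n. Ef (u n) (w n)) \<longlonglongrightarrow> Ef u0 w0"
proof -
  note [simp] = dconvD(1,2)[OF u] dconvD(1,2)[OF w]
  obtain C where C: "0 \<le> C" "\<And>f g. f \<in> Dom \<Longrightarrow> g \<in> Dom \<Longrightarrow> \<bar>Ef f g\<bar> \<le> C * sqrt (E0l M D 1 f) * sqrt (E0l M D 1 g)"
    using Ef_bounded by blast
  define p where "p n = E0l M D 1 (\<lambda>x. u n x - u0 x)" for n
  define q where "q n = E0l M D 1 (\<lambda>x. w n x - w0 x)" for n
  have p: "p \<longlonglongrightarrow> 0" unfolding p_def[abs_def] using u dconv_iff_E0l[of u u0] by simp
  have q: "q \<longlonglongrightarrow> 0" unfolding q_def[abs_def] using w dconv_iff_E0l[of w w0] by simp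
  have bd: "\<bar>Ef (u n) (w n) - Ef u0 w0\<bar> \<le> C * sqrt (p n) * sqrt (2 * q n + 2 * E0l M D 1 w0) + C * sqrt (E0l M D 1 u0) * sqrt (q n)" for n
  proof -
    have "Ef (u n) (w n) - Ef u0 w0 = Ef (\<lambda>x. u n x - u0 x) (w n) + Ef u0 (\<lambda>x. w n x - w0 x)"
      by (simp add: Ef_diff)
    moreover have "\<bar>Ef (\<lambda>x. u n x - u0 x) (w n)\<bar> \<le> C * sqrt (p n) * sqrt (E0l M D 1 (w n))"
      unfolding p_def by (intro C dom_diff) auto
    moreover have "E0l M D 1 (w n) \<le> 2 * q n + 2 * E0l M D 1 w0"
      unfolding q_def using E0l_add_le[of "\<lambda>x. w n x - w0 x" w0] by (simp add: dom_diff)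
    then have "C * sqrt (p n) * sqrt (E0l M D 1 (w n)) \<le> C * sqrt (p n) * sqrt (2 * q n + 2 * E0l M D 1 w0)"
      using C(1) by (intro mult_left_mono real_sqrt_le_mono) (auto simp: p_def E0l_nonneg)
    moreover have "\<bar>Ef u0 (\<lambda>x. w n x - w0 x)\<bar> \<le> C * sqrt (E0l M D 1 u0) * sqrt (q n)"
      unfolding q_def by (intro C dom_diff) auto
    ultimately show ?thesis by linarith
  qed
  have "(\<lambda>n. C * sqrt (p n) * sqrt (2 * q n + 2 * E0l M D 1 w0) + C * sqrt (E0l M D 1 u0) * sqrt (q n))
    \<longlonglongrightarrow> C * sqrt 0 * sqrt (2 * 0 + 2 * E0l M D 1 w0) + C * sqrt (E0l M D 1 u0) * sqrt 0"
    by (intro tendsto_intros p q)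
  then have "(\<lambda>n. C * sqrt (p n) * sqrt (2 * q n + 2 * E0l M D 1 w0) + C * sqrt (E0l M D 1 u0) * sqrt (q n)) \<longlonglongrightarrow> 0" by simp
  then have "(\<lambda>n. Ef (u n) (w n) - Ef u0 w0) \<longlonglongrightarrow> 0"
    by (rule Lim_null_comparison[rotated]) (use bd in auto)
  then show ?thesis by (simp add: LIM_zero_iff)
qed

text \<open>\<open>Ef\<close> acts on representatives. A constant sequence converges to every
  version of its limit, so continuity forces the same value on all versions.\<close>

lemma Ef_cong:
  assumes "f \<in> Dom" "g \<in> Dom" "AE x in M. f x = g x" "h \<in> Dom"
  shows "Ef f h = Ef g h" "Ef h f = Ef h g"
proof -
  have "dconv (\<lambda>_. f) g" by (rule dconv_cong_limit[OF dconv_const[OF assms(1)] assms(2,3)])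
  from Ef_tendsto[OF this dconv_const[OF assms(4)]] Ef_tendsto[OF dconv_const[OF assms(4)] this]
  show "Ef f h = Ef g h" "Ef h f = Ef h g" by (auto simp: LIMSEQ_const_iff)
qed

lemma Ef_core:
  assumes "f \<in> DAb M Dom (E k)" "g \<in> DAb M Dom (E j)"
  shows "Ef f g = E0 M D f g + bform M D b c V f g"
  using form_extension assms unfolding form_extension_def by blast

text \<open>On the core the first bound of (A.2) with \<eta> < 1 leaves a nonnegative multiple of
  E0, which is dropped; the remaining bound involves L^2-norms only and passes to the limit.\<close>

lemma Ef_lower: "\<exists>\<theta>\<ge>0. \<forall>u\<in>Dom. - \<theta> * (\<integral>x. (u x)\<^sup>2 \<partial>M) \<le> Ef u u"
proof -
  have "\<exists>\<eta> \<theta> \<omega> l::real. 0 \<le> \<eta> \<and> \<eta> < 1 \<and> 0 \<le> \<theta> \<and> 0 \<le> \<omega> \<and> 0 \<le> l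
       \<and> (\<forall>f\<in>(\<Union>k. DAb M Dom (E k)).
            - (\<integral>x. inner (b x + c x) (D f x) * f x + V x * (f x)^2 \<partial>M)
              \<le> \<eta> * E0 M D f f + \<theta> * (\<integral>x. (f x)^2 \<partial>M))
       \<and> (\<forall>f\<in>(\<Union>k. DAb M Dom (E k)). \<forall>g\<in>(\<Union>k. DAb M Dom (E k)).
            \<bar>bform M D b c V f g\<bar> \<le> \<omega> * sqrt (E0l M D l f) * sqrt (E0l M D l g))"
    using assumption_A unfolding assumption_A_def by (elim conjE)
  then obtain \<eta> \<theta> :: real where \<eta>: "0 \<le> \<eta>" "\<eta> < 1" "0 \<le> \<theta>"
    and low': "\<forall>f\<in>(\<Union>k. DAb M Dom (E k)).
            - (\<integral>x. inner (b x + c x) (D f x) * f x + V x * (f x)^2 \<partial>M)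
              \<le> \<eta> * E0 M D f f + \<theta> * (\<integral>x. (f x)^2 \<partial>M)"
    by (elim exE conjE)
  have low: "- (\<integral>x. inner (b x + c x) (D f x) * f x + V x * (f x)\<^sup>2 \<partial>M)
              \<le> \<eta> * E0 M D f f + \<theta> * (\<integral>x. (f x)\<^sup>2 \<partial>M)" if "f \<in> DAb M Dom (E k)" for f k
    using that by (intro bspec[OF low']) blast
  have core: "- \<theta> * (\<integral>x. (f x)\<^sup>2 \<partial>M) \<le> Ef f f" if f: "f \<in> DAb M Dom (E k)" for f k
  proof -
    have "bform M D b c V f f = (\<integral>x. inner (b x + c x) (D f x) * f x + V x * (f x)\<^sup>2 \<partial>M)"
      unfolding bform_def
      by (intro Bochner_Integration.integral_cong) (auto simp: inner_add_left power2_eq_square algebra_simps)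
    then have "Ef f f \<ge> (1 - \<eta>) * E0 M D f f - \<theta> * (\<integral>x. (f x)\<^sup>2 \<partial>M)"
      using low[OF f] Ef_core[OF f f] by (simp add: algebra_simps)
    moreover have "0 \<le> (1 - \<eta>) * E0 M D f f" using \<eta> by (intro mult_nonneg_nonneg) (auto simp: E0_def)
    ultimately show ?thesis by linarith
  qed
  have "- \<theta> * (\<integral>x. (u x)\<^sup>2 \<partial>M) \<le> Ef u u" if u: "u \<in> Dom" for u
  proof -
    from nest_dense_bounded[OF nest u] obtain w k where w: "\<And>n. w n \<in> DAb M Dom (E (k n))" "dconv w u" by blast
    have "(\<lambda>n. \<integral>x. (norm (w n x))\<^sup>2 \<partial>M) \<longlonglongrightarrow> (\<integral>x. (norm (u x))\<^sup>2 \<partial>M)"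
      by (rule L2H_square_integral_tendsto)
         (use dconvD[OF w(2)] dom_L2 in \<open>auto simp: L2_iff_L2H[symmetric]\<close>)
    then have "(\<lambda>n. - \<theta> * (\<integral>x. (w n x)\<^sup>2 \<partial>M)) \<longlonglongrightarrow> - \<theta> * (\<integral>x. (u x)\<^sup>2 \<partial>M)"
      by (intro tendsto_intros) simp
    from LIMSEQ_le[OF this Ef_tendsto[OF w(2) w(2)]] core[OF w(1)] show ?thesis by blast
  qed
  with \<eta>(3) show ?thesis by blast
qed

text \<open>Locality: at almost every point one of the two parts vanishes together with its
  gradient, so on the core every integrand is 0. Continuity of the form carries this to
  \<open>Dom\<close>. It is the algebraic source of positivity of the flow.\<close>

lemma Ef_pos_neg_part:
  assumes u: "u \<in> Dom"
  shows "Ef (\<lambda>x. max (u x) 0) (\<lambda>x. max (- u x) 0) = 0"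
proof -
  from nest_dense_bounded[OF nest u] obtain w k where w: "\<And>n. w n \<in> DAb M Dom (E (k n))" "dconv w u" by blast
  from dconv_pos_part_subseq[OF w(2)] obtain r :: "nat \<Rightarrow> nat"
    where r: "strict_mono r" "dconv (\<lambda>n x. max (w (r n) x) 0) (\<lambda>x. max (u x) 0)" by blast
  from dconv_pos_part_subseq[OF dconv_uminus[OF dconv_subseq[OF w(2) r(1)]]] obtain s :: "nat \<Rightarrow> nat"
    where s: "strict_mono s" "dconv (\<lambda>n x. max (- w (r (s n)) x) 0) (\<lambda>x. max (- u x) 0)" by blast
  have z: "Ef (\<lambda>x. max (g x) 0) (\<lambda>x. max (- g x) 0) = 0" if g: "g \<in> DAb M Dom (E k)" for g k
  proof -
    have gd: "g \<in> Dom" using g by (simp add: DAb_def DA_def)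
    obtain B where B: "AE x in M. \<bar>g x\<bar> \<le> B" using g by (auto simp: DAb_def)
    have g0: "AE x in M. x \<notin> E k \<longrightarrow> g x = 0" using g by (auto simp: DAb_def DA_def)
    have "AE x in M. \<bar>max (g x) 0\<bar> \<le> B" "AE x in M. \<bar>max (- g x) 0\<bar> \<le> B"
      using B by (eventually_elim, auto)+
    moreover have "AE x in M. x \<notin> E k \<longrightarrow> max (g x) 0 = 0" "AE x in M. x \<notin> E k \<longrightarrow> max (- g x) 0 = 0"
      using g0 by (eventually_elim, auto)+
    ultimately have p: "(\<lambda>x. max (g x) 0) \<in> DAb M Dom (E k)" "(\<lambda>x. max (- g x) 0) \<in> DAb M Dom (E k)"
      using dom_pos_part(1)[OF gd] dom_pos_part(1)[OF dom_uminus[OF gd]] by (auto simp: DAb_def DA_def)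
    note dd = dom_pos_part(2)[OF gd] dom_pos_part(2)[OF dom_uminus[OF gd]]
    have "E0 M D (\<lambda>x. max (g x) 0) (\<lambda>x. max (- g x) 0) = 0"
    proof -
      have "AE x in M. inner (D (\<lambda>x. max (g x) 0) x) (D (\<lambda>x. max (- g x) 0) x) = 0"
        using dd by eventually_elim auto
      then show ?thesis by (simp add: E0_def integral_eq_zero_AE)
    qed
    moreover have "bform M D b c V (\<lambda>x. max (g x) 0) (\<lambda>x. max (- g x) 0) = 0"
      unfolding bform_def by (rule integral_eq_zero_AE) (use dd in eventually_elim, auto)
    ultimately show ?thesis using Ef_core[OF p] by simp
  qed
  have "(\<lambda>n. Ef (\<lambda>x. max (w (r (s n)) x) 0) (\<lambda>x. max (- w (r (s n)) x) 0)) \<longlonglongrightarrow> Ef (\<lambda>x. max (u x) 0) (\<lambda>x. max (- u x) 0)"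
    by (rule Ef_tendsto[OF dconv_subseq[OF r(2) s(1)] s(2)])
  then show ?thesis using z[OF w(1)] by (simp add: LIMSEQ_const_iff)
qed

text \<open>Here v need be neither bounded nor supported in the nest. For approximants 0 <= w <= v
  from the core, the b-term converges because g b is square integrable, and the c- and V-terms
  converge by the two integrability hypotheses.\<close>

lemma Ef_formula:
  assumes v: "v \<in> Dom" "\<And>x. 0 \<le> v x" and g: "g \<in> DAb M Dom (E k)"
    and ic: "integrable M (\<lambda>x. norm (c x) * norm (D g x) * v x)"
    and iV: "integrable M (\<lambda>x. \<bar>V x\<bar> * \<bar>g x\<bar> * v x)"
  shows "Ef v g = E0 M D v g + bform M D b c V v g"
    "integrable M (\<lambda>x. inner (b x) (D v x) * g x + inner (c x) (D g x) * v x + V x * v x * g x)"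
proof -
  from nest_dense_bounded_nonneg[OF nest v] obtain w j where
    w: "\<And>n. w n \<in> DAb M Dom (E (j n))" "\<And>n x. 0 \<le> w n x \<and> w n x \<le> v x" "dconv w v"
    "AE x in M. (\<lambda>n. w n x) \<longlonglongrightarrow> v x" by blast
  have gd: "g \<in> Dom" and g0: "AE x in M. x \<notin> E k \<longrightarrow> g x = 0" using g by (auto simp: DAb_def DA_def)
  obtain B where B: "AE x in M. \<bar>g x\<bar> \<le> B" using g by (auto simp: DAb_def)
  have [measurable]: "g \<in> borel_measurable M" "D g \<in> borel_measurable M" "v \<in> borel_measurable M"
    "D v \<in> borel_measurable M" "w n \<in> borel_measurable M" "D (w n) \<in> borel_measurable M" for n
    using gd v dconvD(1)[OF w(3)] by (auto intro: dom_measurable D_measurable)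
  define G where "G x = g x *\<^sub>R ((indicator (E k) x :: real) *\<^sub>R b x)" for x
  have GL: "L2H M G" unfolding G_def by (intro L2H_mult[where C=B] coeff_L2 B) measurable
  have Geq: "AE x in M. \<forall>y. inner (b x) y * g x = inner y (G x)"
    using g0 by eventually_elim (auto simp: G_def indicator_def inner_commute)
  have b_int: "integrable M (\<lambda>x. inner (b x) (D f x) * g x)" and b_eq: "(\<integral>x. inner (b x) (D f x) * g x \<partial>M) = (\<integral>x. inner (D f x) (G x) \<partial>M)"
    if f: "f \<in> Dom" for f
  proof -
    have [measurable]: "D f \<in> borel_measurable M" "G \<in> borel_measurable M" using f D_measurable GL by (auto simp: L2H_def)
    have ae: "AE x in M. inner (b x) (D f x) * g x = inner (D f x) (G x)" using Geq by eventually_elim auto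
    show "(\<integral>x. inner (b x) (D f x) * g x \<partial>M) = (\<integral>x. inner (D f x) (G x) \<partial>M)"
      by (rule integral_cong_AE[OF _ _ ae]) measurable
    show "integrable M (\<lambda>x. inner (b x) (D f x) * g x)"
      by (rule integrable_cong_AE[THEN iffD2, OF _ _ ae L2H_inner_integrable[OF D_L2H[OF f] GL]]) measurable
  qed
  have c_bd: "\<bar>inner (c x) (D g x) * a\<bar> \<le> norm (c x) * norm (D g x) * v x" if "0 \<le> a" "a \<le> v x" for x a
    unfolding abs_mult using that by (intro mult_mono Cauchy_Schwarz_ineq2) auto
  have V_bd: "\<bar>V x * a * g x\<bar> \<le> \<bar>V x\<bar> * \<bar>g x\<bar> * v x" if "0 \<le> a" "a \<le> v x" for x a
  proof -
    have "\<bar>V x * a * g x\<bar> = (\<bar>V x\<bar> * \<bar>g x\<bar>) * a" using that by (simp add: abs_mult ac_simps)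
    also have "\<dots> \<le> (\<bar>V x\<bar> * \<bar>g x\<bar>) * v x" using that by (intro mult_left_mono) auto
    finally show ?thesis .
  qed
  have c_int: "integrable M (\<lambda>x. inner (c x) (D g x) * a x)" and V_int: "integrable M (\<lambda>x. V x * a x * g x)"
    if [measurable]: "a \<in> borel_measurable M" and a: "\<And>x. 0 \<le> a x" "\<And>x. a x \<le> v x" for a
  proof -
    show "integrable M (\<lambda>x. inner (c x) (D g x) * a x)"
    proof (rule Bochner_Integration.integrable_bound[OF ic])
      show "AE x in M. norm (inner (c x) (D g x) * a x) \<le> norm (norm (c x) * norm (D g x) * v x)"
        using c_bd[OF a] by (auto intro!: AE_I2 order_trans[OF _ abs_ge_self])
    qed measurable
    show "integrable M (\<lambda>x. V x * a x * g x)"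
    proof (rule Bochner_Integration.integrable_bound[OF iV])
      show "AE x in M. norm (V x * a x * g x) \<le> norm (\<bar>V x\<bar> * \<bar>g x\<bar> * v x)"
        using V_bd[OF a] by (auto intro!: AE_I2 order_trans[OF _ abs_ge_self])
    qed measurable
  qed
  have wle: "0 \<le> w n x" "w n x \<le> v x" for n x using w(2) by auto
  show "integrable M (\<lambda>x. inner (b x) (D v x) * g x + inner (c x) (D g x) * v x + V x * v x * g x)"
    using b_int[OF v(1)] c_int[of v] V_int[of v] v(2) by auto
  have bf: "bform M D b c V f g = (\<integral>x. inner (D f x) (G x) \<partial>M) + (\<integral>x. inner (c x) (D g x) * f x \<partial>M) + (\<integral>x. V x * f x * g x \<partial>M)"
    if f: "f \<in> Dom" "\<And>x. 0 \<le> f x" "\<And>x. f x \<le> v x" for f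
    unfolding bform_def using b_int[OF f(1)] b_eq[OF f(1)] c_int[OF dom_measurable[OF f(1)] f(2,3)] V_int[OF dom_measurable[OF f(1)] f(2,3)]
    by simp
  have l1: "(\<lambda>n. \<integral>x. inner (D (w n) x) (G x) \<partial>M) \<longlonglongrightarrow> (\<integral>x. inner (D v x) (G x) \<partial>M)"
    by (rule L2H_product_tendsto) (use dconvD[OF w(3)] GL D_L2H in auto)
  have l2: "(\<lambda>n. \<integral>x. inner (c x) (D g x) * w n x \<partial>M) \<longlonglongrightarrow> (\<integral>x. inner (c x) (D g x) * v x \<partial>M)"
  proof (rule integral_dominated_convergence[OF _ _ ic])
    show "AE x in M. (\<lambda>n. inner (c x) (D g x) * w n x) \<longlonglongrightarrow> inner (c x) (D g x) * v x"
      using w(4) by eventually_elim (intro tendsto_intros)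
    show "AE x in M. norm (inner (c x) (D g x) * w n x) \<le> norm (c x) * norm (D g x) * v x" for n
      using c_bd[OF wle] by auto
  qed measurable
  have l3: "(\<lambda>n. \<integral>x. V x * w n x * g x \<partial>M) \<longlonglongrightarrow> (\<integral>x. V x * v x * g x \<partial>M)"
  proof (rule integral_dominated_convergence[OF _ _ iV])
    show "AE x in M. (\<lambda>n. V x * w n x * g x) \<longlonglongrightarrow> V x * v x * g x"
      using w(4) by eventually_elim (intro tendsto_intros)
    show "AE x in M. norm (V x * w n x * g x) \<le> \<bar>V x\<bar> * \<bar>g x\<bar> * v x" for n
      using V_bd[OF wle] by auto
  qed measurable
  have l0: "(\<lambda>n. E0 M D (w n) g) \<longlonglongrightarrow> E0 M D v g"
    unfolding E0_def by (intro tendsto_intros L2H_product_tendsto) (use dconvD[OF w(3)] gd D_L2H in auto)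
  have "(\<lambda>n. E0 M D (w n) g + bform M D b c V (w n) g) \<longlonglongrightarrow> E0 M D v g + bform M D b c V v g"
    using bf[OF dconvD(1)[OF w(3)] wle] bf[OF v] by (simp, intro tendsto_intros l0 l1 l2 l3)
  moreover have "(\<lambda>n. Ef (w n) g) \<longlonglongrightarrow> Ef v g" by (rule Ef_tendsto[OF w(3) dconv_const[OF gd]])
  ultimately show "Ef v g = E0 M D v g + bform M D b c V v g"
    using Ef_core[OF w(1) g] LIMSEQ_unique by simp
qed

text \<open>Gronwall for the squared norm of the negative part n of the flow u: its time derivative
  is 2 Ef(u, n) = -2 Ef(n, n) <= 2 \<theta> |n|^2, and it tends to 0 at time 0. The chosen version
  is nonnegative at every point, since the logarithm is applied pointwise, and the time derivative
  is restated by increments so that no difference quotient remains.\<close>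

lemma heat_flow_nonneg:
  assumes T: "associated_semigroup M Dom Ef T" and B: "B \<in> B0 M"
  shows "\<exists>v v'. ((\<lambda>s. \<integral>x. (v s x - indicator B x)\<^sup>2 \<partial>M) \<longlongrightarrow> 0) (at_right 0) \<and>
    (\<forall>s>0. v s \<in> Dom \<and> (\<forall>x. 0 \<le> v s x) \<and> (AE x in M. v s x = T s (indicator B) x) \<and> L2 M (v' s)
      \<and> (\<forall>g\<in>Dom. (\<integral>x. v' s x * g x \<partial>M) = - Ef (v s) g)
      \<and> (\<forall>e>0. \<exists>d>0. \<forall>r. \<bar>r - s\<bar> < d \<longrightarrow> 0 < r \<and> (\<integral>x. (v r x - v s x - (r - s) * v' s x)\<^sup>2 \<partial>M) \<le> e\<^sup>2 * (r - s)\<^sup>2))"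
proof -
  have Bm [measurable]: "B \<in> sets M" and Bf: "emeasure M B < \<infinity>" using B by (auto simp: B0_def)
  have sq: "((indicator B x :: real))\<^sup>2 = indicator B x" for x by (simp add: indicator_def)
  have BL: "L2 M (indicator B)" using Bf by (auto simp: L2_def sq)
  define u where "u s = T s (indicator B)" for s
  have u0: "((\<lambda>s. \<integral>x. (u s x - indicator B x)\<^sup>2 \<partial>M) \<longlongrightarrow> 0) (at_right 0)"
    using T BL by (simp add: associated_semigroup_def u_def l2norm_tendsto_0_iff)
  have ud: "u s \<in> Dom" if "0 < s" for s using T BL that by (simp add: associated_semigroup_def u_def)
  have "\<exists>u'. \<forall>s>0. L2 M (u' s)
      \<and> ((\<lambda>r. l2norm M (\<lambda>x. (u r x - u s x) / (r - s) - u' s x)) \<longlongrightarrow> 0) (at s)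
      \<and> (\<forall>g\<in>Dom. (\<integral>x. u' s x * g x \<partial>M) = - Ef (u s) g)"
  proof -
    have "\<forall>s. \<exists>p. 0 < s \<longrightarrow> L2 M p
      \<and> ((\<lambda>r. l2norm M (\<lambda>x. (u r x - u s x) / (r - s) - p x)) \<longlongrightarrow> 0) (at s)
      \<and> (\<forall>g\<in>Dom. (\<integral>x. p x * g x \<partial>M) = - Ef (u s) g)"
      using T BL unfolding associated_semigroup_def u_def by meson
    from choice[OF this] show ?thesis by blast
  qed
  then obtain u' where u': "\<And>s. 0 < s \<Longrightarrow> L2 M (u' s)"
    "\<And>s. 0 < s \<Longrightarrow> ((\<lambda>r. l2norm M (\<lambda>x. (u r x - u s x) / (r - s) - u' s x)) \<longlongrightarrow> 0) (at s)"
    "\<And>s g. 0 < s \<Longrightarrow> g \<in> Dom \<Longrightarrow> (\<integral>x. u' s x * g x \<partial>M) = - Ef (u s) g" by blast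
  have inc: "\<exists>d>0. \<forall>r. \<bar>r - s\<bar> < d \<longrightarrow> 0 < r \<and> (\<integral>x. (u r x - u s x - (r - s) * u' s x)\<^sup>2 \<partial>M) \<le> e\<^sup>2 * (r - s)\<^sup>2"
    if s: "0 < s" and e: "0 < e" for s e
  proof -
    from u'(2)[OF s] have "((\<lambda>r. \<integral>x. ((u r x - u s x) / (r - s) - u' s x)\<^sup>2 \<partial>M) \<longlongrightarrow> 0) (at s)"
      by (simp add: l2norm_tendsto_0_iff)
    from order_tendstoD(2)[OF this, of "e\<^sup>2"] e
    have "\<forall>\<^sub>F r in at s. (\<integral>x. ((u r x - u s x) / (r - s) - u' s x)\<^sup>2 \<partial>M) < e\<^sup>2" by simp
    then obtain d where d: "0 < d" "\<And>r. r \<noteq> s \<Longrightarrow> \<bar>r - s\<bar> < d \<Longrightarrow> (\<integral>x. ((u r x - u s x) / (r - s) - u' s x)\<^sup>2 \<partial>M) < e\<^sup>2"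
      by (auto simp: eventually_at dist_real_def)
    show ?thesis
    proof (intro exI[of _ "min d s"] conjI allI impI)
      show "0 < min d s" using d(1) s by simp
      fix r assume r: "\<bar>r - s\<bar> < min d s"
      then have "\<bar>r - s\<bar> < s" by simp
      then show "0 < r" by linarith
      show "(\<integral>x. (u r x - u s x - (r - s) * u' s x)\<^sup>2 \<partial>M) \<le> e\<^sup>2 * (r - s)\<^sup>2"
      proof (cases "r = s")
        case True
        show ?thesis unfolding True by simp
      next
        case False
        then have ne: "r \<noteq> s" by simp
        have id: "(r - s) * (p / (r - s) - q) = p - (r - s) * q" for p q
          using ne by (simp add: field_simps)
        have "(\<integral>x. (u r x - u s x - (r - s) * u' s x)\<^sup>2 \<partial>M)
          = (\<integral>x. (r - s)\<^sup>2 * ((u r x - u s x) / (r - s) - u' s x)\<^sup>2 \<partial>M)"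
          by (simp only: power_mult_distrib[symmetric] id)
        also have "\<dots> = (r - s)\<^sup>2 * (\<integral>x. ((u r x - u s x) / (r - s) - u' s x)\<^sup>2 \<partial>M)" by (rule integral_mult_right_zero)
        also have "\<dots> \<le> (r - s)\<^sup>2 * e\<^sup>2"
        proof (rule mult_left_mono[OF less_imp_le])
          have "\<bar>r - s\<bar> < d" using r by simp
          from d(2)[OF ne this] show "(\<integral>x. ((u r x - u s x) / (r - s) - u' s x)\<^sup>2 \<partial>M) < e\<^sup>2" .
        qed simp
        finally show ?thesis by (simp add: mult.commute)
      qed
    qed
  qed
  define n where "n s x = max (- u s x) 0" for s x
  have nd: "n s \<in> Dom" if "0 < s" for s
    unfolding n_def[abs_def] by (intro dom_pos_part dom_uminus ud that)
  define \<phi> where "\<phi> s = (\<integral>x. (n s x)\<^sup>2 \<partial>M)" for s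
  have deriv: "(\<phi> has_real_derivative (\<integral>x. (- 2 * n s x) * u' s x \<partial>M)) (at s)" if s: "0 < s" for s
    unfolding has_field_derivative_def has_derivative_at_alt
  proof (intro conjI allI impI)
    fix \<epsilon> :: real assume \<epsilon>: "0 < \<epsilon>"
    define K where "K = 1 + 1 + (\<integral>x. (- 2 * n s x)\<^sup>2 \<partial>M)"
    have K: "0 < K" unfolding K_def by (intro add_pos_nonneg) auto
    define e where "e = min 1 (\<epsilon> / K)"
    have e: "0 < e" "e \<le> 1" using \<epsilon> K by (auto simp: e_def)
    have "e \<le> \<epsilon> / K" by (simp add: e_def)
    then have eK: "e * K \<le> \<epsilon>" using K by (simp add: pos_le_divide_eq)
    from inc[OF s e(1)] obtain d where d: "0 < d"
      "\<And>r. \<bar>r - s\<bar> < d \<Longrightarrow> 0 < r" "\<And>r. \<bar>r - s\<bar> < d \<Longrightarrow> (\<integral>x. (u r x - u s x - (r - s) * u' s x)\<^sup>2 \<partial>M) \<le> e\<^sup>2 * (r - s)\<^sup>2" by blast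
    define A where "A = (\<integral>x. (u' s x)\<^sup>2 \<partial>M) + 1"
    have A: "0 < A" unfolding A_def by (intro add_nonneg_pos) auto
    show "\<exists>d>0. \<forall>y. norm (y - s) < d \<longrightarrow> norm (\<phi> y - \<phi> s - (\<integral>x. - 2 * n s x * u' s x \<partial>M) * (y - s)) \<le> \<epsilon> * norm (y - s)"
    proof (intro exI[of _ "min d (e / (2 * A))"] conjI allI impI)
      show "0 < min d (e / (2 * A))" using d(1) e A by simp
      fix r assume r: "norm (r - s) < min d (e / (2 * A))"
      then have rd: "\<bar>r - s\<bar> < d" by simp
      then have r0: "0 < r" by (rule d(2))
      have "\<bar>(\<integral>x. (n r x)\<^sup>2 - (n s x)\<^sup>2 \<partial>M) - (r - s) * (\<integral>x. (- 2 * n s x) * u' s x \<partial>M)\<bar> \<le> e * \<bar>r - s\<bar> * (1 + 1 + (\<integral>x. (- 2 * n s x)\<^sup>2 \<partial>M))"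
      proof (rule functional_increment(2))
        show "L2 M (u r)" "L2 M (u s)" "L2 M (u' s)" by (intro dom_L2 ud r0 s u')+
        show "L2 M (\<lambda>x. - 2 * n s x)" by (intro L2_cmult dom_L2 nd s)
        show "(\<lambda>x. (n r x)\<^sup>2 - (n s x)\<^sup>2) \<in> borel_measurable M"
          using dom_measurable[OF nd[OF r0]] dom_measurable[OF nd[OF s]] by measurable
        show "(\<integral>x. (u r x - u s x - (r - s) * u' s x)\<^sup>2 \<partial>M) \<le> e\<^sup>2 * (r - s)\<^sup>2" by (rule d(3)[OF rd])
        show "2 * \<bar>r - s\<bar> * ((\<integral>x. (u' s x)\<^sup>2 \<partial>M) + 1) \<le> e"
        proof -
          have "\<bar>r - s\<bar> < e / (2 * A)" using r by simp
          then have "2 * \<bar>r - s\<bar> * A < e" using A by (simp add: field_simps)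
          then show ?thesis by (simp add: A_def)
        qed
        show "AE x in M. \<bar>(n r x)\<^sup>2 - (n s x)\<^sup>2 - - 2 * n s x * (u r x - u s x)\<bar> \<le> 1 * (u r x - u s x)\<^sup>2"
        proof (rule AE_I2)
          fix x
          show "\<bar>(n r x)\<^sup>2 - (n s x)\<^sup>2 - - 2 * n s x * (u r x - u s x)\<bar> \<le> 1 * (u r x - u s x)\<^sup>2"
            using neg_part_square_expansion[of "u r x" "u s x"] by (simp add: n_def)
        qed
      qed (use e in auto)
      also have "\<dots> \<le> \<epsilon> * \<bar>r - s\<bar>"
        using mult_right_mono[OF eK, of "\<bar>r - s\<bar>"] by (simp add: K_def ac_simps)
      finally show "norm (\<phi> r - \<phi> s - (\<integral>x. - 2 * n s x * u' s x \<partial>M) * (r - s)) \<le> \<epsilon> * norm (r - s)"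
        using dom_square_integrable[OF nd[OF r0]] dom_square_integrable[OF nd[OF s]]
        by (simp add: \<phi>_def mult.commute)
    qed
  qed (rule bounded_linear_mult_right)
  obtain \<theta> where \<theta>: "0 \<le> \<theta>" "\<And>w. w \<in> Dom \<Longrightarrow> - \<theta> * (\<integral>x. (w x)\<^sup>2 \<partial>M) \<le> Ef w w" using Ef_lower by blast
  have dle: "(\<integral>x. (- 2 * n s x) * u' s x \<partial>M) \<le> 2 * \<theta> * \<phi> s" if s: "0 < s" for s
  proof -
    have "(\<integral>x. (- 2 * n s x) * u' s x \<partial>M) = (\<integral>x. - 2 * (u' s x * n s x) \<partial>M)"
      by (intro Bochner_Integration.integral_cong) auto
    also have "\<dots> = 2 * Ef (u s) (n s)" using u'(3)[OF s nd[OF s]] by simp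
    also have "Ef (u s) (n s) = Ef (\<lambda>x. max (u s x) 0 - n s x) (n s)"
    proof -
      have "(\<lambda>x. max (u s x) 0 - n s x) = u s" by (auto simp: n_def fun_eq_iff max_def)
      then show ?thesis by simp
    qed
    also have "\<dots> = Ef (\<lambda>x. max (u s x) 0) (n s) - Ef (n s) (n s)"
      by (intro Ef_diff dom_pos_part ud s nd)
    also have "Ef (\<lambda>x. max (u s x) 0) (n s) = 0" unfolding n_def by (rule Ef_pos_neg_part[OF ud[OF s]])
    finally show ?thesis using \<theta>(2)[OF nd[OF s]] by (simp add: \<phi>_def)
  qed
  \<comment> \<open>The exponential weight absorbs the Gronwall constant: the weighted norm is
    nonincreasing, hence bounded by its limit at time 0.\<close>
  define \<psi> where "\<psi> s = exp (- 2 * \<theta> * s) * \<phi> s" for s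
  have \<psi>_mono: "\<psi> s \<le> \<psi> r" if "0 < r" "r \<le> s" for r s
  proof (rule DERIV_nonpos_imp_nonincreasing[OF that(2)])
    fix y assume "r \<le> y" "y \<le> s"
    then have y: "0 < y" using that by simp
    have "(\<psi> has_real_derivative (exp (- 2 * \<theta> * y) * (\<integral>x. (- 2 * n y x) * u' y x \<partial>M) + (exp (- 2 * \<theta> * y) * (- 2 * \<theta>)) * \<phi> y)) (at y)"
      unfolding \<psi>_def[abs_def] by (rule derivative_eq_intros deriv[OF y] refl | simp)+
    moreover have "exp (- 2 * \<theta> * y) * (\<integral>x. (- 2 * n y x) * u' y x \<partial>M) + (exp (- 2 * \<theta> * y) * (- 2 * \<theta>)) * \<phi> y
      = exp (- 2 * \<theta> * y) * ((\<integral>x. (- 2 * n y x) * u' y x \<partial>M) - 2 * \<theta> * \<phi> y)" by (simp add: algebra_simps)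
    moreover have "exp (- 2 * \<theta> * y) * ((\<integral>x. (- 2 * n y x) * u' y x \<partial>M) - 2 * \<theta> * \<phi> y) \<le> 0"
      using dle[OF y] by (intro mult_nonneg_nonpos) auto
    ultimately show "\<exists>z. (\<psi> has_real_derivative z) (at y) \<and> z \<le> 0" by metis
  qed
  \<comment> \<open>As the indicator is nonnegative, the negative part of u r is at most |u r -
    1_B|, so the initial condition sends its norm to 0.\<close>
  have \<phi>_le: "\<phi> r \<le> (\<integral>x. (u r x - indicator B x)\<^sup>2 \<partial>M)" if r: "0 < r" for r
    unfolding \<phi>_def
  proof (rule integral_mono)
    show "integrable M (\<lambda>x. (n r x)\<^sup>2)" by (rule dom_square_integrable[OF nd[OF r]])
    show "integrable M (\<lambda>x. (u r x - indicator B x)\<^sup>2)" by (intro L2_square_integrable L2_diff dom_L2 ud r BL)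
    fix x
    have "\<bar>n r x\<bar> \<le> \<bar>u r x - indicator B x\<bar>" by (auto simp: n_def indicator_def max_def)
    then show "(n r x)\<^sup>2 \<le> (u r x - indicator B x)\<^sup>2" by (simp add: abs_le_square_iff)
  qed
  have nonneg: "AE x in M. 0 \<le> u s x" if s: "0 < s" for s
  proof -
    have "\<psi> s \<le> 0"
    proof (rule tendsto_lowerbound[OF u0])
      show "\<forall>\<^sub>F r in at_right 0. \<psi> s \<le> (\<integral>x. (u r x - indicator B x)\<^sup>2 \<partial>M)"
        unfolding eventually_at_right_field
      proof (intro exI[of _ s] conjI allI impI s)
        fix r assume r: "0 < r" "r < s"
        have "\<psi> s \<le> \<psi> r" using \<psi>_mono r by simp
        also have "\<psi> r \<le> 1 * \<phi> r" unfolding \<psi>_def using \<theta>(1) r by (intro mult_right_mono) (auto simp: \<phi>_def)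
        also have "\<dots> \<le> (\<integral>x. (u r x - indicator B x)\<^sup>2 \<partial>M)" using \<phi>_le[OF r(1)] by simp
        finally show "\<psi> s \<le> (\<integral>x. (u r x - indicator B x)\<^sup>2 \<partial>M)" .
      qed
    qed simp
    then have "\<phi> s \<le> 0" by (simp add: \<psi>_def mult_le_0_iff)
    then have "(\<integral>x. (n s x)\<^sup>2 \<partial>M) = 0" unfolding \<phi>_def by (intro antisym) auto
    then have "AE x in M. (n s x)\<^sup>2 = 0"
      using integral_nonneg_eq_0_iff_AE[OF dom_square_integrable[OF nd[OF s]]] by simp
    then show ?thesis by eventually_elim (auto simp: n_def max_def split: if_splits)
  qed
  define v where "v s x = max (u s x) 0" for s x
  have veq: "AE x in M. v s x = u s x" if "0 < s" for s
    using nonneg[OF that] by eventually_elim (auto simp: v_def)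
  have vd: "v s \<in> Dom" if "0 < s" for s unfolding v_def[abs_def] by (intro dom_pos_part ud that)
  have vm [measurable]: "0 < s \<Longrightarrow> v s \<in> borel_measurable M" "0 < s \<Longrightarrow> u s \<in> borel_measurable M" "0 < s \<Longrightarrow> u' s \<in> borel_measurable M" for s
    using vd ud u'(1) by (auto intro: dom_measurable L2_measurable)
  show ?thesis
  proof (rule exI[of _ v], rule exI[of _ u'], intro conjI allI impI ballI)
    have "(\<integral>x. (u s x - indicator B x)\<^sup>2 \<partial>M) = (\<integral>x. (v s x - indicator B x)\<^sup>2 \<partial>M)" if s: "0 < s" for s
      by (rule integral_cong_AE) (use s veq[OF s] in auto)
    then have "\<forall>\<^sub>F s in at_right 0. (\<integral>x. (u s x - indicator B x)\<^sup>2 \<partial>M) = (\<integral>x. (v s x - indicator B x)\<^sup>2 \<partial>M)"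
      by (auto simp: eventually_at_right_field intro: exI[of _ 1])
    with u0 show "((\<lambda>s. \<integral>x. (v s x - indicator B x)\<^sup>2 \<partial>M) \<longlongrightarrow> 0) (at_right 0)"
      by (rule Lim_transform_eventually)
  next
    fix s :: real assume s: "0 < s"
    show "v s \<in> Dom" by (rule vd[OF s])
    show "0 \<le> v s x" for x by (simp add: v_def)
    show "AE x in M. v s x = T s (indicator B) x" using veq[OF s] by (simp add: u_def)
    show "L2 M (u' s)" by (rule u'(1)[OF s])
    show "\<And>g. g \<in> Dom \<Longrightarrow> (\<integral>x. u' s x * g x \<partial>M) = - Ef (v s) g"
      using u'(3)[OF s] Ef_cong(1)[OF vd[OF s] ud[OF s] veq[OF s]] by simp
    fix e :: real assume e: "0 < e"
    from inc[OF s e] obtain d where d: "0 < d"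
      "\<And>r. \<bar>r - s\<bar> < d \<Longrightarrow> 0 < r \<and> (\<integral>x. (u r x - u s x - (r - s) * u' s x)\<^sup>2 \<partial>M) \<le> e\<^sup>2 * (r - s)\<^sup>2" by blast
    have "(\<integral>x. (v r x - v s x - (r - s) * u' s x)\<^sup>2 \<partial>M) = (\<integral>x. (u r x - u s x - (r - s) * u' s x)\<^sup>2 \<partial>M)" if "\<bar>r - s\<bar> < d" for r
    proof -
      have r: "0 < r" using d that by auto
      have [measurable]: "v s \<in> borel_measurable M" "u s \<in> borel_measurable M" "u' s \<in> borel_measurable M"
        "v r \<in> borel_measurable M" "u r \<in> borel_measurable M" using s r by auto
      show ?thesis by (rule integral_cong_AE) (use veq[OF s] veq[OF r] in auto)
    qed
    with d show "\<exists>d>0. \<forall>r. \<bar>r - s\<bar> < d \<longrightarrow> 0 < r \<and> (\<integral>x. (v r x - v s x - (r - s) * u' s x)\<^sup>2 \<partial>M) \<le> e\<^sup>2 * (r - s)\<^sup>2"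
      by (intro exI[of _ d]) auto
  qed
qed

end

section \<open>The logarithmic transform\<close>

text \<open>With $\delta = e^{-K/t}$ the function \<open>log_trans t \<delta> v\<close> is $K$ minus a bounded version of
  $-t \log v$: it is bounded by $K$, and the factor $1/(1+v)$ only improves the sign of the second derivative.\<close>

definition log_trans :: "real \<Rightarrow> real \<Rightarrow> real \<Rightarrow> real" where
  "log_trans t \<delta> v = t * (ln (v + \<delta>) - ln \<delta> - ln (1 + v))"

text \<open>The v-derivative 1/(v + \<delta>) - 1/(1 + v) of \<open>log_trans\<close>, without the
  factor t.\<close>

definition log_rate :: "real \<Rightarrow> real \<Rightarrow> real" where
  "log_rate \<delta> v = (1 - \<delta>) / ((1 + v) * (v + \<delta>))"

definition log_rate' :: "real \<Rightarrow> real \<Rightarrow> real" where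
  "log_rate' \<delta> v = - ((1 - \<delta>) * (1 + \<delta> + 2 * v)) / ((1 + v) * (v + \<delta>))\<^sup>2"

context
  fixes \<delta> :: real assumes \<delta>: "0 < \<delta>" "\<delta> < 1"
begin

lemma log_rate_nonneg: "0 \<le> v \<Longrightarrow> 0 \<le> log_rate \<delta> v"
  using \<delta> by (simp add: log_rate_def)

lemma log_rate_le: "0 \<le> v \<Longrightarrow> log_rate \<delta> v \<le> 1 / \<delta>"
proof -
  assume v: "0 \<le> v"
  have "1 * \<delta> \<le> (1 + v) * (v + \<delta>)" using v \<delta> by (intro mult_mono) auto
  then show ?thesis unfolding log_rate_def using \<delta> by (intro frac_le) auto
qed

text \<open>Counterpart of v (log v)' = 1. It cancels the undifferentiated factor v in the c- and
  V-terms and leaves bounds free of \<delta>.\<close>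

lemma mult_log_rate_le: "0 \<le> v \<Longrightarrow> v * log_rate \<delta> v \<le> 1"
proof -
  assume v: "0 \<le> v"
  have "v * (1 - \<delta>) \<le> (v + \<delta>) * (1 + v)" using v \<delta> by (intro mult_mono) auto
  then show ?thesis using v \<delta> by (simp add: log_rate_def divide_le_eq mult.commute)
qed

lemma log_rate_deriv: "0 \<le> v \<Longrightarrow> (log_rate \<delta> has_real_derivative log_rate' \<delta> v) (at v)"
proof -
  assume v: "0 \<le> v"
  have nz: "(1 + v) * (v + \<delta>) \<noteq> 0" using v \<delta> by auto
  have "((\<lambda>v. (1 - \<delta>) / ((1 + v) * (v + \<delta>))) has_real_derivative
    (0 * ((1 + v) * (v + \<delta>)) - (1 - \<delta>) * (1 * (v + \<delta>) + 1 * (1 + v))) / (((1 + v) * (v + \<delta>)) * ((1 + v) * (v + \<delta>)))) (at v)"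
    using nz by (intro DERIV_divide DERIV_mult' derivative_eq_intros refl) auto
  moreover have "(0 * ((1 + v) * (v + \<delta>)) - (1 - \<delta>) * (1 * (v + \<delta>) + 1 * (1 + v))) / (((1 + v) * (v + \<delta>)) * ((1 + v) * (v + \<delta>))) = log_rate' \<delta> v"
    by (simp add: log_rate'_def power2_eq_square algebra_simps)
  ultimately show ?thesis by (simp add: log_rate_def[abs_def])
qed

lemma log_rate'_eq: "0 \<le> v \<Longrightarrow> log_rate' \<delta> v = - log_rate \<delta> v * ((1 + \<delta> + 2 * v) / ((1 + v) * (v + \<delta>)))"
  by (simp add: log_rate'_def log_rate_def power2_eq_square)

text \<open>For the pure logarithm this is an equality; it produces the quadratic gradient term of
  the Hamilton-Jacobi inequality. The modification by \<delta> and 1 + v changes it only in the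
  favourable direction.\<close>

lemma log_rate'_le: "0 \<le> v \<Longrightarrow> log_rate' \<delta> v \<le> - (log_rate \<delta> v)\<^sup>2"
proof -
  assume v: "0 \<le> v"
  have "(1 - \<delta>) * (1 - \<delta>) \<le> (1 - \<delta>) * (1 + \<delta> + 2 * v)" using v \<delta> by (intro mult_left_mono) auto
  then have "(1 - \<delta>)\<^sup>2 / ((1 + v) * (v + \<delta>))\<^sup>2 \<le> ((1 - \<delta>) * (1 + \<delta> + 2 * v)) / ((1 + v) * (v + \<delta>))\<^sup>2"
    by (intro divide_right_mono) (auto simp: power2_eq_square)
  then show ?thesis by (simp add: log_rate'_def log_rate_def power_divide)
qed

text \<open>The gradient of the test function h R(v) contains h R'(v) Dv. In the c-term this is
  multiplied by v and becomes of size R |Dv|, again with no dependence on \<delta>.\<close>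

lemma mult_log_rate'_le: "0 \<le> v \<Longrightarrow> v * \<bar>log_rate' \<delta> v\<bar> \<le> 2 * log_rate \<delta> v"
proof -
  assume v: "0 \<le> v"
  have pos: "0 < (1 + v) * (v + \<delta>)" using v \<delta> by auto
  have "v * (1 + \<delta> + 2 * v) \<le> (v + \<delta>) * (2 * (1 + v))" using v \<delta> by (intro mult_mono) auto
  then have "v * ((1 + \<delta> + 2 * v) / ((1 + v) * (v + \<delta>))) \<le> 2"
    using pos by (simp add: divide_le_eq algebra_simps)
  from mult_left_mono[OF this log_rate_nonneg[OF v]]
  show ?thesis using v \<delta> log_rate_nonneg[OF v] by (simp add: log_rate'_eq abs_mult ac_simps)
qed

text \<open>In contrast to the preceding bounds this one degenerates as \<delta> tends to 0. It
  enters only where \<delta> is fixed: membership in \<open>Dom\<close> and Taylor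
  remainders.\<close>

lemma abs_log_rate'_le: "0 \<le> v \<Longrightarrow> \<bar>log_rate' \<delta> v\<bar> \<le> 2 / \<delta>\<^sup>2"
proof -
  assume v: "0 \<le> v"
  have pos: "0 < 1 + v" "0 < v + \<delta>" using v \<delta> by auto
  have "(1 + \<delta> + 2 * v) \<le> 2 * (1 + v)" using \<delta> by simp
  then have "(1 + \<delta> + 2 * v) / ((1 + v) * (v + \<delta>)) \<le> 2 * (1 + v) / ((1 + v) * (v + \<delta>))"
    using pos by (intro divide_right_mono) auto
  also have "\<dots> = 2 / (v + \<delta>)"
    by (metis less_irrefl mult.commute mult_divide_mult_cancel_left pos(1))
  also have "\<dots> \<le> 2 / \<delta>" using v \<delta> by (intro divide_left_mono) auto
  finally have "(1 + \<delta> + 2 * v) / ((1 + v) * (v + \<delta>)) \<le> 2 / \<delta>" .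
  then have "log_rate \<delta> v * ((1 + \<delta> + 2 * v) / ((1 + v) * (v + \<delta>))) \<le> (1 / \<delta>) * (2 / \<delta>)"
    using log_rate_nonneg[OF v] log_rate_le[OF v] v \<delta> by (intro mult_mono) auto
  moreover have "\<bar>log_rate' \<delta> v\<bar> = log_rate \<delta> v * ((1 + \<delta> + 2 * v) / ((1 + v) * (v + \<delta>)))"
    using v \<delta> log_rate_nonneg[OF v] by (simp add: log_rate'_eq abs_mult)
  ultimately show ?thesis by (simp add: power2_eq_square)
qed

lemma continuous_on_log_rate: "continuous_on {0..} (log_rate \<delta>)" "continuous_on {0..} (log_rate' \<delta>)"
proof -
  have "(1 + v) * (v + \<delta>) \<noteq> 0" "1 + v \<noteq> 0" "v + \<delta> \<noteq> 0" if "0 \<le> v" for v using that \<delta> by auto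
  then show "continuous_on {0..} (log_rate \<delta>)" "continuous_on {0..} (log_rate' \<delta>)"
    unfolding log_rate_def[abs_def] log_rate'_def[abs_def] by (auto intro!: continuous_intros)
qed

lemma log_trans_deriv: "0 \<le> v \<Longrightarrow> (log_trans t \<delta> has_real_derivative t * log_rate \<delta> v) (at v)"
proof -
  assume v: "0 \<le> v"
  have pos: "0 < v + \<delta>" "0 < 1 + v" using v \<delta> by auto
  have "((\<lambda>v. t * (ln (v + \<delta>) - ln \<delta> - ln (1 + v))) has_real_derivative t * (1 / (v + \<delta>) - 1 / (1 + v))) (at v)"
    using pos by (auto intro!: derivative_eq_intros)
  moreover have "1 / (v + \<delta>) - 1 / (1 + v) = log_rate \<delta> v"
    using pos by (simp add: log_rate_def field_simps)
  ultimately show ?thesis by (simp add: log_trans_def[abs_def])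
qed

lemma log_trans_0: "log_trans t \<delta> 0 = 0"
  by (simp add: log_trans_def)

lemma log_trans_nonneg: "0 \<le> v \<Longrightarrow> 0 \<le> t \<Longrightarrow> 0 \<le> log_trans t \<delta> v"
proof -
  assume v: "0 \<le> v" and t: "0 \<le> t"
  have "\<delta> * v \<le> 1 * v" using v \<delta> by (intro mult_right_mono) auto
  then have "ln (\<delta> * (1 + v)) \<le> ln (v + \<delta>)" using v \<delta> by (subst ln_le_cancel_iff) (auto simp: algebra_simps intro: add_pos_nonneg)
  then have "0 \<le> ln (v + \<delta>) - ln \<delta> - ln (1 + v)" using v \<delta> by (simp add: ln_mult)
  then show ?thesis using t by (simp add: log_trans_def)
qed

lemma log_trans_le: "0 \<le> v \<Longrightarrow> 0 \<le> t \<Longrightarrow> log_trans t \<delta> v \<le> t * (- ln \<delta>)"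
  unfolding log_trans_def using \<delta> by (intro mult_left_mono) auto

lemma log_trans_expansion:
  assumes "0 \<le> x" "0 \<le> y" "0 \<le> t"
  shows "\<bar>log_trans t \<delta> x - log_trans t \<delta> y - t * log_rate \<delta> y * (x - y)\<bar> \<le> t * (2 / \<delta>\<^sup>2) * (x - y)\<^sup>2"
proof -
  let ?S = "closed_segment y x"
  have S: "0 \<le> w" "\<bar>w - y\<bar> \<le> \<bar>x - y\<bar>" if "w \<in> ?S" for w
    using that assms by (auto simp: closed_segment_eq_real_ivl split: if_splits)
  have "norm ((log_trans t \<delta> x - t * log_rate \<delta> y * x) - (log_trans t \<delta> y - t * log_rate \<delta> y * y)) \<le> (t * (2 / \<delta>\<^sup>2) * \<bar>x - y\<bar>) * norm (x - y)"
  proof (rule field_differentiable_bound[of ?S "\<lambda>w. log_trans t \<delta> w - t * log_rate \<delta> y * w" "\<lambda>w. t * log_rate \<delta> w - t * log_rate \<delta> y"])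
    fix w assume w: "w \<in> ?S"
    have "((\<lambda>w. log_trans t \<delta> w - t * log_rate \<delta> y * w) has_real_derivative t * log_rate \<delta> w - t * log_rate \<delta> y * 1) (at w)"
      by (intro DERIV_diff DERIV_cmult log_trans_deriv S w DERIV_ident)
    then show "((\<lambda>w. log_trans t \<delta> w - t * log_rate \<delta> y * w) has_real_derivative t * log_rate \<delta> w - t * log_rate \<delta> y) (at w within ?S)"
      by (auto intro: has_field_derivative_at_within)
    have "norm (log_rate \<delta> w - log_rate \<delta> y) \<le> (2 / \<delta>\<^sup>2) * norm (w - y)"
      by (rule field_differentiable_bound[of "{0..}" _ "log_rate' \<delta>"])
         (use assms S[OF w] in \<open>auto intro: has_field_derivative_at_within log_rate_deriv abs_log_rate'_le\<close>)
    also have "\<dots> \<le> (2 / \<delta>\<^sup>2) * \<bar>x - y\<bar>" using S[OF w] \<delta> by (intro mult_left_mono) auto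
    finally have "t * norm (log_rate \<delta> w - log_rate \<delta> y) \<le> t * ((2 / \<delta>\<^sup>2) * \<bar>x - y\<bar>)"
      using assms(3) by (rule mult_left_mono)
    moreover have "norm (t * log_rate \<delta> w - t * log_rate \<delta> y) = t * norm (log_rate \<delta> w - log_rate \<delta> y)"
      using assms(3) by (simp add: right_diff_distrib[symmetric] abs_mult)
    ultimately show "norm (t * log_rate \<delta> w - t * log_rate \<delta> y) \<le> t * (2 / \<delta>\<^sup>2) * \<bar>x - y\<bar>"
      by (simp add: mult.assoc)
  qed auto
  moreover have "(log_trans t \<delta> x - t * log_rate \<delta> y * x) - (log_trans t \<delta> y - t * log_rate \<delta> y * y)
    = log_trans t \<delta> x - log_trans t \<delta> y - t * log_rate \<delta> y * (x - y)" by (simp add: right_diff_distrib)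
  moreover have "\<bar>x - y\<bar> * \<bar>x - y\<bar> = (x - y)\<^sup>2" by (simp add: power2_eq_square)
  ultimately show ?thesis by (simp add: mult.assoc)
qed

end

section \<open>Jensen's inequality for squares of finite averages\<close>

lemma weighted_square_le:
  fixes a w :: "'i \<Rightarrow> real"
  assumes "finite p" "\<And>q. q \<in> p \<Longrightarrow> 0 \<le> w q" "(\<Sum>q\<in>p. w q) = 1"
  shows "(\<Sum>q\<in>p. w q * a q)\<^sup>2 \<le> (\<Sum>q\<in>p. w q * (a q)\<^sup>2)"
proof -
  define m where "m = (\<Sum>q\<in>p. w q * a q)"
  have "0 \<le> (\<Sum>q\<in>p. w q * (a q - m)\<^sup>2)" using assms by (intro sum_nonneg) auto
  also have "\<dots> = (\<Sum>q\<in>p. w q * (a q)\<^sup>2 - 2 * m * (w q * a q) + m\<^sup>2 * w q)"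
    by (intro sum.cong) (auto simp: power2_eq_square algebra_simps)
  also have "\<dots> = (\<Sum>q\<in>p. w q * (a q)\<^sup>2) - 2 * m * m + m\<^sup>2 * 1"
    by (simp add: sum.distrib sum_subtractf sum_distrib_left[symmetric] m_def assms(3))
  finally show ?thesis by (simp add: m_def power2_eq_square)
qed

lemma weighted_norm_square_le:
  fixes a :: "'i \<Rightarrow> 'h::real_normed_vector" and w :: "'i \<Rightarrow> real"
  assumes "finite p" "\<And>q. q \<in> p \<Longrightarrow> 0 \<le> w q" "(\<Sum>q\<in>p. w q) = 1"
  shows "(norm (\<Sum>q\<in>p. w q *\<^sub>R a q))\<^sup>2 \<le> (\<Sum>q\<in>p. w q * (norm (a q))\<^sup>2)"
proof -
  have "norm (\<Sum>q\<in>p. w q *\<^sub>R a q) \<le> (\<Sum>q\<in>p. w q * norm (a q))"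
    by (rule order_trans[OF norm_sum]) (auto intro!: sum_mono simp: assms)
  then have "(norm (\<Sum>q\<in>p. w q *\<^sub>R a q))\<^sup>2 \<le> (\<Sum>q\<in>p. w q * norm (a q))\<^sup>2"
    by (intro power_mono) auto
  also have "\<dots> \<le> (\<Sum>q\<in>p. w q * (norm (a q))\<^sup>2)" by (rule weighted_square_le[OF assms])
  finally show ?thesis .
qed

section \<open>The energy inequality at a fixed time\<close>

context perturbed_form
begin

text \<open>The condition |Dh| <= \<zeta> G lets the mixed term with Dh be split into \<zeta>^2
  times the squared gradient of the transform and G^2. Since h = \<zeta>^2 is itself admissible, the
  first of these errors is controlled by the energy inequality itself.\<close>

definition test_pair :: "('a \<Rightarrow> real) \<Rightarrow> ('a \<Rightarrow> real) \<Rightarrow> bool" where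
  "test_pair \<zeta> h \<longleftrightarrow> \<zeta> \<in> Dom \<and> (\<forall>x. 0 \<le> \<zeta> x \<and> \<zeta> x \<le> 1) \<and> h \<in> Dom \<and> (\<forall>x. 0 \<le> h x \<and> h x \<le> (\<zeta> x)\<^sup>2)
    \<and> (\<exists>G. L2 M G \<and> (\<forall>x. 0 \<le> G x) \<and> (AE x in M. norm (D h x) \<le> \<zeta> x * G x))
    \<and> (\<exists>k. AE x in M. x \<notin> E k \<longrightarrow> \<zeta> x = 0)"

lemma test_pair_square:
  assumes "\<zeta> \<in> Dom" "\<And>x. 0 \<le> \<zeta> x" "\<And>x. \<zeta> x \<le> 1" "AE x in M. x \<notin> E k \<longrightarrow> \<zeta> x = 0"
    and g: "g \<in> Dom" "\<And>x. 0 \<le> g x" "\<And>x. g x \<le> 1"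
  shows "test_pair \<zeta> (\<lambda>x. (\<zeta> x)\<^sup>2)" "test_pair \<zeta> (\<lambda>x. (\<zeta> x)\<^sup>2 * g x)"
proof -
  have "AE x in M. \<bar>\<zeta> x\<bar> \<le> 1" using assms by auto
  note sq = dom_square[OF assms(1) this]
  have sq1: "(\<zeta> x)\<^sup>2 \<le> 1" for x using assms(2,3) by (intro power_le_one)
  have N: "L2 M (\<lambda>x. 2 * norm (D \<zeta> x))" by (intro L2_cmult L2H_norm D_L2H assms)
  show "test_pair \<zeta> (\<lambda>x. (\<zeta> x)\<^sup>2)" unfolding test_pair_def
  proof (intro conjI exI[of _ "\<lambda>x. 2 * norm (D \<zeta> x)"])
    show "AE x in M. norm (D (\<lambda>x. (\<zeta> x)\<^sup>2) x) \<le> \<zeta> x * (2 * norm (D \<zeta> x))"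
      using sq(2) by eventually_elim (use assms(2) in simp)
  qed (use assms sq N in auto)
  have a: "AE x in M. \<bar>(\<zeta> x)\<^sup>2\<bar> \<le> 1" "AE x in M. \<bar>g x\<bar> \<le> 1" using sq1 g by auto
  note pr = dom_product[OF sq(1) a(1) g(1) a(2)]
  show "test_pair \<zeta> (\<lambda>x. (\<zeta> x)\<^sup>2 * g x)" unfolding test_pair_def
  proof (intro conjI exI[of _ "\<lambda>x. norm (D g x) + 2 * norm (D \<zeta> x)"] allI)
    show "L2 M (\<lambda>x. norm (D g x) + 2 * norm (D \<zeta> x))" by (intro L2_add N L2H_norm D_L2H g)
    show "AE x in M. norm (D (\<lambda>x. (\<zeta> x)\<^sup>2 * g x) x) \<le> \<zeta> x * (norm (D g x) + 2 * norm (D \<zeta> x))"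
      using pr(2) sq(2)
    proof eventually_elim
      case (elim x)
      have "norm (D (\<lambda>x. (\<zeta> x)\<^sup>2 * g x) x) \<le> (\<zeta> x)\<^sup>2 * norm (D g x) + g x * (2 * \<zeta> x * norm (D \<zeta> x))"
        unfolding elim by (rule order_trans[OF norm_triangle_ineq]) (use assms(2) g(2) in simp)
      also have "\<dots> \<le> \<zeta> x * norm (D g x) + 1 * (2 * \<zeta> x * norm (D \<zeta> x))"
        using assms(2,3)[of x] g(2,3)[of x]
        by (intro add_mono mult_right_mono) (auto simp: power2_eq_square mult_left_le)
      finally show ?case by (simp add: algebra_simps)
    qed
    show "(\<zeta> x)\<^sup>2 * g x \<le> (\<zeta> x)\<^sup>2" for x using g(3)[of x] by (simp add: mult_left_le)
  qed (use assms g pr in auto)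
qed

lemma dom_mult_log_rate:
  assumes \<delta>: "0 < \<delta>" "\<delta> < 1" and h: "h \<in> Dom" "\<And>x. 0 \<le> h x" "\<And>x. h x \<le> 1"
    and v: "v \<in> Dom" "\<And>x. 0 \<le> v x"
  shows "(\<lambda>x. h x * log_rate \<delta> (v x)) \<in> Dom"
    "AE x in M. D (\<lambda>x. h x * log_rate \<delta> (v x)) x = log_rate \<delta> (v x) *\<^sub>R D h x + (h x * log_rate' \<delta> (v x)) *\<^sub>R D v x"
proof -
  \<comment> \<open>The chain rule needs a function vanishing at 0, and the rate does not; its value
    at 0 is restored by adding a multiple of h.\<close>
  define w where "w x = log_rate \<delta> (v x) - log_rate \<delta> 0" for x
  have w: "w \<in> Dom" "AE x in M. D w x = log_rate' \<delta> (v x) *\<^sub>R D v x"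
  proof -
    have d: "((\<lambda>y. log_rate \<delta> y - log_rate \<delta> 0) has_real_derivative log_rate' \<delta> x) (at x)" if "0 \<le> x" for x
      using DERIV_diff[OF log_rate_deriv[OF \<delta> that] DERIV_const[of "log_rate \<delta> 0"]] by simp
    show "w \<in> Dom" "AE x in M. D w x = log_rate' \<delta> (v x) *\<^sub>R D v x"
      using dom_chain_nonneg[OF v d continuous_on_log_rate(2)[OF \<delta>] abs_log_rate'_le[OF \<delta>]]
      by (auto simp: w_def[abs_def])
  qed
  have wb: "AE x in M. \<bar>w x\<bar> \<le> 1 / \<delta>"
  proof (rule AE_I2)
    fix x
    show "\<bar>w x\<bar> \<le> 1 / \<delta>"
      using log_rate_nonneg[OF \<delta> v(2)[of x]] log_rate_le[OF \<delta> v(2)[of x]] log_rate_nonneg[OF \<delta> order_refl] log_rate_le[OF \<delta> order_refl]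
      unfolding w_def by linarith
  qed
  have hb: "AE x in M. \<bar>h x\<bar> \<le> 1" using h by auto
  note pr = dom_product[OF h(1) hb w(1) wb]
  have eq: "(\<lambda>x. h x * log_rate \<delta> (v x)) = (\<lambda>x. 1 * (h x * w x) + log_rate \<delta> 0 * h x)"
    by (auto simp: w_def fun_eq_iff algebra_simps)
  show "(\<lambda>x. h x * log_rate \<delta> (v x)) \<in> Dom" unfolding eq by (intro dom_lin pr h)
  have "AE x in M. D (\<lambda>x. h x * log_rate \<delta> (v x)) x = 1 *\<^sub>R D (\<lambda>x. h x * w x) x + log_rate \<delta> 0 *\<^sub>R D h x"
    unfolding eq by (intro D_lin pr h)
  then show "AE x in M. D (\<lambda>x. h x * log_rate \<delta> (v x)) x = log_rate \<delta> (v x) *\<^sub>R D h x + (h x * log_rate' \<delta> (v x)) *\<^sub>R D v x"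
    using pr(2) w(2)
  proof eventually_elim
    case (elim x)
    show ?case unfolding elim by (simp add: w_def scaleR_diff_left)
  qed
qed

text \<open>The integrand of t^2 Ef(v, h R(v)) at one point, with p = t R |Dv| the gradient norm of
  the transform. The part with R' paired with Dv itself gives -H p^2/2. Every other term keeps a
  spare factor t, either because only one t is consumed in forming p, or because v R <= 1 removes
  the rate and t^2 <= t.\<close>

lemma energy_pointwise:
  fixes Dv Dh bb cc :: 'h and v H Z G t VV \<delta> :: real
  defines "R \<equiv> log_rate \<delta> v" and "R' \<equiv> log_rate' \<delta> v"
  defines "Dg \<equiv> R *\<^sub>R Dh + (H * R') *\<^sub>R Dv" and "p \<equiv> t * log_rate \<delta> v * norm Dv"
  assumes \<delta>: "0 < \<delta>" "\<delta> < 1" and v: "0 \<le> v" and t: "0 < t" "t \<le> 1" and Z: "0 \<le> Z" "Z \<le> 1"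
    and H: "0 \<le> H" "H \<le> Z\<^sup>2" and G: "0 \<le> G" "norm Dh \<le> Z * G"
  shows "t\<^sup>2 * ((1/2) * inner Dv Dg + (inner bb Dv * (H * R) + inner cc Dg * v + VV * v * (H * R)))
    \<le> - (1/2) * (H * p\<^sup>2) + t * (Z\<^sup>2 * p\<^sup>2 + ((1/2) * G + norm bb + 2 * norm cc)\<^sup>2 + (norm cc * G + \<bar>VV\<bar>))"
proof -
  have R0: "0 \<le> R" unfolding R_def by (rule log_rate_nonneg[OF \<delta> v])
  have R'le: "R' \<le> - R\<^sup>2" unfolding R_def R'_def by (rule log_rate'_le[OF \<delta> v])
  have vR: "v * R \<le> 1" "0 \<le> v * R" using mult_log_rate_le[OF \<delta> v] v R0 by (auto simp: R_def)
  have vR': "v * \<bar>R'\<bar> \<le> 2 * R" unfolding R_def R'_def by (rule mult_log_rate'_le[OF \<delta> v])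
  have pe: "p = t * (R * norm Dv)" using t R0 by (auto simp: p_def R_def)
  have "Z\<^sup>2 \<le> Z * 1" unfolding power2_eq_square using Z by (intro mult_left_mono) auto
  then have HZ: "H \<le> Z" using H by simp
  have t2: "t\<^sup>2 \<le> t" unfolding power2_eq_square using t by (simp add: mult_left_le)
  have T1: "t\<^sup>2 * ((1/2) * inner Dv Dg) \<le> t * (Z * p) * ((1/2) * G) - (1/2) * (H * p\<^sup>2)"
  proof -
    have "inner Dv Dh \<le> norm Dv * (Z * G)"
      using norm_cauchy_schwarz[of Dv Dh] G(2) mult_left_mono[OF G(2), of "norm Dv"] by simp
    then have "R * inner Dv Dh \<le> R * (norm Dv * (Z * G))" using R0 by (rule mult_left_mono)
    moreover have "H * R' * (norm Dv)\<^sup>2 \<le> H * (- R\<^sup>2) * (norm Dv)\<^sup>2"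
      using R'le H by (intro mult_right_mono mult_left_mono) auto
    moreover have "inner Dv Dg = R * inner Dv Dh + H * R' * (norm Dv)\<^sup>2"
      by (simp add: Dg_def inner_add_right power2_norm_eq_inner)
    ultimately have "inner Dv Dg \<le> R * (norm Dv * (Z * G)) + H * (- R\<^sup>2) * (norm Dv)\<^sup>2" by linarith
    then have "t\<^sup>2 * ((1/2) * inner Dv Dg) \<le> t\<^sup>2 * ((1/2) * (R * (norm Dv * (Z * G)) + H * (- R\<^sup>2) * (norm Dv)\<^sup>2))"
      by (intro mult_left_mono) auto
    also have "\<dots> = t * (Z * p) * ((1/2) * G) - (1/2) * (H * p\<^sup>2)"
      by (simp add: pe power2_eq_square algebra_simps)
    finally show ?thesis .
  qed
  have T2: "t\<^sup>2 * (inner bb Dv * (H * R)) \<le> t * (Z * p) * norm bb"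
  proof -
    have "inner bb Dv * (H * R) \<le> (norm bb * norm Dv) * (Z * R)"
      using norm_cauchy_schwarz[of bb Dv] HZ H R0 Z by (intro mult_mono) auto
    then have "t\<^sup>2 * (inner bb Dv * (H * R)) \<le> t\<^sup>2 * ((norm bb * norm Dv) * (Z * R))" by (intro mult_left_mono) auto
    also have "\<dots> = t * (Z * p) * norm bb" by (simp add: pe power2_eq_square algebra_simps)
    finally show ?thesis .
  qed
  have T3: "t\<^sup>2 * (inner cc Dg * v) \<le> t * (norm cc * G) + t * (Z * p) * (2 * norm cc)"
  proof -
    have a: "v * R * inner cc Dh \<le> 1 * (norm cc * G)"
    proof -
      have "norm Dh \<le> 1 * G" using G Z by (intro order_trans[OF G(2)] mult_right_mono)
      then have "norm cc * norm Dh \<le> norm cc * G" by (intro mult_left_mono) auto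
      then have "inner cc Dh \<le> norm cc * G" using norm_cauchy_schwarz[of cc Dh] by simp
      then have "v * R * inner cc Dh \<le> v * R * (norm cc * G)" using vR(2) by (rule mult_left_mono)
      also have "\<dots> \<le> 1 * (norm cc * G)" using vR(1) G by (intro mult_right_mono) auto
      finally show ?thesis .
    qed
    have b: "v * (H * R') * inner cc Dv \<le> Z * (2 * R) * (norm cc * norm Dv)"
    proof -
      have "v * (H * R') * inner cc Dv \<le> \<bar>v * (H * R') * inner cc Dv\<bar>" by simp
      also have "\<dots> = H * (v * \<bar>R'\<bar>) * \<bar>inner cc Dv\<bar>" using H v by (simp add: abs_mult ac_simps)
      also have "\<dots> \<le> Z * (2 * R) * (norm cc * norm Dv)"
        by (rule mult_mono[OF mult_mono[OF HZ vR'] Cauchy_Schwarz_ineq2]) (use v Z R0 in auto)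
      finally show ?thesis .
    qed
    have "inner cc Dg * v = v * R * inner cc Dh + v * (H * R') * inner cc Dv"
      by (simp add: Dg_def inner_add_right algebra_simps)
    also have "\<dots> \<le> norm cc * G + Z * (2 * R) * (norm cc * norm Dv)" using a b by simp
    finally have "t\<^sup>2 * (inner cc Dg * v) \<le> t\<^sup>2 * (norm cc * G + Z * (2 * R) * (norm cc * norm Dv))" by (intro mult_left_mono) auto
    also have "\<dots> = t\<^sup>2 * (norm cc * G) + t * (Z * p) * (2 * norm cc)"
      by (simp add: pe power2_eq_square algebra_simps)
    also have "\<dots> \<le> t * (norm cc * G) + t * (Z * p) * (2 * norm cc)"
      using t2 G by (intro add_right_mono mult_right_mono) auto
    finally show ?thesis .
  qed
  have T4: "t\<^sup>2 * (VV * v * (H * R)) \<le> t * \<bar>VV\<bar>"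
  proof -
    have "VV * v * (H * R) \<le> \<bar>VV\<bar> * (H * (v * R))"
    proof -
      have "VV * v * (H * R) = VV * (H * (v * R))" by simp
      also have "\<dots> \<le> \<bar>VV\<bar> * (H * (v * R))" using H vR by (intro mult_right_mono) auto
      finally show ?thesis .
    qed
    also have "\<dots> \<le> \<bar>VV\<bar> * (1 * 1)" using H HZ Z vR by (intro mult_left_mono mult_mono) auto
    finally have "t\<^sup>2 * (VV * v * (H * R)) \<le> t\<^sup>2 * \<bar>VV\<bar>" by (intro mult_left_mono) auto
    also have "\<dots> \<le> t * \<bar>VV\<bar>" using t2 by (intro mult_right_mono) auto
    finally show ?thesis .
  qed
  \<comment> \<open>\<beta> collects the coefficients of t Z p; Young's inequality turns the product
    into Z^2 p^2 plus \<beta>^2.\<close>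
  define \<beta> where "\<beta> = (1/2) * G + norm bb + 2 * norm cc"
  have "(Z * p) * \<beta> \<le> (Z * p)\<^sup>2 + \<beta>\<^sup>2"
  proof -
    have "2 * (Z * p) * \<beta> \<le> (Z * p)\<^sup>2 + \<beta>\<^sup>2" by (rule sum_squares_bound)
    moreover have "0 \<le> (Z * p)\<^sup>2 + \<beta>\<^sup>2" by simp
    ultimately show ?thesis unfolding mult.assoc by linarith
  qed
  then have "t * ((Z * p) * \<beta>) \<le> t * ((Z * p)\<^sup>2 + \<beta>\<^sup>2)" using t by (intro mult_left_mono) auto
  moreover have "t * ((Z * p) * \<beta>) = t * (Z * p) * ((1/2) * G) + t * (Z * p) * norm bb + t * (Z * p) * (2 * norm cc)"
    by (simp add: \<beta>_def algebra_simps)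
  ultimately have "t\<^sup>2 * ((1/2) * inner Dv Dg) + t\<^sup>2 * (inner bb Dv * (H * R)) + t\<^sup>2 * (inner cc Dg * v) + t\<^sup>2 * (VV * v * (H * R))
    \<le> - (1/2) * (H * p\<^sup>2) + t * ((Z * p)\<^sup>2 + \<beta>\<^sup>2) + t * (norm cc * G) + t * \<bar>VV\<bar>"
    using T1 T2 T3 T4 by linarith
  then show ?thesis by (simp add: \<beta>_def power_mult_distrib algebra_simps)
qed

text \<open>\<open>energy_pointwise\<close>, integrated. The point is that \<open>C\<close> depends
  on the test pair alone and not on v, t or \<delta>, so it survives averaging over times and
  letting t tend to 0.\<close>

lemma energy_inequality:
  assumes tp: "test_pair \<zeta> h"
  shows "\<exists>C\<ge>0. \<forall>v t \<delta>. v \<in> Dom \<longrightarrow> (\<forall>x. 0 \<le> v x) \<longrightarrow> 0 < t \<longrightarrow> t \<le> 1 \<longrightarrow> 0 < \<delta> \<longrightarrow> \<delta> < 1 \<longrightarrow>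
    t\<^sup>2 * Ef v (\<lambda>x. h x * log_rate \<delta> (v x)) \<le> - (1/2) * (\<integral>x. h x * (t * log_rate \<delta> (v x) * norm (D v x))\<^sup>2 \<partial>M)
      + t * C * (1 + (\<integral>x. (\<zeta> x)\<^sup>2 * (t * log_rate \<delta> (v x) * norm (D v x))\<^sup>2 \<partial>M))"
proof -
  from tp obtain G k where \<zeta>: "\<zeta> \<in> Dom" "\<And>x. 0 \<le> \<zeta> x" "\<And>x. \<zeta> x \<le> 1"
    and h: "h \<in> Dom" "\<And>x. 0 \<le> h x" "\<And>x. h x \<le> (\<zeta> x)\<^sup>2"
    and G: "L2 M G" "\<And>x. 0 \<le> G x" "AE x in M. norm (D h x) \<le> \<zeta> x * G x"
    and k: "AE x in M. x \<notin> E k \<longrightarrow> \<zeta> x = 0" unfolding test_pair_def by auto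
  have h1: "h x \<le> 1" for x using h(3)[of x] \<zeta>(2,3)[of x] power_le_one[of "\<zeta> x" 2] by linarith
  \<comment> \<open>Restricting b, c, V to the member of the nest that carries \<zeta> makes \<beta>
    square integrable and \<gamma> integrable.\<close>
  define I where "I x = (indicator (E k) x :: real)" for x
  define \<beta> where "\<beta> x = (1/2) * G x + norm (I x *\<^sub>R b x) + 2 * norm (I x *\<^sub>R c x)" for x
  define \<gamma> where "\<gamma> x = norm (I x *\<^sub>R c x) * G x + \<bar>I x * V x\<bar>" for x
  have \<beta>: "L2 M \<beta>" unfolding \<beta>_def[abs_def] I_def by (intro L2_add L2_cmult L2H_norm coeff_L2 G)
  have \<gamma>: "integrable M \<gamma>" unfolding \<gamma>_def[abs_def] I_def
    by (intro Bochner_Integration.integrable_add L2_product_integrable L2H_norm coeff_L2 G integrable_abs)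
  have \<gamma>0: "0 \<le> \<gamma> x" for x using G(2) by (simp add: \<gamma>_def)
  define C where "C = 1 + (\<integral>x. (\<beta> x)\<^sup>2 \<partial>M) + (\<integral>x. \<gamma> x \<partial>M)"
  have ints: "0 \<le> (\<integral>x. (\<beta> x)\<^sup>2 \<partial>M)" "0 \<le> (\<integral>x. \<gamma> x \<partial>M)" using \<gamma>0 by auto
  then have C: "1 \<le> C" by (simp add: C_def)
  have "t\<^sup>2 * Ef v (\<lambda>x. h x * log_rate \<delta> (v x)) \<le> - (1/2) * (\<integral>x. h x * (t * log_rate \<delta> (v x) * norm (D v x))\<^sup>2 \<partial>M)
      + t * C * (1 + (\<integral>x. (\<zeta> x)\<^sup>2 * (t * log_rate \<delta> (v x) * norm (D v x))\<^sup>2 \<partial>M))"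
    if v: "v \<in> Dom" "\<And>x. 0 \<le> v x" and t: "0 < t" "t \<le> 1" and \<delta>: "0 < \<delta>" "\<delta> < 1" for v t \<delta>
  proof -
    define g where "g x = h x * log_rate \<delta> (v x)" for x
    have gd: "g \<in> Dom" "AE x in M. D g x = log_rate \<delta> (v x) *\<^sub>R D h x + (h x * log_rate' \<delta> (v x)) *\<^sub>R D v x"
      using dom_mult_log_rate[OF \<delta> h(1,2) h1 v] by (simp_all add: g_def[abs_def])
    have [measurable]: "v \<in> borel_measurable M" "D v \<in> borel_measurable M" "h \<in> borel_measurable M" "D h \<in> borel_measurable M"
      "\<zeta> \<in> borel_measurable M" "g \<in> borel_measurable M" "D g \<in> borel_measurable M" "G \<in> borel_measurable M"
      using v h \<zeta> gd G by (auto intro: dom_measurable D_measurable L2_measurable)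
    have [measurable]: "(\<lambda>x. log_rate \<delta> (v x)) \<in> borel_measurable M" unfolding log_rate_def by measurable
    have k0: "AE x in M. x \<notin> E k \<longrightarrow> h x = 0"
      using k
    proof eventually_elim
      case (elim x) then show ?case using h(2,3)[of x] by (auto intro: antisym)
    qed
    have gb: "\<bar>g x\<bar> \<le> 1 / \<delta>" for x
      unfolding g_def abs_mult using h(2)[of x] h1[of x] log_rate_nonneg[OF \<delta> v(2)[of x]] log_rate_le[OF \<delta> v(2)[of x]]
      using mult_mono[of "\<bar>h x\<bar>" 1 "\<bar>log_rate \<delta> (v x)\<bar>" "1/\<delta>"] by simp
    have gA: "g \<in> DAb M Dom (E k)"
      using gd(1) gb k0 by (auto simp: DAb_def DA_def g_def elim!: eventually_mono)
    define p where "p x = t * log_rate \<delta> (v x) * norm (D v x)" for x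
    have rL: "L2 M (\<lambda>x. log_rate \<delta> (v x) * norm (D v x))"
    proof (rule L2_mult[where C="1/\<delta>"])
      show "AE x in M. \<bar>log_rate \<delta> (v x)\<bar> \<le> 1 / \<delta>"
        using log_rate_nonneg[OF \<delta> v(2)] log_rate_le[OF \<delta> v(2)] by auto
    qed (auto intro: L2H_norm D_L2H v)
    have pL: "L2 M p" unfolding p_def[abs_def] using L2_cmult[OF rL, of t] by (simp add: mult.assoc)
    \<comment> \<open>This prepares the integrability hypothesis on c in \<open>Ef_formula\<close>:
      v |Dg| has a square integrable bound living on \<open>E k\<close>, although v itself may be
      unbounded.\<close>
    have bound_Dg: "AE x in M. norm (D g x) * v x \<le> I x * (G x + 2 * (log_rate \<delta> (v x) * norm (D v x)))"
      using gd(2) G(3) k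
    proof eventually_elim
      case (elim x)
      have R0: "0 \<le> log_rate \<delta> (v x)" by (rule log_rate_nonneg[OF \<delta> v(2)])
      have "norm (D g x) \<le> log_rate \<delta> (v x) * norm (D h x) + h x * \<bar>log_rate' \<delta> (v x)\<bar> * norm (D v x)"
        unfolding elim(1) by (rule order_trans[OF norm_triangle_ineq]) (use R0 h(2)[of x] in \<open>simp add: abs_mult\<close>)
      then have "norm (D g x) * v x \<le> (log_rate \<delta> (v x) * norm (D h x) + h x * \<bar>log_rate' \<delta> (v x)\<bar> * norm (D v x)) * v x"
        using v(2) by (rule mult_right_mono)
      also have "\<dots> = (v x * log_rate \<delta> (v x)) * norm (D h x) + h x * (v x * \<bar>log_rate' \<delta> (v x)\<bar>) * norm (D v x)"
        by (simp add: algebra_simps)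
      also have "\<dots> \<le> 1 * (\<zeta> x * G x) + h x * (2 * log_rate \<delta> (v x)) * norm (D v x)"
        by (rule add_mono[OF mult_mono[OF mult_log_rate_le[OF \<delta> v(2)] elim(2)]
              mult_right_mono[OF mult_left_mono[OF mult_log_rate'_le[OF \<delta> v(2)] h(2)]]]) auto
      also have "\<dots> \<le> I x * (G x + 2 * (log_rate \<delta> (v x) * norm (D v x)))"
      proof (cases "x \<in> E k")
        case True
        have "\<zeta> x * G x \<le> 1 * G x" using \<zeta>(3) G(2) by (intro mult_right_mono)
        moreover have "h x * (2 * log_rate \<delta> (v x)) * norm (D v x) \<le> 1 * (2 * log_rate \<delta> (v x)) * norm (D v x)"
          using h1 R0 by (intro mult_right_mono) auto
        ultimately show ?thesis using True by (simp add: I_def)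
      next
        case False
        then have "\<zeta> x = 0" using elim(3) by simp
        moreover from this have "h x = 0" using h(2,3)[of x] by auto
        ultimately show ?thesis using False by (simp add: I_def)
      qed
      finally show ?case .
    qed
    have ic: "integrable M (\<lambda>x. norm (c x) * norm (D g x) * v x)"
    proof (rule Bochner_Integration.integrable_bound[where f="\<lambda>x. norm (I x *\<^sub>R c x) * (G x + 2 * (log_rate \<delta> (v x) * norm (D v x)))"])
      show "integrable M (\<lambda>x. norm (I x *\<^sub>R c x) * (G x + 2 * (log_rate \<delta> (v x) * norm (D v x))))"
        unfolding I_def by (intro L2_product_integrable L2H_norm coeff_L2 L2_add G L2_cmult rL)
      show "AE x in M. norm (norm (c x) * norm (D g x) * v x) \<le> norm (norm (I x *\<^sub>R c x) * (G x + 2 * (log_rate \<delta> (v x) * norm (D v x))))"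
        using bound_Dg
      proof eventually_elim
        case (elim x)
        have "norm (c x) * (norm (D g x) * v x) \<le> norm (c x) * (I x * (G x + 2 * (log_rate \<delta> (v x) * norm (D v x))))"
          using elim by (intro mult_left_mono) auto
        then show ?case using v(2)[of x] G(2)[of x] log_rate_nonneg[OF \<delta> v(2)[of x]]
          by (simp add: abs_mult I_def ac_simps)
      qed
    qed measurable
    have iV: "integrable M (\<lambda>x. \<bar>V x\<bar> * \<bar>g x\<bar> * v x)"
    proof (rule Bochner_Integration.integrable_bound[OF coeff_L2(3)[of k]])
      show "AE x in M. norm (\<bar>V x\<bar> * \<bar>g x\<bar> * v x) \<le> norm (indicator (E k) x * V x)"
        using k0
      proof eventually_elim
        case (elim x)
        have R0: "0 \<le> log_rate \<delta> (v x)" by (rule log_rate_nonneg[OF \<delta> v(2)])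
        have "\<bar>g x\<bar> * v x = h x * (v x * log_rate \<delta> (v x))" using h(2)[of x] R0 by (simp add: g_def abs_mult ac_simps)
        also have "\<dots> \<le> 1 * 1" using h(2)[of x] h1[of x] R0 v(2)[of x] mult_log_rate_le[OF \<delta> v(2)[of x]] by (intro mult_mono) auto
        finally have "\<bar>V x\<bar> * (\<bar>g x\<bar> * v x) \<le> \<bar>V x\<bar> * 1" by (intro mult_left_mono) auto
        then show ?case using elim v(2)[of x] by (cases "x \<in> E k") (auto simp: abs_mult ac_simps g_def)
      qed
    qed measurable
    note F = Ef_formula[OF v gA ic iV]
    let ?L = "\<lambda>x. (1/2) * inner (D v x) (D g x) + (inner (b x) (D v x) * g x + inner (c x) (D g x) * v x + V x * v x * g x)"
    have Li: "integrable M ?L"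
      by (intro Bochner_Integration.integrable_add[OF _ F(2)] integrable_mult_right L2H_inner_integrable D_L2H v gd)
    have "Ef v g = (\<integral>x. ?L x \<partial>M)"
      using F(1) Bochner_Integration.integral_add[OF integrable_mult_right[OF L2H_inner_integrable[OF D_L2H[OF v(1)] D_L2H[OF gd(1)]], of "1/2"] F(2)]
      by (simp add: E0_def bform_def)
    then have e1: "t\<^sup>2 * Ef v g = (\<integral>x. t\<^sup>2 * ?L x \<partial>M)" by simp
    have hp: "integrable M (\<lambda>x. h x * (p x)\<^sup>2)"
      by (rule Bochner_Integration.integrable_bound[OF L2_square_integrable[OF pL]])
         (use pL h(2) h1 in \<open>auto simp: L2_def abs_mult mult_right_le_one_le mult_left_le_one_le\<close>)
    have zp: "integrable M (\<lambda>x. (\<zeta> x)\<^sup>2 * (p x)\<^sup>2)"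
      by (rule Bochner_Integration.integrable_bound[OF L2_square_integrable[OF pL]])
         (use pL \<zeta>(2,3) in \<open>auto simp: L2_def abs_mult power_le_one mult_left_le_one_le\<close>)
    have "(\<integral>x. t\<^sup>2 * ?L x \<partial>M) \<le> (\<integral>x. - (1/2) * (h x * (p x)\<^sup>2) + t * ((\<zeta> x)\<^sup>2 * (p x)\<^sup>2 + (\<beta> x)\<^sup>2 + \<gamma> x) \<partial>M)"
    proof (rule integral_mono_AE)
      show "integrable M (\<lambda>x. t\<^sup>2 * ?L x)" using Li by (rule integrable_mult_right)
      show "integrable M (\<lambda>x. - (1/2) * (h x * (p x)\<^sup>2) + t * ((\<zeta> x)\<^sup>2 * (p x)\<^sup>2 + (\<beta> x)\<^sup>2 + \<gamma> x))"
        by (intro Bochner_Integration.integrable_add integrable_mult_right hp zp L2_square_integrable \<beta> \<gamma>)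
      show "AE x in M. t\<^sup>2 * ?L x \<le> - (1/2) * (h x * (p x)\<^sup>2) + t * ((\<zeta> x)\<^sup>2 * (p x)\<^sup>2 + (\<beta> x)\<^sup>2 + \<gamma> x)"
        using gd(2) G(3) k
      proof eventually_elim
        case (elim x)
        show ?case
        proof (cases "x \<in> E k")
          case True
          show ?thesis
            using energy_pointwise[OF \<delta> v(2)[of x] t \<zeta>(2)[of x] \<zeta>(3)[of x] h(2)[of x] h(3)[of x] G(2)[of x] elim(2), of "D v x" "b x" "c x" "V x"]
            using True by (simp add: elim(1) g_def p_def \<beta>_def \<gamma>_def I_def)
        next
          case False
          then have z: "\<zeta> x = 0" using elim(3) by simp
          then have h0: "h x = 0" using h(2,3)[of x] by auto
          have "D h x = 0" using elim(2) z by simp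
          then have "D g x = 0" using elim(1) h0 by simp
          then show ?thesis using z h0 \<gamma>0[of x] t by (simp add: g_def)
        qed
      qed
    qed
    also have "\<dots> = - (1/2) * (\<integral>x. h x * (p x)\<^sup>2 \<partial>M) + t * ((\<integral>x. (\<zeta> x)\<^sup>2 * (p x)\<^sup>2 \<partial>M) + (\<integral>x. (\<beta> x)\<^sup>2 \<partial>M) + (\<integral>x. \<gamma> x \<partial>M))"
      using hp zp L2_square_integrable[OF \<beta>] \<gamma> by simp
    also have "\<dots> \<le> - (1/2) * (\<integral>x. h x * (p x)\<^sup>2 \<partial>M) + t * (C * (1 + (\<integral>x. (\<zeta> x)\<^sup>2 * (p x)\<^sup>2 \<partial>M)))"
    proof -
      have "0 \<le> (\<integral>x. (\<zeta> x)\<^sup>2 * (p x)\<^sup>2 \<partial>M)" by simp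
      then have "1 * (\<integral>x. (\<zeta> x)\<^sup>2 * (p x)\<^sup>2 \<partial>M) \<le> C * (\<integral>x. (\<zeta> x)\<^sup>2 * (p x)\<^sup>2 \<partial>M)"
        using C by (intro mult_right_mono) auto
      then show ?thesis using t ints by (intro add_left_mono mult_left_mono) (auto simp: C_def algebra_simps)
    qed
    finally have fin: "t\<^sup>2 * Ef v g \<le> - (1/2) * (\<integral>x. h x * (p x)\<^sup>2 \<partial>M) + t * (C * (1 + (\<integral>x. (\<zeta> x)\<^sup>2 * (p x)\<^sup>2 \<partial>M)))"
      unfolding e1 .
    have "g = (\<lambda>x. h x * log_rate \<delta> (v x))" by (simp add: g_def fun_eq_iff)
    with fin show ?thesis by (simp only: p_def mult.assoc)
  qed
  then show ?thesis using C by (intro exI[of _ C]) auto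
qed

end

section \<open>Averaging the energy inequality in time\<close>

text \<open>The flow is fixed as a nonnegative version \<open>v\<close> of the semigroup applied to
  the indicator of B and is described only through the properties supplied by
  \<open>heat_flow_nonneg\<close>.\<close>

locale heat_flow = perturbed_form M Dom D b c V E Ef
  for M :: "'a measure" and Dom :: "('a \<Rightarrow> real) set"
    and D :: "('a \<Rightarrow> real) \<Rightarrow> 'a \<Rightarrow> 'h::{real_inner, complete_space, second_countable_topology}"
    and b c :: "'a \<Rightarrow> 'h" and V :: "'a \<Rightarrow> real" and E :: "nat \<Rightarrow> 'a set"
    and Ef :: "('a \<Rightarrow> real) \<Rightarrow> ('a \<Rightarrow> real) \<Rightarrow> real" +
  fixes v v' :: "real \<Rightarrow> 'a \<Rightarrow> real" and B :: "'a set"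
  assumes B: "B \<in> B0 M"
    and v_init: "((\<lambda>s. \<integral>x. (v s x - indicator B x)\<^sup>2 \<partial>M) \<longlongrightarrow> 0) (at_right 0)"
    and v_dom: "\<And>s. 0 < s \<Longrightarrow> v s \<in> Dom"
    and v_nonneg: "\<And>s x. 0 < s \<Longrightarrow> 0 \<le> v s x"
    and v'_L2: "\<And>s. 0 < s \<Longrightarrow> L2 M (v' s)"
    and v_weak: "\<And>s g. 0 < s \<Longrightarrow> g \<in> Dom \<Longrightarrow> (\<integral>x. v' s x * g x \<partial>M) = - Ef (v s) g"
    and v_increment: "\<And>s e. 0 < s \<Longrightarrow> 0 < e \<Longrightarrow> \<exists>d>0. \<forall>r. \<bar>r - s\<bar> < d \<longrightarrow> 0 < r \<and>
      (\<integral>x. (v r x - v s x - (r - s) * v' s x)\<^sup>2 \<partial>M) \<le> e\<^sup>2 * (r - s)\<^sup>2"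
begin

definition lv :: "real \<Rightarrow> real \<Rightarrow> real \<Rightarrow> 'a \<Rightarrow> real" where
  "lv t \<delta> s x = log_trans t \<delta> (v s x)"

lemma lv_dom:
  assumes "0 < t" "0 < \<delta>" "\<delta> < 1" "0 < s"
  shows "lv t \<delta> s \<in> Dom" "AE x in M. D (lv t \<delta> s) x = (t * log_rate \<delta> (v s x)) *\<^sub>R D (v s) x"
proof -
  note d = assms(2,3)
  have c: "continuous_on {0..} (\<lambda>y. t * log_rate \<delta> y)"
    by (intro continuous_intros continuous_on_log_rate d)
  have bd: "\<bar>t * log_rate \<delta> y\<bar> \<le> t * (1 / \<delta>)" if "0 \<le> y" for y
    using log_rate_nonneg[OF d that] mult_left_mono[OF log_rate_le[OF d that], of t] assms(1) by (simp add: abs_mult)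
  show "lv t \<delta> s \<in> Dom" "AE x in M. D (lv t \<delta> s) x = (t * log_rate \<delta> (v s x)) *\<^sub>R D (v s) x"
    using dom_chain_nonneg[OF v_dom[OF assms(4)] v_nonneg[OF assms(4)] log_trans_deriv[OF d] c bd log_trans_0[OF d]]
    by (auto simp: lv_def[abs_def])
qed

lemma lv_range:
  assumes "0 < t" "0 < \<delta>" "\<delta> < 1" "0 < s"
  shows "0 \<le> lv t \<delta> s x" "lv t \<delta> s x \<le> t * (- ln \<delta>)"
  using log_trans_nonneg[OF assms(2,3) v_nonneg[OF assms(4)], of t x] log_trans_le[OF assms(2,3) v_nonneg[OF assms(4)], of t x] assms(1)
  by (auto simp: lv_def)

text \<open>By the weak equation the tested transform has time derivative -t Ef(v s, h R(v s)). One
  radius d serves all test functions h at once, with an error proportional to 1 plus the squared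
  norm of h, because the partition of time built below must not depend on h.\<close>

lemma lv_increment:
  assumes t: "0 < t" "t \<le> 1" and \<delta>: "0 < \<delta>" "\<delta> < 1" and s: "0 < s" and e: "0 < e" "e \<le> 1"
  shows "\<exists>d>0. \<forall>r. \<bar>r - s\<bar> < d \<longrightarrow> 0 < r \<and> (\<forall>h\<in>Dom. (\<forall>x. 0 \<le> h x \<and> h x \<le> 1) \<longrightarrow>
    \<bar>(\<integral>x. lv t \<delta> r x * h x \<partial>M) - (\<integral>x. lv t \<delta> s x * h x \<partial>M) + (r - s) * (t * Ef (v s) (\<lambda>x. h x * log_rate \<delta> (v s x)))\<bar>
      \<le> e * \<bar>r - s\<bar> * (1 + (\<integral>x. (h x)\<^sup>2 \<partial>M)))"
proof -
  \<comment> \<open>Q times 1 plus the integral of h^2 dominates 1 + 2/\<delta>^2 plus the integral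
    of P^2. Dividing the tolerance by Q is harmless because \<delta> is fixed.\<close>
  define Q where "Q = 1 + 3 / \<delta>\<^sup>2"
  have Q: "1 \<le> Q" using \<delta> by (simp add: Q_def)
  define e0 where "e0 = e / Q"
  have e0: "0 < e0" "e0 \<le> 1" "e0 * Q = e" using e Q by (auto simp: e0_def)
  define A where "A = (\<integral>x. (v' s x)\<^sup>2 \<partial>M) + 1"
  have A: "0 < A" unfolding A_def by (intro add_nonneg_pos) auto
  from v_increment[OF s e0(1)] obtain d0 where d0: "0 < d0" "\<And>r. \<bar>r - s\<bar> < d0 \<Longrightarrow> 0 < r"
    "\<And>r. \<bar>r - s\<bar> < d0 \<Longrightarrow> (\<integral>x. (v r x - v s x - (r - s) * v' s x)\<^sup>2 \<partial>M) \<le> e0\<^sup>2 * (r - s)\<^sup>2" by blast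
  show ?thesis
  proof (intro exI[of _ "min d0 (e0 / (2 * A))"] conjI allI impI ballI)
    show "0 < min d0 (e0 / (2 * A))" using d0(1) e0 A by simp
    fix r assume rr: "\<bar>r - s\<bar> < min d0 (e0 / (2 * A))"
    then have rd: "\<bar>r - s\<bar> < d0" by simp
    show r: "0 < r" by (rule d0(2)[OF rd])
    fix h assume h: "h \<in> Dom" "\<forall>x. 0 \<le> h x \<and> h x \<le> 1"
    define P where "P x = (t * log_rate \<delta> (v s x)) * h x" for x
    have R: "0 \<le> log_rate \<delta> (v s x)" "log_rate \<delta> (v s x) \<le> 1 / \<delta>" for x
      using log_rate_nonneg[OF \<delta> v_nonneg[OF s]] log_rate_le[OF \<delta> v_nonneg[OF s]] by auto
    have tR: "\<bar>t * log_rate \<delta> (v s x)\<bar> \<le> 1 / \<delta>" for x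
      using mult_mono[OF t(2) R(2)[of x]] t R(1)[of x] by (simp add: abs_mult)
    have [measurable]: "v s \<in> borel_measurable M" "v r \<in> borel_measurable M" "h \<in> borel_measurable M"
      "lv t \<delta> r \<in> borel_measurable M" "lv t \<delta> s \<in> borel_measurable M"
      using v_dom[OF s] v_dom[OF r] h(1) lv_dom(1)[OF t(1) \<delta> s] lv_dom(1)[OF t(1) \<delta> r] by (auto intro: dom_measurable)
    have PL: "L2 M P" unfolding P_def[abs_def]
    proof (rule L2_mult[OF dom_L2[OF h(1)]])
      show "(\<lambda>x. t * log_rate \<delta> (v s x)) \<in> borel_measurable M" unfolding log_rate_def by measurable
      show "AE x in M. \<bar>t * log_rate \<delta> (v s x)\<bar> \<le> 1 / \<delta>" using tR by simp
    qed
    have P2: "(\<integral>x. (P x)\<^sup>2 \<partial>M) \<le> (1 / \<delta>\<^sup>2) * (\<integral>x. (h x)\<^sup>2 \<partial>M)"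
    proof -
      have "(\<integral>x. (P x)\<^sup>2 \<partial>M) \<le> (\<integral>x. (1 / \<delta>\<^sup>2) * (h x)\<^sup>2 \<partial>M)"
      proof (rule integral_mono)
        fix x
        have "(t * log_rate \<delta> (v s x))\<^sup>2 \<le> (1 / \<delta>)\<^sup>2" using tR[of x] \<delta> by (simp add: abs_le_square_iff[symmetric])
        then show "(P x)\<^sup>2 \<le> (1 / \<delta>\<^sup>2) * (h x)\<^sup>2"
          unfolding P_def power_mult_distrib[of _ "h x"] by (intro mult_right_mono) (auto simp: power_divide)
      qed (use PL dom_square_integrable[OF h(1)] in \<open>auto simp: L2_def\<close>)
      then show ?thesis by simp
    qed
    have "\<bar>(\<integral>x. (lv t \<delta> r x - lv t \<delta> s x) * h x \<partial>M) - (r - s) * (\<integral>x. P x * v' s x \<partial>M)\<bar> \<le> e0 * \<bar>r - s\<bar> * (1 + 2 / \<delta>\<^sup>2 + (\<integral>x. (P x)\<^sup>2 \<partial>M))"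
    proof (rule functional_increment(2)[where a="v r" and a0 = "v s"])
      show "(\<integral>x. (v r x - v s x - (r - s) * v' s x)\<^sup>2 \<partial>M) \<le> e0\<^sup>2 * (r - s)\<^sup>2" by (rule d0(3)[OF rd])
      have "\<bar>r - s\<bar> < e0 / (2 * A)" using rr by simp
      then have "2 * \<bar>r - s\<bar> * A < e0" using A by (simp add: field_simps)
      then show "2 * \<bar>r - s\<bar> * ((\<integral>x. (v' s x)\<^sup>2 \<partial>M) + 1) \<le> e0" by (simp add: A_def)
      show "AE x in M. \<bar>(lv t \<delta> r x - lv t \<delta> s x) * h x - P x * (v r x - v s x)\<bar> \<le> 2 / \<delta>\<^sup>2 * (v r x - v s x)\<^sup>2"
      proof (rule AE_I2)
        fix x
        have "\<bar>lv t \<delta> r x - lv t \<delta> s x - t * log_rate \<delta> (v s x) * (v r x - v s x)\<bar> \<le> t * (2 / \<delta>\<^sup>2) * (v r x - v s x)\<^sup>2"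
          unfolding lv_def using t by (intro log_trans_expansion \<delta> v_nonneg r s) auto
        also have "\<dots> \<le> 1 * (2 / \<delta>\<^sup>2) * (v r x - v s x)\<^sup>2" using t by (intro mult_right_mono) auto
        finally have *: "\<bar>lv t \<delta> r x - lv t \<delta> s x - t * log_rate \<delta> (v s x) * (v r x - v s x)\<bar> \<le> 2 / \<delta>\<^sup>2 * (v r x - v s x)\<^sup>2" by simp
        have "(lv t \<delta> r x - lv t \<delta> s x) * h x - P x * (v r x - v s x) = (lv t \<delta> r x - lv t \<delta> s x - t * log_rate \<delta> (v s x) * (v r x - v s x)) * h x"
          by (simp add: P_def algebra_simps)
        then have "\<bar>(lv t \<delta> r x - lv t \<delta> s x) * h x - P x * (v r x - v s x)\<bar> = \<bar>lv t \<delta> r x - lv t \<delta> s x - t * log_rate \<delta> (v s x) * (v r x - v s x)\<bar> * h x"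
          using h(2) by (simp add: abs_mult)
        also have "\<dots> \<le> (2 / \<delta>\<^sup>2 * (v r x - v s x)\<^sup>2) * 1" using * h(2) by (intro mult_mono) auto
        finally show "\<bar>(lv t \<delta> r x - lv t \<delta> s x) * h x - P x * (v r x - v s x)\<bar> \<le> 2 / \<delta>\<^sup>2 * (v r x - v s x)\<^sup>2" by simp
      qed
    qed (use e0 PL v_dom[OF r] v_dom[OF s] v'_L2[OF s] in \<open>auto intro: dom_L2\<close>)
    also have "(\<integral>x. P x * v' s x \<partial>M) = t * (\<integral>x. v' s x * (h x * log_rate \<delta> (v s x)) \<partial>M)"
    proof -
      have "(\<integral>x. P x * v' s x \<partial>M) = (\<integral>x. t * (v' s x * (h x * log_rate \<delta> (v s x))) \<partial>M)"
        by (intro Bochner_Integration.integral_cong) (auto simp: P_def)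
      then show ?thesis by simp
    qed
    also have "(\<integral>x. v' s x * (h x * log_rate \<delta> (v s x)) \<partial>M) = - Ef (v s) (\<lambda>x. h x * log_rate \<delta> (v s x))"
      by (intro v_weak s dom_mult_log_rate \<delta> v_dom v_nonneg) (use h in auto)
    also have "(\<integral>x. (lv t \<delta> r x - lv t \<delta> s x) * h x \<partial>M) = (\<integral>x. lv t \<delta> r x * h x \<partial>M) - (\<integral>x. lv t \<delta> s x * h x \<partial>M)"
      using L2_product_integrable[OF dom_L2[OF lv_dom(1)[OF t(1) \<delta> r]] dom_L2[OF h(1)]]
        L2_product_integrable[OF dom_L2[OF lv_dom(1)[OF t(1) \<delta> s]] dom_L2[OF h(1)]]
      by (simp add: left_diff_distrib)
    also have "e0 * \<bar>r - s\<bar> * (1 + 2 / \<delta>\<^sup>2 + (\<integral>x. (P x)\<^sup>2 \<partial>M)) \<le> e0 * \<bar>r - s\<bar> * (Q * (1 + (\<integral>x. (h x)\<^sup>2 \<partial>M)))"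
    proof (intro mult_left_mono)
      have X: "0 \<le> (\<integral>x. (h x)\<^sup>2 \<partial>M)" "0 \<le> (\<integral>x. (h x)\<^sup>2 \<partial>M) / \<delta>\<^sup>2" by simp_all
      show "1 + 2 / \<delta>\<^sup>2 + (\<integral>x. (P x)\<^sup>2 \<partial>M) \<le> Q * (1 + (\<integral>x. (h x)\<^sup>2 \<partial>M))"
      proof -
        have "Q * (1 + (\<integral>x. (h x)\<^sup>2 \<partial>M)) = 1 + 3 / \<delta>\<^sup>2 + (\<integral>x. (h x)\<^sup>2 \<partial>M) + 3 * ((\<integral>x. (h x)\<^sup>2 \<partial>M) / \<delta>\<^sup>2)"
          by (simp add: Q_def algebra_simps)
        moreover have "2 / \<delta>\<^sup>2 \<le> 3 / \<delta>\<^sup>2" by (intro divide_right_mono) auto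
        moreover have "(\<integral>x. (P x)\<^sup>2 \<partial>M) \<le> (\<integral>x. (h x)\<^sup>2 \<partial>M) / \<delta>\<^sup>2" using P2 by simp
        ultimately show ?thesis using X by linarith
      qed
    qed (use e0 in auto)
    also have "e0 * \<bar>r - s\<bar> * (Q * (1 + (\<integral>x. (h x)\<^sup>2 \<partial>M))) = (e0 * Q) * \<bar>r - s\<bar> * (1 + (\<integral>x. (h x)\<^sup>2 \<partial>M))"
      by (simp only: ac_simps)
    finally show "\<bar>(\<integral>x. lv t \<delta> r x * h x \<partial>M) - (\<integral>x. lv t \<delta> s x * h x \<partial>M) + (r - s) * (t * Ef (v s) (\<lambda>x. h x * log_rate \<delta> (v s x)))\<bar>
      \<le> e * \<bar>r - s\<bar> * (1 + (\<integral>x. (h x)\<^sup>2 \<partial>M))" unfolding e0(3) by simp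
  qed
qed

text \<open>A finite convex combination of times in \<open>[\<alpha>, \<beta>]\<close> that reproduces the mean of the time
  derivative up to an error controlled uniformly in the test function.\<close>

definition window :: "real \<Rightarrow> real \<Rightarrow> real \<Rightarrow> real \<Rightarrow> (real \<times> real set) set \<Rightarrow> (real \<times> real set \<Rightarrow> real) \<Rightarrow> bool" where
  "window t \<delta> \<alpha> \<beta> p w \<longleftrightarrow> finite p \<and> (\<forall>q\<in>p. 0 \<le> w q \<and> \<alpha> \<le> fst q \<and> fst q \<le> \<beta>) \<and> (\<Sum>q\<in>p. w q) = 1 \<and>
    (\<forall>h\<in>Dom. (\<forall>x. 0 \<le> h x \<and> h x \<le> 1) \<longrightarrow>
      \<bar>((\<integral>x. lv t \<delta> \<beta> x * h x \<partial>M) - (\<integral>x. lv t \<delta> \<alpha> x * h x \<partial>M)) / (\<beta> - \<alpha>)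
        + t * (\<Sum>q\<in>p. w q * Ef (v (fst q)) (\<lambda>x. h x * log_rate \<delta> (v (fst q) x)))\<bar> \<le> 1 + (\<integral>x. (h x)\<^sup>2 \<partial>M))"

text \<open>The fundamental theorem of calculus for the gauge integral, applied to the functionals
  \<open>h\<close> simultaneously.\<close>

lemma window_exists:
  assumes t: "0 < t" "t \<le> 1" and \<delta>: "0 < \<delta>" "\<delta> < 1" and \<alpha>\<beta>: "0 < \<alpha>" "\<alpha> < \<beta>"
  shows "\<exists>p w. window t \<delta> \<alpha> \<beta> p w"
proof -
  define g where "g h s = (\<integral>x. lv t \<delta> s x * h x \<partial>M)" for h s
  define f where "f h s = t * Ef (v s) (\<lambda>x. h x * log_rate \<delta> (v s x))" for h s
  define N where "N h = 1 + (\<integral>x. (h x)\<^sup>2 \<partial>M)" for h :: "'a \<Rightarrow> real"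
  \<comment> \<open>Tolerance 1 is accurate enough: in \<open>window_energy\<close> the resulting
    error is multiplied by t.\<close>
  have "\<forall>s. \<exists>d. 0 < s \<longrightarrow> 0 < d \<and> (\<forall>r. \<bar>r - s\<bar> < d \<longrightarrow> (\<forall>h\<in>Dom. (\<forall>x. 0 \<le> h x \<and> h x \<le> 1) \<longrightarrow>
    \<bar>g h r - g h s + (r - s) * f h s\<bar> \<le> 1 * \<bar>r - s\<bar> * N h))"
    using lv_increment[OF t \<delta>, of _ 1] unfolding g_def f_def N_def by (meson zero_less_one order_refl)
  from choice[OF this] obtain d where d: "\<And>s. 0 < s \<Longrightarrow> 0 < d s"
    "\<And>s r h. 0 < s \<Longrightarrow> \<bar>r - s\<bar> < d s \<Longrightarrow> h \<in> Dom \<Longrightarrow> (\<forall>x. 0 \<le> h x \<and> h x \<le> 1) \<Longrightarrow>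
      \<bar>g h r - g h s + (r - s) * f h s\<bar> \<le> 1 * \<bar>r - s\<bar> * N h" by blast
  \<comment> \<open>All tags in [\<alpha>, \<beta>] are positive; the radius 1 at the other points
    only completes \<gamma> to a gauge on the whole line.\<close>
  define \<gamma> where "\<gamma> s = ball s (if 0 < s then d s else 1)" for s
  have "gauge \<gamma>" using d(1) by (auto simp: gauge_def \<gamma>_def)
  from fine_division_exists_real[OF this, of \<alpha> \<beta>] obtain p where p: "p tagged_division_of {\<alpha>..\<beta>}" "\<gamma> fine p" by blast
  have pc: "p tagged_division_of cbox \<alpha> \<beta>" using p(1) by simp
  have el: "\<exists>l u. k = {l..u} \<and> l \<le> x \<and> x \<le> u \<and> \<alpha> \<le> l \<and> u \<le> \<beta> \<and> k \<subseteq> \<gamma> x" if "(x, k) \<in> p" for x k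
  proof -
    from tagged_division_ofD(4)[OF p(1) that] obtain l u where k: "k = {l..u}" by auto
    have "x \<in> k" "k \<subseteq> {\<alpha>..\<beta>}" using tagged_division_ofD(2,3)[OF p(1) that] by auto
    with k have "l \<le> x" "x \<le> u" "\<alpha> \<le> l" "u \<le> \<beta>" by auto
    moreover have "k \<subseteq> \<gamma> x" using p(2) that by (auto simp: fine_def)
    ultimately show ?thesis using k by blast
  qed
  have fin: "finite p" by (rule tagged_division_ofD(1)[OF p(1)])
  \<comment> \<open>The weight of a tag is the share of its interval in the window, so the weighted
    sum is a Riemann sum for the mean of the time derivative.\<close>
  define w where "w q = measure lborel (snd q) / (\<beta> - \<alpha>)" for q :: "real \<times> real set"
  have cont: "(\<Sum>q\<in>p. measure lborel (snd q)) = \<beta> - \<alpha>"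
    using additive_content_tagged_division[OF pc] \<alpha>\<beta> by (simp add: case_prod_unfold)
  have main: "\<bar>(g h \<beta> - g h \<alpha>) / (\<beta> - \<alpha>) + (\<Sum>q\<in>p. w q * f h (fst q))\<bar> \<le> N h"
    if h: "h \<in> Dom" "\<forall>x. 0 \<le> h x \<and> h x \<le> 1" for h
  proof -
    have each: "\<bar>(g h (Sup (snd q)) - g h (Inf (snd q))) + measure lborel (snd q) * f h (fst q)\<bar> \<le> measure lborel (snd q) * N h" if "q \<in> p" for q
    proof -
      obtain x k where q: "q = (x, k)" by (cases q)
      from el that q obtain l u where k: "k = {l..u}" "l \<le> x" "x \<le> u" "\<alpha> \<le> l" "u \<le> \<beta>" "k \<subseteq> \<gamma> x" by blast
      have x: "0 < x" using k \<alpha>\<beta> by simp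
      have lu: "l \<in> \<gamma> x" "u \<in> \<gamma> x" using k by auto
      have "\<bar>g h u - g h x + (u - x) * f h x\<bar> \<le> 1 * \<bar>u - x\<bar> * N h"
        using lu x by (intro d h) (auto simp: \<gamma>_def dist_real_def)
      moreover have "\<bar>g h l - g h x + (l - x) * f h x\<bar> \<le> 1 * \<bar>l - x\<bar> * N h"
        using lu x by (intro d h) (auto simp: \<gamma>_def dist_real_def)
      moreover have "1 * \<bar>u - x\<bar> * N h + 1 * \<bar>l - x\<bar> * N h = (u - l) * N h" using k by (simp add: algebra_simps)
      moreover have "(g h u - g h l) + (u - l) * f h x = (g h u - g h x + (u - x) * f h x) - (g h l - g h x + (l - x) * f h x)"
        by (simp add: algebra_simps)
      ultimately have "\<bar>(g h u - g h l) + (u - l) * f h x\<bar> \<le> (u - l) * N h" by linarith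
      moreover have "Sup k = u" "Inf k = l" "measure lborel k = u - l" using k by auto
      ultimately show ?thesis by (simp add: q)
    qed
    have tele: "(\<Sum>q\<in>p. g h (Sup (snd q)) - g h (Inf (snd q))) = g h \<beta> - g h \<alpha>"
      using additive_tagged_division_1[OF _ p(1), of "g h"] \<alpha>\<beta> by (simp add: case_prod_unfold)
    have "\<bar>\<Sum>q\<in>p. (g h (Sup (snd q)) - g h (Inf (snd q))) + measure lborel (snd q) * f h (fst q)\<bar> \<le> (\<Sum>q\<in>p. measure lborel (snd q) * N h)"
      by (rule order_trans[OF sum_abs sum_mono[OF each]])
    then have "\<bar>(g h \<beta> - g h \<alpha>) + (\<Sum>q\<in>p. measure lborel (snd q) * f h (fst q))\<bar> \<le> (\<beta> - \<alpha>) * N h"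
      by (simp add: sum.distrib tele sum_distrib_right[symmetric] cont)
    then have "\<bar>(g h \<beta> - g h \<alpha>) + (\<Sum>q\<in>p. measure lborel (snd q) * f h (fst q))\<bar> / (\<beta> - \<alpha>) \<le> N h"
      using \<alpha>\<beta> by (simp add: divide_le_eq mult.commute)
    moreover have "(g h \<beta> - g h \<alpha>) / (\<beta> - \<alpha>) + (\<Sum>q\<in>p. w q * f h (fst q)) = ((g h \<beta> - g h \<alpha>) + (\<Sum>q\<in>p. measure lborel (snd q) * f h (fst q))) / (\<beta> - \<alpha>)"
      by (simp add: w_def add_divide_distrib sum_divide_distrib)
    ultimately show ?thesis using \<alpha>\<beta> by (simp add: abs_divide)
  qed
  have "window t \<delta> \<alpha> \<beta> p w"
    unfolding window_def
  proof (intro conjI ballI impI fin)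
    fix q assume q: "q \<in> p"
    obtain x k where qq: "q = (x, k)" by (cases q)
    show "0 \<le> w q" using \<alpha>\<beta> by (simp add: w_def)
    from el[of x k] q qq show "\<alpha> \<le> fst q" "fst q \<le> \<beta>" by auto
  next
    show "(\<Sum>q\<in>p. w q) = 1" using cont \<alpha>\<beta> by (simp add: w_def sum_divide_distrib[symmetric])
  next
    fix h assume "h \<in> Dom" "\<forall>x. 0 \<le> h x \<and> h x \<le> 1"
    from main[OF this] show "\<bar>((\<integral>x. lv t \<delta> \<beta> x * h x \<partial>M) - (\<integral>x. lv t \<delta> \<alpha> x * h x \<partial>M)) / (\<beta> - \<alpha>)
        + t * (\<Sum>q\<in>p. w q * Ef (v (fst q)) (\<lambda>x. h x * log_rate \<delta> (v (fst q) x)))\<bar> \<le> 1 + (\<integral>x. (h x)\<^sup>2 \<partial>M)"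
      by (simp add: g_def f_def N_def sum_distrib_left ac_simps)
  qed
  then show ?thesis by blast
qed

definition wavg :: "real \<Rightarrow> real \<Rightarrow> (real \<times> real set) set \<Rightarrow> (real \<times> real set \<Rightarrow> real) \<Rightarrow> 'a \<Rightarrow> real" where
  "wavg t \<delta> p w x = (\<Sum>q\<in>p. w q * lv t \<delta> (fst q) x)"

text \<open>By Jensen the squared gradient of the average is at most the average of the squared
  gradients, which is the quantity that the averaged energy inequality bounds.\<close>

lemma wavg_dom:
  assumes t: "0 < t" and \<delta>: "0 < \<delta>" "\<delta> < 1" and \<alpha>: "0 < \<alpha>" and W: "window t \<delta> \<alpha> \<beta> p w"
  shows "wavg t \<delta> p w \<in> Dom"
    "AE x in M. (norm (D (wavg t \<delta> p w) x))\<^sup>2 \<le> (\<Sum>q\<in>p. w q * (t * log_rate \<delta> (v (fst q) x) * norm (D (v (fst q)) x))\<^sup>2)"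
    "0 \<le> wavg t \<delta> p w x" "wavg t \<delta> p w x \<le> t * (- ln \<delta>)"
proof -
  have fin: "finite p" and w: "\<And>q. q \<in> p \<Longrightarrow> 0 \<le> w q" "(\<Sum>q\<in>p. w q) = 1" and s: "\<And>q. q \<in> p \<Longrightarrow> 0 < fst q"
    using W \<alpha> by (force simp: window_def)+
  have d: "lv t \<delta> (fst q) \<in> Dom" if "q \<in> p" for q by (intro lv_dom t \<delta> s that)
  have S: "(\<lambda>x. \<Sum>q\<in>p. w q * lv t \<delta> (fst q) x) \<in> Dom \<and>
    (AE x in M. D (\<lambda>x. \<Sum>q\<in>p. w q * lv t \<delta> (fst q) x) x = (\<Sum>q\<in>p. w q *\<^sub>R D (lv t \<delta> (fst q)) x))"
    by (rule dom_sum[OF fin d])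
  show "wavg t \<delta> p w \<in> Dom" using S by (simp add: wavg_def[abs_def])
  have "AE x in M. \<forall>q\<in>p. D (lv t \<delta> (fst q)) x = (t * log_rate \<delta> (v (fst q) x)) *\<^sub>R D (v (fst q)) x"
    using lv_dom(2)[OF t \<delta> s] fin by (intro AE_finite_allI) auto
  then show "AE x in M. (norm (D (wavg t \<delta> p w) x))\<^sup>2 \<le> (\<Sum>q\<in>p. w q * (t * log_rate \<delta> (v (fst q) x) * norm (D (v (fst q)) x))\<^sup>2)"
    using S[THEN conjunct2]
  proof eventually_elim
    case (elim x)
    have "D (wavg t \<delta> p w) x = (\<Sum>q\<in>p. w q *\<^sub>R D (lv t \<delta> (fst q)) x)" using elim(2) by (simp add: wavg_def[abs_def])
    also have "(norm \<dots>)\<^sup>2 \<le> (\<Sum>q\<in>p. w q * (norm (D (lv t \<delta> (fst q)) x))\<^sup>2)"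
      by (rule weighted_norm_square_le[OF fin w])
    also have "\<dots> = (\<Sum>q\<in>p. w q * (t * log_rate \<delta> (v (fst q) x) * norm (D (v (fst q)) x))\<^sup>2)"
      by (intro sum.cong refl) (use elim(1) in \<open>simp add: power_mult_distrib\<close>)
    finally show ?case .
  qed
  show "0 \<le> wavg t \<delta> p w x" unfolding wavg_def
    by (intro sum_nonneg mult_nonneg_nonneg w lv_range t \<delta> s)
  have "wavg t \<delta> p w x \<le> (\<Sum>q\<in>p. w q * (t * (- ln \<delta>)))" unfolding wavg_def
    by (intro sum_mono mult_left_mono w lv_range t \<delta> s)
  also have "\<dots> = t * (- ln \<delta>)" by (simp only: sum_distrib_right[symmetric] w(2) mult_1_left)
  finally show "wavg t \<delta> p w x \<le> t * (- ln \<delta>)" .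
qed

text \<open>The energy inequality is averaged over the window twice: with h, and with \<zeta>^2 in
  order to bound the error term of the first. In the second the gradient error is absorbed for small
  t, and the time increment that remains is at most K times the integral of \<zeta>^2, since the
  transform lies in [0, K].\<close>

lemma window_energy:
  assumes tp: "test_pair \<zeta> h" and K: "0 < K"
  shows "\<exists>C t0. 0 \<le> C \<and> 0 < t0 \<and> t0 \<le> 1 \<and> (\<forall>t \<alpha> \<beta> p w. 0 < t \<longrightarrow> t \<le> t0 \<longrightarrow> 0 < \<alpha> \<longrightarrow> \<alpha> < \<beta> \<longrightarrow> window t (exp (- K / t)) \<alpha> \<beta> p w \<longrightarrow>
    (1/2) * (\<integral>x. h x * (norm (D (wavg t (exp (- K / t)) p w) x))\<^sup>2 \<partial>M)
      \<le> (t / (\<beta> - \<alpha>)) * ((\<integral>x. lv t (exp (- K / t)) \<beta> x * h x \<partial>M) - (\<integral>x. lv t (exp (- K / t)) \<alpha> x * h x \<partial>M)) + C * t * (1 + t / (\<beta> - \<alpha>)))"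
proof -
  have \<zeta>: "\<zeta> \<in> Dom" "\<And>x. 0 \<le> \<zeta> x" "\<And>x. \<zeta> x \<le> 1" and h: "h \<in> Dom" "\<And>x. 0 \<le> h x" "\<And>x. h x \<le> (\<zeta> x)\<^sup>2"
    using tp by (auto simp: test_pair_def)
  obtain k where k: "AE x in M. x \<notin> E k \<longrightarrow> \<zeta> x = 0" using tp by (auto simp: test_pair_def)
  have tp2: "test_pair \<zeta> (\<lambda>x. (\<zeta> x)\<^sup>2)" by (rule test_pair_square(1)[OF \<zeta> k dom_zero]) auto
  have sq: "(\<lambda>x. (\<zeta> x)\<^sup>2) \<in> Dom" "\<And>x. 0 \<le> (\<zeta> x)\<^sup>2" "\<And>x. (\<zeta> x)\<^sup>2 \<le> 1"
    using tp2 \<zeta> by (auto simp: test_pair_def intro: power_le_one)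
  have h1: "h x \<le> 1" for x using h(3)[of x] sq(3)[of x] by linarith
  from energy_inequality[OF tp] obtain C1 where C1: "0 \<le> C1" "\<And>v t \<delta>. v \<in> Dom \<Longrightarrow> (\<forall>x. 0 \<le> v x) \<Longrightarrow> 0 < t \<Longrightarrow> t \<le> 1 \<Longrightarrow> 0 < \<delta> \<Longrightarrow> \<delta> < 1 \<Longrightarrow>
    t\<^sup>2 * Ef v (\<lambda>x. h x * log_rate \<delta> (v x)) \<le> - (1/2) * (\<integral>x. h x * (t * log_rate \<delta> (v x) * norm (D v x))\<^sup>2 \<partial>M)
      + t * C1 * (1 + (\<integral>x. (\<zeta> x)\<^sup>2 * (t * log_rate \<delta> (v x) * norm (D v x))\<^sup>2 \<partial>M))" by blast
  from energy_inequality[OF tp2] obtain C2 where C2: "0 \<le> C2" "\<And>v t \<delta>. v \<in> Dom \<Longrightarrow> (\<forall>x. 0 \<le> v x) \<Longrightarrow> 0 < t \<Longrightarrow> t \<le> 1 \<Longrightarrow> 0 < \<delta> \<Longrightarrow> \<delta> < 1 \<Longrightarrow>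
    t\<^sup>2 * Ef v (\<lambda>x. (\<zeta> x)\<^sup>2 * log_rate \<delta> (v x)) \<le> - (1/2) * (\<integral>x. (\<zeta> x)\<^sup>2 * (t * log_rate \<delta> (v x) * norm (D v x))\<^sup>2 \<partial>M)
      + t * C2 * (1 + (\<integral>x. (\<zeta> x)\<^sup>2 * (t * log_rate \<delta> (v x) * norm (D v x))\<^sup>2 \<partial>M))" by blast
  define S where "S = (\<integral>x. (\<zeta> x)\<^sup>2 \<partial>M)"
  define n1 where "n1 = (\<integral>x. (h x)\<^sup>2 \<partial>M)"
  define n2 where "n2 = (\<integral>x. ((\<zeta> x)\<^sup>2)\<^sup>2 \<partial>M)"
  have S0: "0 \<le> S" "0 \<le> n1" "0 \<le> n2" by (auto simp: S_def n1_def n2_def)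
  define C where "C = 1 + n1 + C1 * (1 + 4 * C2) + 4 * C1 * (1 + n2) + 4 * C1 * (K * S)"
  have C: "0 \<le> C" using C1(1) C2(1) S0 K by (simp add: C_def)
  \<comment> \<open>Ensures t C2 <= 1/4: the half of the gradient integral on the good side then
    absorbs the quarter produced by the error, and the other quarter gives the factor 4 in
    \<open>k2\<close>.\<close>
  define t0 where "t0 = 1 / (1 + 4 * C2)"
  have t0: "0 < t0" "t0 \<le> 1" using C2(1) by (auto simp: t0_def)
  have main: "(1/2) * (\<integral>x. h x * (norm (D (wavg t \<delta> p w) x))\<^sup>2 \<partial>M)
      \<le> (t / (\<beta> - \<alpha>)) * ((\<integral>x. lv t \<delta> \<beta> x * h x \<partial>M) - (\<integral>x. lv t \<delta> \<alpha> x * h x \<partial>M)) + C * t * (1 + t / (\<beta> - \<alpha>))"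
    if t: "0 < t" "t \<le> t0" and \<alpha>\<beta>: "0 < \<alpha>" "\<alpha> < \<beta>" and \<delta>e: "\<delta> = exp (- K / t)" and W: "window t \<delta> \<alpha> \<beta> p w" for t \<alpha> \<beta> p w \<delta>
  proof -
    have t1: "t \<le> 1" using t t0 by simp
    have tC2: "t * C2 \<le> 1/4"
    proof -
      have "t * (1 + 4 * C2) \<le> t0 * (1 + 4 * C2)" using t C2(1) by (intro mult_right_mono) auto
      also have "\<dots> = 1" using C2(1) by (simp add: t0_def)
      finally show ?thesis using t by (simp add: algebra_simps)
    qed
    have \<delta>: "0 < \<delta>" "\<delta> < 1" using K t by (auto simp: \<delta>e)
    have lnd: "t * (- ln \<delta>) = K" using t by (simp add: \<delta>e)
    have w: "\<And>q. q \<in> p \<Longrightarrow> 0 \<le> w q" "(\<Sum>q\<in>p. w q) = 1" and s: "\<And>q. q \<in> p \<Longrightarrow> 0 < fst q"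
      using W \<alpha>\<beta> by (force simp: window_def)+
    have win: "\<bar>((\<integral>x. lv t \<delta> \<beta> x * f x \<partial>M) - (\<integral>x. lv t \<delta> \<alpha> x * f x \<partial>M)) / (\<beta> - \<alpha>)
        + t * (\<Sum>q\<in>p. w q * Ef (v (fst q)) (\<lambda>x. f x * log_rate \<delta> (v (fst q) x)))\<bar> \<le> 1 + (\<integral>x. (f x)\<^sup>2 \<partial>M)"
      if "f \<in> Dom" "\<forall>x. 0 \<le> f x \<and> f x \<le> 1" for f using W that by (simp add: window_def)
    define pp where "pp q x = t * log_rate \<delta> (v (fst q) x) * norm (D (v (fst q)) x)" for q :: "real \<times> real set" and x
    have ppL: "L2 M (pp q)" if "q \<in> p" for q
    proof -
      have "L2 M (\<lambda>x. (t * log_rate \<delta> (v (fst q) x)) * norm (D (v (fst q)) x))"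
      proof (rule L2_mult[OF L2H_norm[OF D_L2H[OF v_dom[OF s[OF that]]]]])
        have [measurable]: "v (fst q) \<in> borel_measurable M" using v_dom[OF s[OF that]] by (rule dom_measurable)
        show "(\<lambda>x. t * log_rate \<delta> (v (fst q) x)) \<in> borel_measurable M" unfolding log_rate_def by measurable
        show "AE x in M. \<bar>t * log_rate \<delta> (v (fst q) x)\<bar> \<le> t * (1 / \<delta>)"
          using log_rate_nonneg[OF \<delta> v_nonneg[OF s[OF that]]] mult_left_mono[OF log_rate_le[OF \<delta> v_nonneg[OF s[OF that]]], of t] t
          by (simp add: abs_mult)
      qed
      then show ?thesis by (simp add: pp_def[abs_def])
    qed
    have [measurable]: "h \<in> borel_measurable M" "\<zeta> \<in> borel_measurable M" using h \<zeta> by (auto intro: dom_measurable)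
    have hpi: "integrable M (\<lambda>x. h x * (pp q x)\<^sup>2)" if "q \<in> p" for q
      by (rule Bochner_Integration.integrable_bound[OF L2_square_integrable[OF ppL[OF that]]])
         (use ppL[OF that] h(2) h1 in \<open>auto simp: L2_def abs_mult mult_left_le_one_le\<close>)
    define e1 where "e1 q = Ef (v (fst q)) (\<lambda>x. h x * log_rate \<delta> (v (fst q) x))" for q :: "real \<times> real set"
    define e2 where "e2 q = Ef (v (fst q)) (\<lambda>x. (\<zeta> x)\<^sup>2 * log_rate \<delta> (v (fst q) x))" for q :: "real \<times> real set"
    define X where "X q = (\<integral>x. (\<zeta> x)\<^sup>2 * (pp q x)\<^sup>2 \<partial>M)" for q
    have X0: "0 \<le> X q" for q by (simp add: X_def)
    have k1: "(1/2) * (\<integral>x. h x * (pp q x)\<^sup>2 \<partial>M) \<le> - (t\<^sup>2 * e1 q) + t * C1 * (1 + X q)" if "q \<in> p" for q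
      using C1(2)[OF v_dom[OF s[OF that]] _ t(1) t1 \<delta>] v_nonneg[OF s[OF that]] by (simp add: e1_def X_def pp_def)
    have k2: "X q \<le> 4 * (- (t\<^sup>2 * e2 q) + t * C2)" if "q \<in> p" for q
    proof -
      have "t\<^sup>2 * e2 q \<le> - (1/2) * X q + t * C2 * (1 + X q)"
        using C2(2)[OF v_dom[OF s[OF that]] _ t(1) t1 \<delta>] v_nonneg[OF s[OF that]] by (simp add: e2_def X_def pp_def)
      moreover have "t * C2 * X q \<le> 1/4 * X q" using tC2 X0 by (intro mult_right_mono) auto
      ultimately show ?thesis by (simp add: algebra_simps)
    qed
    have k12: "(1/2) * (\<integral>x. h x * (pp q x)\<^sup>2 \<partial>M) \<le> t * (- (t * e1 q)) + t * C1 * (1 + 4 * (t * C2)) + 4 * (t * C1) * (t * (- (t * e2 q)))" if "q \<in> p" for q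
    proof -
      have "t * C1 * X q \<le> t * C1 * (4 * (- (t\<^sup>2 * e2 q) + t * C2))" using k2[OF that] t C1(1) by (intro mult_left_mono) auto
      then show ?thesis using k1[OF that] by (simp add: algebra_simps power2_eq_square)
    qed
    have "(\<integral>x. h x * (norm (D (wavg t \<delta> p w) x))\<^sup>2 \<partial>M) \<le> (\<integral>x. (\<Sum>q\<in>p. w q * (h x * (pp q x)\<^sup>2)) \<partial>M)"
    proof (rule integral_mono_AE)
      show "integrable M (\<lambda>x. \<Sum>q\<in>p. w q * (h x * (pp q x)\<^sup>2))"
        by (intro Bochner_Integration.integrable_sum integrable_mult_right hpi)
      show "integrable M (\<lambda>x. h x * (norm (D (wavg t \<delta> p w) x))\<^sup>2)"
        by (rule Bochner_Integration.integrable_bound[OF D_square_integrable[OF wavg_dom(1)[OF t(1) \<delta> \<alpha>\<beta>(1) W]]])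
           (use D_measurable[OF wavg_dom(1)[OF t(1) \<delta> \<alpha>\<beta>(1) W]] h(2) h1 in \<open>auto simp: abs_mult mult_left_le_one_le\<close>)
      show "AE x in M. h x * (norm (D (wavg t \<delta> p w) x))\<^sup>2 \<le> (\<Sum>q\<in>p. w q * (h x * (pp q x)\<^sup>2))"
        using wavg_dom(2)[OF t(1) \<delta> \<alpha>\<beta>(1) W]
      proof eventually_elim
        case (elim x)
        from mult_left_mono[OF elim h(2)[of x]] show ?case by (simp add: pp_def sum_distrib_left ac_simps)
      qed
    qed
    also have "\<dots> = (\<Sum>q\<in>p. w q * (\<integral>x. h x * (pp q x)\<^sup>2 \<partial>M))"
      using hpi by (subst Bochner_Integration.integral_sum) auto
    finally have "(1/2) * (\<integral>x. h x * (norm (D (wavg t \<delta> p w) x))\<^sup>2 \<partial>M) \<le> (\<Sum>q\<in>p. w q * ((1/2) * (\<integral>x. h x * (pp q x)\<^sup>2 \<partial>M)))"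
      by (simp add: sum_divide_distrib[symmetric])
    also have "\<dots> \<le> (\<Sum>q\<in>p. w q * (t * (- (t * e1 q)) + t * C1 * (1 + 4 * (t * C2)) + 4 * (t * C1) * (t * (- (t * e2 q)))))"
      by (intro sum_mono mult_left_mono k12 w)
    also have "\<dots> = (\<Sum>q\<in>p. t * (- (t * (w q * e1 q))) + (t * C1 * (1 + 4 * (t * C2))) * w q + 4 * (t * C1) * (t * (- (t * (w q * e2 q)))))"
      by (intro sum.cong) (auto simp: algebra_simps)
    also have "\<dots> = t * (- (t * (\<Sum>q\<in>p. w q * e1 q))) + t * C1 * (1 + 4 * (t * C2)) + 4 * (t * C1) * (t * (- (t * (\<Sum>q\<in>p. w q * e2 q))))"
    proof -
      have "(\<Sum>q\<in>p. t * (- (t * (w q * e1 q))) + (t * C1 * (1 + 4 * (t * C2))) * w q + 4 * (t * C1) * (t * (- (t * (w q * e2 q)))))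
        = (\<Sum>q\<in>p. t * (- (t * (w q * e1 q)))) + (\<Sum>q\<in>p. (t * C1 * (1 + 4 * (t * C2))) * w q) + (\<Sum>q\<in>p. 4 * (t * C1) * (t * (- (t * (w q * e2 q)))))"
        by (simp only: sum.distrib)
      also have "\<dots> = t * (- (t * (\<Sum>q\<in>p. w q * e1 q))) + (t * C1 * (1 + 4 * (t * C2))) * (\<Sum>q\<in>p. w q) + 4 * (t * C1) * (t * (- (t * (\<Sum>q\<in>p. w q * e2 q))))"
        by (simp add: sum_negf sum_distrib_left mult.assoc)
      finally show ?thesis by (simp only: w(2) mult_1_right)
    qed
    also have "\<dots> \<le> t * (((\<integral>x. lv t \<delta> \<beta> x * h x \<partial>M) - (\<integral>x. lv t \<delta> \<alpha> x * h x \<partial>M)) / (\<beta> - \<alpha>) + 1 + n1)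
      + t * C1 * (1 + 4 * C2) + 4 * (t * C1) * (t * (K * S / (\<beta> - \<alpha>) + 1 + n2))"
    proof (intro add_mono mult_left_mono)
      show "- (t * (\<Sum>q\<in>p. w q * e1 q)) \<le> ((\<integral>x. lv t \<delta> \<beta> x * h x \<partial>M) - (\<integral>x. lv t \<delta> \<alpha> x * h x \<partial>M)) / (\<beta> - \<alpha>) + 1 + n1"
        using win[of h] h h1 unfolding e1_def n1_def by (simp add: abs_le_iff)
      show "t * C2 \<le> C2" using t t1 C2(1) by (simp add: mult_left_le_one_le)
      have "- (t * (\<Sum>q\<in>p. w q * e2 q)) \<le> ((\<integral>x. lv t \<delta> \<beta> x * (\<zeta> x)\<^sup>2 \<partial>M) - (\<integral>x. lv t \<delta> \<alpha> x * (\<zeta> x)\<^sup>2 \<partial>M)) / (\<beta> - \<alpha>) + 1 + n2"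
        using win[of "\<lambda>x. (\<zeta> x)\<^sup>2"] sq unfolding e2_def n2_def by (simp add: abs_le_iff)
      moreover have "((\<integral>x. lv t \<delta> \<beta> x * (\<zeta> x)\<^sup>2 \<partial>M) - (\<integral>x. lv t \<delta> \<alpha> x * (\<zeta> x)\<^sup>2 \<partial>M)) / (\<beta> - \<alpha>) \<le> K * S / (\<beta> - \<alpha>)"
      proof (rule divide_right_mono)
        have "0 \<le> (\<integral>x. lv t \<delta> \<alpha> x * (\<zeta> x)\<^sup>2 \<partial>M)" using lv_range(1)[OF t(1) \<delta> \<alpha>\<beta>(1)] by (intro Bochner_Integration.integral_nonneg) auto
        moreover have "(\<integral>x. lv t \<delta> \<beta> x * (\<zeta> x)\<^sup>2 \<partial>M) \<le> (\<integral>x. K * (\<zeta> x)\<^sup>2 \<partial>M)"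
        proof (rule integral_mono)
          have b0: "0 < \<beta>" using \<alpha>\<beta> by simp
          show "integrable M (\<lambda>x. lv t \<delta> \<beta> x * (\<zeta> x)\<^sup>2)"
            by (intro L2_product_integrable dom_L2 lv_dom t \<delta> b0 sq)
          show "integrable M (\<lambda>x. K * (\<zeta> x)\<^sup>2)" using dom_square_integrable[OF \<zeta>(1)] by simp
          show "lv t \<delta> \<beta> x * (\<zeta> x)\<^sup>2 \<le> K * (\<zeta> x)\<^sup>2" for x
            using lv_range(2)[OF t(1) \<delta> b0, of x] lnd by (intro mult_right_mono) auto
        qed
        ultimately show "(\<integral>x. lv t \<delta> \<beta> x * (\<zeta> x)\<^sup>2 \<partial>M) - (\<integral>x. lv t \<delta> \<alpha> x * (\<zeta> x)\<^sup>2 \<partial>M) \<le> K * S" by (simp add: S_def)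
      qed (use \<alpha>\<beta> in simp)
      ultimately show "- (t * (\<Sum>q\<in>p. w q * e2 q)) \<le> K * S / (\<beta> - \<alpha>) + 1 + n2" by linarith
    qed (use t C1(1) in auto)
    also have "\<dots> \<le> (t / (\<beta> - \<alpha>)) * ((\<integral>x. lv t \<delta> \<beta> x * h x \<partial>M) - (\<integral>x. lv t \<delta> \<alpha> x * h x \<partial>M)) + C * t * (1 + t / (\<beta> - \<alpha>))"
    proof -
      define \<rho> where "\<rho> = t / (\<beta> - \<alpha>)"
      have \<rho>: "0 \<le> \<rho>" using t \<alpha>\<beta> by (simp add: \<rho>_def)
      have eq: "t * (K * S / (\<beta> - \<alpha>)) = K * S * \<rho>" by (simp add: \<rho>_def)
      have "4 * (t * C1) * (t * (K * S / (\<beta> - \<alpha>) + 1 + n2)) = 4 * (t * C1) * (K * S * \<rho> + t * (1 + n2))"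
        unfolding eq[symmetric] by (simp add: algebra_simps)
      also have "\<dots> \<le> 4 * (t * C1) * (K * S * \<rho> + 1 * (1 + n2))"
        using t t1 C1(1) S0 by (intro mult_left_mono add_left_mono mult_right_mono) auto
      finally have a: "4 * (t * C1) * (t * (K * S / (\<beta> - \<alpha>) + 1 + n2)) \<le> t * (4 * C1 * (1 + n2)) + t * (4 * C1 * (K * S) * \<rho>)"
        by (simp add: algebra_simps)
      have "t * (1 + n1) + t * C1 * (1 + 4 * C2) + t * (4 * C1 * (1 + n2)) + t * (4 * C1 * (K * S) * \<rho>) \<le> C * t * (1 + \<rho>)"
      proof -
        have "C * t * (1 + \<rho>) - (t * (1 + n1) + t * C1 * (1 + 4 * C2) + t * (4 * C1 * (1 + n2)) + t * (4 * C1 * (K * S) * \<rho>))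
          = t * (4 * C1 * (K * S)) + t * ((1 + n1 + C1 * (1 + 4 * C2) + 4 * C1 * (1 + n2)) * \<rho>)"
          by (simp add: C_def algebra_simps)
        moreover have "0 \<le> t * (4 * C1 * (K * S)) + t * ((1 + n1 + C1 * (1 + 4 * C2) + 4 * C1 * (1 + n2)) * \<rho>)"
          using t C1(1) C2(1) K S0 \<rho> by (intro add_nonneg_nonneg mult_nonneg_nonneg) auto
        ultimately show ?thesis by linarith
      qed
      moreover have "t * (((\<integral>x. lv t \<delta> \<beta> x * h x \<partial>M) - (\<integral>x. lv t \<delta> \<alpha> x * h x \<partial>M)) / (\<beta> - \<alpha>) + 1 + n1)
        = \<rho> * ((\<integral>x. lv t \<delta> \<beta> x * h x \<partial>M) - (\<integral>x. lv t \<delta> \<alpha> x * h x \<partial>M)) + t * (1 + n1)"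
        by (simp add: \<rho>_def distrib_left add.assoc)
      ultimately show ?thesis using a unfolding \<rho>_def[symmetric] by linarith
    qed
    finally show ?thesis .
  qed
  show ?thesis
    by (rule exI[of _ C], rule exI[of _ t0]) (use C t0 main in blast)
qed

text \<open>The nonnegative gradient term of \<open>window_energy\<close> is dropped and the rest
  multiplied by (\<beta> - \<alpha>)/t. Monotonicity in time is obtained only in the tested sense
  and up to an error of order \<beta> - \<alpha> + t, which disappears on the time scale t.\<close>

lemma lv_almost_mono:
  assumes tp: "test_pair \<zeta> h" and K: "0 < K"
  shows "\<exists>C t0. 0 \<le> C \<and> 0 < t0 \<and> t0 \<le> 1 \<and> (\<forall>t \<alpha> \<beta>. 0 < t \<longrightarrow> t \<le> t0 \<longrightarrow> 0 < \<alpha> \<longrightarrow> \<alpha> \<le> \<beta> \<longrightarrow>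
    (\<integral>x. lv t (exp (- K / t)) \<alpha> x * h x \<partial>M) \<le> (\<integral>x. lv t (exp (- K / t)) \<beta> x * h x \<partial>M) + C * (\<beta> - \<alpha> + t))"
proof -
  from window_energy[OF assms] obtain C t0 where C: "0 \<le> C" "0 < t0" "t0 \<le> 1"
    and W: "\<And>t \<alpha> \<beta> p w. 0 < t \<Longrightarrow> t \<le> t0 \<Longrightarrow> 0 < \<alpha> \<Longrightarrow> \<alpha> < \<beta> \<Longrightarrow> window t (exp (- K / t)) \<alpha> \<beta> p w \<Longrightarrow>
    (1/2) * (\<integral>x. h x * (norm (D (wavg t (exp (- K / t)) p w) x))\<^sup>2 \<partial>M)
      \<le> (t / (\<beta> - \<alpha>)) * ((\<integral>x. lv t (exp (- K / t)) \<beta> x * h x \<partial>M) - (\<integral>x. lv t (exp (- K / t)) \<alpha> x * h x \<partial>M)) + C * t * (1 + t / (\<beta> - \<alpha>))"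
    by blast
  have h0: "0 \<le> h x" for x using tp by (auto simp: test_pair_def)
  have "(\<integral>x. lv t (exp (- K / t)) \<alpha> x * h x \<partial>M) \<le> (\<integral>x. lv t (exp (- K / t)) \<beta> x * h x \<partial>M) + C * (\<beta> - \<alpha> + t)"
    if t: "0 < t" "t \<le> t0" and \<alpha>: "0 < \<alpha>" "\<alpha> \<le> \<beta>" for t \<alpha> \<beta>
  proof (cases "\<alpha> = \<beta>")
    case True
    then show ?thesis using C t by simp
  next
    case False
    then have ab: "\<alpha> < \<beta>" using \<alpha> by simp
    have \<delta>: "0 < exp (- K / t)" "exp (- K / t) < 1" using K t by auto
    from window_exists[OF t(1) _ \<delta> \<alpha>(1) ab] t C obtain p w where pw: "window t (exp (- K / t)) \<alpha> \<beta> p w" by auto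
    define g where "g = (\<integral>x. lv t (exp (- K / t)) \<beta> x * h x \<partial>M) - (\<integral>x. lv t (exp (- K / t)) \<alpha> x * h x \<partial>M)"
    have "0 \<le> (1/2) * (\<integral>x. h x * (norm (D (wavg t (exp (- K / t)) p w) x))\<^sup>2 \<partial>M)" using h0 by simp
    also have "\<dots> \<le> (t / (\<beta> - \<alpha>)) * g + C * t * (1 + t / (\<beta> - \<alpha>))" unfolding g_def by (rule W[OF t \<alpha>(1) ab pw])
    also have "\<dots> = (t / (\<beta> - \<alpha>)) * (g + C * (\<beta> - \<alpha> + t))"
    proof -
      have "(t / L) * g + C * t * (1 + t / L) = (t / L) * (g + C * (L + t))" if "L \<noteq> 0" for L
        using that by (simp add: field_simps)
      from this[of "\<beta> - \<alpha>"] show ?thesis using ab by simp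
    qed
    finally have "0 \<le> (t / (\<beta> - \<alpha>)) * (g + C * (\<beta> - \<alpha> + t))" .
    moreover have "0 < t / (\<beta> - \<alpha>)" using t ab by simp
    ultimately have "0 \<le> g + C * (\<beta> - \<alpha> + t)" by (meson linorder_not_less mult_pos_neg)
    then show ?thesis by (simp add: g_def)
  qed
  then show ?thesis using C by blast
qed

end

section \<open>Forward convex combinations\<close>

text \<open>Convex weights on the tail of indices from n on. The finite supports have no common
  bound, so a weight is a total function that vanishes off a finite set.\<close>

definition cweights :: "nat \<Rightarrow> (nat \<Rightarrow> real) set" where
  "cweights n = {c. finite {i. c i \<noteq> 0} \<and> (\<forall>i. 0 \<le> c i) \<and> (\<forall>i. c i \<noteq> 0 \<longrightarrow> n \<le> i) \<and> (\<Sum>i | c i \<noteq> 0. c i) = 1}"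

definition cmid :: "(nat \<Rightarrow> real) \<Rightarrow> (nat \<Rightarrow> real) \<Rightarrow> nat \<Rightarrow> real" where
  "cmid c d i = (c i + d i) / 2"

definition lincomb :: "(nat \<Rightarrow> real) \<Rightarrow> (nat \<Rightarrow> 'a \<Rightarrow> 'h::real_vector) \<Rightarrow> 'a \<Rightarrow> 'h" where
  "lincomb c X x = (\<Sum>i | c i \<noteq> 0. c i *\<^sub>R X i x)"

lemma lincomb_superset:
  assumes "finite S" "{i. c i \<noteq> 0} \<subseteq> S"
  shows "lincomb c X x = (\<Sum>i\<in>S. c i *\<^sub>R X i x)"
  unfolding lincomb_def by (rule sum.mono_neutral_left) (use assms in auto)

lemma cweights_mono: "m \<le> n \<Longrightarrow> cweights n \<subseteq> cweights m"
  by (auto simp: cweights_def)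

lemma cweights_unit: "(\<lambda>i. if i = n then 1 else 0) \<in> cweights n"
  by (auto simp: cweights_def)

lemma lincomb_unit: "lincomb (\<lambda>i. if i = n then 1 else 0) X x = X n x"
  by (simp add: lincomb_def)

lemma cmid_cweights:
  assumes c: "c \<in> cweights n" and d: "d \<in> cweights n"
  shows "cmid c d \<in> cweights n"
proof -
  let ?S = "{i. c i \<noteq> 0} \<union> {i. d i \<noteq> 0}"
  have fin: "finite ?S" using c d by (auto simp: cweights_def)
  have sub: "{i. cmid c d i \<noteq> 0} \<subseteq> ?S" by (auto simp: cmid_def)
  have "(\<Sum>i | cmid c d i \<noteq> 0. cmid c d i) = (\<Sum>i\<in>?S. cmid c d i)"
    by (rule sum.mono_neutral_left[OF fin sub]) auto
  also have "\<dots> = ((\<Sum>i\<in>?S. c i) + (\<Sum>i\<in>?S. d i)) / 2"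
    by (simp add: cmid_def sum.distrib sum_divide_distrib[symmetric])
  also have "(\<Sum>i\<in>?S. c i) = (\<Sum>i | c i \<noteq> 0. c i)"
    by (rule sum.mono_neutral_right[OF fin]) auto
  also have "(\<Sum>i\<in>?S. d i) = (\<Sum>i | d i \<noteq> 0. d i)"
    by (rule sum.mono_neutral_right[OF fin]) auto
  finally have "(\<Sum>i | cmid c d i \<noteq> 0. cmid c d i) = 1" using c d by (simp add: cweights_def)
  moreover have "finite {i. cmid c d i \<noteq> 0}" using fin sub by (rule finite_subset[rotated])
  moreover have "n \<le> i" if "cmid c d i \<noteq> 0" for i
  proof -
    have "c i \<noteq> 0 \<or> d i \<noteq> 0" using that by (auto simp: cmid_def)
    then show ?thesis using c d by (auto simp: cweights_def)
  qed
  moreover have "0 \<le> cmid c d i" for i using c d by (auto simp: cweights_def cmid_def)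
  ultimately show ?thesis by (simp add: cweights_def)
qed

lemma lincomb_cmid:
  assumes c: "c \<in> cweights n" and d: "d \<in> cweights n"
  shows "lincomb (cmid c d) X x = (1/2) *\<^sub>R (lincomb c X x + lincomb d X x)"
proof -
  let ?S = "{i. c i \<noteq> 0} \<union> {i. d i \<noteq> 0}"
  have fin: "finite ?S" using c d by (auto simp: cweights_def)
  have "{i. cmid c d i \<noteq> 0} \<subseteq> ?S" by (auto simp: cmid_def)
  note eqs = lincomb_superset[OF fin this, of X x] lincomb_superset[OF fin, of c X x] lincomb_superset[OF fin, of d X x]
  have "(\<Sum>i\<in>?S. cmid c d i *\<^sub>R X i x) = (1/2) *\<^sub>R ((\<Sum>i\<in>?S. c i *\<^sub>R X i x) + (\<Sum>i\<in>?S. d i *\<^sub>R X i x))"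
    unfolding sum.distrib[symmetric] scaleR_sum_right
    by (intro sum.cong refl) (simp add: cmid_def scaleR_add_left add_divide_distrib scaleR_add_right)
  then show ?thesis using eqs by simp
qed

text \<open>Almost minimisers of a quadratic functional over the convex hulls of the tails form a Cauchy
  sequence by the parallelogram identity; no weak compactness is needed.\<close>

lemma forward_convex_combinations:
  fixes q :: "(nat \<Rightarrow> real) \<Rightarrow> real"
  assumes nonneg: "\<And>c. c \<in> cweights 0 \<Longrightarrow> 0 \<le> q c"
    and bound: "\<And>n. q (\<lambda>i. if i = n then 1 else 0) \<le> C"
    and par: "\<And>c d. c \<in> cweights 0 \<Longrightarrow> d \<in> cweights 0 \<Longrightarrow> r c d = 2 * q c + 2 * q d - 4 * q (cmid c d)"
  shows "\<exists>c. (\<forall>n. c n \<in> cweights n) \<and> (\<forall>e>0. \<exists>N. \<forall>m\<ge>N. \<forall>n\<ge>N. r (c m) (c n) < e)"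
proof -
  have sub0: "cweights n \<subseteq> cweights 0" for n by (rule cweights_mono) simp
  \<comment> \<open>The infima over shrinking tails increase and are bounded by C, hence converge.
    The midpoint of two almost minimisers cannot lie below the infimum of the earlier tail, so their
    distance is small.\<close>
  define I where "I n = Inf (q ` cweights n)" for n
  have bdd: "bdd_below (q ` cweights n)" for n
    using nonneg sub0 by (intro bdd_belowI[of _ 0]) auto
  have ne: "q ` cweights n \<noteq> {}" for n using cweights_unit[of n] by auto
  have Ile: "I n \<le> q c" if "c \<in> cweights n" for n c
    unfolding I_def by (rule cInf_lower) (use that bdd in auto)
  have IC: "I n \<le> C" for n using Ile[OF cweights_unit[of n]] bound[of n] by simp
  have Imono: "incseq I"
    unfolding I_def by (intro incseq_SucI cInf_superset_mono ne bdd image_mono cweights_mono) auto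
  obtain L where L: "I \<longlonglongrightarrow> L" "\<And>n. I n \<le> L"
    using incseq_convergent[OF Imono, of C] IC by blast
  have "\<exists>c. c \<in> cweights n \<and> q c < I n + 1 / (real n + 1)" for n
  proof -
    have "Inf (q ` cweights n) < I n + 1 / (real n + 1)" by (simp add: I_def)
    from cInf_lessD[OF ne this] show ?thesis by auto
  qed
  then obtain c where c: "\<And>n. c n \<in> cweights n" "\<And>n. q (c n) < I n + 1 / (real n + 1)" by metis
  have est: "r (c m) (c n) < e" if e: "0 < e" and N: "L - e / 8 < I N" "1 / (real N + 1) < e / 8" and mn: "N \<le> n" "n \<le> m" for e N m n
  proof -
    have c0: "c m \<in> cweights 0" "c n \<in> cweights 0" using c(1) sub0 by auto
    have "c m \<in> cweights n" using c(1)[of m] cweights_mono[OF mn(2)] by auto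
    then have "I n \<le> q (cmid (c m) (c n))" by (intro Ile cmid_cweights c)
    moreover have "r (c m) (c n) = 2 * q (c m) + 2 * q (c n) - 4 * q (cmid (c m) (c n))" by (rule par[OF c0])
    moreover have "1 / (real n + 1) \<le> 1 / (real N + 1)" "1 / (real m + 1) \<le> 1 / (real N + 1)"
      using mn by (auto intro!: divide_left_mono)
    moreover have "I N \<le> I n" using incseqD[OF Imono mn(1)] .
    ultimately show ?thesis using c(2)[of m] c(2)[of n] L(2)[of m] N e by linarith
  qed
  have sym: "r (c m) (c n) = r (c n) (c m)" for m n
  proof -
    have "cmid (c m) (c n) = cmid (c n) (c m)" by (auto simp: cmid_def fun_eq_iff)
    moreover have "c m \<in> cweights 0" "c n \<in> cweights 0" using c(1) sub0 by auto
    ultimately show ?thesis using par[of "c m" "c n"] par[of "c n" "c m"] by simp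
  qed
  have "\<exists>N. \<forall>m\<ge>N. \<forall>n\<ge>N. r (c m) (c n) < e" if e: "0 < e" for e
  proof -
    have "\<forall>\<^sub>F N in sequentially. L - e / 8 < I N" using L(1) e by (intro order_tendstoD) auto
    moreover have "\<forall>\<^sub>F N in sequentially. 1 / (real N + 1) < e / 8"
    proof -
      have "(\<lambda>n. 1 / (real n + 1)) \<longlonglongrightarrow> 0"
        using LIMSEQ_inverse_real_of_nat by (simp add: inverse_eq_divide add.commute)
      then show ?thesis using e by (intro order_tendstoD) auto
    qed
    ultimately have "\<forall>\<^sub>F N in sequentially. L - e / 8 < I N \<and> 1 / (real N + 1) < e / 8" by eventually_elim simp
    then obtain N where N: "L - e / 8 < I N" "1 / (real N + 1) < e / 8" by (auto simp: eventually_sequentially)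
    show ?thesis
    proof (intro exI[of _ N] allI impI)
      fix m n assume "N \<le> m" "N \<le> n"
      then show "r (c m) (c n) < e"
        using est[OF e N, of n m] est[OF e N, of m n] sym[of m n] by (cases "n \<le> m") auto
    qed
  qed
  with c(1) show ?thesis by blast
qed

section \<open>Convex combinations of square integrable sequences\<close>

lemma L2H_sum:
  fixes F :: "'i \<Rightarrow> 'a \<Rightarrow> 'h::{real_inner, second_countable_topology}"
  assumes "\<And>i. i \<in> S \<Longrightarrow> L2H M (F i)"
  shows "L2H M (\<lambda>x. \<Sum>i\<in>S. F i x)"
proof (cases "finite S")
  case True
  then show ?thesis using assms
    by (induction S) (auto simp: L2H_add L2H_def[of M "\<lambda>x. 0"])
qed (simp add: L2H_def)

lemma lincomb_L2H:
  fixes X :: "nat \<Rightarrow> 'a \<Rightarrow> 'h::{real_inner, second_countable_topology}"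
  assumes "\<And>n. L2H M (X n)"
  shows "L2H M (lincomb c X)"
  unfolding lincomb_def[abs_def] by (intro L2H_sum L2H_scale assms)

lemma lincomb_parallelogram:
  fixes X :: "nat \<Rightarrow> 'a \<Rightarrow> 'h::{real_inner, second_countable_topology}"
  assumes X: "\<And>n. L2H M (X n)" and c: "c \<in> cweights k" and d: "d \<in> cweights k"
  shows "(\<integral>x. (norm (lincomb c X x - lincomb d X x))\<^sup>2 \<partial>M) = 2 * (\<integral>x. (norm (lincomb c X x))\<^sup>2 \<partial>M)
    + 2 * (\<integral>x. (norm (lincomb d X x))\<^sup>2 \<partial>M) - 4 * (\<integral>x. (norm (lincomb (cmid c d) X x))\<^sup>2 \<partial>M)"
proof -
  note L = lincomb_L2H[OF X]
  have par: "(norm (a - b))\<^sup>2 = 2 * (norm a)\<^sup>2 + 2 * (norm b)\<^sup>2 - 4 * (norm ((1/2) *\<^sub>R (a + b)))\<^sup>2" for a b :: 'h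
  proof -
    have "(norm ((1/2) *\<^sub>R (a + b)))\<^sup>2 = (1/4) * (norm (a + b))\<^sup>2" by (simp add: power_divide)
    then show ?thesis
      by (simp add: power2_norm_eq_inner inner_add_left inner_add_right inner_diff_left inner_diff_right inner_commute)
  qed
  have "(\<integral>x. (norm (lincomb c X x - lincomb d X x))\<^sup>2 \<partial>M)
    = (\<integral>x. 2 * (norm (lincomb c X x))\<^sup>2 + 2 * (norm (lincomb d X x))\<^sup>2 - 4 * (norm (lincomb (cmid c d) X x))\<^sup>2 \<partial>M)"
    by (intro Bochner_Integration.integral_cong) (simp_all add: lincomb_cmid[OF c d] par[of "lincomb c X _"])
  then show ?thesis
    using L2H_square_integrable[OF L[of c]] L2H_square_integrable[OF L[of d]] L2H_square_integrable[OF L[of "cmid c d"]]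
    by simp
qed

lemma lincomb_norm_square_le:
  fixes X :: "nat \<Rightarrow> 'a \<Rightarrow> 'h::real_normed_vector"
  assumes "c \<in> cweights k"
  shows "(norm (lincomb c X x))\<^sup>2 \<le> (\<Sum>i | c i \<noteq> 0. c i * (norm (X i x))\<^sup>2)"
  unfolding lincomb_def by (rule weighted_norm_square_le) (use assms in \<open>auto simp: cweights_def\<close>)

lemma lincomb_range:
  fixes X :: "nat \<Rightarrow> 'a \<Rightarrow> real"
  assumes c: "c \<in> cweights k" and X: "\<And>i. 0 \<le> X i x" "\<And>i. X i x \<le> K"
  shows "0 \<le> lincomb c X x" "lincomb c X x \<le> K"
proof -
  have c': "\<And>i. 0 \<le> c i" "(\<Sum>i | c i \<noteq> 0. c i) = 1" using c by (auto simp: cweights_def)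
  show "0 \<le> lincomb c X x" unfolding lincomb_def using c' X by (intro sum_nonneg) auto
  have "lincomb c X x \<le> (\<Sum>i | c i \<noteq> 0. c i * K)" unfolding lincomb_def using c' X by (intro sum_mono) (simp add: mult_left_mono)
  also have "\<dots> = K" using c' by (simp add: sum_distrib_right[symmetric])
  finally show "lincomb c X x \<le> K" .
qed

text \<open>Carries a bound valid for all late indices to forward combinations, whose weights see
  late indices only.\<close>

lemma lincomb_le_average:
  assumes c: "c \<in> cweights k" and a: "\<And>i. k \<le> i \<Longrightarrow> a i \<le> m"
  shows "(\<Sum>i | c i \<noteq> 0. c i * a i) \<le> m"
proof -
  have c': "\<And>i. 0 \<le> c i" "(\<Sum>i | c i \<noteq> 0. c i) = 1" "\<And>i. c i \<noteq> 0 \<Longrightarrow> k \<le> i" using c by (auto simp: cweights_def)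
  have "(\<Sum>i | c i \<noteq> 0. c i * a i) \<le> (\<Sum>i | c i \<noteq> 0. c i * m)" by (intro sum_mono mult_left_mono) (use c' a in auto)
  also have "\<dots> = m" using c' by (simp add: sum_distrib_right[symmetric])
  finally show ?thesis .
qed

lemma integral_lincomb:
  fixes X :: "nat \<Rightarrow> 'a \<Rightarrow> real"
  assumes "\<And>i. integrable M (\<lambda>x. X i x * h x)"
  shows "integrable M (\<lambda>x. lincomb c X x * h x)" "(\<integral>x. lincomb c X x * h x \<partial>M) = (\<Sum>i | c i \<noteq> 0. c i * (\<integral>x. X i x * h x \<partial>M))"
proof -
  have eq: "lincomb c X x * h x = (\<Sum>i | c i \<noteq> 0. c i * (X i x * h x))" for x
    by (simp add: lincomb_def sum_distrib_right mult.assoc)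
  show "integrable M (\<lambda>x. lincomb c X x * h x)" unfolding eq using assms by simp
  show "(\<integral>x. lincomb c X x * h x \<partial>M) = (\<Sum>i | c i \<noteq> 0. c i * (\<integral>x. X i x * h x \<partial>M))"
    unfolding eq using assms by (subst Bochner_Integration.integral_sum) auto
qed

lemma eventually_le_imp_bounded:
  fixes a :: "nat \<Rightarrow> real"
  assumes "\<forall>\<^sub>F n in sequentially. a n \<le> c"
  shows "\<exists>C\<ge>0. \<forall>n. a n \<le> C"
proof -
  from assms obtain N where N: "\<And>n. n \<ge> N \<Longrightarrow> a n \<le> c" by (auto simp: eventually_sequentially)
  show ?thesis
  proof (intro exI[of _ "\<bar>c\<bar> + (\<Sum>i<N. \<bar>a i\<bar>)"] conjI allI)
    show "0 \<le> \<bar>c\<bar> + (\<Sum>i<N. \<bar>a i\<bar>)" by (intro add_nonneg_nonneg sum_nonneg) auto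
    fix n
    show "a n \<le> \<bar>c\<bar> + (\<Sum>i<N. \<bar>a i\<bar>)"
    proof (cases "n < N")
      case True
      then have "\<bar>a n\<bar> \<le> (\<Sum>i<N. \<bar>a i\<bar>)" by (intro member_le_sum) auto
      then show ?thesis by linarith
    next
      case False
      have "0 \<le> (\<Sum>i<N. \<bar>a i\<bar>)" by (intro sum_nonneg) auto
      with False N[of n] show ?thesis by linarith
    qed
  qed
qed

lemma (in derivation) dom_clamp:
  assumes g: "g \<in> Dom"
  shows "(\<lambda>x. max (g x) 0 - max (max (g x) 0 - 1) 0) \<in> Dom"
  by (intro dom_diff dom_pos_part_shift dom_pos_part g) simp

text \<open>Elements of \<open>Dom\<close> clamped to [0, 1] approximate the indicator of {P >
  1/(k+1)} almost everywhere along a subsequence. That indicator is in L^2 because P is integrable,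
  and the clamping provides the majorant |P|.\<close>

lemma (in derivation) nonpos_of_tests:
  assumes P: "integrable M P"
    and test: "\<And>g. g \<in> Dom \<Longrightarrow> (\<And>x. 0 \<le> g x) \<Longrightarrow> (\<And>x. g x \<le> 1) \<Longrightarrow> (\<integral>x. g x * P x \<partial>M) \<le> 0"
  shows "AE x in M. P x \<le> 0"
proof -
  have [measurable]: "P \<in> borel_measurable M" using P by simp
  have "AE x in M. \<not> (1 / (real k + 1) < P x)" for k
  proof -
    define A where "A = {x \<in> space M. 1 / (real k + 1) < P x}"
    have [measurable]: "A \<in> sets M" unfolding A_def by measurable
    define u :: "'a \<Rightarrow> real" where "u = indicator A"
    have um [measurable]: "u \<in> borel_measurable M" by (simp add: u_def)
    have u2: "(u x)\<^sup>2 = u x" "0 \<le> u x" "u x \<le> 1" for x by (auto simp: u_def indicator_def)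
    have uP: "u x \<le> (real k + 1) * \<bar>P x\<bar>" for x
    proof (cases "x \<in> A")
      case True
      then have "1 / (real k + 1) < P x" by (simp add: A_def)
      then have "1 < (real k + 1) * P x" by (simp add: field_simps)
      moreover have "(real k + 1) * P x \<le> (real k + 1) * \<bar>P x\<bar>" by (intro mult_left_mono) auto
      ultimately have "1 \<le> (real k + 1) * \<bar>P x\<bar>" by linarith
      then show ?thesis using True by (simp add: u_def)
    qed (simp add: u_def)
    have ui: "integrable M u"
      by (rule Bochner_Integration.integrable_bound[where f="\<lambda>x. (real k + 1) * P x"])
         (use P uP u2 in \<open>auto simp: abs_mult\<close>)
    have uL: "L2 M u" using ui by (simp add: L2_def u2)
    have "\<exists>g\<in>Dom. l2norm M (\<lambda>x. u x - g x) < 1 / (real n + 1)" for n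
      by (rule dom_dense_L2[OF uL]) simp
    then obtain g where g: "\<And>n. g n \<in> Dom" "\<And>n. l2norm M (\<lambda>x. u x - g n x) < 1 / (real n + 1)" by metis
    have "(\<lambda>n. l2norm M (\<lambda>x. u x - g n x)) \<longlonglongrightarrow> 0"
    proof (rule tendsto_sandwich[OF _ _ tendsto_const])
      show "(\<lambda>n. 1 / (real n + 1)) \<longlonglongrightarrow> 0"
        using LIMSEQ_inverse_real_of_nat by (simp add: inverse_eq_divide add.commute)
      show "\<forall>\<^sub>F n in sequentially. l2norm M (\<lambda>x. u x - g n x) \<le> 1 / (real n + 1)"
        using g(2) by (intro always_eventually) (auto intro: less_imp_le)
      show "\<forall>\<^sub>F n in sequentially. 0 \<le> l2norm M (\<lambda>x. u x - g n x)" by (simp add: l2norm_def)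
    qed
    then have "(\<lambda>n. \<integral>x. (norm (u x - g n x))\<^sup>2 \<partial>M) \<longlonglongrightarrow> 0" by (simp add: l2norm_tendsto_0_iff)
    from square_integral_0_AE_subseq[OF _ this] uL g(1) dom_L2 obtain r :: "nat \<Rightarrow> nat"
      where r: "AE x in M. (\<lambda>n. u x - g (r n) x) \<longlonglongrightarrow> 0" by (auto simp: L2_iff_L2H intro: L2H_diff)
    define f where "f n x = max (g (r n) x) 0 - max (max (g (r n) x) 0 - 1) 0" for n x
    have fd: "f n \<in> Dom" for n unfolding f_def[abs_def] by (rule dom_clamp[OF g(1)])
    have f01: "0 \<le> f n x" "f n x \<le> 1" for n x by (auto simp: f_def max_def)
    have lim: "AE x in M. (\<lambda>n. f n x * P x) \<longlonglongrightarrow> u x * P x"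
      using r
    proof eventually_elim
      case (elim x)
      have "(\<lambda>n. u x - (u x - g (r n) x)) \<longlonglongrightarrow> u x - 0" by (intro tendsto_intros elim)
      then have "(\<lambda>n. g (r n) x) \<longlonglongrightarrow> u x" by simp
      then have "(\<lambda>n. f n x * P x) \<longlonglongrightarrow> (max (u x) 0 - max (max (u x) 0 - 1) 0) * P x"
        unfolding f_def by (intro tendsto_intros)
      then show ?case using u2[of x] by simp
    qed
    have [measurable]: "f n \<in> borel_measurable M" for n by (rule dom_measurable[OF fd])
    have "(\<lambda>n. \<integral>x. f n x * P x \<partial>M) \<longlonglongrightarrow> (\<integral>x. u x * P x \<partial>M)"
    proof (rule integral_dominated_convergence[where w="\<lambda>x. \<bar>P x\<bar>"])
      show "AE x in M. norm (f n x * P x) \<le> \<bar>P x\<bar>" for n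
        using f01 by (auto simp: abs_mult mult_left_le_one_le)
    qed (use P lim in auto)
    moreover have "(\<integral>x. f n x * P x \<partial>M) \<le> 0" for n by (rule test[OF fd f01])
    ultimately have le0: "(\<integral>x. u x * P x \<partial>M) \<le> 0" by (intro LIMSEQ_le_const2) auto
    have uPn: "0 \<le> u x * P x" for x
    proof (cases "x \<in> A")
      case True
      then have "1 / (real k + 1) < P x" by (simp add: A_def)
      then have "0 < P x" by (rule less_trans[rotated]) simp
      then show ?thesis using True by (simp add: u_def)
    qed (simp add: u_def)
    have "integrable M (\<lambda>x. u x * P x)"
      by (rule Bochner_Integration.integrable_bound[OF P]) (use u2 in \<open>auto simp: abs_mult mult_left_le_one_le\<close>)
    moreover have "(\<integral>x. u x * P x \<partial>M) = 0" using le0 uPn by (intro antisym) auto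
    ultimately have "AE x in M. u x * P x = 0"
      using integral_nonneg_eq_0_iff_AE[of M "\<lambda>x. u x * P x"] uPn by simp
    then show ?thesis using AE_space
    proof eventually_elim
      case (elim x)
      show ?case
      proof
        assume a: "1 / (real k + 1) < P x"
        then have "x \<in> A" using elim by (simp add: A_def)
        moreover have "0 < P x" using a by (rule less_trans[rotated]) simp
        ultimately show False using elim by (simp add: u_def)
      qed
    qed
  qed
  then have "AE x in M. \<forall>k. \<not> (1 / (real k + 1) < P x)" by (simp add: AE_all_countable)
  then show ?thesis
  proof eventually_elim
    case (elim x)
    show ?case
    proof (rule ccontr)
      assume "\<not> P x \<le> 0"
      then obtain k where "inverse (real (Suc k)) < P x" using reals_Archimedean[of "P x"] by auto
      then show False using elim by (simp add: inverse_eq_divide add.commute)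
    qed
  qed
qed

text \<open>For v >= 1/2 the ratio (1 + v)/(v + \<delta>) is at most 3; otherwise (v - 1)^2 >= 1/4
  and the trivial bound K applies. In this way L^2-convergence of the flow to the indicator makes
  the transform tend to K on B.\<close>

lemma log_trans_deficit:
  assumes v: "0 \<le> v" and t: "0 < t" and K: "0 < K"
  shows "K - log_trans t (exp (- K / t)) v \<le> t * ln 3 + 4 * K * (v - 1)\<^sup>2"
proof -
  define \<delta> where "\<delta> = exp (- K / t)"
  have \<delta>: "0 < \<delta>" "\<delta> < 1" using K t by (auto simp: \<delta>_def)
  have eq: "K - log_trans t \<delta> v = t * (ln (1 + v) - ln (v + \<delta>))"
  proof -
    have "t * ln \<delta> = - K" using t by (simp add: \<delta>_def)
    then show ?thesis by (simp add: log_trans_def right_diff_distrib)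
  qed
  show ?thesis
  proof (cases "1/2 \<le> v")
    case True
    have "ln (1 + v) \<le> ln (3 * (v + \<delta>))" using True \<delta> by (subst ln_le_cancel_iff) auto
    also have "\<dots> = ln 3 + ln (v + \<delta>)" using True \<delta> by (subst ln_mult) auto
    finally have "t * (ln (1 + v) - ln (v + \<delta>)) \<le> t * ln 3" using t by (intro mult_left_mono) auto
    moreover have "0 \<le> 4 * K * (v - 1)\<^sup>2" using K by simp
    ultimately show ?thesis using eq by (simp add: \<delta>_def)
  next
    case False
    have "(1/2)\<^sup>2 \<le> (1 - v)\<^sup>2" using False by (intro power_mono) auto
    then have "1 \<le> 4 * (v - 1)\<^sup>2" by (simp add: power2_commute power_divide)
    then have "K * 1 \<le> K * (4 * (v - 1)\<^sup>2)" using K by (intro mult_left_mono) auto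
    moreover have "0 \<le> t * ln 3" using t by simp
    moreover have "0 \<le> log_trans t \<delta> v" using log_trans_nonneg[OF \<delta> v] t by simp
    ultimately show ?thesis by (simp add: \<delta>_def)
  qed
qed

section \<open>The limiting profile\<close>

locale log_profile = heat_flow M Dom D b c V E Ef v v' B
  for M :: "'a measure" and Dom :: "('a \<Rightarrow> real) set"
    and D :: "('a \<Rightarrow> real) \<Rightarrow> 'a \<Rightarrow> 'h::{real_inner, complete_space, second_countable_topology}"
    and b c :: "'a \<Rightarrow> 'h" and V :: "'a \<Rightarrow> real" and E :: "nat \<Rightarrow> 'a set"
    and Ef :: "('a \<Rightarrow> real) \<Rightarrow> ('a \<Rightarrow> real) \<Rightarrow> real"
    and v v' :: "real \<Rightarrow> 'a \<Rightarrow> real" and B :: "'a set" +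
  fixes F :: "nat \<Rightarrow> 'a set" and \<zeta> :: "nat \<Rightarrow> 'a \<Rightarrow> real" and K :: real and J :: nat and tn :: "nat \<Rightarrow> real"
  assumes exhausts: "AE x in M. \<exists>l. x \<in> F l"
    and cut_dom: "\<And>l. \<zeta> l \<in> Dom" and cut_range: "\<And>l x. 0 \<le> \<zeta> l x" "\<And>l x. \<zeta> l x \<le> 1"
    and cut_one: "\<And>l x. x \<in> F l \<Longrightarrow> \<zeta> l x = 1"
    and cut_supp: "\<And>l. \<exists>k. AE x in M. x \<notin> E k \<longrightarrow> \<zeta> l x = 0"
    and K: "0 < K" and tn: "\<And>n. 0 < tn n" "\<And>n. tn n \<le> 1" "tn \<longlonglongrightarrow> 0"
begin

text \<open>Time in units of \<open>tn n\<close>: the nodes are \<open>tn n * \<sigma> j\<close>,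
  and j = J is the final time \<open>tn n\<close>. The node with j = 0 is positive, because the flow
  is placed in \<open>Dom\<close> at positive times only.\<close>

definition \<sigma> :: "nat \<Rightarrow> real" where "\<sigma> j = (real j + 1) / (real J + 1)"
definition del :: "nat \<Rightarrow> real" where "del n = exp (- K / tn n)"
definition Z :: "nat \<Rightarrow> nat \<Rightarrow> 'a \<Rightarrow> real" where "Z n j = lv (tn n) (del n) (tn n * \<sigma> j)"
definition pw where "pw n j = (SOME pw. window (tn n) (del n) (tn n * \<sigma> j) (tn n * \<sigma> (Suc j)) (fst pw) (snd pw))"
definition Zb :: "nat \<Rightarrow> nat \<Rightarrow> 'a \<Rightarrow> real" where "Zb n j = wavg (tn n) (del n) (fst (pw n j)) (snd (pw n j))"

lemma \<sigma>: "0 < \<sigma> j" "\<sigma> (Suc j) - \<sigma> j = 1 / (real J + 1)" "\<sigma> J = 1"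
proof -
  show "0 < \<sigma> j" by (simp add: \<sigma>_def)
  show "\<sigma> J = 1" by (simp add: \<sigma>_def)
  show "\<sigma> (Suc j) - \<sigma> j = 1 / (real J + 1)" by (simp add: \<sigma>_def diff_divide_distrib[symmetric])
qed

lemma \<sigma>_mono: "i \<le> j \<Longrightarrow> \<sigma> i \<le> \<sigma> j"
  by (simp add: \<sigma>_def divide_right_mono)

lemma del: "0 < del n" "del n < 1" "tn n * (- ln (del n)) = K"
  using K tn(1)[of n] by (auto simp: del_def)

lemma lv_bounds: "0 < s \<Longrightarrow> 0 \<le> lv (tn n) (del n) s x" "0 < s \<Longrightarrow> lv (tn n) (del n) s x \<le> K"
  using lv_range[OF tn(1)[of n] del(1,2)[of n], of s x] del(3)[of n] by auto

lemma Z_dom: "Z n j \<in> Dom" "0 \<le> Z n j x" "Z n j x \<le> K"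
proof -
  have "0 < tn n * \<sigma> j" using tn(1) \<sigma>(1) by simp
  then show "Z n j \<in> Dom" "0 \<le> Z n j x" "Z n j x \<le> K"
    using lv_dom(1)[OF tn(1)[of n] del(1,2)[of n]] lv_range[OF tn(1)[of n] del(1,2)[of n]] del(3)[of n]
    by (auto simp: Z_def)
qed

lemma pw_window: "window (tn n) (del n) (tn n * \<sigma> j) (tn n * \<sigma> (Suc j)) (fst (pw n j)) (snd (pw n j))"
proof -
  have "0 < 1 / (real J + 1)" by simp
  then have "\<sigma> j < \<sigma> (Suc j)" using \<sigma>(2)[of j] by linarith
  then have "tn n * \<sigma> j < tn n * \<sigma> (Suc j)" using tn(1)[of n] by simp
  moreover have "0 < tn n * \<sigma> j" using tn(1) \<sigma>(1) by simp
  ultimately obtain p w where "window (tn n) (del n) (tn n * \<sigma> j) (tn n * \<sigma> (Suc j)) p w"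
    using window_exists[OF tn(1,2) del(1,2)] by blast
  then have "\<exists>q. window (tn n) (del n) (tn n * \<sigma> j) (tn n * \<sigma> (Suc j)) (fst q) (snd q)" by (intro exI[of _ "(p, w)"]) simp
  then show ?thesis unfolding pw_def by (rule someI_ex)
qed

lemma Zb_dom: "Zb n j \<in> Dom" "0 \<le> Zb n j x" "Zb n j x \<le> K"
proof -
  have "0 < tn n * \<sigma> j" using tn(1) \<sigma>(1) by simp
  from wavg_dom[OF tn(1) del(1,2) this pw_window]
  show "Zb n j \<in> Dom" "0 \<le> Zb n j x" "Zb n j x \<le> K" using del(3)[of n] by (auto simp: Zb_def)
qed

text \<open>Between neighbouring nodes t/(\<beta> - \<alpha>) equals J + 1. With J fixed, the errors
  of \<open>window_energy\<close> and \<open>lv_almost_mono\<close> are therefore O(tn n), uniformly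
  in j.\<close>

lemma test_limits:
  assumes tp: "test_pair \<xi> h"
  shows "\<exists>e. e \<longlonglongrightarrow> 0 \<and> (\<forall>\<^sub>F n in sequentially. \<forall>j.
    (1/2) * (\<integral>x. h x * (norm (D (Zb n j) x))\<^sup>2 \<partial>M) \<le> (real J + 1) * ((\<integral>x. Z n (Suc j) x * h x \<partial>M) - (\<integral>x. Z n j x * h x \<partial>M)) + e n
    \<and> (\<integral>x. Z n j x * h x \<partial>M) \<le> (\<integral>x. Zb n j x * h x \<partial>M) + e n
    \<and> (\<integral>x. Zb n j x * h x \<partial>M) \<le> (\<integral>x. Z n (Suc j) x * h x \<partial>M) + e n)"
proof -
  from window_energy[OF tp K] obtain C1 t1 where C1: "0 \<le> C1" "0 < t1"
    and W: "\<And>t \<alpha> \<beta> p w. 0 < t \<Longrightarrow> t \<le> t1 \<Longrightarrow> 0 < \<alpha> \<Longrightarrow> \<alpha> < \<beta> \<Longrightarrow> window t (exp (- K / t)) \<alpha> \<beta> p w \<Longrightarrow>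
    (1/2) * (\<integral>x. h x * (norm (D (wavg t (exp (- K / t)) p w) x))\<^sup>2 \<partial>M)
      \<le> (t / (\<beta> - \<alpha>)) * ((\<integral>x. lv t (exp (- K / t)) \<beta> x * h x \<partial>M) - (\<integral>x. lv t (exp (- K / t)) \<alpha> x * h x \<partial>M)) + C1 * t * (1 + t / (\<beta> - \<alpha>))"
    by blast
  from lv_almost_mono[OF tp K] obtain C2 t2 where C2: "0 \<le> C2" "0 < t2"
    and mono: "\<And>t \<alpha> \<beta>. 0 < t \<Longrightarrow> t \<le> t2 \<Longrightarrow> 0 < \<alpha> \<Longrightarrow> \<alpha> \<le> \<beta> \<Longrightarrow>
    (\<integral>x. lv t (exp (- K / t)) \<alpha> x * h x \<partial>M) \<le> (\<integral>x. lv t (exp (- K / t)) \<beta> x * h x \<partial>M) + C2 * (\<beta> - \<alpha> + t)" by blast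
  define e where "e n = (C1 * (1 + (real J + 1)) + 2 * C2) * tn n" for n
  have hd: "h \<in> Dom" using tp by (simp add: test_pair_def)
  have "e \<longlonglongrightarrow> 0" unfolding e_def[abs_def] using tendsto_mult_right_zero[OF tn(3)] by simp
  moreover have "\<forall>\<^sub>F n in sequentially. \<forall>j.
    (1/2) * (\<integral>x. h x * (norm (D (Zb n j) x))\<^sup>2 \<partial>M) \<le> (real J + 1) * ((\<integral>x. Z n (Suc j) x * h x \<partial>M) - (\<integral>x. Z n j x * h x \<partial>M)) + e n
    \<and> (\<integral>x. Z n j x * h x \<partial>M) \<le> (\<integral>x. Zb n j x * h x \<partial>M) + e n
    \<and> (\<integral>x. Zb n j x * h x \<partial>M) \<le> (\<integral>x. Z n (Suc j) x * h x \<partial>M) + e n"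
    using order_tendstoD(2)[OF tn(3) C1(2)] order_tendstoD(2)[OF tn(3) C2(2)]
  proof eventually_elim
    case (elim n)
    show ?case
    proof
      fix j
      let ?t = "tn n" and ?a = "tn n * \<sigma> j" and ?b = "tn n * \<sigma> (Suc j)"
      have a0: "0 < ?a" using tn(1) \<sigma>(1) by simp
      have ba: "?b - ?a = ?t / (real J + 1)" using \<sigma>(2)[of j] by (simp add: right_diff_distrib[symmetric])
      have ba0: "0 < ?t / (real J + 1)" using tn(1) by simp
      have bat: "?t / (real J + 1) \<le> ?t" using tn(1)[of n] by (simp add: divide_le_eq mult_le_cancel_left1 pos_divide_le_eq)
      have ab: "?a < ?b" using ba ba0 by linarith
      have ratio: "?t / (?b - ?a) = real J + 1" unfolding ba using tn(1)[of n] by simp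
      have win: "window ?t (exp (- K / ?t)) ?a ?b (fst (pw n j)) (snd (pw n j))"
        using pw_window[of n j] by (simp add: del_def)
      have en: "0 \<le> (C1 * (1 + (real J + 1))) * tn n" "0 \<le> 2 * C2 * tn n"
        using C1 C2 tn(1)[of n] by auto
      have ee: "e n = (C1 * (1 + (real J + 1))) * tn n + 2 * C2 * tn n" by (simp add: e_def algebra_simps)
      have 1: "(1/2) * (\<integral>x. h x * (norm (D (Zb n j) x))\<^sup>2 \<partial>M) \<le> (real J + 1) * ((\<integral>x. Z n (Suc j) x * h x \<partial>M) - (\<integral>x. Z n j x * h x \<partial>M)) + e n"
      proof -
        have "(1/2) * (\<integral>x. h x * (norm (D (Zb n j) x))\<^sup>2 \<partial>M) \<le> (real J + 1) * ((\<integral>x. Z n (Suc j) x * h x \<partial>M) - (\<integral>x. Z n j x * h x \<partial>M)) + C1 * ?t * (1 + (real J + 1))"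
          using W[OF tn(1) less_imp_le[OF elim(1)] a0 ab win] unfolding ratio by (simp add: Zb_def Z_def del_def)
        then show ?thesis using ee en by (simp add: ac_simps)
      qed
      define p where "p = fst (pw n j)"
      define w where "w = snd (pw n j)"
      have w: "\<And>q. q \<in> p \<Longrightarrow> 0 \<le> w q" "(\<Sum>q\<in>p. w q) = 1"
        and s: "\<And>q. q \<in> p \<Longrightarrow> ?a \<le> fst q" "\<And>q. q \<in> p \<Longrightarrow> fst q \<le> ?b"
        using pw_window[of n j] by (force simp: window_def p_def w_def)+
      have s0: "0 < fst q" if "q \<in> p" for q using s(1)[OF that] a0 by linarith
      have eqb: "(\<integral>x. Zb n j x * h x \<partial>M) = (\<Sum>q\<in>p. w q * (\<integral>x. lv ?t (del n) (fst q) x * h x \<partial>M))"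
      proof -
        have "(\<integral>x. Zb n j x * h x \<partial>M) = (\<integral>x. (\<Sum>q\<in>p. w q * (lv ?t (del n) (fst q) x * h x)) \<partial>M)"
          by (intro Bochner_Integration.integral_cong) (auto simp: Zb_def wavg_def p_def w_def sum_distrib_right mult.assoc)
        also have "\<dots> = (\<Sum>q\<in>p. w q * (\<integral>x. lv ?t (del n) (fst q) x * h x \<partial>M))"
          by (subst Bochner_Integration.integral_sum)
             (auto intro!: integrable_mult_right L2_product_integrable dom_L2 lv_dom tn del s0 hd)
        finally show ?thesis .
      qed
      have 2: "(\<integral>x. Z n j x * h x \<partial>M) \<le> (\<integral>x. Zb n j x * h x \<partial>M) + e n"
      proof -
        have "(\<integral>x. Z n j x * h x \<partial>M) - 2 * C2 * tn n \<le> (\<integral>x. lv ?t (del n) (fst q) x * h x \<partial>M)" if q: "q \<in> p" for q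
        proof -
          have "(\<integral>x. Z n j x * h x \<partial>M) \<le> (\<integral>x. lv ?t (del n) (fst q) x * h x \<partial>M) + C2 * (fst q - ?a + ?t)"
            using mono[OF tn(1) less_imp_le[OF elim(2)] a0 s(1)[OF q]] by (simp add: Z_def del_def)
          moreover have "C2 * (fst q - ?a + ?t) \<le> C2 * (2 * ?t)"
            using C2 s(2)[OF q] ba bat by (intro mult_left_mono) auto
          ultimately show ?thesis by simp
        qed
        then have "(\<Sum>q\<in>p. w q * ((\<integral>x. Z n j x * h x \<partial>M) - 2 * C2 * tn n)) \<le> (\<integral>x. Zb n j x * h x \<partial>M)"
          unfolding eqb by (intro sum_mono mult_left_mono w)
        then have "(\<integral>x. Z n j x * h x \<partial>M) - 2 * C2 * tn n \<le> (\<integral>x. Zb n j x * h x \<partial>M)"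
          by (simp only: sum_distrib_right[symmetric] w(2) mult_1_left)
        then show ?thesis using ee en by linarith
      qed
      have 3: "(\<integral>x. Zb n j x * h x \<partial>M) \<le> (\<integral>x. Z n (Suc j) x * h x \<partial>M) + e n"
      proof -
        have "(\<integral>x. lv ?t (del n) (fst q) x * h x \<partial>M) \<le> (\<integral>x. Z n (Suc j) x * h x \<partial>M) + 2 * C2 * tn n" if q: "q \<in> p" for q
        proof -
          have "(\<integral>x. lv ?t (del n) (fst q) x * h x \<partial>M) \<le> (\<integral>x. Z n (Suc j) x * h x \<partial>M) + C2 * (?b - fst q + ?t)"
            using mono[OF tn(1) less_imp_le[OF elim(2)] s0[OF q] s(2)[OF q]] by (simp add: Z_def del_def)
          moreover have "C2 * (?b - fst q + ?t) \<le> C2 * (2 * ?t)"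
            using C2 s(1)[OF q] ba bat by (intro mult_left_mono) auto
          ultimately show ?thesis by simp
        qed
        then have "(\<integral>x. Zb n j x * h x \<partial>M) \<le> (\<Sum>q\<in>p. w q * ((\<integral>x. Z n (Suc j) x * h x \<partial>M) + 2 * C2 * tn n))"
          unfolding eqb by (intro sum_mono mult_left_mono w)
        also have "\<dots> = (\<integral>x. Z n (Suc j) x * h x \<partial>M) + 2 * C2 * tn n"
          by (simp only: sum_distrib_right[symmetric] w(2) mult_1_left)
        finally show ?thesis using ee en by linarith
      qed
      show "(1/2) * (\<integral>x. h x * (norm (D (Zb n j) x))\<^sup>2 \<partial>M) \<le> (real J + 1) * ((\<integral>x. Z n (Suc j) x * h x \<partial>M) - (\<integral>x. Z n j x * h x \<partial>M)) + e n
        \<and> (\<integral>x. Z n j x * h x \<partial>M) \<le> (\<integral>x. Zb n j x * h x \<partial>M) + e n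
        \<and> (\<integral>x. Zb n j x * h x \<partial>M) \<le> (\<integral>x. Z n (Suc j) x * h x \<partial>M) + e n"
        using 1 2 3 by blast
    qed
  qed
  ultimately show ?thesis by blast
qed

lemma B_measurable: "B \<in> sets M" "emeasure M B < \<infinity>"
  using B by (auto simp: B0_def)

lemma integrable_on_finite:
  fixes f :: "'a \<Rightarrow> real"
  assumes "A \<in> sets M" "emeasure M A < \<infinity>" "f \<in> borel_measurable M" "AE x in M. \<bar>f x\<bar> \<le> C"
  shows "integrable M (\<lambda>x. indicator A x * f x)"
proof (rule Bochner_Integration.integrable_bound[where f="\<lambda>x. C * indicator A x"])
  show "AE x in M. norm (indicator A x * f x) \<le> norm (C * indicator A x)"
    using assms(4) by eventually_elim (auto simp: indicator_def)
qed (use assms in auto)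

text \<open>\<open>log_trans_deficit\<close> integrated over B: the first part is O(tn n), the
  second is bounded by the squared L^2-distance of the flow from the indicator. For j < J all times
  of the window are at most \<open>tn n\<close>, so this distance tends to 0.\<close>

lemma Zb_on_B:
  assumes "j < J"
  shows "(\<lambda>n. \<integral>x. indicator B x * (K - Zb n j x) \<partial>M) \<longlonglongrightarrow> 0"
proof (rule LIMSEQ_I)
  fix r :: real assume r: "0 < r"
  have [measurable]: "B \<in> sets M" by (rule B_measurable)
  define mB where "mB = measure M B"
  \<comment> \<open>The term 4 K \<epsilon> becomes r/4 and fits beside the other contribution,
    which is kept below r/2.\<close>
  define \<epsilon> where "\<epsilon> = r / (16 * K)"
  have e0: "0 < \<epsilon>" using r K by (simp add: \<epsilon>_def)
  from order_tendstoD(2)[OF v_init e0] obtain s0 where s0: "0 < s0"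
    "\<And>s. 0 < s \<Longrightarrow> s < s0 \<Longrightarrow> (\<integral>x. (v s x - indicator B x)\<^sup>2 \<partial>M) < \<epsilon>"
    by (auto simp: eventually_at_right_field)
  have "(\<lambda>n. tn n * (ln 3 * mB)) \<longlonglongrightarrow> 0" using tendsto_mult_left_zero[OF tn(3)] by simp
  then have "\<forall>\<^sub>F n in sequentially. tn n * (ln 3 * mB) < r / 2" using r by (intro order_tendstoD) auto
  moreover have "\<forall>\<^sub>F n in sequentially. tn n < s0" by (rule order_tendstoD(2)[OF tn(3) s0(1)])
  ultimately have "\<forall>\<^sub>F n in sequentially. norm ((\<integral>x. indicator B x * (K - Zb n j x) \<partial>M) - 0) < r"
  proof eventually_elim
    case (elim n)
    have le: "(\<integral>x. indicator B x * (K - lv (tn n) (del n) s x) \<partial>M) \<le> tn n * (ln 3 * mB) + 4 * K * \<epsilon>" if s: "0 < s" "s \<le> tn n" for s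
    proof -
      have vL: "L2 M (v s)" by (rule dom_L2[OF v_dom[OF s(1)]])
      have [measurable]: "v s \<in> borel_measurable M" using vL by (simp add: L2_def)
      have BL: "L2 M (indicator B :: 'a \<Rightarrow> real)"
      proof -
        have "(indicator B x :: real)\<^sup>2 = indicator B x" for x by (simp add: indicator_def)
        then show ?thesis using B_measurable by (simp add: L2_def)
      qed
      have i1: "integrable M (\<lambda>x. (v s x - indicator B x)\<^sup>2)" by (intro L2_square_integrable L2_diff vL BL)
      have i2: "integrable M (\<lambda>x. tn n * ln 3 * indicator B x)" using B_measurable by simp
      have "(\<integral>x. indicator B x * (K - lv (tn n) (del n) s x) \<partial>M) \<le> (\<integral>x. tn n * ln 3 * indicator B x + 4 * K * (v s x - indicator B x)\<^sup>2 \<partial>M)"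
      proof (rule integral_mono)
        show "integrable M (\<lambda>x. indicator B x * (K - lv (tn n) (del n) s x))"
        proof (rule integrable_on_finite[where C=K])
          show "(\<lambda>x. K - lv (tn n) (del n) s x) \<in> borel_measurable M"
            using dom_measurable[OF lv_dom(1)[OF tn(1) del(1,2) s(1)]] by measurable
          show "AE x in M. \<bar>K - lv (tn n) (del n) s x\<bar> \<le> K"
            using lv_bounds[OF s(1)] by (intro AE_I2) simp
        qed (rule B_measurable)+
        show "integrable M (\<lambda>x. tn n * ln 3 * indicator B x + 4 * K * (v s x - indicator B x)\<^sup>2)" using i1 i2 by simp
        fix x
        show "indicator B x * (K - lv (tn n) (del n) s x) \<le> tn n * ln 3 * indicator B x + 4 * K * (v s x - indicator B x)\<^sup>2"
        proof (cases "x \<in> B")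
          case True
          then show ?thesis using log_trans_deficit[OF v_nonneg[OF s(1), of x] tn(1)[of n] K] by (simp add: lv_def del_def)
        next
          case False
          then show ?thesis using K by simp
        qed
      qed
      also have "\<dots> = tn n * (ln 3 * mB) + 4 * K * (\<integral>x. (v s x - indicator B x)\<^sup>2 \<partial>M)"
        using i1 i2 by (simp add: mB_def)
      also have "\<dots> \<le> tn n * (ln 3 * mB) + 4 * K * \<epsilon>"
        using s0(2)[OF s(1)] s elim(2) K by (intro add_left_mono mult_left_mono less_imp_le) auto
      finally show ?thesis .
    qed
    define p where "p = fst (pw n j)"
    define w where "w = snd (pw n j)"
    have w: "\<And>q. q \<in> p \<Longrightarrow> 0 \<le> w q" "(\<Sum>q\<in>p. w q) = 1"
      and s: "\<And>q. q \<in> p \<Longrightarrow> tn n * \<sigma> j \<le> fst q" "\<And>q. q \<in> p \<Longrightarrow> fst q \<le> tn n * \<sigma> (Suc j)"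
      using pw_window[of n j] by (force simp: window_def p_def w_def)+
    have q0: "0 < fst q" if "q \<in> p" for q
    proof -
      have "0 < tn n * \<sigma> j" using tn(1) \<sigma>(1) by simp
      then show ?thesis using s(1)[OF that] by linarith
    qed
    have q1: "fst q \<le> tn n" if "q \<in> p" for q
    proof -
      have "\<sigma> (Suc j) \<le> \<sigma> J" using assms by (intro \<sigma>_mono) simp
      then have "tn n * \<sigma> (Suc j) \<le> tn n * 1" using tn(1)[of n] \<sigma>(3) by (intro mult_left_mono) auto
      then show ?thesis using s(2)[OF that] by simp
    qed
    have lvi: "integrable M (\<lambda>x. indicator B x * (K - lv (tn n) (del n) (fst q) x))" if "q \<in> p" for q
    proof (rule integrable_on_finite[where C=K])
      show "(\<lambda>x. K - lv (tn n) (del n) (fst q) x) \<in> borel_measurable M"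
        using dom_measurable[OF lv_dom(1)[OF tn(1) del(1,2) q0[OF that]]] by measurable
      show "AE x in M. \<bar>K - lv (tn n) (del n) (fst q) x\<bar> \<le> K"
        using lv_bounds[OF q0[OF that]] by (intro AE_I2) simp
    qed (rule B_measurable)+
    have "(\<integral>x. indicator B x * (K - Zb n j x) \<partial>M) = (\<integral>x. (\<Sum>q\<in>p. w q * (indicator B x * (K - lv (tn n) (del n) (fst q) x))) \<partial>M)"
    proof (intro Bochner_Integration.integral_cong refl)
      fix x
      have "(\<Sum>q\<in>p. w q * (indicator B x * (K - lv (tn n) (del n) (fst q) x)))
        = indicator B x * (\<Sum>q\<in>p. w q * K - w q * lv (tn n) (del n) (fst q) x)"
        by (simp add: sum_distrib_left right_diff_distrib mult.left_commute)
      also have "(\<Sum>q\<in>p. w q * K - w q * lv (tn n) (del n) (fst q) x) = K - Zb n j x"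
        by (simp add: sum_subtractf sum_distrib_right[symmetric] w(2) Zb_def wavg_def p_def[symmetric] w_def[symmetric])
      finally show "indicator B x * (K - Zb n j x) = (\<Sum>q\<in>p. w q * (indicator B x * (K - lv (tn n) (del n) (fst q) x)))" by simp
    qed
    also have "\<dots> = (\<Sum>q\<in>p. w q * (\<integral>x. indicator B x * (K - lv (tn n) (del n) (fst q) x) \<partial>M))"
      using lvi by (subst Bochner_Integration.integral_sum) auto
    also have "\<dots> \<le> (\<Sum>q\<in>p. w q * (tn n * (ln 3 * mB) + 4 * K * \<epsilon>))"
      by (intro sum_mono mult_left_mono le w q0 q1)
    also have "\<dots> = tn n * (ln 3 * mB) + 4 * K * \<epsilon>" by (simp only: sum_distrib_right[symmetric] w(2) mult_1_left)
    also have "\<dots> < r" using elim(1) K r by (simp add: \<epsilon>_def)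
    finally have "(\<integral>x. indicator B x * (K - Zb n j x) \<partial>M) < r" .
    moreover have "0 \<le> (\<integral>x. indicator B x * (K - Zb n j x) \<partial>M)" using Zb_dom(3) by (intro Bochner_Integration.integral_nonneg) auto
    ultimately show ?case by simp
  qed
  then show "\<exists>n0. \<forall>n\<ge>n0. norm ((\<integral>x. indicator B x * (K - Zb n j x) \<partial>M) - 0) < r"
    by (simp add: eventually_sequentially)
qed

lemma cut_test: "test_pair (\<zeta> l) (\<lambda>x. (\<zeta> l x)\<^sup>2)"
  "g \<in> Dom \<Longrightarrow> (\<And>x. 0 \<le> g x) \<Longrightarrow> (\<And>x. g x \<le> 1) \<Longrightarrow> test_pair (\<zeta> l) (\<lambda>x. (\<zeta> l x)\<^sup>2 * g x)"
proof -
  obtain k where k: "AE x in M. x \<notin> E k \<longrightarrow> \<zeta> l x = 0" using cut_supp by blast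
  show "test_pair (\<zeta> l) (\<lambda>x. (\<zeta> l x)\<^sup>2)"
    by (rule test_pair_square(1)[OF cut_dom cut_range k dom_zero]) auto
  show "g \<in> Dom \<Longrightarrow> (\<And>x. 0 \<le> g x) \<Longrightarrow> (\<And>x. g x \<le> 1) \<Longrightarrow> test_pair (\<zeta> l) (\<lambda>x. (\<zeta> l x)\<^sup>2 * g x)"
    by (rule test_pair_square(2)[OF cut_dom cut_range k])
qed

text \<open>The right side of the tested inequality is an increment of integrals of
  \<open>Z\<close>, hence bounded in terms of K and the integral of the squared cutoff. Summing over
  j before passing from late n to all n yields a single constant.\<close>

lemma local_energy_bound: "\<exists>C\<ge>0. \<forall>n. \<forall>j<J. (\<integral>x. (\<zeta> l x)\<^sup>2 * (norm (D (Zb n j) x))\<^sup>2 \<partial>M) \<le> C"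
proof -
  from test_limits[OF cut_test(1)[of l]] obtain e where e: "e \<longlonglongrightarrow> 0" "\<forall>\<^sub>F n in sequentially. \<forall>j.
    (1/2) * (\<integral>x. (\<zeta> l x)\<^sup>2 * (norm (D (Zb n j) x))\<^sup>2 \<partial>M) \<le> (real J + 1) * ((\<integral>x. Z n (Suc j) x * (\<zeta> l x)\<^sup>2 \<partial>M) - (\<integral>x. Z n j x * (\<zeta> l x)\<^sup>2 \<partial>M)) + e n
    \<and> (\<integral>x. Z n j x * (\<zeta> l x)\<^sup>2 \<partial>M) \<le> (\<integral>x. Zb n j x * (\<zeta> l x)\<^sup>2 \<partial>M) + e n
    \<and> (\<integral>x. Zb n j x * (\<zeta> l x)\<^sup>2 \<partial>M) \<le> (\<integral>x. Z n (Suc j) x * (\<zeta> l x)\<^sup>2 \<partial>M) + e n"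
    by blast
  define S where "S = (\<integral>x. (\<zeta> l x)\<^sup>2 \<partial>M)"
  have sqd: "(\<lambda>x. (\<zeta> l x)\<^sup>2) \<in> Dom" using cut_test(1)[of l] by (simp add: test_pair_def)
  have Zle: "(\<integral>x. Z n j x * (\<zeta> l x)\<^sup>2 \<partial>M) \<le> K * S" for n j
  proof -
    have "(\<integral>x. Z n j x * (\<zeta> l x)\<^sup>2 \<partial>M) \<le> (\<integral>x. K * (\<zeta> l x)\<^sup>2 \<partial>M)"
      by (intro integral_mono L2_product_integrable dom_L2 Z_dom sqd integrable_mult_right dom_square_integrable cut_dom mult_right_mono) auto
    then show ?thesis by (simp add: S_def)
  qed
  have Zge: "0 \<le> (\<integral>x. Z n j x * (\<zeta> l x)\<^sup>2 \<partial>M)" for n j using Z_dom(2) by (intro Bochner_Integration.integral_nonneg) auto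
  have aux: "(1/2) * q \<le> r + d \<Longrightarrow> r \<le> r' \<Longrightarrow> d < 1 \<Longrightarrow> q \<le> 2 * (r' + 1)" for q r r' d :: real
    by argo
  have ev: "\<forall>\<^sub>F n in sequentially. (\<Sum>j<J. (\<integral>x. (\<zeta> l x)\<^sup>2 * (norm (D (Zb n j) x))\<^sup>2 \<partial>M)) \<le> (\<Sum>j<J. 2 * ((real J + 1) * (K * S) + 1))"
    using e(2) order_tendstoD(2)[OF e(1) zero_less_one]
  proof eventually_elim
    case (elim n)
    show ?case
    proof (rule sum_mono)
      fix j
      have "(real J + 1) * ((\<integral>x. Z n (Suc j) x * (\<zeta> l x)\<^sup>2 \<partial>M) - (\<integral>x. Z n j x * (\<zeta> l x)\<^sup>2 \<partial>M)) \<le> (real J + 1) * (K * S)"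
        using Zle[of n "Suc j"] Zge[of n j] by (intro mult_left_mono) auto
      then show "(\<integral>x. (\<zeta> l x)\<^sup>2 * (norm (D (Zb n j) x))\<^sup>2 \<partial>M) \<le> 2 * ((real J + 1) * (K * S) + 1)"
        by (rule aux[OF elim(1)[rule_format, of j, THEN conjunct1] _ elim(2)])
    qed
  qed
  from eventually_le_imp_bounded[OF ev] obtain C where C: "0 \<le> C" "\<And>n. (\<Sum>j<J. (\<integral>x. (\<zeta> l x)\<^sup>2 * (norm (D (Zb n j) x))\<^sup>2 \<partial>M)) \<le> C" by blast
  have "(\<integral>x. (\<zeta> l x)\<^sup>2 * (norm (D (Zb n j) x))\<^sup>2 \<partial>M) \<le> C" if "j < J" for n j
  proof -
    have "(\<integral>x. (\<zeta> l x)\<^sup>2 * (norm (D (Zb n j) x))\<^sup>2 \<partial>M) \<le> (\<Sum>j<J. (\<integral>x. (\<zeta> l x)\<^sup>2 * (norm (D (Zb n j) x))\<^sup>2 \<partial>M))"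
      using that by (intro member_le_sum[of j "{..<J}" "\<lambda>j. \<integral>x. (\<zeta> l x)\<^sup>2 * (norm (D (Zb n j) x))\<^sup>2 \<partial>M"]) auto
    then show ?thesis using C(2)[of n] by linarith
  qed
  with C(1) show ?thesis by blast
qed

lemma cut_measurable [measurable]: "\<zeta> l \<in> borel_measurable M"
  by (rule dom_measurable[OF cut_dom])

text \<open>The gradients are bounded only after localisation, with bounds depending on the cutoff; a
  summable weight puts all of them into one Hilbert space.\<close>

lemma weight_exists:
  "\<exists>\<Theta>. \<Theta> \<in> borel_measurable M \<and> (\<forall>x. 0 \<le> \<Theta> x \<and> \<Theta> x \<le> 2) \<and> (\<forall>l. \<exists>C>0. \<forall>x. (\<zeta> l x)\<^sup>2 \<le> C * \<Theta> x)
    \<and> (\<forall>n. \<forall>j<J. (\<integral>x. \<Theta> x * (norm (D (Zb n j) x))\<^sup>2 \<partial>M) \<le> 2)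
    \<and> integrable M \<Theta> \<and> (\<integral>x. \<Theta> x \<partial>M) \<le> 2"
proof -
  have "\<exists>C. \<forall>l. 0 \<le> C l \<and> (\<forall>n. \<forall>j<J. (\<integral>x. (\<zeta> l x)\<^sup>2 * (norm (D (Zb n j) x))\<^sup>2 \<partial>M) \<le> C l)"
    by (intro choice allI) (use local_energy_bound in blast)
  then obtain C where C: "\<And>l. 0 \<le> C l" "\<And>l n j. j < J \<Longrightarrow> (\<integral>x. (\<zeta> l x)\<^sup>2 * (norm (D (Zb n j) x))\<^sup>2 \<partial>M) \<le> C l" by blast
  define S where "S l = (\<integral>x. (\<zeta> l x)\<^sup>2 \<partial>M)" for l
  have S0: "0 \<le> S l" for l by (simp add: S_def)
  \<comment> \<open>The denominator makes the l-th contribution at most (1/2)^l both to the weighted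
    integral of the squared gradient and to that of 1; the geometric sum is the bound 2 of the
    statement.\<close>
  define cl where "cl l = (1/2)^l / (1 + C l + S l)" for l
  have den: "0 < 1 + C l + S l" for l using C(1)[of l] S0[of l] by simp
  have cl0: "0 < cl l" for l using den[of l] by (simp add: cl_def)
  have cl1: "cl l \<le> (1/2)^l" for l
    unfolding cl_def using den[of l] C(1)[of l] S0[of l] by (simp add: divide_le_eq mult_le_cancel_left1)
  have sq1: "0 \<le> (\<zeta> l x)\<^sup>2" "(\<zeta> l x)\<^sup>2 \<le> 1" for l x using cut_range by (auto intro: power_le_one)
  have term_le: "0 \<le> cl l * (\<zeta> l x)\<^sup>2" "cl l * (\<zeta> l x)\<^sup>2 \<le> (1/2)^l" for l x
  proof -
    show "0 \<le> cl l * (\<zeta> l x)\<^sup>2" using cl0[of l] by simp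
    have "cl l * (\<zeta> l x)\<^sup>2 \<le> cl l * 1" using sq1 cl0[of l] by (intro mult_left_mono) auto
    then show "cl l * (\<zeta> l x)\<^sup>2 \<le> (1/2)^l" using cl1[of l] by simp
  qed
  have geo: "summable (\<lambda>l. (1/2::real)^l)" "(\<Sum>l. (1/2::real)^l) = 2"
    using geometric_sums[of "1/2::real"] by (auto simp: sums_iff)
  have summ: "summable (\<lambda>l. cl l * (\<zeta> l x)\<^sup>2)" for x
    by (rule summable_comparison_test'[OF geo(1), of 0]) (use term_le in simp)
  define \<Theta> where "\<Theta> x = (\<Sum>l. cl l * (\<zeta> l x)\<^sup>2)" for x
  have Tm [measurable]: "\<Theta> \<in> borel_measurable M" unfolding \<Theta>_def by measurable
  have T0: "0 \<le> \<Theta> x" for x unfolding \<Theta>_def by (intro suminf_nonneg summ term_le)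
  have T2: "\<Theta> x \<le> 2" for x
  proof -
    have "\<Theta> x \<le> (\<Sum>l. (1/2::real)^l)" unfolding \<Theta>_def by (intro suminf_le summ geo term_le)
    then show ?thesis using geo by simp
  qed
  have Tl: "cl l * (\<zeta> l x)\<^sup>2 \<le> \<Theta> x" for l x
    using sum_le_suminf[OF summ, of "{l}" x] term_le by (simp add: \<Theta>_def)
  have int: "integrable M (\<lambda>x. \<Theta> x * a x) \<and> (\<integral>x. \<Theta> x * a x \<partial>M) \<le> 2"
    if am [measurable]: "a \<in> borel_measurable M" and a0: "\<And>x. 0 \<le> a x"
      and ai: "\<And>l. integrable M (\<lambda>x. (\<zeta> l x)\<^sup>2 * a x)" and al: "\<And>l. (\<integral>x. (\<zeta> l x)\<^sup>2 * a x \<partial>M) \<le> C l + S l" for a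
  proof -
    have "(\<integral>\<^sup>+x. ennreal (\<Theta> x * a x) \<partial>M) = (\<integral>\<^sup>+x. (\<Sum>l. ennreal (cl l * (\<zeta> l x)\<^sup>2 * a x)) \<partial>M)"
    proof (intro nn_integral_cong)
      fix x
      have "ennreal (\<Theta> x * a x) = ennreal (\<Sum>l. cl l * (\<zeta> l x)\<^sup>2 * a x)"
        unfolding \<Theta>_def by (simp add: suminf_mult2[OF summ])
      also have "\<dots> = (\<Sum>l. ennreal (cl l * (\<zeta> l x)\<^sup>2 * a x))"
        by (rule suminf_ennreal2[symmetric]) (use term_le a0 summ in \<open>auto intro: summable_mult2\<close>)
      finally show "ennreal (\<Theta> x * a x) = (\<Sum>l. ennreal (cl l * (\<zeta> l x)\<^sup>2 * a x))" .
    qed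
    also have "\<dots> = (\<Sum>l. \<integral>\<^sup>+x. ennreal (cl l * (\<zeta> l x)\<^sup>2 * a x) \<partial>M)"
      by (intro nn_integral_suminf) measurable
    also have "\<dots> \<le> (\<Sum>l. ennreal ((1/2)^l))"
    proof (intro suminf_le)
      fix l
      have "(\<integral>\<^sup>+x. ennreal (cl l * (\<zeta> l x)\<^sup>2 * a x) \<partial>M) = ennreal (\<integral>x. cl l * ((\<zeta> l x)\<^sup>2 * a x) \<partial>M)"
        using ai[of l] term_le a0 cl0[of l] by (subst nn_integral_eq_integral[symmetric]) (auto simp: mult.assoc less_imp_le)
      also have "(\<integral>x. cl l * ((\<zeta> l x)\<^sup>2 * a x) \<partial>M) = cl l * (\<integral>x. (\<zeta> l x)\<^sup>2 * a x \<partial>M)" by simp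
      also have "\<dots> \<le> cl l * (1 + C l + S l)" using al[of l] cl0[of l] by (intro mult_left_mono) auto
      also have "\<dots> = (1/2)^l" using den[of l] by (simp add: cl_def)
      finally show "(\<integral>\<^sup>+x. ennreal (cl l * (\<zeta> l x)\<^sup>2 * a x) \<partial>M) \<le> ennreal ((1/2)^l)" by (simp add: ennreal_leI)
    qed auto
    also have "\<dots> = ennreal 2" using geo by (subst suminf_ennreal2) auto
    finally have le: "(\<integral>\<^sup>+x. ennreal (\<Theta> x * a x) \<partial>M) \<le> ennreal 2" .
    have i: "integrable M (\<lambda>x. \<Theta> x * a x)"
    proof (rule integrableI_bounded)
      have "(\<integral>\<^sup>+x. ennreal (norm (\<Theta> x * a x)) \<partial>M) = (\<integral>\<^sup>+x. ennreal (\<Theta> x * a x) \<partial>M)" using T0 a0 by simp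
      also have "\<dots> < \<infinity>" using le by (rule le_less_trans) simp
      finally show "(\<integral>\<^sup>+x. ennreal (norm (\<Theta> x * a x)) \<partial>M) < \<infinity>" .
    qed measurable
    have "(\<integral>x. \<Theta> x * a x \<partial>M) \<le> 2"
    proof -
      have "AE x in M. 0 \<le> \<Theta> x * a x" using T0 a0 by simp
      from le[unfolded nn_integral_eq_integral[OF i this]]
      show ?thesis by (rule ennreal_le_iff[THEN iffD1, rotated]) simp
    qed
    with i show ?thesis by blast
  qed
  have "(\<integral>x. \<Theta> x * (norm (D (Zb n j) x))\<^sup>2 \<partial>M) \<le> 2" if "j < J" for n j
  proof (rule int[THEN conjunct2])
    have [measurable]: "D (Zb n j) \<in> borel_measurable M" by (rule D_measurable[OF Zb_dom(1)])
    show "(\<lambda>x. (norm (D (Zb n j) x))\<^sup>2) \<in> borel_measurable M" by measurable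
    show "integrable M (\<lambda>x. (\<zeta> l x)\<^sup>2 * (norm (D (Zb n j) x))\<^sup>2)" for l
      by (rule Bochner_Integration.integrable_bound[OF D_square_integrable[OF Zb_dom(1)[of n j]]])
         (use sq1 in \<open>auto simp: abs_mult mult_left_le_one_le\<close>)
    show "(\<integral>x. (\<zeta> l x)\<^sup>2 * (norm (D (Zb n j) x))\<^sup>2 \<partial>M) \<le> C l + S l" for l using C(2)[OF that] S0[of l] by (simp add: add_increasing2)
  qed simp
  moreover have "integrable M (\<lambda>x. \<Theta> x * 1) \<and> (\<integral>x. \<Theta> x * 1 \<partial>M) \<le> 2"
    by (rule int) (use dom_square_integrable[OF cut_dom] C(1) in \<open>auto simp: S_def\<close>)
  moreover have "\<exists>C>0. \<forall>x. (\<zeta> l x)\<^sup>2 \<le> C * \<Theta> x" for l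
  proof (intro exI[of _ "1 / cl l"] conjI allI)
    show "0 < 1 / cl l" using cl0[of l] by simp
    show "(\<zeta> l x)\<^sup>2 \<le> 1 / cl l * \<Theta> x" for x using Tl[of l x] cl0[of l] by (simp add: pos_le_divide_eq mult.commute)
  qed
  ultimately show ?thesis using Tm T0 T2 by (intro exI[of _ \<Theta>]) auto
qed

end

section \<open>Local strong limits of the convex combinations\<close>

lemma lincomb_scale:
  fixes X :: "nat \<Rightarrow> 'a \<Rightarrow> 'h::real_vector"
  shows "lincomb c (\<lambda>n x. a x *\<^sub>R X n x) x = a x *\<^sub>R lincomb c X x"
  by (simp add: lincomb_def scaleR_sum_right mult.commute)

context log_profile
begin

text \<open>Strong L^2-convergence of the combinations under every cutoff; as the cutoffs exhaust
  the space, the limit is determined almost everywhere. An almost everywhere convergent subsequence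
  is recorded as well, since pointwise bounds are read off from it.\<close>

definition local_limit :: "(nat \<Rightarrow> nat \<Rightarrow> real) \<Rightarrow> (nat \<Rightarrow> 'a \<Rightarrow> 'k::{real_inner, complete_space, second_countable_topology}) \<Rightarrow> ('a \<Rightarrow> 'k) \<Rightarrow> bool" where
  "local_limit \<omega> X X0 \<longleftrightarrow> X0 \<in> borel_measurable M \<and> (\<forall>l. L2H M (\<lambda>x. \<zeta> l x *\<^sub>R X0 x))
    \<and> (\<forall>l. (\<lambda>n. \<integral>x. (norm (\<zeta> l x *\<^sub>R lincomb (\<omega> n) X x - \<zeta> l x *\<^sub>R X0 x))\<^sup>2 \<partial>M) \<longlonglongrightarrow> 0)
    \<and> (\<exists>r. strict_mono (r :: nat \<Rightarrow> nat) \<and> (AE x in M. (\<lambda>n. lincomb (\<omega> (r n)) X x) \<longlonglongrightarrow> X0 x))"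

text \<open>The combinations weighted by sqrt \<Theta> are Cauchy in L^2, and their limit can be
  divided by sqrt \<Theta>: almost every point lies where some cutoff is 1, so \<Theta> > 0 there.
  The bound of \<zeta>^2 by a multiple of \<Theta> transfers the convergence to each cutoff.\<close>

lemma local_limit_exists:
  fixes X :: "nat \<Rightarrow> 'a \<Rightarrow> 'k::{real_inner, complete_space, second_countable_topology}"
  assumes X: "\<And>n. L2H M (X n)"
    and \<Theta>m [measurable]: "\<Theta> \<in> borel_measurable M" and \<Theta>: "\<And>x. 0 \<le> \<Theta> x" "\<And>x. \<Theta> x \<le> 2" "\<And>l. \<exists>C>0. \<forall>x. (\<zeta> l x)\<^sup>2 \<le> C * \<Theta> x"
    and Cau: "\<And>e. 0 < e \<Longrightarrow> \<exists>N. \<forall>m\<ge>N. \<forall>n\<ge>N. (\<integral>x. (norm (lincomb (\<omega> m) (\<lambda>n x. sqrt (\<Theta> x) *\<^sub>R X n x) x - lincomb (\<omega> n) (\<lambda>n x. sqrt (\<Theta> x) *\<^sub>R X n x) x))\<^sup>2 \<partial>M) < e"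
  shows "\<exists>X0. local_limit \<omega> X X0"
proof -
  have sb: "AE x in M. \<bar>sqrt (\<Theta> x)\<bar> \<le> sqrt 2" using \<Theta> by (intro AE_I2) (auto simp: real_sqrt_le_mono)
  have sX: "L2H M (\<lambda>x. sqrt (\<Theta> x) *\<^sub>R X n x)" for n by (rule L2H_mult[OF X _ sb]) measurable
  from L2H_complete[OF lincomb_L2H[OF sX] Cau] obtain Y r where Y: "L2H M Y"
    "(\<lambda>n. \<integral>x. (norm (lincomb (\<omega> n) (\<lambda>n x. sqrt (\<Theta> x) *\<^sub>R X n x) x - Y x))\<^sup>2 \<partial>M) \<longlonglongrightarrow> 0"
    and r: "strict_mono (r :: nat \<Rightarrow> nat)" "AE x in M. (\<lambda>n. lincomb (\<omega> (r n)) (\<lambda>n x. sqrt (\<Theta> x) *\<^sub>R X n x) x) \<longlonglongrightarrow> Y x"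
    by (metis (no_types, lifting))
  have pos: "AE x in M. 0 < \<Theta> x"
    using exhausts
  proof eventually_elim
    case (elim x)
    then obtain l where l: "x \<in> F l" by blast
    from \<Theta>(3)[of l] obtain C where C: "0 < C" "(\<zeta> l x)\<^sup>2 \<le> C * \<Theta> x" by blast
    then have "1 \<le> C * \<Theta> x" using cut_one[OF l] by simp
    then have "\<Theta> x \<noteq> 0" by auto
    then show ?case using \<Theta>(1)[of x] by simp
  qed
  define X0 where "X0 x = (1 / sqrt (\<Theta> x)) *\<^sub>R Y x" for x
  have [measurable]: "Y \<in> borel_measurable M" "X n \<in> borel_measurable M" for n using Y(1) X by (auto simp: L2H_def)
  have [measurable]: "X0 \<in> borel_measurable M" unfolding X0_def by measurable
  have lm [measurable]: "lincomb d X \<in> borel_measurable M" for d using lincomb_L2H[OF X] by (auto simp: L2H_def)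
  have bd': "AE x in M. (norm (\<zeta> l x *\<^sub>R f x - \<zeta> l x *\<^sub>R X0 x))\<^sup>2 \<le> C * (norm (sqrt (\<Theta> x) *\<^sub>R f x - Y x))\<^sup>2" if "\<forall>x. (\<zeta> l x)\<^sup>2 \<le> C * \<Theta> x" for l C f
    using pos
  proof eventually_elim
    case (elim x)
    have "Y x = sqrt (\<Theta> x) *\<^sub>R X0 x" using elim by (simp add: X0_def)
    then have "(norm (sqrt (\<Theta> x) *\<^sub>R f x - Y x))\<^sup>2 = \<Theta> x * (norm (f x - X0 x))\<^sup>2"
      using elim by (simp add: scaleR_diff_right[symmetric] power_mult_distrib)
    moreover have "(norm (\<zeta> l x *\<^sub>R f x - \<zeta> l x *\<^sub>R X0 x))\<^sup>2 = (\<zeta> l x)\<^sup>2 * (norm (f x - X0 x))\<^sup>2"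
      by (simp add: scaleR_diff_right[symmetric] power_mult_distrib)
    moreover have "(\<zeta> l x)\<^sup>2 * (norm (f x - X0 x))\<^sup>2 \<le> C * \<Theta> x * (norm (f x - X0 x))\<^sup>2" using that by (intro mult_right_mono) auto
    ultimately show ?case by simp
  qed
  have "local_limit \<omega> X X0"
    unfolding local_limit_def
  proof (intro conjI allI)
    show "X0 \<in> borel_measurable M" by measurable
    fix l
    from \<Theta>(3)[of l] obtain C where C: "0 < C" "\<forall>x. (\<zeta> l x)\<^sup>2 \<le> C * \<Theta> x" by blast
    show "L2H M (\<lambda>x. \<zeta> l x *\<^sub>R X0 x)"
    proof (rule L2H_bound[where W="\<lambda>x. C * (norm (Y x))\<^sup>2"])
      show "AE x in M. (norm (\<zeta> l x *\<^sub>R X0 x))\<^sup>2 \<le> C * (norm (Y x))\<^sup>2" using bd'[OF C(2), of "\<lambda>_. 0"] by simp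
    qed (use Y(1) in \<open>auto simp: L2H_def\<close>)
    show "(\<lambda>n. \<integral>x. (norm (\<zeta> l x *\<^sub>R lincomb (\<omega> n) X x - \<zeta> l x *\<^sub>R X0 x))\<^sup>2 \<partial>M) \<longlonglongrightarrow> 0"
    proof (rule tendsto_sandwich[OF _ _ tendsto_const tendsto_mult_right_zero[OF Y(2), of C]])
      show "\<forall>\<^sub>F n in sequentially. (\<integral>x. (norm (\<zeta> l x *\<^sub>R lincomb (\<omega> n) X x - \<zeta> l x *\<^sub>R X0 x))\<^sup>2 \<partial>M)
        \<le> C * (\<integral>x. (norm (lincomb (\<omega> n) (\<lambda>n x. sqrt (\<Theta> x) *\<^sub>R X n x) x - Y x))\<^sup>2 \<partial>M)"
      proof (intro always_eventually allI)
        fix n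
        have i: "integrable M (\<lambda>x. C * (norm (lincomb (\<omega> n) (\<lambda>n x. sqrt (\<Theta> x) *\<^sub>R X n x) x - Y x))\<^sup>2)"
          by (intro integrable_mult_right L2H_square_integrable L2H_diff lincomb_L2H sX Y)
        have ae: "AE x in M. (norm (\<zeta> l x *\<^sub>R lincomb (\<omega> n) X x - \<zeta> l x *\<^sub>R X0 x))\<^sup>2 \<le> C * (norm (lincomb (\<omega> n) (\<lambda>n x. sqrt (\<Theta> x) *\<^sub>R X n x) x - Y x))\<^sup>2"
          using bd'[OF C(2), of "lincomb (\<omega> n) X"] by (simp add: lincomb_scale)
        have "(\<integral>x. (norm (\<zeta> l x *\<^sub>R lincomb (\<omega> n) X x - \<zeta> l x *\<^sub>R X0 x))\<^sup>2 \<partial>M)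
          \<le> (\<integral>x. C * (norm (lincomb (\<omega> n) (\<lambda>n x. sqrt (\<Theta> x) *\<^sub>R X n x) x - Y x))\<^sup>2 \<partial>M)"
        proof (rule integral_mono_AE[OF _ i ae])
          show "integrable M (\<lambda>x. (norm (\<zeta> l x *\<^sub>R lincomb (\<omega> n) X x - \<zeta> l x *\<^sub>R X0 x))\<^sup>2)"
            by (rule Bochner_Integration.integrable_bound[OF i]) (use ae in \<open>auto simp: C(1) less_imp_le elim!: eventually_mono\<close>)
        qed
        then show "(\<integral>x. (norm (\<zeta> l x *\<^sub>R lincomb (\<omega> n) X x - \<zeta> l x *\<^sub>R X0 x))\<^sup>2 \<partial>M)
          \<le> C * (\<integral>x. (norm (lincomb (\<omega> n) (\<lambda>n x. sqrt (\<Theta> x) *\<^sub>R X n x) x - Y x))\<^sup>2 \<partial>M)" by simp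
      qed
    qed simp
  next
    have "AE x in M. (\<lambda>n. lincomb (\<omega> (r n)) X x) \<longlonglongrightarrow> X0 x"
      using r(2) pos
    proof eventually_elim
      case (elim x)
      have "(\<lambda>n. (1 / sqrt (\<Theta> x)) *\<^sub>R lincomb (\<omega> (r n)) (\<lambda>n x. sqrt (\<Theta> x) *\<^sub>R X n x) x) \<longlonglongrightarrow> (1 / sqrt (\<Theta> x)) *\<^sub>R Y x"
        by (intro tendsto_intros elim)
      then show ?case using elim(2) by (simp add: lincomb_scale X0_def)
    qed
    with r(1) show "\<exists>r. strict_mono (r :: nat \<Rightarrow> nat) \<and> (AE x in M. (\<lambda>n. lincomb (\<omega> (r n)) X x) \<longlonglongrightarrow> X0 x)" by blast
  qed
  then show ?thesis by blast
qed

text \<open>All profiles and gradients, for all j, enter one quadratic functional, so a single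
  sequence of weights makes them converge together. Only then can relations between different j, and
  between a profile and its gradient, be passed to the limit.\<close>

lemma profile_limits_exist:
  "\<exists>\<omega> zb z G. (\<forall>n. \<omega> n \<in> cweights n) \<and> (\<forall>j<J. local_limit \<omega> (\<lambda>n. Zb n j) (zb j) \<and> local_limit \<omega> (\<lambda>n. D (Zb n j)) (G j))
    \<and> (\<forall>j\<le>J. local_limit \<omega> (\<lambda>n. Z n j) (z j))"
proof -
  from weight_exists obtain \<Theta> where \<Theta>m [measurable]: "\<Theta> \<in> borel_measurable M" and \<Theta>: "\<And>x. 0 \<le> \<Theta> x" "\<And>x. \<Theta> x \<le> 2" "\<And>l. \<exists>C>0. \<forall>x. (\<zeta> l x)\<^sup>2 \<le> C * \<Theta> x"
    and en: "\<And>n j. j < J \<Longrightarrow> (\<integral>x. \<Theta> x * (norm (D (Zb n j) x))\<^sup>2 \<partial>M) \<le> 2" and \<Theta>i: "integrable M \<Theta>" "(\<integral>x. \<Theta> x \<partial>M) \<le> 2" by blast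
  have ZbL: "L2H M (Zb n j)" "L2H M (D (Zb n j))" "L2H M (Z n j)" for n j
    using dom_L2[OF Zb_dom(1)] D_L2H[OF Zb_dom(1)] dom_L2[OF Z_dom(1)] by (auto simp: L2_iff_L2H)
  have sb: "AE x in M. \<bar>sqrt (\<Theta> x)\<bar> \<le> sqrt 2" using \<Theta> by (intro AE_I2) (auto simp: real_sqrt_le_mono)
  have wL: "L2H M (\<lambda>x. sqrt (\<Theta> x) *\<^sub>R X x)" if "L2H M X" for X :: "'a \<Rightarrow> 'k::{real_inner, second_countable_topology}"
    by (rule L2H_mult[OF that _ sb]) measurable
  define A where "A j = (\<lambda>n x. sqrt (\<Theta> x) *\<^sub>R Zb n j x)" for j
  define Bv where "Bv j = (\<lambda>n x. sqrt (\<Theta> x) *\<^sub>R D (Zb n j) x)" for j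
  define Cv where "Cv j = (\<lambda>n x. sqrt (\<Theta> x) *\<^sub>R Z n j x)" for j
  have AL: "L2H M (A j n)" and BL: "L2H M (Bv j n)" and CL: "L2H M (Cv j n)" for j n
    unfolding A_def Bv_def Cv_def by (intro wL ZbL)+
  define q where "q \<omega> = (\<Sum>j<J. (\<integral>x. (norm (lincomb \<omega> (A j) x))\<^sup>2 \<partial>M) + (\<integral>x. (norm (lincomb \<omega> (Bv j) x))\<^sup>2 \<partial>M))
    + (\<Sum>j\<le>J. (\<integral>x. (norm (lincomb \<omega> (Cv j) x))\<^sup>2 \<partial>M))" for \<omega>
  define r where "r \<omega> d = (\<Sum>j<J. (\<integral>x. (norm (lincomb \<omega> (A j) x - lincomb d (A j) x))\<^sup>2 \<partial>M) + (\<integral>x. (norm (lincomb \<omega> (Bv j) x - lincomb d (Bv j) x))\<^sup>2 \<partial>M))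
    + (\<Sum>j\<le>J. (\<integral>x. (norm (lincomb \<omega> (Cv j) x - lincomb d (Cv j) x))\<^sup>2 \<partial>M))" for \<omega> d
  \<comment> \<open>The weight has total mass at most 2, so profiles with values in [0, K] are
    bounded in the weighted L^2-norm uniformly in n.\<close>
  have bounded: "(\<integral>x. (norm (sqrt (\<Theta> x) *\<^sub>R f x))\<^sup>2 \<partial>M) \<le> 2 * K\<^sup>2" if fL: "L2H M f" and f: "\<And>x. 0 \<le> f x" "\<And>x. f x \<le> K" for f :: "'a \<Rightarrow> real"
  proof -
    have "(\<integral>x. (norm (sqrt (\<Theta> x) *\<^sub>R f x))\<^sup>2 \<partial>M) \<le> (\<integral>x. \<Theta> x * K\<^sup>2 \<partial>M)"
    proof (rule integral_mono)
      show "integrable M (\<lambda>x. (norm (sqrt (\<Theta> x) *\<^sub>R f x))\<^sup>2)" by (rule L2H_square_integrable[OF wL[OF fL]])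
      show "integrable M (\<lambda>x. \<Theta> x * K\<^sup>2)" using \<Theta>i by simp
      show "(norm (sqrt (\<Theta> x) *\<^sub>R f x))\<^sup>2 \<le> \<Theta> x * K\<^sup>2" for x
        using \<Theta>(1)[of x] f[of x] by (simp add: power_mult_distrib mult_left_mono power_mono)
    qed
    also have "\<dots> = (\<integral>x. \<Theta> x \<partial>M) * K\<^sup>2" by simp
    also have "\<dots> \<le> 2 * K\<^sup>2" using \<Theta>i by (intro mult_right_mono) auto
    finally show ?thesis .
  qed
  have "\<exists>\<omega>. (\<forall>n. \<omega> n \<in> cweights n) \<and> (\<forall>e>0. \<exists>N. \<forall>m\<ge>N. \<forall>n\<ge>N. r (\<omega> m) (\<omega> n) < e)"
  proof (rule forward_convex_combinations[where q=q and C="(\<Sum>j<J. 2 * K\<^sup>2 + 2) + (\<Sum>j\<le>J. 2 * K\<^sup>2)"])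
    show "0 \<le> q \<omega>" for \<omega> unfolding q_def by (intro add_nonneg_nonneg sum_nonneg) auto
    fix n
    show "q (\<lambda>i. if i = n then 1 else 0) \<le> (\<Sum>j<J. 2 * K\<^sup>2 + 2) + (\<Sum>j\<le>J. 2 * K\<^sup>2)"
      unfolding q_def lincomb_unit
    proof (intro add_mono sum_mono)
      show "(\<integral>x. (norm (A j n x))\<^sup>2 \<partial>M) \<le> 2 * K\<^sup>2" for j
        unfolding A_def by (intro bounded ZbL Zb_dom)
      show "(\<integral>x. (norm (Cv j n x))\<^sup>2 \<partial>M) \<le> 2 * K\<^sup>2" for j
        unfolding Cv_def by (intro bounded ZbL Z_dom)
      fix j assume "j \<in> {..<J}"
      then have "(\<integral>x. \<Theta> x * (norm (D (Zb n j) x))\<^sup>2 \<partial>M) \<le> 2" using en by simp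
      then show "(\<integral>x. (norm (Bv j n x))\<^sup>2 \<partial>M) \<le> 2" unfolding Bv_def using \<Theta>(1) by (simp add: power_mult_distrib)
    qed
  next
    fix \<omega> d assume cd: "\<omega> \<in> cweights 0" "d \<in> cweights 0"
    have "r \<omega> d = (\<Sum>j<J. (2 * (\<integral>x. (norm (lincomb \<omega> (A j) x))\<^sup>2 \<partial>M) + 2 * (\<integral>x. (norm (lincomb d (A j) x))\<^sup>2 \<partial>M) - 4 * (\<integral>x. (norm (lincomb (cmid \<omega> d) (A j) x))\<^sup>2 \<partial>M))
        + (2 * (\<integral>x. (norm (lincomb \<omega> (Bv j) x))\<^sup>2 \<partial>M) + 2 * (\<integral>x. (norm (lincomb d (Bv j) x))\<^sup>2 \<partial>M) - 4 * (\<integral>x. (norm (lincomb (cmid \<omega> d) (Bv j) x))\<^sup>2 \<partial>M)))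
      + (\<Sum>j\<le>J. 2 * (\<integral>x. (norm (lincomb \<omega> (Cv j) x))\<^sup>2 \<partial>M) + 2 * (\<integral>x. (norm (lincomb d (Cv j) x))\<^sup>2 \<partial>M) - 4 * (\<integral>x. (norm (lincomb (cmid \<omega> d) (Cv j) x))\<^sup>2 \<partial>M))"
      unfolding r_def
      by (simp only: lincomb_parallelogram[OF AL cd] lincomb_parallelogram[OF BL cd] lincomb_parallelogram[OF CL cd])
    also have "\<dots> = 2 * q \<omega> + 2 * q d - 4 * q (cmid \<omega> d)"
      unfolding q_def by (simp add: sum.distrib sum_subtractf sum_distrib_left[symmetric] algebra_simps)
    finally show "r \<omega> d = 2 * q \<omega> + 2 * q d - 4 * q (cmid \<omega> d)" .
  qed
  then obtain \<omega> where c: "\<And>n. \<omega> n \<in> cweights n" "\<And>e. 0 < e \<Longrightarrow> \<exists>N. \<forall>m\<ge>N. \<forall>n\<ge>N. r (\<omega> m) (\<omega> n) < e" by blast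
  have leA: "(\<integral>x. (norm (lincomb a (A j) x - lincomb d (A j) x))\<^sup>2 \<partial>M) \<le> r a d"
    and leB: "(\<integral>x. (norm (lincomb a (Bv j) x - lincomb d (Bv j) x))\<^sup>2 \<partial>M) \<le> r a d" if "j < J" for a d j
  proof -
    let ?f = "\<lambda>j. (\<integral>x. (norm (lincomb a (A j) x - lincomb d (A j) x))\<^sup>2 \<partial>M) + (\<integral>x. (norm (lincomb a (Bv j) x - lincomb d (Bv j) x))\<^sup>2 \<partial>M)"
    have "?f j \<le> (\<Sum>j<J. ?f j)" by (rule member_le_sum) (use that in auto)
    moreover have "0 \<le> (\<Sum>j\<le>J. (\<integral>x. (norm (lincomb a (Cv j) x - lincomb d (Cv j) x))\<^sup>2 \<partial>M))" by (intro sum_nonneg) auto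
    ultimately have "?f j \<le> r a d" unfolding r_def by linarith
    moreover have "0 \<le> (\<integral>x. (norm (lincomb a (A j) x - lincomb d (A j) x))\<^sup>2 \<partial>M)" "0 \<le> (\<integral>x. (norm (lincomb a (Bv j) x - lincomb d (Bv j) x))\<^sup>2 \<partial>M)" by auto
    ultimately show "(\<integral>x. (norm (lincomb a (A j) x - lincomb d (A j) x))\<^sup>2 \<partial>M) \<le> r a d"
      "(\<integral>x. (norm (lincomb a (Bv j) x - lincomb d (Bv j) x))\<^sup>2 \<partial>M) \<le> r a d" by linarith+
  qed
  have leC: "(\<integral>x. (norm (lincomb a (Cv j) x - lincomb d (Cv j) x))\<^sup>2 \<partial>M) \<le> r a d" if "j \<le> J" for a d j
  proof -
    let ?f = "\<lambda>j. (\<integral>x. (norm (lincomb a (Cv j) x - lincomb d (Cv j) x))\<^sup>2 \<partial>M)"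
    have "?f j \<le> (\<Sum>j\<le>J. ?f j)" by (rule member_le_sum) (use that in auto)
    moreover have "0 \<le> (\<Sum>j<J. (\<integral>x. (norm (lincomb a (A j) x - lincomb d (A j) x))\<^sup>2 \<partial>M) + (\<integral>x. (norm (lincomb a (Bv j) x - lincomb d (Bv j) x))\<^sup>2 \<partial>M))"
      by (intro sum_nonneg) auto
    ultimately show ?thesis unfolding r_def by linarith
  qed
  have Cauchy: "\<exists>N. \<forall>m\<ge>N. \<forall>n\<ge>N. f (\<omega> m) (\<omega> n) < e" if "0 < e" "\<And>a d. f a d \<le> r a d" for f :: "(nat \<Rightarrow> real) \<Rightarrow> (nat \<Rightarrow> real) \<Rightarrow> real" and e
    using c(2)[OF that(1)] that(2) by (meson le_less_trans)
  have "\<exists>X0. local_limit \<omega> (\<lambda>n. Zb n j) X0" if "j < J" for j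
  proof (rule local_limit_exists[OF ZbL(1) \<Theta>m \<Theta>])
    fix e :: real assume "0 < e"
    from Cauchy[OF this leA[OF that]]
    show "\<exists>N. \<forall>m\<ge>N. \<forall>n\<ge>N. (\<integral>x. (norm (lincomb (\<omega> m) (\<lambda>n x. sqrt (\<Theta> x) *\<^sub>R Zb n j x) x - lincomb (\<omega> n) (\<lambda>n x. sqrt (\<Theta> x) *\<^sub>R Zb n j x) x))\<^sup>2 \<partial>M) < e"
      unfolding A_def .
  qed
  then obtain zb where zb: "\<And>j. j < J \<Longrightarrow> local_limit \<omega> (\<lambda>n. Zb n j) (zb j)" by metis
  have "\<exists>X0. local_limit \<omega> (\<lambda>n. D (Zb n j)) X0" if "j < J" for j
  proof (rule local_limit_exists[OF ZbL(2) \<Theta>m \<Theta>])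
    fix e :: real assume "0 < e"
    from Cauchy[OF this leB[OF that]]
    show "\<exists>N. \<forall>m\<ge>N. \<forall>n\<ge>N. (\<integral>x. (norm (lincomb (\<omega> m) (\<lambda>n x. sqrt (\<Theta> x) *\<^sub>R D (Zb n j) x) x - lincomb (\<omega> n) (\<lambda>n x. sqrt (\<Theta> x) *\<^sub>R D (Zb n j) x) x))\<^sup>2 \<partial>M) < e"
      unfolding Bv_def .
  qed
  then obtain G where G: "\<And>j. j < J \<Longrightarrow> local_limit \<omega> (\<lambda>n. D (Zb n j)) (G j)" by metis
  have "\<exists>X0. local_limit \<omega> (\<lambda>n. Z n j) X0" if "j \<le> J" for j
  proof (rule local_limit_exists[OF ZbL(3) \<Theta>m \<Theta>])
    fix e :: real assume "0 < e"
    from Cauchy[OF this leC[OF that]]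
    show "\<exists>N. \<forall>m\<ge>N. \<forall>n\<ge>N. (\<integral>x. (norm (lincomb (\<omega> m) (\<lambda>n x. sqrt (\<Theta> x) *\<^sub>R Z n j x) x - lincomb (\<omega> n) (\<lambda>n x. sqrt (\<Theta> x) *\<^sub>R Z n j x) x))\<^sup>2 \<partial>M) < e"
      unfolding Cv_def .
  qed
  then obtain z where z: "\<And>j. j \<le> J \<Longrightarrow> local_limit \<omega> (\<lambda>n. Z n j) (z j)" by metis
  show ?thesis
    by (rule exI[of _ \<omega>], rule exI[of _ zb], rule exI[of _ z], rule exI[of _ G]) (simp add: c(1) zb G z)
qed

lemma local_limit_range:
  fixes X :: "nat \<Rightarrow> 'a \<Rightarrow> real"
  assumes "local_limit \<omega> X X0" "\<And>n. \<omega> n \<in> cweights n" "\<And>i x. 0 \<le> X i x" "\<And>i x. X i x \<le> K"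
  shows "AE x in M. 0 \<le> X0 x \<and> X0 x \<le> K"
proof -
  obtain r :: "nat \<Rightarrow> nat" where "AE x in M. (\<lambda>n. lincomb (\<omega> (r n)) X x) \<longlonglongrightarrow> X0 x" using assms(1) by (auto simp: local_limit_def)
  then show ?thesis
  proof eventually_elim
    case (elim x)
    have "0 \<le> lincomb (\<omega> (r n)) X x" "lincomb (\<omega> (r n)) X x \<le> K" for n
      using lincomb_range[OF assms(2)[of "r n"], of X x K] assms(3,4) by auto
    with elim show ?case by (auto intro: LIMSEQ_le_const LIMSEQ_le_const2)
  qed
qed

lemma local_limit_integral:
  fixes X :: "nat \<Rightarrow> 'a \<Rightarrow> real"
  assumes L: "local_limit \<omega> X X0" and X: "\<And>n. X n \<in> Dom" and g: "g \<in> Dom" "\<And>x. 0 \<le> g x" "\<And>x. g x \<le> 1"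
  shows "integrable M (\<lambda>x. X0 x * ((\<zeta> l x)\<^sup>2 * g x))"
    "(\<lambda>n. \<integral>x. lincomb (\<omega> n) X x * ((\<zeta> l x)\<^sup>2 * g x) \<partial>M) \<longlonglongrightarrow> (\<integral>x. X0 x * ((\<zeta> l x)\<^sup>2 * g x) \<partial>M)"
proof -
  have XL: "L2H M (lincomb d X)" for d by (rule lincomb_L2H) (use X dom_L2 in \<open>auto simp: L2_iff_L2H\<close>)
  have [measurable]: "g \<in> borel_measurable M" by (rule dom_measurable[OF g(1)])
  have gb: "AE x in M. \<bar>g x\<bar> \<le> 1" using g by auto
  have zb: "AE x in M. \<bar>\<zeta> l x\<bar> \<le> 1" using cut_range by auto
  have gL: "L2H M (\<lambda>x. g x * \<zeta> l x)" using L2_mult[OF dom_L2[OF cut_dom] _ gb] by (simp add: L2_iff_L2H)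
  have zX: "L2H M (\<lambda>x. \<zeta> l x *\<^sub>R lincomb d X x)" for d by (rule L2H_mult[OF XL _ zb]) measurable
  have zX0: "L2H M (\<lambda>x. \<zeta> l x *\<^sub>R X0 x)" using L by (simp add: local_limit_def)
  have eq: "inner (\<zeta> l x *\<^sub>R y) (g x * \<zeta> l x) = y * ((\<zeta> l x)\<^sup>2 * g x)" for x and y :: real
    by (simp add: power2_eq_square)
  from L2H_inner_integrable[OF zX0 gL] show "integrable M (\<lambda>x. X0 x * ((\<zeta> l x)\<^sup>2 * g x))" by (simp only: eq)
  from L2H_product_tendsto[OF zX zX0 gL, of \<omega>] L
  show "(\<lambda>n. \<integral>x. lincomb (\<omega> n) X x * ((\<zeta> l x)\<^sup>2 * g x) \<partial>M) \<longlonglongrightarrow> (\<integral>x. X0 x * ((\<zeta> l x)\<^sup>2 * g x) \<partial>M)"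
    by (simp only: eq local_limit_def)
qed

lemma AE_cutoff_nonpos:
  assumes "\<And>l. AE x in M. (\<zeta> l x)\<^sup>2 * P x \<le> (0::real)"
  shows "AE x in M. P x \<le> 0"
proof -
  have "AE x in M. \<forall>l. (\<zeta> l x)\<^sup>2 * P x \<le> 0" using assms by (simp add: AE_all_countable)
  then show ?thesis using exhausts
  proof eventually_elim
    case (elim x)
    then obtain l where "x \<in> F l" by blast
    then show ?case using elim(1)[rule_format, of l] cut_one by simp
  qed
qed

text \<open>The tested inequality is linear, so combinations of late indices satisfy it up to any
  given \<epsilon>. After the limit \<open>nonpos_of_tests\<close> removes the test function, and
  exhaustion removes the cutoff.\<close>

lemma local_limit_le:
  fixes X Y :: "nat \<Rightarrow> 'a \<Rightarrow> real"
  assumes X: "local_limit \<omega> X X0" "\<And>n. X n \<in> Dom" and Y: "local_limit \<omega> Y Y0" "\<And>n. Y n \<in> Dom" and c: "\<And>n. \<omega> n \<in> cweights n"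
    and le: "\<And>l g. g \<in> Dom \<Longrightarrow> (\<And>x. 0 \<le> g x) \<Longrightarrow> (\<And>x. g x \<le> 1) \<Longrightarrow>
      \<exists>e. e \<longlonglongrightarrow> 0 \<and> (\<forall>\<^sub>F n in sequentially. (\<integral>x. X n x * ((\<zeta> l x)\<^sup>2 * g x) \<partial>M) \<le> (\<integral>x. Y n x * ((\<zeta> l x)\<^sup>2 * g x) \<partial>M) + e n)"
  shows "AE x in M. X0 x \<le> Y0 x"
proof -
  have "AE x in M. (\<zeta> l x)\<^sup>2 * (X0 x - Y0 x) \<le> 0" for l
  proof (rule nonpos_of_tests)
    have one: "integrable M (\<lambda>x. (\<zeta> l x)\<^sup>2 * W0 x)" if "local_limit \<omega> W W0" for W and W0 :: "'a \<Rightarrow> real"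
    proof -
      have "L2H M (\<lambda>x. \<zeta> l x *\<^sub>R W0 x)" using that by (simp add: local_limit_def)
      from L2_product_integrable[OF dom_L2[OF cut_dom] this[folded L2_iff_L2H], of l]
      show ?thesis by (simp add: power2_eq_square mult.assoc)
    qed
    show "integrable M (\<lambda>x. (\<zeta> l x)\<^sup>2 * (X0 x - Y0 x))" using one[OF X(1)] one[OF Y(1)] by (simp add: right_diff_distrib)
    fix g assume g: "g \<in> Dom" "\<And>x. 0 \<le> g x" "\<And>x. g x \<le> 1"
    from le[OF g, of l] obtain e where e: "e \<longlonglongrightarrow> 0" "\<forall>\<^sub>F n in sequentially. (\<integral>x. X n x * ((\<zeta> l x)\<^sup>2 * g x) \<partial>M) \<le> (\<integral>x. Y n x * ((\<zeta> l x)\<^sup>2 * g x) \<partial>M) + e n" by blast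
    have hd: "(\<lambda>x. (\<zeta> l x)\<^sup>2 * g x) \<in> Dom" using cut_test(2)[OF g, of l] by (simp add: test_pair_def)
    have Xi: "integrable M (\<lambda>x. X n x * ((\<zeta> l x)\<^sup>2 * g x))" and Yi: "integrable M (\<lambda>x. Y n x * ((\<zeta> l x)\<^sup>2 * g x))" for n
      by (intro L2_product_integrable dom_L2 X Y hd)+
    note lX = local_limit_integral[OF X g, of l] and lY = local_limit_integral[OF Y g, of l]
    have "(\<integral>x. X0 x * ((\<zeta> l x)\<^sup>2 * g x) \<partial>M) \<le> (\<integral>x. Y0 x * ((\<zeta> l x)\<^sup>2 * g x) \<partial>M) + \<epsilon>" if \<epsilon>: "0 < \<epsilon>" for \<epsilon>
    proof -
      have "\<forall>\<^sub>F n in sequentially. (\<integral>x. X n x * ((\<zeta> l x)\<^sup>2 * g x) \<partial>M) - (\<integral>x. Y n x * ((\<zeta> l x)\<^sup>2 * g x) \<partial>M) \<le> \<epsilon>"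
        using e(2) order_tendstoD(2)[OF e(1) \<epsilon>] by eventually_elim linarith
      then obtain N where N: "\<And>n. n \<ge> N \<Longrightarrow> (\<integral>x. X n x * ((\<zeta> l x)\<^sup>2 * g x) \<partial>M) - (\<integral>x. Y n x * ((\<zeta> l x)\<^sup>2 * g x) \<partial>M) \<le> \<epsilon>"
        by (auto simp: eventually_sequentially)
      have "(\<integral>x. lincomb (\<omega> n) X x * ((\<zeta> l x)\<^sup>2 * g x) \<partial>M) \<le> (\<integral>x. lincomb (\<omega> n) Y x * ((\<zeta> l x)\<^sup>2 * g x) \<partial>M) + \<epsilon>" if n: "n \<ge> N" for n
      proof -
        have "(\<Sum>i | \<omega> n i \<noteq> 0. \<omega> n i * ((\<integral>x. X i x * ((\<zeta> l x)\<^sup>2 * g x) \<partial>M) - (\<integral>x. Y i x * ((\<zeta> l x)\<^sup>2 * g x) \<partial>M))) \<le> \<epsilon>"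
          by (rule lincomb_le_average[OF c[of n]]) (use N n in auto)
        then show ?thesis
          by (simp add: integral_lincomb(2)[OF Xi] integral_lincomb(2)[OF Yi] right_diff_distrib sum_subtractf)
      qed
      then show ?thesis
        by (intro LIMSEQ_le[OF lX(2) tendsto_add[OF lY(2) tendsto_const]]) auto
    qed
    then have "(\<integral>x. X0 x * ((\<zeta> l x)\<^sup>2 * g x) \<partial>M) \<le> (\<integral>x. Y0 x * ((\<zeta> l x)\<^sup>2 * g x) \<partial>M)" by (rule field_le_epsilon)
    moreover have "(\<integral>x. g x * ((\<zeta> l x)\<^sup>2 * (X0 x - Y0 x)) \<partial>M) = (\<integral>x. X0 x * ((\<zeta> l x)\<^sup>2 * g x) - Y0 x * ((\<zeta> l x)\<^sup>2 * g x) \<partial>M)"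
      by (intro Bochner_Integration.integral_cong) (auto simp: algebra_simps)
    moreover have "\<dots> = (\<integral>x. X0 x * ((\<zeta> l x)\<^sup>2 * g x) \<partial>M) - (\<integral>x. Y0 x * ((\<zeta> l x)\<^sup>2 * g x) \<partial>M)"
      by (rule Bochner_Integration.integral_diff[OF lX(1) lY(1)])
    ultimately show "(\<integral>x. g x * ((\<zeta> l x)\<^sup>2 * (X0 x - Y0 x)) \<partial>M) \<le> 0" by simp
  qed
  from AE_cutoff_nonpos[OF this] show ?thesis by eventually_elim simp
qed

text \<open>The gradient side is convex and the other side linear, so forward combinations keep the
  inequality. Strong convergence of the gradients then gives the square of their limit itself, and
  the tests are removed as in \<open>local_limit_le\<close>.\<close>

lemma local_limit_energy:
  assumes G: "local_limit \<omega> (\<lambda>n. D (Zb n j)) G0" and z1: "local_limit \<omega> (\<lambda>n. Z n (Suc j)) z1" and z0: "local_limit \<omega> (\<lambda>n. Z n j) z0"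
    and c: "\<And>n. \<omega> n \<in> cweights n"
  shows "AE x in M. (1/2) * (norm (G0 x))\<^sup>2 \<le> (real J + 1) * (z1 x - z0 x)"
proof -
  have DL: "L2H M (D (Zb n j))" for n by (rule D_L2H[OF Zb_dom(1)])
  have [measurable]: "D (Zb n j) \<in> borel_measurable M" "G0 \<in> borel_measurable M" for n using DL G by (auto simp: L2H_def local_limit_def)
  have "AE x in M. (\<zeta> l x)\<^sup>2 * ((1/2) * (norm (G0 x))\<^sup>2 - (real J + 1) * (z1 x - z0 x)) \<le> 0" for l
  proof (rule nonpos_of_tests)
    have one: "integrable M (\<lambda>x. (\<zeta> l x)\<^sup>2 * W0 x)" if "local_limit \<omega> W W0" for W and W0 :: "'a \<Rightarrow> real"
    proof -
      have "L2H M (\<lambda>x. \<zeta> l x *\<^sub>R W0 x)" using that by (simp add: local_limit_def)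
      from L2_product_integrable[OF dom_L2[OF cut_dom] this[folded L2_iff_L2H], of l]
      show ?thesis by (simp add: power2_eq_square mult.assoc)
    qed
    have zG: "L2H M (\<lambda>x. \<zeta> l x *\<^sub>R G0 x)" using G by (simp add: local_limit_def)
    have Gi: "integrable M (\<lambda>x. (\<zeta> l x)\<^sup>2 * (norm (G0 x))\<^sup>2)" using L2H_square_integrable[OF zG] by (simp add: power_mult_distrib)
    have "integrable M (\<lambda>x. (1/2) * ((\<zeta> l x)\<^sup>2 * (norm (G0 x))\<^sup>2) - (real J + 1) * ((\<zeta> l x)\<^sup>2 * z1 x - (\<zeta> l x)\<^sup>2 * z0 x))"
      by (intro Bochner_Integration.integrable_diff integrable_mult_right Gi one[OF z1] one[OF z0])
    then show "integrable M (\<lambda>x. (\<zeta> l x)\<^sup>2 * ((1/2) * (norm (G0 x))\<^sup>2 - (real J + 1) * (z1 x - z0 x)))" by (simp add: algebra_simps)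
    fix g assume g: "g \<in> Dom" "\<And>x. 0 \<le> g x" "\<And>x. g x \<le> 1"
    define h where "h x = (\<zeta> l x)\<^sup>2 * g x" for x
    have tp: "test_pair (\<zeta> l) h" unfolding h_def[abs_def] by (rule cut_test(2)[OF g])
    then have hd: "h \<in> Dom" and h0: "\<And>x. 0 \<le> h x" by (auto simp: test_pair_def)
    have h1: "h x \<le> 1" for x using tp cut_range[where l=l and x=x] power_le_one[of "\<zeta> l x" 2] by (auto simp: test_pair_def intro: order_trans)
    have [measurable]: "g \<in> borel_measurable M" "h \<in> borel_measurable M" using g hd by (auto intro: dom_measurable)
    from test_limits[OF tp] obtain e where e: "e \<longlonglongrightarrow> 0" and ev: "\<forall>\<^sub>F n in sequentially. \<forall>j.
      (1/2) * (\<integral>x. h x * (norm (D (Zb n j) x))\<^sup>2 \<partial>M) \<le> (real J + 1) * ((\<integral>x. Z n (Suc j) x * h x \<partial>M) - (\<integral>x. Z n j x * h x \<partial>M)) + e n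
      \<and> (\<integral>x. Z n j x * h x \<partial>M) \<le> (\<integral>x. Zb n j x * h x \<partial>M) + e n
      \<and> (\<integral>x. Zb n j x * h x \<partial>M) \<le> (\<integral>x. Z n (Suc j) x * h x \<partial>M) + e n" by blast
    have Zi: "integrable M (\<lambda>x. Z n i x * h x)" for n i by (intro L2_product_integrable dom_L2 Z_dom hd)
    have hDi: "integrable M (\<lambda>x. h x * (norm (D (Zb n j) x))\<^sup>2)" for n
      by (rule Bochner_Integration.integrable_bound[OF L2H_square_integrable[OF DL[of n]]])
         (use h0 h1 in \<open>auto simp: abs_mult mult_left_le_one_le\<close>)
    note l1 = local_limit_integral[OF z1 Z_dom(1) g, of l, folded h_def] and l0 = local_limit_integral[OF z0 Z_dom(1) g, of l, folded h_def]
    have sg: "\<bar>sqrt (g x)\<bar> \<le> 1" for x using g by simp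
    \<comment> \<open>Writing the weighted square as the squared norm of sqrt g \<zeta> times the
      gradient reduces the claim to convergence of squared L^2-norms.\<close>
    have lG: "(\<lambda>n. \<integral>x. h x * (norm (lincomb (\<omega> n) (\<lambda>n. D (Zb n j)) x))\<^sup>2 \<partial>M) \<longlonglongrightarrow> (\<integral>x. h x * (norm (G0 x))\<^sup>2 \<partial>M)"
    proof -
      have LL: "L2H M (lincomb d (\<lambda>n. D (Zb n j)))" for d by (rule lincomb_L2H[OF DL])
      have zL: "L2H M (\<lambda>x. \<zeta> l x *\<^sub>R lincomb d (\<lambda>n. D (Zb n j)) x)" for d
        by (rule L2H_mult[OF LL, where C=1]) (use cut_range in auto)
      have "(\<lambda>n. \<integral>x. (norm (sqrt (g x) *\<^sub>R (\<zeta> l x *\<^sub>R lincomb (\<omega> n) (\<lambda>n. D (Zb n j)) x)))\<^sup>2 \<partial>M) \<longlonglongrightarrow> (\<integral>x. (norm (sqrt (g x) *\<^sub>R (\<zeta> l x *\<^sub>R G0 x)))\<^sup>2 \<partial>M)"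
      proof (rule L2H_square_integral_tendsto)
        show gzL: "L2H M (\<lambda>x. sqrt (g x) *\<^sub>R (\<zeta> l x *\<^sub>R lincomb (\<omega> n) (\<lambda>n. D (Zb n j)) x))" for n
          by (rule L2H_mult[OF zL, where C=1]) (use sg in auto)
        show gzG: "L2H M (\<lambda>x. sqrt (g x) *\<^sub>R (\<zeta> l x *\<^sub>R G0 x))" by (rule L2H_mult[OF zG, where C=1]) (use sg in auto)
        show "(\<lambda>n. \<integral>x. (norm (sqrt (g x) *\<^sub>R (\<zeta> l x *\<^sub>R lincomb (\<omega> n) (\<lambda>n. D (Zb n j)) x) - sqrt (g x) *\<^sub>R (\<zeta> l x *\<^sub>R G0 x)))\<^sup>2 \<partial>M) \<longlonglongrightarrow> 0"
        proof (rule tendsto_sandwich[OF _ _ tendsto_const])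
          show "(\<lambda>n. \<integral>x. (norm (\<zeta> l x *\<^sub>R lincomb (\<omega> n) (\<lambda>n. D (Zb n j)) x - \<zeta> l x *\<^sub>R G0 x))\<^sup>2 \<partial>M) \<longlonglongrightarrow> 0" using G by (simp add: local_limit_def)
          show "\<forall>\<^sub>F n in sequentially. (\<integral>x. (norm (sqrt (g x) *\<^sub>R (\<zeta> l x *\<^sub>R lincomb (\<omega> n) (\<lambda>n. D (Zb n j)) x) - sqrt (g x) *\<^sub>R (\<zeta> l x *\<^sub>R G0 x)))\<^sup>2 \<partial>M)
            \<le> (\<integral>x. (norm (\<zeta> l x *\<^sub>R lincomb (\<omega> n) (\<lambda>n. D (Zb n j)) x - \<zeta> l x *\<^sub>R G0 x))\<^sup>2 \<partial>M)"
          proof (intro always_eventually allI integral_mono L2H_square_integrable L2H_diff gzL gzG zL zG)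
            fix n x
            have "norm (sqrt (g x) *\<^sub>R (\<zeta> l x *\<^sub>R lincomb (\<omega> n) (\<lambda>n. D (Zb n j)) x) - sqrt (g x) *\<^sub>R (\<zeta> l x *\<^sub>R G0 x))
              = \<bar>sqrt (g x)\<bar> * norm (\<zeta> l x *\<^sub>R lincomb (\<omega> n) (\<lambda>n. D (Zb n j)) x - \<zeta> l x *\<^sub>R G0 x)"
              unfolding scaleR_diff_right[of "sqrt (g x)", symmetric] norm_scaleR ..
            also have "\<dots> \<le> 1 * norm (\<zeta> l x *\<^sub>R lincomb (\<omega> n) (\<lambda>n. D (Zb n j)) x - \<zeta> l x *\<^sub>R G0 x)"
              using sg by (intro mult_right_mono) auto
            finally show "(norm (sqrt (g x) *\<^sub>R (\<zeta> l x *\<^sub>R lincomb (\<omega> n) (\<lambda>n. D (Zb n j)) x) - sqrt (g x) *\<^sub>R (\<zeta> l x *\<^sub>R G0 x)))\<^sup>2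
              \<le> (norm (\<zeta> l x *\<^sub>R lincomb (\<omega> n) (\<lambda>n. D (Zb n j)) x - \<zeta> l x *\<^sub>R G0 x))\<^sup>2" by (intro power_mono) auto
          qed
        qed simp
      qed
      moreover have "(norm (sqrt (g x) *\<^sub>R (\<zeta> l x *\<^sub>R y)))\<^sup>2 = h x * (norm y)\<^sup>2" for x and y :: 'h
        using g(2)[of x] by (simp add: h_def power_mult_distrib)
      ultimately show ?thesis by simp
    qed
    have main: "(1/2) * (\<integral>x. h x * (norm (G0 x))\<^sup>2 \<partial>M) \<le> (real J + 1) * ((\<integral>x. z1 x * h x \<partial>M) - (\<integral>x. z0 x * h x \<partial>M)) + \<epsilon>" if \<epsilon>: "0 < \<epsilon>" for \<epsilon>
    proof -
      have "\<forall>\<^sub>F n in sequentially. (1/2) * (\<integral>x. h x * (norm (D (Zb n j) x))\<^sup>2 \<partial>M) - (real J + 1) * ((\<integral>x. Z n (Suc j) x * h x \<partial>M) - (\<integral>x. Z n j x * h x \<partial>M)) \<le> \<epsilon>"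
        using ev order_tendstoD(2)[OF e \<epsilon>]
      proof eventually_elim
        case (elim n)
        have aux: "q - p \<le> \<epsilon>" if "q \<le> p + d" "d < \<epsilon>" for p q d :: real using that by linarith
        show ?case by (rule aux[OF elim(1)[rule_format, of j, THEN conjunct1] elim(2)])
      qed
      then obtain N where N: "\<And>n. n \<ge> N \<Longrightarrow> (1/2) * (\<integral>x. h x * (norm (D (Zb n j) x))\<^sup>2 \<partial>M) - (real J + 1) * ((\<integral>x. Z n (Suc j) x * h x \<partial>M) - (\<integral>x. Z n j x * h x \<partial>M)) \<le> \<epsilon>"
        by (auto simp: eventually_sequentially)
      have "(1/2) * (\<integral>x. h x * (norm (lincomb (\<omega> n) (\<lambda>n. D (Zb n j)) x))\<^sup>2 \<partial>M) \<le> (real J + 1) * ((\<integral>x. lincomb (\<omega> n) (\<lambda>n. Z n (Suc j)) x * h x \<partial>M) - (\<integral>x. lincomb (\<omega> n) (\<lambda>n. Z n j) x * h x \<partial>M)) + \<epsilon>" if n: "n \<ge> N" for n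
      proof -
        have "(\<integral>x. h x * (norm (lincomb (\<omega> n) (\<lambda>n. D (Zb n j)) x))\<^sup>2 \<partial>M) \<le> (\<integral>x. (\<Sum>i | \<omega> n i \<noteq> 0. \<omega> n i * (h x * (norm (D (Zb i j) x))\<^sup>2)) \<partial>M)"
        proof (rule integral_mono)
          show "integrable M (\<lambda>x. \<Sum>i | \<omega> n i \<noteq> 0. \<omega> n i * (h x * (norm (D (Zb i j) x))\<^sup>2))" using hDi by simp
          have LL: "L2H M (lincomb (\<omega> n) (\<lambda>n. D (Zb n j)))" by (rule lincomb_L2H[OF DL])
          show "integrable M (\<lambda>x. h x * (norm (lincomb (\<omega> n) (\<lambda>n. D (Zb n j)) x))\<^sup>2)"
            by (rule Bochner_Integration.integrable_bound[OF L2H_square_integrable[OF LL]])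
               (use h0 h1 L2H_measurable[OF LL] in \<open>auto simp: abs_mult mult_left_le_one_le\<close>)
          fix x
          show "h x * (norm (lincomb (\<omega> n) (\<lambda>n. D (Zb n j)) x))\<^sup>2 \<le> (\<Sum>i | \<omega> n i \<noteq> 0. \<omega> n i * (h x * (norm (D (Zb i j) x))\<^sup>2))"
            using mult_left_mono[OF lincomb_norm_square_le[OF c[of n], of "\<lambda>n. D (Zb n j)" x] h0[of x]]
            by (simp add: sum_distrib_left mult.left_commute)
        qed
        also have "\<dots> = (\<Sum>i | \<omega> n i \<noteq> 0. \<omega> n i * (\<integral>x. h x * (norm (D (Zb i j) x))\<^sup>2 \<partial>M))"
          using hDi by (subst Bochner_Integration.integral_sum) auto
        finally have a: "(\<integral>x. h x * (norm (lincomb (\<omega> n) (\<lambda>n. D (Zb n j)) x))\<^sup>2 \<partial>M) \<le> (\<Sum>i | \<omega> n i \<noteq> 0. \<omega> n i * (\<integral>x. h x * (norm (D (Zb i j) x))\<^sup>2 \<partial>M))" .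
        have "(\<Sum>i | \<omega> n i \<noteq> 0. \<omega> n i * ((1/2) * (\<integral>x. h x * (norm (D (Zb i j) x))\<^sup>2 \<partial>M) - (real J + 1) * ((\<integral>x. Z i (Suc j) x * h x \<partial>M) - (\<integral>x. Z i j x * h x \<partial>M)))) \<le> \<epsilon>"
          by (rule lincomb_le_average[OF c[of n]]) (use N n in auto)
        also have "(\<Sum>i | \<omega> n i \<noteq> 0. \<omega> n i * ((1/2) * (\<integral>x. h x * (norm (D (Zb i j) x))\<^sup>2 \<partial>M) - (real J + 1) * ((\<integral>x. Z i (Suc j) x * h x \<partial>M) - (\<integral>x. Z i j x * h x \<partial>M))))
          = (\<Sum>i | \<omega> n i \<noteq> 0. (1/2) * (\<omega> n i * (\<integral>x. h x * (norm (D (Zb i j) x))\<^sup>2 \<partial>M)) - (real J + 1) * (\<omega> n i * (\<integral>x. Z i (Suc j) x * h x \<partial>M) - \<omega> n i * (\<integral>x. Z i j x * h x \<partial>M)))"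
          by (intro sum.cong refl) (simp add: algebra_simps)
        also have "\<dots> = (1/2) * (\<Sum>i | \<omega> n i \<noteq> 0. \<omega> n i * (\<integral>x. h x * (norm (D (Zb i j) x))\<^sup>2 \<partial>M)) - (real J + 1) * ((\<integral>x. lincomb (\<omega> n) (\<lambda>n. Z n (Suc j)) x * h x \<partial>M) - (\<integral>x. lincomb (\<omega> n) (\<lambda>n. Z n j) x * h x \<partial>M))"
          unfolding integral_lincomb(2)[OF Zi] by (simp only: sum_subtractf sum_distrib_left[symmetric])
        finally show ?thesis using a by linarith
      qed
      then have "\<exists>N. \<forall>n\<ge>N. (1/2) * (\<integral>x. h x * (norm (lincomb (\<omega> n) (\<lambda>n. D (Zb n j)) x))\<^sup>2 \<partial>M) \<le> (real J + 1) * ((\<integral>x. lincomb (\<omega> n) (\<lambda>n. Z n (Suc j)) x * h x \<partial>M) - (\<integral>x. lincomb (\<omega> n) (\<lambda>n. Z n j) x * h x \<partial>M)) + \<epsilon>" by blast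
      then show ?thesis
        by (rule LIMSEQ_le[rotated 2]) (intro tendsto_intros lG l1 l0)+
    qed
    have "(1/2) * (\<integral>x. h x * (norm (G0 x))\<^sup>2 \<partial>M) \<le> (real J + 1) * ((\<integral>x. z1 x * h x \<partial>M) - (\<integral>x. z0 x * h x \<partial>M))"
      by (rule field_le_epsilon[OF main])
    moreover have "(\<integral>x. g x * ((\<zeta> l x)\<^sup>2 * ((1/2) * (norm (G0 x))\<^sup>2 - (real J + 1) * (z1 x - z0 x))) \<partial>M)
      = (\<integral>x. (1/2) * (h x * (norm (G0 x))\<^sup>2) - (real J + 1) * (z1 x * h x - z0 x * h x) \<partial>M)"
      by (intro Bochner_Integration.integral_cong) (auto simp: h_def algebra_simps)
    moreover have "\<dots> = (1/2) * (\<integral>x. h x * (norm (G0 x))\<^sup>2 \<partial>M) - (real J + 1) * ((\<integral>x. z1 x * h x \<partial>M) - (\<integral>x. z0 x * h x \<partial>M))"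
    proof -
      have "integrable M (\<lambda>x. h x * (norm (G0 x))\<^sup>2)"
        by (rule Bochner_Integration.integrable_bound[OF Gi]) (use g in \<open>auto simp: h_def abs_mult mult_left_le_one_le mult_right_le_one_le mult_right_mono\<close>)
      then show ?thesis using l1(1) l0(1) by simp
    qed
    ultimately show "(\<integral>x. g x * ((\<zeta> l x)\<^sup>2 * ((1/2) * (norm (G0 x))\<^sup>2 - (real J + 1) * (z1 x - z0 x))) \<partial>M) \<le> 0" by linarith
  qed
  from AE_cutoff_nonpos[OF this] show ?thesis by eventually_elim simp
qed

text \<open>Forward combinations of K - \<open>Zb\<close> still have vanishing integral over B;
  since the limit does not exceed K, a zero integral means equality almost everywhere.\<close>

lemma local_limit_on_B:
  assumes L: "local_limit \<omega> (\<lambda>n. Zb n j) z0" and w: "\<And>n. \<omega> n \<in> cweights n" and j: "j < J"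
  shows "AE x in M. x \<in> B \<longrightarrow> z0 x = K"
proof -
  have [measurable]: "B \<in> sets M" by (rule B_measurable)
  have [measurable]: "Zb n j \<in> borel_measurable M" "z0 \<in> borel_measurable M" for n
    using L by (auto simp: local_limit_def intro: dom_measurable Zb_dom)
  define X where "X = (\<lambda>n x. K - Zb n j x)"
  obtain r :: "nat \<Rightarrow> nat" where r: "strict_mono r" "AE x in M. (\<lambda>n. lincomb (\<omega> (r n)) (\<lambda>n. Zb n j) x) \<longlonglongrightarrow> z0 x"
    using L by (auto simp: local_limit_def)
  have range: "AE x in M. 0 \<le> z0 x \<and> z0 x \<le> K" by (rule local_limit_range[OF L w]) (auto intro: Zb_dom)
  have eqX: "lincomb (\<omega> n) X x = K - lincomb (\<omega> n) (\<lambda>n. Zb n j) x" for n x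
  proof -
    have "(\<Sum>i | \<omega> n i \<noteq> 0. \<omega> n i) = 1" using w[of n] by (simp add: cweights_def)
    then show ?thesis by (simp add: lincomb_def X_def right_diff_distrib sum_subtractf sum_distrib_right[symmetric])
  qed
  have Xr: "0 \<le> X n x" "X n x \<le> K" for n x using Zb_dom(2,3)[of n j x] by (auto simp: X_def)
  have Xi: "integrable M (\<lambda>x. X n x * indicator B x)" for n
  proof -
    have "integrable M (\<lambda>x. indicator B x * X n x)"
      by (rule integrable_on_finite[where C=K]) (use B_measurable Xr in \<open>auto simp: X_def\<close>)
    then show ?thesis by (simp add: mult.commute)
  qed
  have Xlim: "(\<lambda>n. \<integral>x. X n x * indicator B x \<partial>M) \<longlonglongrightarrow> 0"
    using Zb_on_B[OF j] by (simp add: X_def mult.commute)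
  have "(\<lambda>n. \<integral>x. lincomb (\<omega> n) X x * indicator B x \<partial>M) \<longlonglongrightarrow> 0"
  proof (rule LIMSEQ_I)
    fix e :: real assume e: "0 < e"
    from order_tendstoD(2)[OF Xlim, of "e / 2"] e obtain N where N: "\<And>n. n \<ge> N \<Longrightarrow> (\<integral>x. X n x * indicator B x \<partial>M) < e / 2"
      by (auto simp: eventually_sequentially)
    show "\<exists>N. \<forall>n\<ge>N. norm ((\<integral>x. lincomb (\<omega> n) X x * indicator B x \<partial>M) - 0) < e"
    proof (intro exI[of _ N] allI impI)
      fix n assume n: "n \<ge> N"
      have "(\<integral>x. lincomb (\<omega> n) X x * indicator B x \<partial>M) \<le> e / 2"
        unfolding integral_lincomb(2)[OF Xi] by (rule lincomb_le_average[OF w[of n]]) (use N n in \<open>auto intro: less_imp_le\<close>)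
      moreover have "0 \<le> (\<integral>x. lincomb (\<omega> n) X x * indicator B x \<partial>M)"
        using lincomb_range(1)[OF w[of n], of X _ K] Xr by (intro Bochner_Integration.integral_nonneg) auto
      ultimately show "norm ((\<integral>x. lincomb (\<omega> n) X x * indicator B x \<partial>M) - 0) < e" using e by simp
    qed
  qed
  from LIMSEQ_subseq_LIMSEQ[OF this r(1)]
  have l0: "(\<lambda>n. \<integral>x. lincomb (\<omega> (r n)) X x * indicator B x \<partial>M) \<longlonglongrightarrow> 0" by (simp add: comp_def)
  have lm [measurable]: "lincomb d X \<in> borel_measurable M" for d
    unfolding lincomb_def[abs_def] X_def by measurable
  have "(\<lambda>n. \<integral>x. lincomb (\<omega> (r n)) X x * indicator B x \<partial>M) \<longlonglongrightarrow> (\<integral>x. (K - z0 x) * indicator B x \<partial>M)"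
  proof (rule integral_dominated_convergence[where w="\<lambda>x. K * indicator B x"])
    show "AE x in M. (\<lambda>n. lincomb (\<omega> (r n)) X x * indicator B x) \<longlonglongrightarrow> (K - z0 x) * indicator B x"
      using r(2) by eventually_elim (unfold eqX, intro tendsto_intros)
    show "AE x in M. norm (lincomb (\<omega> (r n)) X x * indicator B x) \<le> K * indicator B x" for n
      using lincomb_range[OF w[of "r n"], of X _ K] Xr by (intro AE_I2) (auto simp: indicator_def)
  qed (use B_measurable in auto)
  from LIMSEQ_unique[OF this l0] have i0: "(\<integral>x. (K - z0 x) * indicator B x \<partial>M) = 0" .
  have zi: "integrable M (\<lambda>x. (K - z0 x) * indicator B x)"
  proof -
    have "AE x in M. \<bar>K - z0 x\<bar> \<le> K" using range by eventually_elim auto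
    from integrable_on_finite[OF B_measurable _ this] show ?thesis by (simp add: mult.commute)
  qed
  have "AE x in M. 0 \<le> (K - z0 x) * indicator B x" using range by eventually_elim (auto simp: indicator_def)
  from integral_nonneg_eq_0_iff_AE[OF zi this] i0 have "AE x in M. (K - z0 x) * indicator B x = 0" by simp
  then show ?thesis by eventually_elim auto
qed

text \<open>Closedness of D, applied to the cutoff times the combinations. Of the two terms of the
  product rule one converges by the local limit of the gradients, the other by domination, the
  combinations being bounded by K.\<close>

lemma local_limit_dom:
  assumes L: "local_limit \<omega> (\<lambda>n. Zb n j) z0" and G: "local_limit \<omega> (\<lambda>n. D (Zb n j)) G0" and w: "\<And>n. \<omega> n \<in> cweights n"
  shows "(\<lambda>x. \<zeta> l x * z0 x) \<in> Dom" "AE x in M. D (\<lambda>x. \<zeta> l x * z0 x) x = \<zeta> l x *\<^sub>R G0 x + z0 x *\<^sub>R D (\<zeta> l) x"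
proof -
  obtain r :: "nat \<Rightarrow> nat" where r: "strict_mono r" "AE x in M. (\<lambda>n. lincomb (\<omega> (r n)) (\<lambda>n. Zb n j) x) \<longlonglongrightarrow> z0 x"
    using L by (auto simp: local_limit_def)
  have range: "AE x in M. 0 \<le> z0 x \<and> z0 x \<le> K" by (rule local_limit_range[OF L w]) (auto intro: Zb_dom)
  define u where "u n = lincomb (\<omega> (r n)) (\<lambda>n. Zb n j)" for n
  define U where "U n = lincomb (\<omega> (r n)) (\<lambda>n. D (Zb n j))" for n
  have fin: "finite {i. \<omega> n i \<noteq> 0}" for n using w[of n] by (simp add: cweights_def)
  have ud: "u n \<in> Dom" "AE x in M. D (u n) x = U n x" for n
  proof -
    have "(\<lambda>x. \<Sum>i | \<omega> (r n) i \<noteq> 0. \<omega> (r n) i * Zb i j x) \<in> Dom \<and>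
      (AE x in M. D (\<lambda>x. \<Sum>i | \<omega> (r n) i \<noteq> 0. \<omega> (r n) i * Zb i j x) x = (\<Sum>i | \<omega> (r n) i \<noteq> 0. \<omega> (r n) i *\<^sub>R D (Zb i j) x))"
      by (rule dom_sum[OF fin Zb_dom(1)])
    then show "u n \<in> Dom" "AE x in M. D (u n) x = U n x"
      by (auto simp: u_def U_def lincomb_def[abs_def])
  qed
  have u01: "0 \<le> u n x" "u n x \<le> K" for n x
    using lincomb_range[OF w[of "r n"], of "\<lambda>n. Zb n j" x K] Zb_dom(2,3) by (auto simp: u_def)
  have ub: "AE x in M. \<bar>u n x\<bar> \<le> K" for n using u01 by (intro AE_I2) simp
  have zb: "AE x in M. \<bar>\<zeta> l x\<bar> \<le> 1" using cut_range by auto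
  note pr = dom_product[OF cut_dom[of l] zb ud(1) ub]
  have [measurable]: "u n \<in> borel_measurable M" "U n \<in> borel_measurable M" "z0 \<in> borel_measurable M" "G0 \<in> borel_measurable M" "D (\<zeta> l) \<in> borel_measurable M" for n
    using ud(1) L G lincomb_L2H[of M "\<lambda>n. D (Zb n j)"] D_L2H[OF Zb_dom(1)] D_measurable[OF cut_dom]
    by (auto simp: local_limit_def U_def L2H_def intro: dom_measurable)
  have zz: "L2H M (\<lambda>x. \<zeta> l x *\<^sub>R z0 x)" and zG: "L2H M (\<lambda>x. \<zeta> l x *\<^sub>R G0 x)" using L G by (auto simp: local_limit_def)
  have zU: "L2H M (\<lambda>x. \<zeta> l x *\<^sub>R U n x)" for n
    unfolding U_def by (rule L2H_mult[OF lincomb_L2H[OF D_L2H[OF Zb_dom(1)]] _ zb]) measurable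
  have DL: "L2H M (D (\<zeta> l))" by (rule D_L2H[OF cut_dom])
  have z0L: "L2H M (\<lambda>x. z0 x *\<^sub>R D (\<zeta> l) x)"
  proof (rule L2H_mult[OF DL])
    show "AE x in M. \<bar>z0 x\<bar> \<le> K" using range by eventually_elim auto
  qed measurable
  have uL: "L2H M (\<lambda>x. u n x *\<^sub>R D (\<zeta> l) x)" for n by (rule L2H_mult[OF DL _ ub]) measurable
  have c1: "(\<lambda>n. \<integral>x. (\<zeta> l x * u n x - \<zeta> l x * z0 x)\<^sup>2 \<partial>M) \<longlonglongrightarrow> 0"
  proof -
    have "(\<lambda>n. \<integral>x. (norm (\<zeta> l x *\<^sub>R lincomb (\<omega> n) (\<lambda>n. Zb n j) x - \<zeta> l x *\<^sub>R z0 x))\<^sup>2 \<partial>M) \<longlonglongrightarrow> 0" using L by (simp add: local_limit_def)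
    from LIMSEQ_subseq_LIMSEQ[OF this r(1)] show ?thesis by (simp add: comp_def u_def)
  qed
  have c2: "(\<lambda>n. \<integral>x. (norm (\<zeta> l x *\<^sub>R U n x - \<zeta> l x *\<^sub>R G0 x))\<^sup>2 \<partial>M) \<longlonglongrightarrow> 0"
  proof -
    have "(\<lambda>n. \<integral>x. (norm (\<zeta> l x *\<^sub>R lincomb (\<omega> n) (\<lambda>n. D (Zb n j)) x - \<zeta> l x *\<^sub>R G0 x))\<^sup>2 \<partial>M) \<longlonglongrightarrow> 0" using G by (simp add: local_limit_def)
    from LIMSEQ_subseq_LIMSEQ[OF this r(1)] show ?thesis by (simp add: comp_def U_def)
  qed
  have c3: "(\<lambda>n. \<integral>x. (norm (u n x *\<^sub>R D (\<zeta> l) x - z0 x *\<^sub>R D (\<zeta> l) x))\<^sup>2 \<partial>M) \<longlonglongrightarrow> 0"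
  proof (rule L2H_dominated_convergence(2)[where W="\<lambda>x. K * norm (D (\<zeta> l) x)"])
    show "L2 M (\<lambda>x. K * norm (D (\<zeta> l) x))" by (intro L2_cmult L2H_norm DL)
    show "AE x in M. (\<lambda>n. u n x *\<^sub>R D (\<zeta> l) x) \<longlonglongrightarrow> z0 x *\<^sub>R D (\<zeta> l) x"
      using r(2) by eventually_elim (unfold u_def, intro tendsto_intros)
    show "AE x in M. norm (u n x *\<^sub>R D (\<zeta> l) x) \<le> K * norm (D (\<zeta> l) x)" for n
      using u01 by (intro AE_I2) (simp add: mult_right_mono)
  qed measurable
  have c4: "(\<lambda>n. \<integral>x. (norm (D (\<lambda>x. \<zeta> l x * u n x) x - (\<zeta> l x *\<^sub>R G0 x + z0 x *\<^sub>R D (\<zeta> l) x)))\<^sup>2 \<partial>M) \<longlonglongrightarrow> 0"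
  proof (rule tendsto_sandwich[OF _ _ tendsto_const])
    show "(\<lambda>n. 2 * (\<integral>x. (norm (\<zeta> l x *\<^sub>R U n x - \<zeta> l x *\<^sub>R G0 x))\<^sup>2 \<partial>M) + 2 * (\<integral>x. (norm (u n x *\<^sub>R D (\<zeta> l) x - z0 x *\<^sub>R D (\<zeta> l) x))\<^sup>2 \<partial>M)) \<longlonglongrightarrow> 0"
      by (intro tendsto_add_zero tendsto_mult_right_zero c2 c3)
    show "\<forall>\<^sub>F n in sequentially. (\<integral>x. (norm (D (\<lambda>x. \<zeta> l x * u n x) x - (\<zeta> l x *\<^sub>R G0 x + z0 x *\<^sub>R D (\<zeta> l) x)))\<^sup>2 \<partial>M)
      \<le> 2 * (\<integral>x. (norm (\<zeta> l x *\<^sub>R U n x - \<zeta> l x *\<^sub>R G0 x))\<^sup>2 \<partial>M) + 2 * (\<integral>x. (norm (u n x *\<^sub>R D (\<zeta> l) x - z0 x *\<^sub>R D (\<zeta> l) x))\<^sup>2 \<partial>M)"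
    proof (intro always_eventually allI)
      fix n
      have [measurable]: "D (\<lambda>x. \<zeta> l x * u n x) \<in> borel_measurable M" by (rule D_measurable[OF pr(1)])
      have "(\<integral>x. (norm (D (\<lambda>x. \<zeta> l x * u n x) x - (\<zeta> l x *\<^sub>R G0 x + z0 x *\<^sub>R D (\<zeta> l) x)))\<^sup>2 \<partial>M)
        = (\<integral>x. (norm ((\<zeta> l x *\<^sub>R U n x - \<zeta> l x *\<^sub>R G0 x) + (u n x *\<^sub>R D (\<zeta> l) x - z0 x *\<^sub>R D (\<zeta> l) x)))\<^sup>2 \<partial>M)"
      proof (rule integral_cong_AE)
        show "AE x in M. (norm (D (\<lambda>x. \<zeta> l x * u n x) x - (\<zeta> l x *\<^sub>R G0 x + z0 x *\<^sub>R D (\<zeta> l) x)))\<^sup>2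
          = (norm ((\<zeta> l x *\<^sub>R U n x - \<zeta> l x *\<^sub>R G0 x) + (u n x *\<^sub>R D (\<zeta> l) x - z0 x *\<^sub>R D (\<zeta> l) x)))\<^sup>2"
          using pr(2)[of n] ud(2)[of n] by eventually_elim (simp add: algebra_simps)
      qed measurable
      also have "\<dots> \<le> 2 * (\<integral>x. (norm (\<zeta> l x *\<^sub>R U n x - \<zeta> l x *\<^sub>R G0 x))\<^sup>2 \<partial>M) + 2 * (\<integral>x. (norm (u n x *\<^sub>R D (\<zeta> l) x - z0 x *\<^sub>R D (\<zeta> l) x))\<^sup>2 \<partial>M)"
        by (intro integral_square_add_le L2H_diff zU zG uL z0L)
      finally show "(\<integral>x. (norm (D (\<lambda>x. \<zeta> l x * u n x) x - (\<zeta> l x *\<^sub>R G0 x + z0 x *\<^sub>R D (\<zeta> l) x)))\<^sup>2 \<partial>M)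
        \<le> 2 * (\<integral>x. (norm (\<zeta> l x *\<^sub>R U n x - \<zeta> l x *\<^sub>R G0 x))\<^sup>2 \<partial>M) + 2 * (\<integral>x. (norm (u n x *\<^sub>R D (\<zeta> l) x - z0 x *\<^sub>R D (\<zeta> l) x))\<^sup>2 \<partial>M)" .
    qed
  qed simp
  have zzL: "L2 M (\<lambda>x. \<zeta> l x * z0 x)" using zz by (simp add: L2_iff_L2H)
  show "(\<lambda>x. \<zeta> l x * z0 x) \<in> Dom" "AE x in M. D (\<lambda>x. \<zeta> l x * z0 x) x = \<zeta> l x *\<^sub>R G0 x + z0 x *\<^sub>R D (\<zeta> l) x"
    using dom_closed[OF pr(1) zzL L2H_add[OF zG z0L] c1 c4] by blast+
qed

text \<open>If the integrals stayed lower by e for all late indices, so would those of the forward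
  combinations and hence of the limit. This leads back from combinations to one actual time
  \<open>tn m\<close>, at which Jensen's inequality can be applied.\<close>

lemma local_limit_average:
  assumes L: "local_limit \<omega> (\<lambda>n. Z n j) z0" and w: "\<And>n. \<omega> n \<in> cweights n"
    and A: "A \<in> sets M" "emeasure M A < \<infinity>" and e: "0 < e"
  shows "\<exists>m\<ge>n0. (\<integral>x. z0 x * indicator A x \<partial>M) - e \<le> (\<integral>x. Z m j x * indicator A x \<partial>M)"
proof (rule ccontr)
  assume "\<not> ?thesis"
  then have less: "(\<integral>x. Z m j x * indicator A x \<partial>M) \<le> (\<integral>x. z0 x * indicator A x \<partial>M) - e" if "n0 \<le> m" for m
    using that by (meson linear)
  have [measurable]: "A \<in> sets M" by (rule A)
  have [measurable]: "Z n j \<in> borel_measurable M" "z0 \<in> borel_measurable M" for n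
    using L by (auto simp: local_limit_def intro: dom_measurable Z_dom)
  obtain r :: "nat \<Rightarrow> nat" where r: "strict_mono r" "AE x in M. (\<lambda>n. lincomb (\<omega> (r n)) (\<lambda>n. Z n j) x) \<longlonglongrightarrow> z0 x"
    using L by (auto simp: local_limit_def)
  have Zi: "integrable M (\<lambda>x. Z n j x * indicator A x)" for n
  proof -
    have "integrable M (\<lambda>x. indicator A x * Z n j x)"
      by (rule integrable_on_finite[where C=K]) (use A Z_dom(2,3) in auto)
    then show ?thesis by (simp add: mult.commute)
  qed
  have lm [measurable]: "lincomb d (\<lambda>n. Z n j) \<in> borel_measurable M" for d
    unfolding lincomb_def[abs_def] by measurable
  have lim: "(\<lambda>n. \<integral>x. lincomb (\<omega> (r n)) (\<lambda>n. Z n j) x * indicator A x \<partial>M) \<longlonglongrightarrow> (\<integral>x. z0 x * indicator A x \<partial>M)"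
  proof (rule integral_dominated_convergence[where w="\<lambda>x. K * indicator A x"])
    show "AE x in M. (\<lambda>n. lincomb (\<omega> (r n)) (\<lambda>n. Z n j) x * indicator A x) \<longlonglongrightarrow> z0 x * indicator A x"
      using r(2) by eventually_elim (intro tendsto_intros)
    show "AE x in M. norm (lincomb (\<omega> (r n)) (\<lambda>n. Z n j) x * indicator A x) \<le> K * indicator A x" for n
      using lincomb_range[OF w[of "r n"], of "\<lambda>n. Z n j" _ K] Z_dom(2,3) by (intro AE_I2) (auto simp: indicator_def)
  qed (use A in auto)
  have "(\<integral>x. z0 x * indicator A x \<partial>M) \<le> (\<integral>x. z0 x * indicator A x \<partial>M) - e"
  proof (rule LIMSEQ_le_const2[OF lim], intro exI[of _ n0] allI impI)
    fix n assume n: "n0 \<le> n"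
    have rn: "n0 \<le> r n" using n seq_suble[OF r(1), of n] by simp
    show "(\<integral>x. lincomb (\<omega> (r n)) (\<lambda>n. Z n j) x * indicator A x \<partial>M) \<le> (\<integral>x. z0 x * indicator A x \<partial>M) - e"
      unfolding integral_lincomb(2)[OF Zi] by (rule lincomb_le_average[OF w[of "r n"]]) (use less rn in auto)
  qed
  then show False using e by simp
qed

text \<open>The weak limit of the logarithmic transforms is a time-discrete subsolution of the
  Hamilton-Jacobi equation.\<close>

lemma limit_profile:
  "\<exists>z zb G. (\<forall>j\<le>J. z j \<in> borel_measurable M) \<and> (\<forall>j<J. zb j \<in> borel_measurable M)
    \<and> (AE x in M. (\<forall>j\<le>J. 0 \<le> z j x \<and> z j x \<le> K) \<and> (\<forall>j<J. 0 \<le> zb j x \<and> zb j x \<le> K \<and> z j x \<le> zb j x \<and> zb j x \<le> z (Suc j) x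
        \<and> (1/2) * (norm (G j x))\<^sup>2 \<le> (real J + 1) * (z (Suc j) x - z j x)))
    \<and> (AE x in M. x \<in> B \<longrightarrow> (\<forall>j<J. zb j x = K))
    \<and> (\<forall>j<J. \<forall>l. (\<lambda>x. \<zeta> l x * zb j x) \<in> Dom \<and> (AE x in M. D (\<lambda>x. \<zeta> l x * zb j x) x = \<zeta> l x *\<^sub>R G j x + zb j x *\<^sub>R D (\<zeta> l) x))
    \<and> (\<forall>A n0 e. A \<in> sets M \<longrightarrow> emeasure M A < \<infinity> \<longrightarrow> 0 < e \<longrightarrow>
        (\<exists>m\<ge>n0. (\<integral>x. z J x * indicator A x \<partial>M) - e \<le> (\<integral>x. Z m J x * indicator A x \<partial>M)))"
proof -
  from profile_limits_exist obtain \<omega> zb z G where w: "\<And>n. \<omega> n \<in> cweights n"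
    and zb: "\<And>j. j < J \<Longrightarrow> local_limit \<omega> (\<lambda>n. Zb n j) (zb j)" and G: "\<And>j. j < J \<Longrightarrow> local_limit \<omega> (\<lambda>n. D (Zb n j)) (G j)"
    and z: "\<And>j. j \<le> J \<Longrightarrow> local_limit \<omega> (\<lambda>n. Z n j) (z j)" by blast
  have r1: "AE x in M. 0 \<le> z j x \<and> z j x \<le> K" if "j \<le> J" for j
    by (rule local_limit_range[OF z[OF that] w]) (auto intro: Z_dom)
  have r2: "AE x in M. 0 \<le> zb j x \<and> zb j x \<le> K" if "j < J" for j
    by (rule local_limit_range[OF zb[OF that] w]) (auto intro: Zb_dom)
  have m1: "AE x in M. z j x \<le> zb j x" if j: "j < J" for j
  proof (rule local_limit_le[OF z _ zb[OF j] _ w])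
    fix l g assume g: "g \<in> Dom" "\<And>x. 0 \<le> g x" "\<And>x. g x \<le> 1"
    from test_limits[OF cut_test(2)[OF g, of l]]
    show "\<exists>e. e \<longlonglongrightarrow> 0 \<and> (\<forall>\<^sub>F n in sequentially. (\<integral>x. Z n j x * ((\<zeta> l x)\<^sup>2 * g x) \<partial>M) \<le> (\<integral>x. Zb n j x * ((\<zeta> l x)\<^sup>2 * g x) \<partial>M) + e n)"
      by (fast elim: eventually_mono)
  qed (use j Z_dom(1) Zb_dom(1) in auto)
  have m2: "AE x in M. zb j x \<le> z (Suc j) x" if j: "j < J" for j
  proof (rule local_limit_le[OF zb[OF j] _ z _ w])
    fix l g assume g: "g \<in> Dom" "\<And>x. 0 \<le> g x" "\<And>x. g x \<le> 1"
    from test_limits[OF cut_test(2)[OF g, of l]]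
    show "\<exists>e. e \<longlonglongrightarrow> 0 \<and> (\<forall>\<^sub>F n in sequentially. (\<integral>x. Zb n j x * ((\<zeta> l x)\<^sup>2 * g x) \<partial>M) \<le> (\<integral>x. Z n (Suc j) x * ((\<zeta> l x)\<^sup>2 * g x) \<partial>M) + e n)"
      by (fast elim: eventually_mono)
  qed (use j Z_dom(1) Zb_dom(1) in auto)
  have m3: "AE x in M. (1/2) * (norm (G j x))\<^sup>2 \<le> (real J + 1) * (z (Suc j) x - z j x)" if j: "j < J" for j
    by (rule local_limit_energy[OF G[OF j] z z w]) (use j in auto)
  have all1: "AE x in M. \<forall>j. j \<le> J \<longrightarrow> 0 \<le> z j x \<and> z j x \<le> K" using r1 by (simp add: AE_all_countable AE_impI)
  have all2: "AE x in M. \<forall>j. j < J \<longrightarrow> 0 \<le> zb j x \<and> zb j x \<le> K" using r2 by (simp add: AE_all_countable AE_impI)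
  have all3: "AE x in M. \<forall>j. j < J \<longrightarrow> z j x \<le> zb j x" using m1 by (simp add: AE_all_countable AE_impI)
  have all4: "AE x in M. \<forall>j. j < J \<longrightarrow> zb j x \<le> z (Suc j) x" using m2 by (simp add: AE_all_countable AE_impI)
  have all5: "AE x in M. \<forall>j. j < J \<longrightarrow> (1/2) * (norm (G j x))\<^sup>2 \<le> (real J + 1) * (z (Suc j) x - z j x)"
    unfolding AE_all_countable by (intro allI AE_impI m3)
  have ae: "AE x in M. (\<forall>j\<le>J. 0 \<le> z j x \<and> z j x \<le> K) \<and> (\<forall>j<J. 0 \<le> zb j x \<and> zb j x \<le> K \<and> z j x \<le> zb j x \<and> zb j x \<le> z (Suc j) x
        \<and> (1/2) * (norm (G j x))\<^sup>2 \<le> (real J + 1) * (z (Suc j) x - z j x))"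
    using all1 all2 all3 all4 all5 by eventually_elim blast
  have "AE x in M. \<forall>j. j < J \<longrightarrow> x \<in> B \<longrightarrow> zb j x = K"
    unfolding AE_all_countable by (intro allI AE_impI local_limit_on_B[OF zb w])
  then have aeB: "AE x in M. x \<in> B \<longrightarrow> (\<forall>j<J. zb j x = K)" by eventually_elim blast
  show ?thesis
  proof (rule exI[of _ z], rule exI[of _ zb], rule exI[of _ G], intro conjI allI impI ae aeB)
    show "z j \<in> borel_measurable M" if "j \<le> J" for j using z[OF that] by (simp add: local_limit_def)
    show "zb j \<in> borel_measurable M" if "j < J" for j using zb[OF that] by (simp add: local_limit_def)
  qed (use local_limit_dom[OF zb G w] local_limit_average[OF z[OF order_refl] w] in auto)
qed

end

section \<open>Discrete Hamilton-Jacobi subsolutions\<close>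

text \<open>Geometric averages over the future: they smooth the time steps so that backward differences
  control the gradient.\<close>

definition geo_avg :: "real \<Rightarrow> nat \<Rightarrow> (nat \<Rightarrow> 'v::real_vector) \<Rightarrow> nat \<Rightarrow> 'v" where
  "geo_avg \<rho> J u k = (\<Sum>i\<in>{k..<J}. (\<rho> * (1 - \<rho>) ^ (i - k)) *\<^sub>R u i)"

lemma geo_avg_rec:
  assumes "k < J"
  shows "geo_avg \<rho> J u k = \<rho> *\<^sub>R u k + (1 - \<rho>) *\<^sub>R geo_avg \<rho> J u (Suc k)"
proof -
  have "geo_avg \<rho> J u k = \<rho> *\<^sub>R u k + (\<Sum>i\<in>{Suc k..<J}. (\<rho> * (1 - \<rho>) ^ (i - k)) *\<^sub>R u i)"
    unfolding geo_avg_def using assms by (simp add: sum.atLeast_Suc_lessThan)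
  also have "(\<Sum>i\<in>{Suc k..<J}. (\<rho> * (1 - \<rho>) ^ (i - k)) *\<^sub>R u i) = (1 - \<rho>) *\<^sub>R geo_avg \<rho> J u (Suc k)"
    unfolding geo_avg_def scaleR_sum_right
  proof (intro sum.cong refl)
    fix i assume "i \<in> {Suc k..<J}"
    then have "i - k = Suc (i - Suc k)" by auto
    then show "(\<rho> * (1 - \<rho>) ^ (i - k)) *\<^sub>R u i = (1 - \<rho>) *\<^sub>R (\<rho> * (1 - \<rho>) ^ (i - Suc k)) *\<^sub>R u i" by simp
  qed
  finally show ?thesis .
qed

lemma geo_avg_end: "geo_avg \<rho> J u J = 0"
  by (simp add: geo_avg_def)

lemma norm_convex_square_le:
  fixes a b :: "'v::real_normed_vector"
  assumes "0 \<le> \<rho>" "\<rho> \<le> 1"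
  shows "(norm (\<rho> *\<^sub>R a + (1 - \<rho>) *\<^sub>R b))\<^sup>2 \<le> \<rho> * (norm a)\<^sup>2 + (1 - \<rho>) * (norm b)\<^sup>2"
proof -
  have "norm (\<rho> *\<^sub>R a + (1 - \<rho>) *\<^sub>R b) \<le> \<rho> * norm a + (1 - \<rho>) * norm b"
    using assms by (intro order_trans[OF norm_triangle_ineq]) simp
  then have "(norm (\<rho> *\<^sub>R a + (1 - \<rho>) *\<^sub>R b))\<^sup>2 \<le> (\<rho> * norm a + (1 - \<rho>) * norm b)\<^sup>2" by (intro power_mono) auto
  also have "\<dots> = \<rho> * (norm a)\<^sup>2 + (1 - \<rho>) * (norm b)\<^sup>2 - \<rho> * (1 - \<rho>) * (norm a - norm b)\<^sup>2"
    by (simp add: power2_eq_square algebra_simps)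
  also have "\<dots> \<le> \<rho> * (norm a)\<^sup>2 + (1 - \<rho>) * (norm b)\<^sup>2" using assms by simp
  finally show ?thesis .
qed

context
  fixes y yb :: "nat \<Rightarrow> real" and g :: "nat \<Rightarrow> 'v::real_normed_vector" and \<rho> \<kappa> K :: real and J :: nat
  assumes l: "0 \<le> \<rho>" "\<rho> \<le> 1" and \<kappa>: "0 < \<kappa>"
    and yr: "\<And>j. j \<le> J \<Longrightarrow> 0 \<le> y j" "\<And>j. j < J \<Longrightarrow> 0 \<le> yb j" "\<And>j. j < J \<Longrightarrow> yb j \<le> K"
    and mono: "\<And>j. j < J \<Longrightarrow> y (Suc j) \<le> yb j" "\<And>j. j < J \<Longrightarrow> yb j \<le> y j"
    and en: "\<And>j. j < J \<Longrightarrow> (\<kappa>/2) * (norm (g j))\<^sup>2 \<le> y j - y (Suc j)"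
begin

lemma geo_avg_range: "k \<le> J \<Longrightarrow> 0 \<le> geo_avg \<rho> J yb k" "k \<le> J \<Longrightarrow> 0 \<le> K \<Longrightarrow> geo_avg \<rho> J yb k \<le> K"
proof -
  show "k \<le> J \<Longrightarrow> 0 \<le> geo_avg \<rho> J yb k"
  proof (induction rule: inc_induct)
    case (step k)
    then show ?case using geo_avg_rec[of k J \<rho> yb] yr(2)[of k] l by simp
  qed (simp add: geo_avg_end)
  assume "0 \<le> K"
  show "k \<le> J \<Longrightarrow> geo_avg \<rho> J yb k \<le> K"
  proof (induction rule: inc_induct)
    case base
    show ?case using \<open>0 \<le> K\<close> by (simp add: geo_avg_end)
  next
    case (step k)
    have "\<rho> * yb k + (1 - \<rho>) * geo_avg \<rho> J yb (Suc k) \<le> \<rho> * K + (1 - \<rho>) * K"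
      using step yr(3)[of k] l by (intro add_mono mult_left_mono) auto
    then show ?case using geo_avg_rec[of k J \<rho> yb] step by (simp add: algebra_simps)
  qed
qed

text \<open>In the application y = K - z and yb = K - zb, so values decrease in j, and \<kappa> is
  the length 1/(J+1) of a time step. The proof is a backward induction: the recursion writes each
  average as a convex combination of g k and the next average, convexity of the square splits it,
  and yb <= y restores the form of the claim.\<close>

lemma geo_avg_gradient: "k < J \<Longrightarrow> (\<kappa>/2) * (norm (geo_avg \<rho> J g k))\<^sup>2 \<le> \<rho> * (y k - geo_avg \<rho> J yb (Suc k))"
proof -
  assume "k < J"
  then have "k \<le> J - 1" "0 < J" by auto
  from this(1) show "(\<kappa>/2) * (norm (geo_avg \<rho> J g k))\<^sup>2 \<le> \<rho> * (y k - geo_avg \<rho> J yb (Suc k))"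
  proof (induction rule: inc_induct)
    case base
    have J: "J - 1 < J" "Suc (J - 1) = J" using \<open>0 < J\<close> by auto
    have "(\<kappa>/2) * (norm (geo_avg \<rho> J g (J - 1)))\<^sup>2 = (\<kappa>/2) * (norm (\<rho> *\<^sub>R g (J - 1) + (1 - \<rho>) *\<^sub>R (0::'v)))\<^sup>2"
      using geo_avg_rec[OF J(1), of \<rho> g] J(2) by (simp add: geo_avg_end)
    also have "\<dots> \<le> (\<kappa>/2) * (\<rho> * (norm (g (J - 1)))\<^sup>2 + (1 - \<rho>) * (norm (0::'v))\<^sup>2)"
      using \<kappa> by (intro mult_left_mono norm_convex_square_le l) auto
    also have "\<dots> = \<rho> * ((\<kappa>/2) * (norm (g (J - 1)))\<^sup>2)" by simp
    also have "\<dots> \<le> \<rho> * (y (J - 1) - 0)"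
      using en[OF J(1)] J(2) yr(1)[of J] l by (intro mult_left_mono) auto
    finally show ?case using J(2) by (simp add: geo_avg_end)
  next
    case (step k)
    have k: "k < J" "Suc k < J" using step by auto
    have "(\<kappa>/2) * (norm (geo_avg \<rho> J g k))\<^sup>2 = (\<kappa>/2) * (norm (\<rho> *\<^sub>R g k + (1 - \<rho>) *\<^sub>R geo_avg \<rho> J g (Suc k)))\<^sup>2"
      by (simp only: geo_avg_rec[OF k(1), of \<rho> g])
    also have "\<dots> \<le> (\<kappa>/2) * (\<rho> * (norm (g k))\<^sup>2 + (1 - \<rho>) * (norm (geo_avg \<rho> J g (Suc k)))\<^sup>2)"
      using \<kappa> by (intro mult_left_mono norm_convex_square_le l) auto
    also have "\<dots> = \<rho> * ((\<kappa>/2) * (norm (g k))\<^sup>2) + (1 - \<rho>) * ((\<kappa>/2) * (norm (geo_avg \<rho> J g (Suc k)))\<^sup>2)" by (simp only: distrib_left mult_ac)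
    also have "\<dots> \<le> \<rho> * (y k - y (Suc k)) + (1 - \<rho>) * (\<rho> * (y (Suc k) - geo_avg \<rho> J yb (Suc (Suc k))))"
      using step.IH en[OF k(1)] l by (intro add_mono mult_left_mono) auto
    also have "\<dots> = \<rho> * (y k - (\<rho> * y (Suc k) + (1 - \<rho>) * geo_avg \<rho> J yb (Suc (Suc k))))" by (simp add: algebra_simps)
    also have "\<dots> \<le> \<rho> * (y k - geo_avg \<rho> J yb (Suc k))"
    proof (intro mult_left_mono diff_left_mono l)
      have "\<rho> * yb (Suc k) \<le> \<rho> * y (Suc k)" using mono(2)[OF k(2)] l by (intro mult_left_mono)
      then show "geo_avg \<rho> J yb (Suc k) \<le> \<rho> * y (Suc k) + (1 - \<rho>) * geo_avg \<rho> J yb (Suc (Suc k))"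
        using geo_avg_rec[OF k(2), of \<rho> yb] by simp
    qed
    finally show ?case .
  qed
qed

text \<open>With Y the averages of yb, \<open>geo_avg_gradient\<close> produces Y at k + 2, while
  the backward difference asks for Y at k + 1. Exchanging them costs \<rho> times a difference of
  consecutive averages, which is itself at most \<rho> K.\<close>

lemma geo_avg_backward_euler:
  assumes k: "Suc k < J" and K: "0 \<le> K"
  shows "(\<kappa>/2) * (norm (geo_avg \<rho> J g (Suc k)))\<^sup>2 \<le> geo_avg \<rho> J yb k - geo_avg \<rho> J yb (Suc k) + \<rho>\<^sup>2 * K"
proof -
  let ?Y = "geo_avg \<rho> J yb"
  have k': "k < J" using k by simp
  have r0: "?Y k = \<rho> * yb k + (1 - \<rho>) * ?Y (Suc k)" using geo_avg_rec[OF k', of \<rho> yb] by simp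
  have r1: "?Y (Suc k) = \<rho> * yb (Suc k) + (1 - \<rho>) * ?Y (Suc (Suc k))" using geo_avg_rec[OF k, of \<rho> yb] by simp
  have "(\<kappa>/2) * (norm (geo_avg \<rho> J g (Suc k)))\<^sup>2 \<le> \<rho> * (y (Suc k) - ?Y (Suc (Suc k)))" by (rule geo_avg_gradient[OF k])
  also have "\<dots> \<le> \<rho> * (yb k - ?Y (Suc (Suc k)))" using mono(1)[OF k'] l by (intro mult_left_mono diff_right_mono)
  also have "\<dots> = ?Y k - ?Y (Suc k) + \<rho> * (?Y (Suc k) - ?Y (Suc (Suc k)))" using r0 by (simp add: algebra_simps)
  also have "?Y (Suc k) - ?Y (Suc (Suc k)) = \<rho> * (yb (Suc k) - ?Y (Suc (Suc k)))" using r1 by (simp add: algebra_simps)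
  also have "?Y k - ?Y (Suc k) + \<rho> * (\<rho> * (yb (Suc k) - ?Y (Suc (Suc k)))) \<le> ?Y k - ?Y (Suc k) + \<rho> * (\<rho> * K)"
    using yr(3)[OF k] geo_avg_range(1)[of "Suc (Suc k)"] k l by (intro add_left_mono mult_left_mono) auto
  finally show ?thesis by (simp add: power2_eq_square mult.assoc)
qed

text \<open>Every yb i with i < J is at least y J, and the factor is the total weight of the
  geometric series cut off at J.\<close>

lemma geo_avg_lower: "k \<le> J \<Longrightarrow> (1 - (1 - \<rho>) ^ (J - k)) * y J \<le> geo_avg \<rho> J yb k"
proof (induction rule: inc_induct)
  case base
  then show ?case by (simp add: geo_avg_end)
next
  case (step k)
  have "y J \<le> y (Suc k)"
  proof -
    have "Suc k \<le> J" using step by simp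
    then show ?thesis
    proof (induction rule: inc_induct)
      case (step i)
      then show ?case using mono(1)[of i] mono(2)[of i] by simp
    qed simp
  qed
  then have yJ: "y J \<le> yb k" using mono(1)[of k] step by simp
  have e: "J - k = Suc (J - Suc k)" using step by simp
  have "(1 - (1 - \<rho>) ^ (J - k)) * y J = \<rho> * y J + (1 - \<rho>) * ((1 - (1 - \<rho>) ^ (J - Suc k)) * y J)"
    unfolding e by (simp add: algebra_simps)
  also have "\<dots> \<le> \<rho> * yb k + (1 - \<rho>) * geo_avg \<rho> J yb (Suc k)"
    using step.IH yJ l by (intro add_mono mult_left_mono) auto
  also have "\<dots> = geo_avg \<rho> J yb k" using geo_avg_rec[of k J \<rho> yb] step by simp
  finally show ?case .
qed

text \<open>Discrete first order condition: with s and r the times of k and k - 1, maximality bounds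
  the backward difference of the averages by W (1/r - 1/s), and s^2 (1/r - 1/s) = \<kappa>' (1 +
  \<kappa>'/r). The step condition pays for the excess over \<kappa>' and for the smoothing error
  \<rho>^2 K.\<close>

lemma geo_avg_max_gradient:
  assumes K: "0 \<le> K" and a: "0 < a" and \<kappa>': "0 \<le> \<kappa>'" "real m * \<kappa>' \<le> 1" and m: "m < J"
    and step: "\<kappa>' * (1 + \<kappa>' / a) + \<rho>\<^sup>2 * (a + 1)\<^sup>2 / a \<le> \<kappa>"
    and k: "k \<in> {1..m}" and W: "W = (a + real k * \<kappa>') * geo_avg \<rho> J yb k" "a * K < W"
    and max: "\<And>i. i \<in> {1..m} \<Longrightarrow> (a + real i * \<kappa>') * geo_avg \<rho> J yb i \<le> W"
  shows "((a + real k * \<kappa>') * norm (geo_avg \<rho> J g k))\<^sup>2 \<le> 2 * W"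
proof -
  let ?Y = "geo_avg \<rho> J yb"
  obtain i where i: "k = Suc i" using k by (cases k) auto
  define s r where "s = a + real k * \<kappa>'" and "r = a + real i * \<kappa>'"
  have sr: "s = r + \<kappa>'" by (simp add: s_def r_def i algebra_simps)
  have r: "a \<le> r" using \<kappa>' by (simp add: r_def)
  have rp: "0 < r" and sp: "0 < s" using r a \<kappa>' sr by auto
  have s1: "s \<le> a + 1"
  proof -
    have "real k * \<kappa>' \<le> real m * \<kappa>'" using k \<kappa>' by (intro mult_right_mono) auto
    then show ?thesis using \<kappa>' by (simp add: s_def)
  qed
  have W0: "0 < W" using W(2) a K by (meson le_less_trans mult_nonneg_nonneg less_imp_le)
  have prev: "r * ?Y i \<le> W"
  \<comment> \<open>Index 0 does not compete for the maximum; there the value is at most a K, which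
    is below W by hypothesis.\<close>
  proof (cases "i = 0")
    case True
    then have "r * ?Y i \<le> a * K" using geo_avg_range(2)[of 0] K a by (simp add: r_def)
    then show ?thesis using W(2) by simp
  next
    case False
    then show ?thesis using max[of i] k i by (simp add: r_def)
  qed
  have Wk: "?Y k = W / s" using W(1) sp by (simp add: s_def)
  have "s\<^sup>2 * (?Y i - ?Y k) \<le> s\<^sup>2 * (W / r - W / s)"
    unfolding Wk using prev rp by (intro mult_left_mono diff_right_mono) (auto simp: pos_le_divide_eq mult.commute)
  also have "\<dots> = W * (s * (s - r) / r)"
    using rp sp by (simp add: power2_eq_square field_simps)
  also have "s * (s - r) / r = \<kappa>' * (1 + \<kappa>' / r)"
    using rp by (simp add: sr field_simps)
  also have "W * (\<kappa>' * (1 + \<kappa>' / r)) \<le> W * (\<kappa>' * (1 + \<kappa>' / a))"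
    using W0 \<kappa>' r a by (intro mult_left_mono add_left_mono divide_left_mono) auto
  finally have 1: "s\<^sup>2 * (?Y i - ?Y k) \<le> W * (\<kappa>' * (1 + \<kappa>' / a))" .
  have "s\<^sup>2 * (\<rho>\<^sup>2 * K) \<le> (a + 1)\<^sup>2 * (\<rho>\<^sup>2 * (W / a))"
    using s1 sp W(2) K a l by (intro mult_mono power_mono) (auto simp: pos_le_divide_eq mult.commute)
  also have "\<dots> = W * (\<rho>\<^sup>2 * (a + 1)\<^sup>2 / a)" by simp
  finally have 2: "s\<^sup>2 * (\<rho>\<^sup>2 * K) \<le> W * (\<rho>\<^sup>2 * (a + 1)\<^sup>2 / a)" .
  have "(\<kappa>/2) * (norm (geo_avg \<rho> J g k))\<^sup>2 \<le> ?Y i - ?Y k + \<rho>\<^sup>2 * K"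
    using geo_avg_backward_euler[of i] K k m i by simp
  then have "s\<^sup>2 * ((\<kappa>/2) * (norm (geo_avg \<rho> J g k))\<^sup>2) \<le> s\<^sup>2 * (?Y i - ?Y k + \<rho>\<^sup>2 * K)" by (intro mult_left_mono) auto
  also have "\<dots> = s\<^sup>2 * (?Y i - ?Y k) + s\<^sup>2 * (\<rho>\<^sup>2 * K)" by (simp only: distrib_left)
  also have "\<dots> \<le> W * (\<kappa>' * (1 + \<kappa>' / a)) + W * (\<rho>\<^sup>2 * (a + 1)\<^sup>2 / a)" using 1 2 by (rule add_mono)
  also have "\<dots> = W * (\<kappa>' * (1 + \<kappa>' / a) + \<rho>\<^sup>2 * (a + 1)\<^sup>2 / a)" by (simp only: distrib_left)
  also have "\<dots> \<le> W * \<kappa>" using step W0 by (intro mult_left_mono) auto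
  finally have "\<kappa> * (s * norm (geo_avg \<rho> J g k))\<^sup>2 \<le> \<kappa> * (2 * W)" by (simp add: power_mult_distrib mult_ac)
  then show ?thesis using \<kappa> by (simp add: s_def)
qed

end

context derivation
begin

lemma dom_Max:
  assumes "finite S" "S \<noteq> {}" "\<And>i. i \<in> S \<Longrightarrow> u i \<in> Dom"
  shows "(\<lambda>x. Max ((\<lambda>i. u i x) ` S)) \<in> Dom \<and>
    (AE x in M. \<exists>i\<in>S. Max ((\<lambda>i. u i x) ` S) = u i x \<and> D (\<lambda>x. Max ((\<lambda>i. u i x) ` S)) x = D (u i) x)"
  using assms
proof (induction S rule: finite_ne_induct)
  case (singleton i)
  then show ?case by simp
next
  case (insert i S)
  let ?m = "\<lambda>x. Max ((\<lambda>i. u i x) ` S)"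
  have eq: "Max ((\<lambda>i. u i x) ` insert i S) = max (u i x) (?m x)" for x using insert.hyps by simp
  have IH: "?m \<in> Dom" "AE x in M. \<exists>i\<in>S. ?m x = u i x \<and> D ?m x = D (u i) x" and ui: "u i \<in> Dom" using insert by auto
  have "AE x in M. \<exists>j\<in>insert i S. max (u i x) (?m x) = u j x \<and> D (\<lambda>x. max (u i x) (?m x)) x = D (u j) x"
    using IH(2) dom_max(2)[OF ui IH(1)]
  proof eventually_elim
    case (elim x)
    then show ?case by (cases "u i x < ?m x") (auto simp: max_def)
  qed
  then show ?case unfolding eq using dom_max(1)[OF ui IH(1)] by blast
qed

text \<open>A discrete Hopf-Lax argument: maximising \<open>s Y\<^sub>s\<close> over the times \<open>s\<close> turns a subsolution of
  \<open>\<partial>\<^sub>s Y + |D Y|\<^sup>2/2 \<le> 0\<close> into a function \<open>W\<close> with \<open>|D W|\<^sup>2 \<le> 2 W\<close>, so that \<open>sqrt (2 W)\<close> is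
  1-Lipschitz; the shift by \<open>a K\<close> keeps the square root away from its singularity.\<close>

lemma eikonal_function_exists:
  assumes nest: "measurable_nest M Dom D F" and cut: "\<And>l. \<zeta> l \<in> Dom" "\<And>l x. x \<in> F l \<Longrightarrow> \<zeta> l x = 1" "\<And>l. AE x in M. x \<in> F l \<longrightarrow> D (\<zeta> l) x = 0"
    and K: "0 < K" and a: "0 < a" and \<rho>: "0 \<le> \<rho>" "\<rho> \<le> 1" and \<kappa>: "0 < \<kappa>" and \<kappa>': "0 \<le> \<kappa>'" "real m * \<kappa>' \<le> 1" and m: "1 \<le> m" "m < J"
    and step: "\<kappa>' * (1 + \<kappa>' / a) + \<rho>\<^sup>2 * (a + 1)\<^sup>2 / a \<le> \<kappa>"
    and meas: "\<And>j. j < J \<Longrightarrow> zb j \<in> borel_measurable M"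
    and prof: "AE x in M. (\<forall>j\<le>J. 0 \<le> z j x \<and> z j x \<le> K) \<and> (\<forall>j<J. 0 \<le> zb j x \<and> zb j x \<le> K \<and> z j x \<le> zb j x \<and> zb j x \<le> z (Suc j) x
        \<and> (\<kappa>/2) * (norm (G j x))\<^sup>2 \<le> z (Suc j) x - z j x)"
    and onB: "AE x in M. x \<in> B \<longrightarrow> (\<forall>j<J. zb j x = K)"
    and dom: "\<And>j l. j < J \<Longrightarrow> (\<lambda>x. \<zeta> l x * zb j x) \<in> Dom"
      "\<And>j l. j < J \<Longrightarrow> AE x in M. D (\<lambda>x. \<zeta> l x * zb j x) x = \<zeta> l x *\<^sub>R G j x + zb j x *\<^sub>R D (\<zeta> l) x"
  shows "\<exists>f\<in>D0 M Dom D. (\<forall>x. 0 \<le> f x) \<and> (AE x in M. x \<in> B \<longrightarrow> f x = 0) \<and>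
    (AE x in M. 2 * ((a + real m * \<kappa>') * (1 - (1 - \<rho>) ^ (J - m))) * (K - z J x) \<le> (f x + sqrt (2 * a * K))\<^sup>2)"
proof -
  define s where "s k = a + real k * \<kappa>'" for k
  define Y where "Y k x = geo_avg \<rho> J (\<lambda>i. K - zb i x) k" for k x
  define W where "W x = Max ((\<lambda>k. s k * Y k x) ` {1..m})" for x
  define c where "c = sqrt (2 * a * K)"
  \<comment> \<open>With u = W - a K the root becomes sqrt (2 W); subtracting c normalises the value
    at u = 0 to 0, and for u >= 0 the slope is at most 1/c.\<close>
  define \<phi> where "\<phi> u = sqrt (2 * u + c\<^sup>2) - c" for u
  define f where "f x = \<phi> (max (W x - a * K) 0)" for x
  have c: "0 < c" "c\<^sup>2 = 2 * a * K" using a K by (auto simp: c_def)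
  have s0: "0 < s k" for k using a \<kappa>' by (simp add: s_def add_pos_nonneg)
  have ne: "{1..m} \<noteq> {}" using m by simp
  have Ym: "Y k \<in> borel_measurable M" for k
    unfolding Y_def geo_avg_def using meas by (intro borel_measurable_sum borel_measurable_scaleR borel_measurable_diff) auto
  have Wm [measurable]: "W \<in> borel_measurable M"
    unfolding W_def using Ym by (intro borel_measurable_Max) auto
  have fm: "f \<in> borel_measurable M" unfolding f_def \<phi>_def by measurable
  have Wmax: "s k * Y k x \<le> W x" if "k \<in> {1..m}" for k x unfolding W_def using that by (intro Max_ge) auto
  have prof': "AE x in M. \<forall>k\<le>J. 0 \<le> Y k x \<and> Y k x \<le> K \<and> (1 - (1 - \<rho>) ^ (J - k)) * (K - z J x) \<le> Y k x"
    using prof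
  proof eventually_elim
    case (elim x)
    note h = geo_avg_range[where y="\<lambda>j. K - z j x" and yb="\<lambda>j. K - zb j x" and g="\<lambda>j. G j x" and \<rho>=\<rho> and \<kappa>=\<kappa> and K=K and J=J]
      geo_avg_lower[where y="\<lambda>j. K - z j x" and yb="\<lambda>j. K - zb j x" and g="\<lambda>j. G j x" and \<rho>=\<rho> and \<kappa>=\<kappa> and K=K and J=J]
    show ?case unfolding Y_def using elim \<rho> \<kappa> K by (intro allI impI conjI h) auto
  qed
  have key: "AE x in M. \<forall>k\<in>{1..m}. W x = s k * Y k x \<longrightarrow> a * K < W x \<longrightarrow> (s k * norm (geo_avg \<rho> J (\<lambda>j. G j x) k))\<^sup>2 \<le> 2 * W x"
    using prof
  proof eventually_elim
    case (elim x)
    note h = geo_avg_max_gradient[where y="\<lambda>j. K - z j x" and yb="\<lambda>j. K - zb j x" and g="\<lambda>j. G j x" and \<rho>=\<rho> and \<kappa>=\<kappa> and K=K and J=J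
        and a=a and \<kappa>'=\<kappa>' and m=m and W="W x"]
    have mx: "\<And>i. i \<in> {1..m} \<Longrightarrow> (a + real i * \<kappa>') * geo_avg \<rho> J (\<lambda>j. K - zb j x) i \<le> W x"
      using Wmax[of _ x] by (simp add: s_def Y_def)
    show ?case
    proof (intro ballI impI)
      fix k assume "k \<in> {1..m}" "W x = s k * Y k x" "a * K < W x"
      then show "(s k * norm (geo_avg \<rho> J (\<lambda>j. G j x) k))\<^sup>2 \<le> 2 * W x"
        unfolding s_def using elim \<rho> \<kappa> K a \<kappa>' m step by (intro h mx) (auto simp: s_def Y_def)
    qed
  qed
  have \<phi>0: "\<phi> 0 = 0" using c(1) by (simp add: \<phi>_def)
  have pos: "0 < 2 * u + c\<^sup>2" if "0 \<le> u" for u using that c(1) by (simp add: add_nonneg_pos)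
  have \<phi>d: "(\<phi> has_real_derivative 1 / sqrt (2 * u + c\<^sup>2)) (at u)" if "0 \<le> u" for u
    unfolding \<phi>_def using pos[OF that] by (auto intro!: derivative_eq_intros simp: field_simps)
  have \<phi>c: "continuous_on {0..} (\<lambda>u. 1 / sqrt (2 * u + c\<^sup>2))"
    by (intro continuous_intros) (use pos in force)
  have \<phi>b: "\<bar>1 / sqrt (2 * u + c\<^sup>2)\<bar> \<le> 1 / c" if "0 \<le> u" for u
  proof -
    have "c = sqrt (c\<^sup>2)" using c(1) by simp
    also have "\<dots> \<le> sqrt (2 * u + c\<^sup>2)" using that by (intro real_sqrt_le_mono) simp
    finally show ?thesis using c(1) pos[OF that] by (subst abs_of_pos) (auto simp: frac_le)
  qed
  have f0: "0 \<le> f x" for x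
  proof -
    have "sqrt (c\<^sup>2) \<le> sqrt (2 * max (W x - a * K) 0 + c\<^sup>2)" by (intro real_sqrt_le_mono) simp
    then show ?thesis using c(1) by (simp add: f_def \<phi>_def)
  qed
  have fc: "2 * W x \<le> (f x + c)\<^sup>2" for x
  proof -
    have "(f x + c)\<^sup>2 = 2 * max (W x - a * K) 0 + c\<^sup>2"
      using pos[of "max (W x - a * K) 0"] by (simp add: f_def \<phi>_def)
    then show ?thesis unfolding c(2) by (simp add: max_def)
  qed
  have fb: "AE x in M. \<bar>f x\<bar> \<le> sqrt (2 * ((a + 1) * K) + c\<^sup>2)"
    using prof'
  proof eventually_elim
    case (elim x)
    have "W x \<le> (a + 1) * K" unfolding W_def
    proof (rule Max.boundedI)
      fix w assume "w \<in> (\<lambda>k. s k * Y k x) ` {1..m}"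
      then obtain k where k: "k \<in> {1..m}" "w = s k * Y k x" by auto
      have "real k * \<kappa>' \<le> real m * \<kappa>'" using k \<kappa>' by (intro mult_right_mono) auto
      then have "s k \<le> a + 1" using \<kappa>' by (simp add: s_def)
      then show "w \<le> (a + 1) * K" unfolding k(2) using elim k m s0[of k] a by (intro mult_mono) auto
    qed (use ne in auto)
    then have "max (W x - a * K) 0 \<le> (a + 1) * K" using a K by (auto intro: order_trans[of _ "W x"] mult_nonneg_nonneg)
    then have "sqrt (2 * max (W x - a * K) 0 + c\<^sup>2) \<le> sqrt (2 * ((a + 1) * K) + c\<^sup>2)" by (intro real_sqrt_le_mono) simp
    then have "f x \<le> sqrt (2 * ((a + 1) * K) + c\<^sup>2)" using c(1) unfolding f_def \<phi>_def by linarith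
    then show ?case using f0[of x] by simp
  qed
  have loc: "\<exists>fl\<in>Dom. (AE x in M. x \<in> F l \<longrightarrow> f x = fl x) \<and> (AE x in M. x \<in> F l \<longrightarrow> norm (D fl x) \<le> 1)" for l
  proof -
    \<comment> \<open>This is \<zeta> (K - zb i). The constant K need not belong to
      \<open>Dom\<close>, so it is cut off; on \<open>F l\<close> neither the cutoff nor its
      gradient is visible.\<close>
    define q where "q i x = K * \<zeta> l x + (-1) * (\<zeta> l x * zb i x)" for i x
    have qd: "q i \<in> Dom" if "i < J" for i unfolding q_def by (rule dom_lin[OF cut(1) dom(1)[OF that]])
    have qD: "AE x in M. x \<in> F l \<longrightarrow> D (q i) x = - G i x" if "i < J" for i
      using D_lin[OF cut(1)[of l] dom(1)[OF that, of l], of K "-1"] dom(2)[OF that, of l] cut(3)[of l]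
      unfolding q_def by eventually_elim (auto simp: cut(2))
    have qD': "AE x in M. \<forall>i<J. x \<in> F l \<longrightarrow> D (q i) x = - G i x"
      unfolding AE_all_countable using qD by (intro allI AE_impI)
    define cf where "cf k i = s k * (\<rho> * (1 - \<rho>) ^ (i - k))" for k i
    define u where "u k x = (\<Sum>i\<in>{k..<J}. cf k i * q i x)" for k x
    have ud: "u k \<in> Dom" "AE x in M. D (u k) x = (\<Sum>i\<in>{k..<J}. cf k i *\<^sub>R D (q i) x)" for k
      using dom_sum[of "{k..<J}" q "cf k"] qd unfolding u_def by auto
    have ueq: "u k x = s k * Y k x" if "x \<in> F l" for k x
      unfolding u_def Y_def geo_avg_def sum_distrib_left by (intro sum.cong refl) (simp add: cf_def q_def cut(2)[OF that])
    have uD: "AE x in M. \<forall>k. x \<in> F l \<longrightarrow> D (u k) x = - (s k *\<^sub>R geo_avg \<rho> J (\<lambda>j. G j x) k)"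
      unfolding AE_all_countable
    proof
      fix k
      show "AE x in M. x \<in> F l \<longrightarrow> D (u k) x = - (s k *\<^sub>R geo_avg \<rho> J (\<lambda>j. G j x) k)"
        using ud(2)[of k] qD'
      proof eventually_elim
        case (elim x)
        show ?case
        proof
          assume x: "x \<in> F l"
          have "D (u k) x = (\<Sum>i\<in>{k..<J}. cf k i *\<^sub>R (- G i x))" unfolding elim(1) using elim(2) x by (intro sum.cong) auto
          also have "\<dots> = - (s k *\<^sub>R geo_avg \<rho> J (\<lambda>j. G j x) k)"
            by (simp add: geo_avg_def scaleR_sum_right sum_negf cf_def)
          finally show "D (u k) x = - (s k *\<^sub>R geo_avg \<rho> J (\<lambda>j. G j x) k)" .
        qed
      qed
    qed
    define Wl where "Wl x = Max ((\<lambda>k. u k x) ` {1..m})" for x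
    have Wld: "Wl \<in> Dom" "AE x in M. \<exists>k\<in>{1..m}. Wl x = u k x \<and> D Wl x = D (u k) x"
      using dom_Max[of "{1..m}" u, OF _ ne] ud(1) unfolding Wl_def by auto
    have Wleq: "Wl x = W x" if "x \<in> F l" for x unfolding Wl_def W_def using ueq[OF that] by simp
    define pl where "pl x = max (Wl x - a * K) 0" for x
    have pld: "pl \<in> Dom" "AE x in M. D pl x = (if a * K < Wl x then D Wl x else 0)"
      using dom_pos_part_shift[OF Wld(1), of "a * K"] a K unfolding pl_def by auto
    have pl0: "0 \<le> pl x" for x by (simp add: pl_def)
    have ch: "(\<lambda>x. \<phi> (pl x)) \<in> Dom" "AE x in M. D (\<lambda>x. \<phi> (pl x)) x = (1 / sqrt (2 * pl x + c\<^sup>2)) *\<^sub>R D pl x"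
      using dom_chain_nonneg[OF pld(1) pl0 \<phi>d \<phi>c \<phi>b \<phi>0] by auto
    show ?thesis
    proof (intro bexI[of _ "\<lambda>x. \<phi> (pl x)"] conjI ch(1))
      show "AE x in M. x \<in> F l \<longrightarrow> f x = \<phi> (pl x)" by (intro AE_I2) (simp add: f_def pl_def Wleq)
      show "AE x in M. x \<in> F l \<longrightarrow> norm (D (\<lambda>x. \<phi> (pl x)) x) \<le> 1"
        using ch(2) pld(2) Wld(2) uD key
      proof eventually_elim
        case (elim x)
        show ?case
        proof
          assume x: "x \<in> F l"
          show "norm (D (\<lambda>x. \<phi> (pl x)) x) \<le> 1"
          proof (cases "a * K < W x")
            case False
            then show ?thesis using elim(1,2) Wleq[OF x] by simp
          next
            case True
            obtain k where k: "k \<in> {1..m}" "Wl x = u k x" "D Wl x = D (u k) x" using elim(3) by blast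
            have "W x = s k * Y k x" using k(2) Wleq[OF x] ueq[OF x] by simp
            then have "(s k * norm (geo_avg \<rho> J (\<lambda>j. G j x) k))\<^sup>2 \<le> 2 * W x" using elim(5) k(1) True by blast
            moreover have "norm (D pl x) = s k * norm (geo_avg \<rho> J (\<lambda>j. G j x) k)"
              using elim(2,4) x True Wleq[OF x] k(3) s0[of k] by simp
            moreover have "2 * W x = 2 * pl x + c\<^sup>2" using True Wleq[OF x] by (simp add: pl_def c(2))
            ultimately have "(norm (D pl x))\<^sup>2 \<le> 2 * pl x + c\<^sup>2" by simp
            then have "norm (D pl x) \<le> sqrt (2 * pl x + c\<^sup>2)" by (simp add: real_le_rsqrt)
            then show ?thesis using elim(1) pos[OF pl0[of x]] by (simp add: divide_le_eq)
          qed
        qed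
      qed
    qed
  qed
  then have "\<forall>l. \<exists>fl. fl \<in> Dom \<and> (AE x in M. x \<in> F l \<longrightarrow> f x = fl x) \<and> (AE x in M. x \<in> F l \<longrightarrow> norm (D fl x) \<le> 1)" by blast
  from choice[OF this] obtain fl where fl: "\<forall>l. fl l \<in> Dom \<and> (AE x in M. x \<in> F l \<longrightarrow> f x = fl l x) \<and> (AE x in M. x \<in> F l \<longrightarrow> norm (D (fl l) x) \<le> 1)" ..
  have fD: "f \<in> D0 M Dom D"
    unfolding D0_def mem_Collect_eq
    by (intro conjI exI[of _ F] exI[of _ fl] exI[of _ "sqrt (2 * ((a + 1) * K) + c\<^sup>2)"] fm fb nest fl)
  have fB: "AE x in M. x \<in> B \<longrightarrow> f x = 0"
    using onB
  proof eventually_elim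
    case (elim x)
    show ?case
    proof
      assume "x \<in> B"
      then have "Y k x = 0" for k using elim unfolding Y_def geo_avg_def by (intro sum.neutral) auto
      then have "(\<lambda>k. s k * Y k x) ` {1..m} = {0}" using ne by auto
      then have "W x = 0" by (simp add: W_def)
      then have "max (W x - a * K) 0 = 0" using a K by simp
      then show "f x = 0" by (simp add: f_def \<phi>0)
    qed
  qed
  have fl: "AE x in M. 2 * ((a + real m * \<kappa>') * (1 - (1 - \<rho>) ^ (J - m))) * (K - z J x) \<le> (f x + sqrt (2 * a * K))\<^sup>2"
    using prof'
  proof eventually_elim
    case (elim x)
    have "s m * ((1 - (1 - \<rho>) ^ (J - m)) * (K - z J x)) \<le> s m * Y m x"
      using elim m s0[of m] by (intro mult_left_mono) auto
    also have "\<dots> \<le> W x" by (rule Wmax) (use m in auto)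
    finally have "s m * ((1 - (1 - \<rho>) ^ (J - m)) * (K - z J x)) \<le> W x" .
    then show ?case using fc[of x] by (simp add: s_def c_def mult.assoc)
  qed
  show ?thesis by (intro bexI[of _ f] conjI allI fD f0 fB fl)
qed

end

text \<open>With e = 1/n the scales are a = e, \<kappa> = e^6/125 and \<rho> = e^4/25. The J - m
  steps left after m, times \<rho>, give about 5n, so the geometric mass cut off is below e.
  Moreover \<rho>^2/a = e \<kappa>/5 and \<kappa>/a = e^5/125, so both discretisation errors fit
  into the gap \<kappa> - \<kappa>' = e \<kappa>. The total loss is a factor (1 - e)^3: two powers
  from the final time m \<kappa>', one from the mass.\<close>

lemma hopf_lax_parameters_exist:
  fixes K d L :: real
  assumes K: "0 \<le> K" and d: "0 \<le> d" "d\<^sup>2 / 2 < L"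
  shows "\<exists>a \<rho> \<kappa>' d' L' :: real. \<exists>J m :: nat. 0 < a \<and> 0 \<le> \<rho> \<and> \<rho> \<le> 1 \<and> 0 \<le> \<kappa>' \<and> real m * \<kappa>' \<le> 1 \<and> 1 \<le> m \<and> m < J
    \<and> \<kappa>' * (1 + \<kappa>' / a) + \<rho>\<^sup>2 * (a + 1)\<^sup>2 / a \<le> 1 / (real J + 1) \<and> d < d' \<and> L' < L
    \<and> 0 < (a + real m * \<kappa>') * (1 - (1 - \<rho>) ^ (J - m))
    \<and> (d' + sqrt (2 * a * K))\<^sup>2 \<le> 2 * ((a + real m * \<kappa>') * (1 - (1 - \<rho>) ^ (J - m))) * L'"
proof -
  define L' where "L' = (d\<^sup>2 / 2 + L) / 2"
  have L': "d\<^sup>2 / 2 < L'" "L' < L" using d by (auto simp: L'_def)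
  have L0: "0 \<le> L'" using L' by (smt (verit) zero_le_power2 divide_nonneg_pos)
  \<comment> \<open>In the limit the requirement reads d^2 < 2 L', so it already holds for some
    finite n.\<close>
  have lim: "(\<lambda>n. (d + 1 / real n + sqrt (2 * (1 / real n) * K))\<^sup>2 - 2 * (1 - 1 / real n) ^ 3 * L') \<longlonglongrightarrow> (d + 0 + sqrt (2 * 0 * K))\<^sup>2 - 2 * (1 - 0) ^ 3 * L'"
    by (intro tendsto_intros lim_1_over_n)
  have "\<forall>\<^sub>F n in sequentially. (d + 1 / real n + sqrt (2 * (1 / real n) * K))\<^sup>2 - 2 * (1 - 1 / real n) ^ 3 * L' < 0"
    by (rule order_tendstoD(2)[OF lim]) (use L' in simp)
  then have "\<forall>\<^sub>F n in sequentially. 2 \<le> n \<and> (d + 1 / real n + sqrt (2 * (1 / real n) * K))\<^sup>2 - 2 * (1 - 1 / real n) ^ 3 * L' < 0"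
    using eventually_ge_at_top[of 2] by eventually_elim auto
  then obtain n :: nat where n: "2 \<le> n" and nl: "(d + 1 / real n + sqrt (2 * (1 / real n) * K))\<^sup>2 - 2 * (1 - 1 / real n) ^ 3 * L' < 0"
    by (auto simp: eventually_sequentially)
  define e where "e = 1 / real n"
  define J where "J = 125 * n ^ 6 - 1"
  define m where "m = 125 * n ^ 5 * (n - 1)"
  define \<kappa> where "\<kappa> = 1 / (125 * real n ^ 6)"
  define \<kappa>' where "\<kappa>' = (1 - e) * \<kappa>"
  define \<rho> where "\<rho> = 1 / (25 * real n ^ 4)"
  have rn: "2 \<le> real n" using n by simp
  have e: "0 < e" "e \<le> 1 / 2" using rn by (auto simp: e_def field_simps)
  have n1: "1 \<le> n ^ k" for k using n by simp
  have J1: "real J + 1 = 125 * real n ^ 6"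
  proof -
    have "1 \<le> 125 * n ^ 6" using n1[of 6] by simp
    then show ?thesis unfolding J_def by (simp add: of_nat_diff)
  qed
  have \<kappa>J: "\<kappa> = 1 / (real J + 1)" by (simp add: \<kappa>_def J1)
  have mr: "real m = 125 * real n ^ 6 * (1 - e)"
    using n by (simp add: m_def e_def of_nat_diff field_simps power_numeral_reduce)
  have Jm: "J = m + (125 * n ^ 5 - 1)"
  proof -
    have "125 * n ^ 6 = m + 125 * n ^ 5" using n by (cases n) (simp_all add: m_def power_numeral_reduce algebra_simps)
    then show ?thesis using n1[of 5] by (simp add: J_def)
  qed
  have m1: "1 \<le> m" using n n1[of 5] by (simp add: m_def)
  have mJ: "m < J" using n1[of 5] by (simp add: Jm)
  have \<kappa>0: "0 < \<kappa>" using rn by (simp add: \<kappa>_def)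
  have m\<kappa>: "real m * \<kappa>' = (1 - e) * (1 - e)"
    using rn by (simp add: mr \<kappa>'_def \<kappa>_def)
  have m\<kappa>1: "real m * \<kappa>' \<le> 1" unfolding m\<kappa> using e by (intro mult_le_one) auto
  have n4: "1 \<le> 25 * real n ^ 4" using one_le_power[of "real n" 4] rn by linarith
  have \<rho>: "0 \<le> \<rho>" "\<rho> \<le> 1" using n4 rn by (auto simp: \<rho>_def divide_le_eq)
  have pow: "(1 - \<rho>) ^ (J - m) \<le> e"
  proof -
    have "(1 - \<rho>) ^ (J - m) \<le> exp (- \<rho>) ^ (J - m)"
      using exp_ge_add_one_self[of "- \<rho>"] \<rho> by (intro power_mono) auto
    also have "\<dots> = exp (- (real (J - m) * \<rho>))" by (simp add: exp_of_nat_mult[symmetric])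
    also have "\<dots> \<le> exp (- (real n - 1))"
    proof -
      have "real (J - m) = 125 * real n ^ 5 - 1" using n1[of 5] by (simp add: Jm of_nat_diff)
      then have "real (J - m) * \<rho> = 5 * real n - \<rho>" using rn by (simp add: \<rho>_def field_simps power_numeral_reduce)
      then have "real n - 1 \<le> real (J - m) * \<rho>" using \<rho> rn by linarith
      then show ?thesis by (simp only: exp_le_cancel_iff neg_le_iff_le)
    qed
    also have "\<dots> = 1 / exp (real n - 1)" by (simp only: exp_minus inverse_eq_divide)
    also have "\<dots> \<le> 1 / real n" using exp_ge_add_one_self[of "real n - 1"] rn by (intro divide_left_mono) auto
    finally show ?thesis by (simp add: e_def)
  qed
  have s: "(1 - e) ^ 2 \<le> e + real m * \<kappa>'" unfolding m\<kappa> using e by (simp add: power2_eq_square)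
  have q: "1 - e \<le> 1 - (1 - \<rho>) ^ (J - m)" using pow by simp
  have sq: "(1 - e) ^ 3 \<le> (e + real m * \<kappa>') * (1 - (1 - \<rho>) ^ (J - m))"
  proof -
    have "(1 - e) ^ 3 = (1 - e) ^ 2 * (1 - e)" by (simp add: power_numeral_reduce)
    also have "\<dots> \<le> (e + real m * \<kappa>') * (1 - (1 - \<rho>) ^ (J - m))" using s q e by (intro mult_mono) (auto intro: order_trans[OF zero_le_power2])
    finally show ?thesis .
  qed
  have e3: "0 < (1 - e) ^ 3" using e by simp
  have st: "\<kappa>' * (1 + \<kappa>' / e) + \<rho>\<^sup>2 * (e + 1)\<^sup>2 / e \<le> \<kappa>"
  proof -
    have ek: "\<kappa> = e ^ 6 / 125" and er: "\<rho> = e ^ 4 / 25" by (simp_all add: \<kappa>_def \<rho>_def e_def power_divide)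
    have "\<kappa>' * (1 + \<kappa>' / e) \<le> ((1 - e) * \<kappa>) * (1 + \<kappa> / e)"
      unfolding \<kappa>'_def using e \<kappa>0 by (intro mult_left_mono add_left_mono divide_right_mono) (auto intro: mult_left_le_one_le)
    also have "\<dots> = \<kappa> * ((1 - e) * (1 + e ^ 5 / 125))" using e by (simp add: ek power_numeral_reduce)
    also have "\<dots> \<le> \<kappa> * (1 - e + e / 125)"
    proof (intro mult_left_mono)
      have "e ^ 5 \<le> e ^ 1" using e by (intro power_decreasing) auto
      then have "(1 - e) * e ^ 5 \<le> 1 * e" using e by (intro mult_mono) auto
      then show "(1 - e) * (1 + e ^ 5 / 125) \<le> 1 - e + e / 125" by (simp add: distrib_left)
    qed (use \<kappa>0 in simp)
    finally have 1: "\<kappa>' * (1 + \<kappa>' / e) \<le> \<kappa> * (1 - e + e / 125)" .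
    have "\<rho>\<^sup>2 * (e + 1)\<^sup>2 / e = \<kappa> * (e * (e + 1)\<^sup>2 / 5)" using e by (simp add: ek er field_simps power_numeral_reduce)
    also have "\<dots> \<le> \<kappa> * (e * (3 / 2)\<^sup>2 / 5)" using e \<kappa>0 by (intro mult_left_mono divide_right_mono power_mono) auto
    finally have "\<kappa>' * (1 + \<kappa>' / e) + \<rho>\<^sup>2 * (e + 1)\<^sup>2 / e \<le> \<kappa> * (1 - e + e / 125) + \<kappa> * (e * (3 / 2)\<^sup>2 / 5)" using 1 by (rule add_mono[rotated])
    also have "\<dots> = \<kappa> * (1 - e + e / 125 + e * (3 / 2)\<^sup>2 / 5)" by (simp only: distrib_left)
    also have "\<dots> \<le> \<kappa> * 1" using e \<kappa>0 by (intro mult_left_mono) (auto simp: power2_eq_square)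
    finally show ?thesis by simp
  qed
  have fin: "(d + e + sqrt (2 * e * K))\<^sup>2 \<le> 2 * ((e + real m * \<kappa>') * (1 - (1 - \<rho>) ^ (J - m))) * L'"
  proof -
    have "(d + e + sqrt (2 * e * K))\<^sup>2 \<le> 2 * (1 - e) ^ 3 * L'" using nl by (simp add: e_def)
    also have "\<dots> \<le> 2 * ((e + real m * \<kappa>') * (1 - (1 - \<rho>) ^ (J - m))) * L'"
      using sq L0 by (intro mult_right_mono mult_left_mono) auto
    finally show ?thesis .
  qed
  have \<kappa>'0: "0 \<le> \<kappa>'" using e \<kappa>0 by (simp add: \<kappa>'_def)
  have dd: "d < d + e" using e by simp
  show ?thesis
    by (rule exI[of _ e], rule exI[of _ \<rho>], rule exI[of _ \<kappa>'], rule exI[of _ "d + e"], rule exI[of _ L'], rule exI[of _ J], rule exI[of _ m],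
      intro conjI e(1) \<rho> \<kappa>'0 m\<kappa>1 m1 mJ st[unfolded \<kappa>J] dd L'(2) less_le_trans[OF e3 sq] fin)
qed

section \<open>From the profile back to the mass of the heat flow\<close>

context log_profile
begin

text \<open>Jensen's inequality, in the form \<open>exp y \<ge> 1 + y\<close> applied around the level \<open>L\<close>.\<close>

lemma mass_lower_bound:
  assumes A: "A \<in> sets M" "emeasure M A < \<infinity>" and Z: "(K - L) * measure M A \<le> (\<integral>x. Z n J x * indicator A x \<partial>M)"
  shows "measure M A * (exp (- L / tn n) - exp (- K / tn n)) \<le> (\<integral>x. v (tn n) x * indicator A x \<partial>M)"
proof -
  define t where "t = tn n"
  have t: "0 < t" using tn(1) by (simp add: t_def)
  have [measurable]: "A \<in> sets M" by (rule A)
  have sq: "((indicator A x :: real))\<^sup>2 = indicator A x" for x by (simp add: indicator_def)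
  have AL: "L2 M (indicator A)" using A by (auto simp: L2_def sq)
  have iA: "integrable M (indicator A :: 'a \<Rightarrow> real)" using A by simp
  have iv: "integrable M (\<lambda>x. v t x * indicator A x)" by (rule L2_product_integrable[OF dom_L2[OF v_dom[OF t]] AL])
  have iZ: "integrable M (\<lambda>x. Z n J x * indicator A x)" by (rule L2_product_integrable[OF dom_L2[OF Z_dom(1)] AL])
  \<comment> \<open>On A one has exp ((Z - K)/t) = (v + \<delta>)/(1 + v) <= v + \<delta>; the
    exponential is bounded below by its tangent at the level Z = K - L.\<close>
  have pt: "exp (- L / t) * ((1 + (L - K) / t) * indicator A x + (1 / t) * (Z n J x * indicator A x)) \<le> v t x * indicator A x + exp (- K / t) * indicator A x" for x
  proof (cases "x \<in> A")
    case True
    have v0: "0 \<le> v t x" by (rule v_nonneg[OF t])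
    define \<delta> where "\<delta> = exp (- K / t)"
    have \<delta>: "0 < \<delta>" by (simp add: \<delta>_def)
    have Zeq: "Z n J x = t * (ln (v t x + \<delta>) + K / t - ln (1 + v t x))"
      unfolding Z_def lv_def log_trans_def \<sigma>(3) del_def t_def[symmetric] \<delta>_def by simp
    have "exp (- L / t) * (1 + (Z n J x - K + L) / t) \<le> exp (- L / t) * exp ((Z n J x - K + L) / t)"
      by (intro mult_left_mono exp_ge_add_one_self) auto
    also have "\<dots> = exp ((Z n J x - K) / t)" by (simp add: exp_add[symmetric] diff_divide_distrib add_divide_distrib)
    also have "(Z n J x - K) / t = ln (v t x + \<delta>) - ln (1 + v t x)" using t by (simp add: Zeq field_simps)
    also have "exp \<dots> = (v t x + \<delta>) / (1 + v t x)" using v0 \<delta> by (simp add: exp_diff add_nonneg_pos)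
    also have "\<dots> \<le> v t x + \<delta>" using v0 \<delta> by (simp add: divide_le_eq mult_le_cancel_left1)
    finally have "exp (- L / t) * (1 + (Z n J x - K + L) / t) \<le> v t x + \<delta>" .
    then show ?thesis using True by (simp add: \<delta>_def diff_divide_distrib add_divide_distrib algebra_simps)
  qed simp
  have "exp (- L / t) * measure M A \<le> exp (- L / t) * ((1 + (L - K) / t) * measure M A + (1 / t) * (\<integral>x. Z n J x * indicator A x \<partial>M))"
  proof (intro mult_left_mono)
    have "(1 / t) * ((K - L) * measure M A) \<le> (1 / t) * (\<integral>x. Z n J x * indicator A x \<partial>M)" using Z t by (intro mult_left_mono) auto
    moreover have "(1 / t) * ((K - L) * measure M A) = measure M A - (1 + (L - K) / t) * measure M A" by (simp add: algebra_simps diff_divide_distrib)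
    ultimately show "measure M A \<le> (1 + (L - K) / t) * measure M A + (1 / t) * (\<integral>x. Z n J x * indicator A x \<partial>M)" by simp
  qed simp
  also have "\<dots> = (\<integral>x. exp (- L / t) * ((1 + (L - K) / t) * indicator A x + (1 / t) * (Z n J x * indicator A x)) \<partial>M)"
    using iA iZ by (subst integral_mult_right_zero, subst Bochner_Integration.integral_add) auto
  also have "\<dots> \<le> (\<integral>x. v t x * indicator A x + exp (- K / t) * indicator A x \<partial>M)"
    using iA iZ iv pt by (intro integral_mono) auto
  also have "\<dots> = (\<integral>x. v t x * indicator A x \<partial>M) + exp (- K / t) * measure M A"
    using iA iv by (subst Bochner_Integration.integral_add) auto
  finally show ?thesis by (simp add: t_def algebra_simps)
qed

end

section \<open>Elementary bounds for the intrinsic distance\<close>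

context derivation
begin

lemma intdist_nonneg:
  assumes "measurable_nest M Dom D F"
  shows "0 \<le> intdist M Dom D A B"
proof -
  have "(\<lambda>x. 0) \<in> D0 M Dom D"
    unfolding D0_def mem_Collect_eq
  proof (intro conjI exI[of _ F] exI[of _ "\<lambda>k x. 0"] exI[of _ 0] allI)
    show "AE x in M. x \<in> F k \<longrightarrow> norm (D (\<lambda>x. 0) x) \<le> 1" for k using D_zero by eventually_elim simp
  qed (use assms dom_zero in auto)
  then have "ess_inf_on M A (\<lambda>x. 0) - ess_sup_on M B (\<lambda>x. 0) \<le> intdist M Dom D A B"
    unfolding intdist_def by (intro Sup_upper imageI)
  moreover have "0 \<le> ess_inf_on M A (\<lambda>x. 0)" unfolding ess_inf_on_def by (intro Sup_upper) simp
  moreover have "ess_sup_on M B (\<lambda>x. 0) \<le> 0" unfolding ess_sup_on_def by (intro Inf_lower) simp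
  ultimately show ?thesis using ereal_minus_mono[of 0 "ess_inf_on M A (\<lambda>x. 0)" "ess_sup_on M B (\<lambda>x. 0)" 0] by simp
qed

lemma intdist_ge:
  assumes f: "f \<in> D0 M Dom D" and fB: "AE x in M. x \<in> B \<longrightarrow> f x = 0" and fA: "AE x in M. x \<in> A \<longrightarrow> r \<le> f x"
  shows "ereal r \<le> intdist M Dom D A B"
proof -
  have "ess_inf_on M A f - ess_sup_on M B f \<le> intdist M Dom D A B"
    unfolding intdist_def using f by (intro Sup_upper imageI)
  moreover have "ereal r \<le> ess_inf_on M A f"
  proof -
    have "AE x in M. x \<in> A \<longrightarrow> ereal r \<le> ereal (f x)" using fA by eventually_elim simp
    then show ?thesis unfolding ess_inf_on_def by (intro Sup_upper) simp
  qed
  moreover have "ess_sup_on M B f \<le> 0"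
  proof -
    have "AE x in M. x \<in> B \<longrightarrow> ereal (f x) \<le> 0" using fB by eventually_elim simp
    then show ?thesis unfolding ess_sup_on_def by (intro Inf_lower) simp
  qed
  ultimately show ?thesis using ereal_minus_mono[of "ereal r" "ess_inf_on M A f" "ess_sup_on M B f" 0] by simp
qed

lemma nest_exhausts_space:
  assumes F: "measurable_nest M Dom D F" and sf: "sigma_finite_measure M"
  shows "AE x in M. \<exists>l. x \<in> F l"
proof -
  obtain C :: "nat \<Rightarrow> 'a set" where C: "range C \<subseteq> sets M" "(\<Union>i. C i) = space M" "\<And>i. emeasure M (C i) \<noteq> \<infinity>"
    using sigma_finite_measure.sigma_finite[OF sf] by blast
  have "AE x in M. \<forall>i. x \<in> C i \<longrightarrow> (\<exists>l. x \<in> F l)"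
    unfolding AE_all_countable using C by (intro allI nest_exhausts[OF F]) (auto simp: less_top)
  then show ?thesis using AE_space by eventually_elim (use C(2) in blast)
qed

end

context heat_flow
begin

text \<open>The distance sees only the essential infimum over A, so the profile is controlled only
  on a part A' of A, whose measure \<mu> is positive but not quantified. This suffices: A' comes
  from the limit profile and does not change with t, and any fixed \<mu> is beaten by the gain e^{(L
  - L'')/t}.\<close>

lemma no_fast_decay:
  assumes sf: "sigma_finite_measure M" and A: "A \<in> B0 M"
    and d: "intdist M Dom D A B = ereal d" "0 \<le> d" "d\<^sup>2 / 2 < L"
    and tn: "\<And>n. 0 < tn n" "\<And>n. tn n \<le> 1" "tn \<longlonglongrightarrow> 0"
    and decay: "\<And>n. (\<integral>x. v (tn n) x * indicator A x \<partial>M) \<le> exp (- L / tn n)"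
  shows False
proof -
  define K where "K = L + 1"
  have L0: "0 < L" using d(3) by (smt (verit) zero_le_power2 divide_nonneg_pos)
  then have K: "0 < K" by (simp add: K_def)
  obtain a \<rho> \<kappa>' d' L' :: real and J m :: nat where par: "0 < a" "0 \<le> \<rho>" "\<rho> \<le> 1" "0 \<le> \<kappa>'" "real m * \<kappa>' \<le> 1" "1 \<le> m" "m < J"
      "\<kappa>' * (1 + \<kappa>' / a) + \<rho>\<^sup>2 * (a + 1)\<^sup>2 / a \<le> 1 / (real J + 1)" "d < d'" "L' < L"
      "0 < (a + real m * \<kappa>') * (1 - (1 - \<rho>) ^ (J - m))"
      "(d' + sqrt (2 * a * K))\<^sup>2 \<le> 2 * ((a + real m * \<kappa>') * (1 - (1 - \<rho>) ^ (J - m))) * L'"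
    using hopf_lax_parameters_exist[OF less_imp_le[OF K] d(2,3)] by blast
  obtain F \<zeta> where F: "measurable_nest M Dom D F" and cut: "\<And>l. \<zeta> l \<in> Dom" "\<And>l x. 0 \<le> \<zeta> l x" "\<And>l x. \<zeta> l x \<le> 1"
      "\<And>l x. x \<in> F l \<Longrightarrow> \<zeta> l x = 1" "\<And>l. AE x in M. x \<in> F l \<longrightarrow> D (\<zeta> l) x = 0" "\<And>l. \<exists>k. AE x in M. x \<notin> E k \<longrightarrow> \<zeta> l x = 0"
    using nest_with_cutoffs[OF nest] by blast
  interpret log_profile M Dom D b c V E Ef v v' B F \<zeta> K J tn
    by unfold_locales (use nest_exhausts_space[OF F sf] cut K tn in auto)
  from limit_profile obtain z zb G where zm: "\<forall>j\<le>J. z j \<in> borel_measurable M" "\<forall>j<J. zb j \<in> borel_measurable M"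
    and prof: "AE x in M. (\<forall>j\<le>J. 0 \<le> z j x \<and> z j x \<le> K) \<and> (\<forall>j<J. 0 \<le> zb j x \<and> zb j x \<le> K \<and> z j x \<le> zb j x \<and> zb j x \<le> z (Suc j) x
        \<and> (1/2) * (norm (G j x))\<^sup>2 \<le> (real J + 1) * (z (Suc j) x - z j x))"
    and onB: "AE x in M. x \<in> B \<longrightarrow> (\<forall>j<J. zb j x = K)"
    and zd: "\<forall>j<J. \<forall>l. (\<lambda>x. \<zeta> l x * zb j x) \<in> Dom \<and> (AE x in M. D (\<lambda>x. \<zeta> l x * zb j x) x = \<zeta> l x *\<^sub>R G j x + zb j x *\<^sub>R D (\<zeta> l) x)"
    and avg: "\<forall>A n0 e. A \<in> sets M \<longrightarrow> emeasure M A < \<infinity> \<longrightarrow> 0 < e \<longrightarrow>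
        (\<exists>m\<ge>n0. (\<integral>x. z J x * indicator A x \<partial>M) - e \<le> (\<integral>x. Z m J x * indicator A x \<partial>M))"
    by (elim exE conjE) (rule that)
  have prof': "AE x in M. (\<forall>j\<le>J. 0 \<le> z j x \<and> z j x \<le> K) \<and> (\<forall>j<J. 0 \<le> zb j x \<and> zb j x \<le> K \<and> z j x \<le> zb j x \<and> zb j x \<le> z (Suc j) x
        \<and> (1 / (real J + 1) / 2) * (norm (G j x))\<^sup>2 \<le> z (Suc j) x - z j x)"
    using prof by eventually_elim (auto simp: field_simps)
  have \<kappa>: "0 < 1 / (real J + 1)" by simp
  obtain f where f: "f \<in> D0 M Dom D" and fB: "AE x in M. x \<in> B \<longrightarrow> f x = 0"
    and fz: "AE x in M. 2 * ((a + real m * \<kappa>') * (1 - (1 - \<rho>) ^ (J - m))) * (K - z J x) \<le> (f x + sqrt (2 * a * K))\<^sup>2"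
    and f0: "\<And>x. 0 \<le> f x"
    using eikonal_function_exists[OF F cut(1,4,5) K par(1-3) \<kappa> par(4-8) zm(2)[rule_format] prof' onB] zd by blast
  have [measurable]: "A \<in> sets M" "f \<in> borel_measurable M" "z J \<in> borel_measurable M" using A f zm by (auto simp: B0_def D0_def)
  have Af: "emeasure M A < \<infinity>" using A by (simp add: B0_def)
  \<comment> \<open>If f were at least d' almost everywhere on A, then f, being admissible and zero
    on B, would force the distance to be at least d' > d.\<close>
  define A' where "A' = {x \<in> space M. x \<in> A \<and> f x < d'}"
  have A'm [measurable]: "A' \<in> sets M" unfolding A'_def by measurable
  have A'A: "A' \<subseteq> A" by (auto simp: A'_def)
  have A'f: "emeasure M A' < \<infinity>" using emeasure_mono[OF A'A, of M] Af by (auto intro: le_less_trans)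
  have A'0: "emeasure M A' \<noteq> 0"
  proof
    assume "emeasure M A' = 0"
    then have "AE x in M. x \<notin> A'" by (intro AE_not_in) (auto simp: null_sets_def)
    then have "AE x in M. x \<in> A \<longrightarrow> d' \<le> f x" using AE_space by eventually_elim (auto simp: A'_def)
    from intdist_ge[OF f fB this] d(1) par(9) show False by simp
  qed
  define \<mu> where "\<mu> = measure M A'"
  have \<mu>: "0 < \<mu>" unfolding \<mu>_def using A'0 A'f by (simp add: measure_def enn2real_positive_iff zero_less_iff_neq_zero)
  have low: "AE x in M. x \<in> A' \<longrightarrow> K - L' \<le> z J x"
    using fz
  proof eventually_elim
    case (elim x)
    show ?case
    proof
      assume "x \<in> A'"
      then have "f x < d'" by (simp add: A'_def)
      then have "(f x + sqrt (2 * a * K))\<^sup>2 \<le> (d' + sqrt (2 * a * K))\<^sup>2" using f0[of x] par(1) K by (intro power_mono) auto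
      then have "2 * ((a + real m * \<kappa>') * (1 - (1 - \<rho>) ^ (J - m))) * (K - z J x) \<le> 2 * ((a + real m * \<kappa>') * (1 - (1 - \<rho>) ^ (J - m))) * L'"
        using elim par(12) by linarith
      then have "K - z J x \<le> L'" using par(11) by (subst (asm) mult_le_cancel_left_pos) auto
      then show "K - L' \<le> z J x" by simp
    qed
  qed
  \<comment> \<open>The gap between L' and L is halved: one half pays for the error in the averaging
    step, the other makes e^{-L''/t} outgrow e^{-L/t}.\<close>
  define L'' where "L'' = (L' + L) / 2"
  have L'': "L' < L''" "L'' < L" using par(10) by (auto simp: L''_def)
  have iz: "integrable M (\<lambda>x. z J x * indicator A' x)"
  proof -
    have "AE x in M. \<bar>z J x\<bar> \<le> K" using prof by eventually_elim auto
    from integrable_on_finite[OF A'm A'f _ this] show ?thesis by (simp add: mult.commute)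
  qed
  have "(K - L') * \<mu> = (\<integral>x. (K - L') * indicator A' x \<partial>M)" using A'f by (simp add: \<mu>_def)
  also have "\<dots> \<le> (\<integral>x. z J x * indicator A' x \<partial>M)"
  proof (rule integral_mono_AE)
    show "AE x in M. (K - L') * indicator A' x \<le> z J x * indicator A' x" using low by eventually_elim (auto simp: indicator_def)
  qed (use iz A'f in auto)
  finally have zlow: "(K - L') * \<mu> \<le> (\<integral>x. z J x * indicator A' x \<partial>M)" .
  have "0 < \<mu> * (L - L'')" using \<mu> L'' by simp
  \<comment> \<open>The chain of estimates below ends in \<mu> (L - L'') <= t, which is impossible
    for t this small.\<close>
  from order_tendstoD(2)[OF tn(3) this] obtain n0 where n0: "\<And>n. n0 \<le> n \<Longrightarrow> tn n < \<mu> * (L - L'')"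
    by (auto simp: eventually_sequentially)
  have "0 < (L'' - L') * \<mu>" using \<mu> L'' by simp
  with avg A'm A'f obtain n where n: "n0 \<le> n" "(\<integral>x. z J x * indicator A' x \<partial>M) - (L'' - L') * \<mu> \<le> (\<integral>x. Z n J x * indicator A' x \<partial>M)" by blast
  define t where "t = tn n"
  have t: "0 < t" "t < \<mu> * (L - L'')" using tn(1) n0 n(1) by (auto simp: t_def)
  have "(K - L'') * measure M A' \<le> (\<integral>x. Z n J x * indicator A' x \<partial>M)"
    using zlow n(2) by (simp add: \<mu>_def algebra_simps)
  from mass_lower_bound[OF A'm A'f this]
  have "\<mu> * (exp (- L'' / t) - exp (- K / t)) \<le> (\<integral>x. v t x * indicator A' x \<partial>M)" by (simp add: \<mu>_def t_def)
  also have "\<dots> \<le> (\<integral>x. v t x * indicator A x \<partial>M)"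
  proof (rule integral_mono)
    have sq: "((indicator S x :: real))\<^sup>2 = indicator S x" for x and S :: "'a set" by (simp add: indicator_def)
    have "L2 M (indicator A')" "L2 M (indicator A)" using A'f Af by (auto simp: L2_def sq)
    then show "integrable M (\<lambda>x. v t x * indicator A' x)" "integrable M (\<lambda>x. v t x * indicator A x)"
      using dom_L2[OF v_dom[OF t(1)]] by (auto intro: L2_product_integrable)
    show "v t x * indicator A' x \<le> v t x * indicator A x" for x
      using v_nonneg[OF t(1), of x] A'A by (auto simp: indicator_def)
  qed
  also have "\<dots> \<le> exp (- L / t)" using decay[of n] by (simp add: t_def)
  finally have "\<mu> * (exp (- L'' / t) - exp (- K / t)) \<le> exp (- L / t)" .
  moreover have "exp (- L'' / t) = exp (- L / t) * exp ((L - L'') / t)" by (simp add: exp_add[symmetric] diff_divide_distrib)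
  moreover have "exp (- K / t) \<le> exp (- L / t)" using t by (simp add: K_def divide_right_mono del: minus_add_distrib)
  ultimately have "\<mu> * (exp (- L / t) * exp ((L - L'') / t) - exp (- L / t)) \<le> exp (- L / t)"
    using \<mu> by (smt (verit) mult_left_mono)
  then have "exp (- L / t) * (\<mu> * (exp ((L - L'') / t) - 1)) \<le> exp (- L / t) * 1" by (simp add: algebra_simps)
  then have "\<mu> * (exp ((L - L'') / t) - 1) \<le> 1" by (subst (asm) mult_le_cancel_left_pos) auto
  moreover have "\<mu> * ((L - L'') / t) \<le> \<mu> * (exp ((L - L'') / t) - 1)"
    using \<mu> exp_ge_add_one_self[of "(L - L'') / t"] by (intro mult_left_mono) linarith+
  ultimately have "\<mu> * (L - L'') / t \<le> 1" by simp
  then show False using t by (simp add: divide_le_eq)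
qed

end

theorem mainTheorem2:
  fixes M :: "'a measure" and Dom :: "('a \<Rightarrow> real) set"
    and D :: "('a \<Rightarrow> real) \<Rightarrow> 'a \<Rightarrow> 'h::{real_inner, complete_space, second_countable_topology}"
    and b c :: "'a \<Rightarrow> 'h" and V :: "'a \<Rightarrow> real"
    and T :: "real \<Rightarrow> ('a \<Rightarrow> real) \<Rightarrow> 'a \<Rightarrow> real"
    and B :: "'a set" and N :: real
  assumes "heat_setting M Dom D b c V T"
    and "B \<in> B0 M" and "N > 0"
    and "\<forall>A\<in>B0 M. intdist M Dom D A B < ereal N \<longrightarrow>
           Limsup (at_right 0) (tlogP M T A B) \<le> - ((intdist M Dom D A B)^2 / 2)"
  shows "\<forall>A\<in>B0 M. intdist M Dom D A B < ereal N \<longrightarrow>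
           Liminf (at_right 0) (tlogP M T A B) \<ge> - ((intdist M Dom D A B)^2 / 2)
         \<and> (tlogP M T A B \<longlongrightarrow> - ((intdist M Dom D A B)^2 / 2)) (at_right 0)"
proof -
  from assms(1) obtain E Ef where sf: "sigma_finite_measure M" and dirichlet: "dirichlet_operator M Dom D"
    and EA: "assumption_A M Dom D b c V E" and EE: "form_extension M Dom D b c V E Ef" and T: "associated_semigroup M Dom Ef T"
    unfolding heat_setting_def by (elim exE conjE) (rule that)
  interpret perturbed_form M Dom D b c V E Ef by unfold_locales fact+
  obtain v v' where v_init: "((\<lambda>s. \<integral>x. (v s x - indicator B x)\<^sup>2 \<partial>M) \<longlongrightarrow> 0) (at_right 0)"
    and v: "\<forall>s>0. v s \<in> Dom \<and> (\<forall>x. 0 \<le> v s x) \<and> (AE x in M. v s x = T s (indicator B) x) \<and> L2 M (v' s)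
      \<and> (\<forall>g\<in>Dom. (\<integral>x. v' s x * g x \<partial>M) = - Ef (v s) g)
      \<and> (\<forall>e>0. \<exists>d>0. \<forall>r. \<bar>r - s\<bar> < d \<longrightarrow> 0 < r \<and> (\<integral>x. (v r x - v s x - (r - s) * v' s x)\<^sup>2 \<partial>M) \<le> e\<^sup>2 * (r - s)\<^sup>2)"
    using heat_flow_nonneg[OF T assms(2)] by (elim exE conjE) (rule that)
  interpret heat_flow M Dom D b c V E Ef v v' B
    by unfold_locales (use assms(2) v_init v in auto)
  have Pt_eq: "Pt M T t A B = (\<integral>x. v t x * indicator A x \<partial>M)" if t: "0 < t" and A: "A \<in> sets M" for t A
  proof -
    have "L2 M (indicator B)"
    proof -
      have sq: "((indicator B x :: real))\<^sup>2 = indicator B x" for x by (simp add: indicator_def)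
      show ?thesis using assms(2) by (auto simp: L2_def sq B0_def)
    qed
    then have "T t (indicator B) \<in> Dom" using T t by (simp add: associated_semigroup_def)
    then have [measurable]: "T t (indicator B) \<in> borel_measurable M" by (rule dom_measurable)
    have [measurable]: "v t \<in> borel_measurable M" "A \<in> sets M" using v t A by (auto intro: dom_measurable)
    have "AE x in M. v t x = T t (indicator B) x" using v t by blast
    then show ?thesis unfolding Pt_def by (intro integral_cong_AE) auto
  qed
  show ?thesis
  proof (intro ballI impI)
    fix A assume A: "A \<in> B0 M" and dN: "intdist M Dom D A B < ereal N"
    have d0: "0 \<le> intdist M Dom D A B" by (rule intdist_nonneg[OF nest])
    then obtain d where d: "intdist M Dom D A B = ereal d" "0 \<le> d" using dN by (cases "intdist M Dom D A B") auto
    have eq: "- ((intdist M Dom D A B)^2 / 2) = ereal (- (d\<^sup>2 / 2))" by (simp add: d(1))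
    have lower: "- ((intdist M Dom D A B)^2 / 2) \<le> Liminf (at_right 0) (tlogP M T A B)"
      unfolding le_Liminf_iff
    proof (intro allI impI)
      fix y assume "y < - ((intdist M Dom D A B)^2 / 2)"
      \<comment> \<open>A real r is put strictly between y and -d^2/2, so that L = -r exceeds d^2/2
        as \<open>no_fast_decay\<close> requires.\<close>
      then obtain r where r: "y < ereal r" "ereal r < ereal (- (d\<^sup>2 / 2))" unfolding eq using ereal_dense2 by blast
      show "\<forall>\<^sub>F t in at_right 0. y < tlogP M T A B t"
      proof (rule ccontr)
        assume n: "\<not> (\<forall>\<^sub>F t in at_right 0. y < tlogP M T A B t)"
        have "\<exists>t. 0 < t \<and> t < 1 / real (Suc n) \<and> tlogP M T A B t \<le> ereal r" for n
        proof (rule ccontr)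
          assume "\<nexists>t. 0 < t \<and> t < 1 / real (Suc n) \<and> tlogP M T A B t \<le> ereal r"
          then have "\<forall>t>0. t < 1 / real (Suc n) \<longrightarrow> y < tlogP M T A B t" using r(1) by (meson less_trans not_le)
          then have "\<forall>\<^sub>F t in at_right 0. y < tlogP M T A B t"
            by (intro eventually_at_rightI[of 0 "1 / real (Suc n)"]) auto
          with n show False by contradiction
        qed
        then obtain tn where tn: "\<And>n. 0 < tn n" "\<And>n. tn n < 1 / real (Suc n)" "\<And>n. tlogP M T A B (tn n) \<le> ereal r" by metis
        show False
        proof (rule no_fast_decay[OF sf A d, of "- r" tn])
          show "d\<^sup>2 / 2 < - r" using r(2) by simp
          show "0 < tn n" for n by (rule tn)
          show "tn n \<le> 1" for n
          proof -
            have "1 / real (Suc n) \<le> 1" by (simp add: divide_le_eq)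
            then show ?thesis using tn(2)[of n] by linarith
          qed
          show "tn \<longlonglongrightarrow> 0"
            by (rule tendsto_sandwich[OF _ _ tendsto_const LIMSEQ_inverse_real_of_nat])
              (use tn in \<open>auto intro!: always_eventually less_imp_le simp: inverse_eq_divide\<close>)
          show "(\<integral>x. v (tn n) x * indicator A x \<partial>M) \<le> exp (- (- r) / tn n)" for n
          proof -
            let ?P = "Pt M T (tn n) A B"
            have "?P \<le> exp (r / tn n)"
            \<comment> \<open>When the mass is not positive, \<open>tlogP\<close> is -\<infinity> by
              convention and the exponential bound is trivial.\<close>
            proof (cases "0 < ?P")
              case True
              then have "tn n * ln ?P \<le> r" using tn(3)[of n] by (simp add: tlogP_def)
              then have "ln ?P \<le> r / tn n" using tn(1)[of n] by (simp add: pos_le_divide_eq mult.commute)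
              then show ?thesis using True by (metis exp_le_cancel_iff exp_ln)
            qed (simp add: not_less order_trans[OF _ exp_ge_zero])
            then show ?thesis using Pt_eq[OF tn(1), of A n] A by (simp add: B0_def)
          qed
        qed
      qed
    qed
    have upper: "Limsup (at_right 0) (tlogP M T A B) \<le> - ((intdist M Dom D A B)^2 / 2)" using assms(4) A dN by blast
    have "Liminf (at_right 0) (tlogP M T A B) = - ((intdist M Dom D A B)^2 / 2)"
      "Limsup (at_right 0) (tlogP M T A B) = - ((intdist M Dom D A B)^2 / 2)"
      using lower upper Liminf_le_Limsup[of "at_right 0" "tlogP M T A B"] by (auto intro: antisym order_trans)
    then show "- ((intdist M Dom D A B)^2 / 2) \<le> Liminf (at_right 0) (tlogP M T A B)
      \<and> (tlogP M T A B \<longlongrightarrow> - ((intdist M Dom D A B)^2 / 2)) (at_right 0)"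
      using lower by (simp add: tendsto_iff_Liminf_eq_Limsup)
  qed
qed

end
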